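(* Let $G$ be a graph and let $J$ be an assignment of clockwise parities (even or odd) to the even circuits of $G$. Then $G$ is $J$-incompatible if and only if $G$ contains, as a subgraph, an even splitting $H$ of one of the graphs $O_1, O_2, E_1, E_2, E_3, \Delta_1, \Delta_2, \Delta_3, \Delta_4$ with the following property: (i) if $H$ is an even splitting of $O_i$ for some $i\in\{1,2\}$, then among the three even circuits of $H$ corresponding to the three even circuits of $O_i$, an even number are prescribed by $J$ to be clockwise even; (ii) if $H$ is an even splitting of $E_i$ for some $i\in\{1,2,3\}$, then among the three even circuits of $H$ corresponding to the three even circuits of $E_i$, an odd number are prescribed by $J$ to be clockwise even; (iii) if $H$ is an even splitting of $\Delta_i$ for some $i\in\{1,2,3,4\}$, then among the four even circuits of $H$ corresponding to the four even circuits of $\Delta_i$, an odd number are prescribed by $J$ to be clockwise even.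
   Context: Graphs are finite and undirected; multiple edges are allowed. Circuits are identified with their edge sets; a circuit is even (odd) if its length, i.e. its number of edges, is even (odd). Clockwise parity: given an orientation of the edges, the clockwise parity of an even circuit is the parity of the number of its edges that are directed in agreement with a specified sense of traversal (since the length is even, this does not depend on the sense chosen). The circuit is clockwise even or clockwise odd accordingly. An orientation of $G$ is $J$-compatible if every even circuit of $G$ has, under it, the clockwise parity prescribed by $J$. $G$ is $J$-compatible if it admits a $J$-compatible orientation, and $J$-incompatible otherwise. Even splittings: if a graph $K$ has a vertex $v$ of degree $2$ with incident edges $e,f$, and $L$ is obtained from $K$ by contracting $e$ and $f$ (so $EL = EK\setminus\{e,f\}$), then $K$ is called an even vertex splitting of $L$. Every even circuit $C_L$ of $L$ is $C\cap EL$ for a unique even circuit $C$ of $K$; we say $C$ corresponds to $C_L$. A graph $H$ is an even splitting of a graph $F$ if there are graphs $F=F_0,F_1,\dots,F_k=H$ ($k\ge 0$) such that each $F_i$ with $i>0$ is an even vertex splitting of $F_{i-1}$; composing the correspondences, each even circuit of $F$ corresponds to a unique even circuit of $H$. (Graphs are considered up to isomorphism.) The nine graphs: $O_1=K_{2,3}$. $O_2$ is obtained from $K_4$ by subdividing once each of the three edges incident with one fixed vertex. $E_1$ has two vertices and three parallel edges joining them. $E_2=K_4$. $E_3$ is obtained from $K_4$ by subdividing once each edge of a fixed circuit of length $4$. Each of $O_1,O_2,E_1,E_2,E_3$ has exactly three even circuits. $\Delta_1$ is the graph with $9$ vertices and $12$ edges consisting of three vertex-disjoint triangles with vertex sets $\{a_i,b_i,c_i\}$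 ($i=1,2,3$) together with the three edges $b_1a_2$, $b_2a_3$, $b_3a_1$. For $j=1,2,3$, $\Delta_{1+j}$ is obtained from $\Delta_1$ by contracting $j$ of the three edges $b_1a_2,b_2a_3,b_3a_1$ (the choice does not matter up to isomorphism). Each $\Delta_i$ has exactly four even circuits. *)

theory Defs
  imports Main
begin

text \<open>Undirected multigraphs. The value of \<open>ends\<close> outside \<open>edges\<close> is irrelevant. An edge with a
  single end is a loop; loops are admitted, but they lie in no even circuit.\<close>

record ('v, 'e) mgraph =
  verts :: "'v set"
  edges :: "'e set"
  ends :: "'e \<Rightarrow> 'v set"

locale multigraph =
  fixes G :: "('v, 'e) mgraph" (structure)
  assumes finite_verts: "finite (verts G)"
    and finite_edges: "finite (edges G)"
    and ends_subset: "e \<in> edges G \<Longrightarrow> ends G e \<subseteq> verts G"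
    and card_ends: "e \<in> edges G \<Longrightarrow> card (ends G e) \<in> {1, 2}"

definition subgraph :: "('v, 'e) mgraph \<Rightarrow> ('v, 'e) mgraph \<Rightarrow> bool" where
  "subgraph H G \<longleftrightarrow> multigraph H \<and> verts H \<subseteq> verts G \<and> edges H \<subseteq> edges G \<and>
     (\<forall>e\<in>edges H. ends H e = ends G e)"

definition graph_iso ::
    "('a \<Rightarrow> 'v) \<Rightarrow> ('b \<Rightarrow> 'e) \<Rightarrow> ('a, 'b) mgraph \<Rightarrow> ('v, 'e) mgraph \<Rightarrow> bool" where
  "graph_iso \<alpha> \<beta> F H \<longleftrightarrow> bij_betw \<alpha> (verts F) (verts H) \<and> bij_betw \<beta> (edges F) (edges H) \<and>
     (\<forall>e\<in>edges F. ends H (\<beta> e) = \<alpha> ` ends F e)"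

text \<open>A loop contributes two to the degree of its end.\<close>

definition degree :: "('v, 'e) mgraph \<Rightarrow> 'v \<Rightarrow> nat" where
  "degree G v = card {e \<in> edges G. v \<in> ends G e} + card {e \<in> edges G. ends G e = {v}}"


section \<open>Circuits and clockwise parity\<close>

text \<open>A circuit traversed through the vertices \<open>vs\<close>, where the \<open>i\<close>-th edge leads from the \<open>i\<close>-th
  vertex to the cyclically next one. Lengths 1 (a loop) and 2 (two parallel edges) are included.\<close>

definition circuit_traversal :: "('v, 'e) mgraph \<Rightarrow> 'v list \<Rightarrow> 'e list \<Rightarrow> bool" where
  "circuit_traversal G vs es \<longleftrightarrow>
     es \<noteq> [] \<and> length vs = length es \<and> distinct vs \<and> distinct es \<and> set es \<subseteq> edges G \<and>
     (\<forall>i<length es. ends G (es ! i) = {vs ! i, vs ! ((i + 1) mod length es)})"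

definition circuit :: "('v, 'e) mgraph \<Rightarrow> 'e set \<Rightarrow> bool" where
  "circuit G C \<longleftrightarrow> (\<exists>vs es. circuit_traversal G vs es \<and> set es = C)"

definition even_circuits :: "('v, 'e) mgraph \<Rightarrow> 'e set set" where
  "even_circuits G = {C. circuit G C \<and> even (card C)}"

text \<open>An orientation assigns to each edge its pair (tail, head).\<close>

definition orientation :: "('v, 'e) mgraph \<Rightarrow> ('e \<Rightarrow> 'v \<times> 'v) \<Rightarrow> bool" where
  "orientation G d \<longleftrightarrow> (\<forall>e\<in>edges G. {fst (d e), snd (d e)} = ends G e)"

definition agreeing :: "('e \<Rightarrow> 'v \<times> 'v) \<Rightarrow> 'v list \<Rightarrow> 'e list \<Rightarrow> nat set" where
  "agreeing d vs es =
     {i. i < length es \<and> d (es ! i) = (vs ! i, vs ! ((i + 1) mod length es))}"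

datatype parity = Clockwise_even | Clockwise_odd

text \<open>Only meaningful for even circuits, where all traversals give the same parity, so that it
  does not matter which one witnesses the existential quantifier.\<close>

definition clockwise_parity ::
    "('v, 'e) mgraph \<Rightarrow> ('e \<Rightarrow> 'v \<times> 'v) \<Rightarrow> 'e set \<Rightarrow> parity" where
  "clockwise_parity G d C =
     (if \<exists>vs es. circuit_traversal G vs es \<and> set es = C \<and> even (card (agreeing d vs es))
      then Clockwise_even else Clockwise_odd)"

text \<open>A prescription \<open>J\<close> is a function on all edge sets of which only the values at even circuits
  matter.\<close>

definition compatible_orientation ::
    "('v, 'e) mgraph \<Rightarrow> ('e set \<Rightarrow> parity) \<Rightarrow> ('e \<Rightarrow> 'v \<times> 'v) \<Rightarrow> bool" where
  "compatible_orientation G J d \<longleftrightarrow>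
     orientation G d \<and> (\<forall>C\<in>even_circuits G. clockwise_parity G d C = J C)"

definition compatible :: "('v, 'e) mgraph \<Rightarrow> ('e set \<Rightarrow> parity) \<Rightarrow> bool" where
  "compatible G J \<longleftrightarrow> (\<exists>d. compatible_orientation G J d)"

abbreviation incompatible :: "('v, 'e) mgraph \<Rightarrow> ('e set \<Rightarrow> parity) \<Rightarrow> bool" where
  "incompatible G J \<equiv> \<not> compatible G J"


section \<open>Even splittings\<close>

text \<open>Contraction of a connected edge set \<open>A\<close>; the vertex it produces is named \<open>v\<close>, which should be
  an end of some edge of \<open>A\<close>. The remaining edges keep their identity.\<close>

definition contract_onto :: "'v \<Rightarrow> 'e set \<Rightarrow> ('v, 'e) mgraph \<Rightarrow> ('v, 'e) mgraph" where
  "contract_onto v A G =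
     (let r = (\<lambda>x. if x \<in> (\<Union>e\<in>A. ends G e) then v else x)
      in \<lparr>verts = r ` verts G, edges = edges G - A, ends = (\<lambda>g. r ` ends G g)\<rparr>)"

definition even_vertex_splitting :: "('v, 'e) mgraph \<Rightarrow> ('v, 'e) mgraph \<Rightarrow> bool" where
  "even_vertex_splitting K L \<longleftrightarrow>
     (\<exists>v e f. v \<in> verts K \<and> degree K v = 2 \<and> e \<in> edges K \<and> f \<in> edges K \<and> e \<noteq> f \<and>
        v \<in> ends K e \<and> v \<in> ends K f \<and> L = contract_onto v {e, f} K)"

definition corresponding_circuit :: "('v, 'e) mgraph \<Rightarrow> ('v, 'e) mgraph \<Rightarrow> 'e set \<Rightarrow> 'e set" where
  "corresponding_circuit K L D = (THE C. C \<in> even_circuits K \<and> C \<inter> edges L = D)"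

text \<open>\<open>even_splitting F H \<phi>\<close>: the graph \<open>H\<close> is an even splitting of \<open>F\<close>, and \<open>\<phi>\<close> maps each even
  circuit of \<open>F\<close> to the corresponding even circuit of \<open>H\<close>. The circuits must be lifted one
  splitting at a time: for a sequence of splittings, an even circuit of \<open>H\<close> is in general not
  determined by its intersection with the edge set of \<open>F\<close>. Isomorphism is needed only at the
  start of the sequence, since it commutes with contraction.\<close>

inductive even_splitting ::
    "('a, 'b) mgraph \<Rightarrow> ('v, 'e) mgraph \<Rightarrow> ('b set \<Rightarrow> 'e set) \<Rightarrow> bool"
  for F :: "('a, 'b) mgraph" where
  iso: "graph_iso \<alpha> \<beta> F H \<Longrightarrow> even_splitting F H (\<lambda>D. \<beta> ` D)"
| step: "even_splitting F L \<phi> \<Longrightarrow> even_vertex_splitting K L \<Longrightarrow>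
    even_splitting F K (\<lambda>D. corresponding_circuit K L (\<phi> D))"

definition prescribed_even ::
    "('e set \<Rightarrow> parity) \<Rightarrow> ('a, 'b) mgraph \<Rightarrow> ('b set \<Rightarrow> 'e set) \<Rightarrow> 'e set set" where
  "prescribed_even J F \<phi> = {C \<in> \<phi> ` even_circuits F. J C = Clockwise_even}"


section \<open>The nine graphs\<close>

definition graph_of :: "(nat \<times> nat) list \<Rightarrow> (nat, nat) mgraph" where
  "graph_of ps =
     \<lparr>verts = fst ` set ps \<union> snd ` set ps, edges = {..<length ps},
      ends = (\<lambda>i. {fst (ps ! i), snd (ps ! i)})\<rparr>"

definition O1 :: "(nat, nat) mgraph" where
  "O1 = graph_of [(0,2), (0,3), (0,4), (1,2), (1,3), (1,4)]"

text \<open>\<open>K\<^sub>4\<close> on 0, 1, 2, 3 with the edges at 0 subdivided by 4, 5, 6.\<close>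

definition O2 :: "(nat, nat) mgraph" where
  "O2 = graph_of [(0,4), (4,1), (0,5), (5,2), (0,6), (6,3), (1,2), (2,3), (3,1)]"

definition E1 :: "(nat, nat) mgraph" where
  "E1 = graph_of [(0,1), (0,1), (0,1)]"

definition E2 :: "(nat, nat) mgraph" where
  "E2 = graph_of [(0,1), (0,2), (0,3), (1,2), (1,3), (2,3)]"

text \<open>\<open>K\<^sub>4\<close> on 0, 1, 2, 3 with the edges of the circuit 0 1 2 3 subdivided by 4, 5, 6, 7.\<close>

definition E3 :: "(nat, nat) mgraph" where
  "E3 = graph_of [(0,4), (4,1), (1,5), (5,2), (2,6), (6,3), (3,7), (7,0), (0,2), (1,3)]"

text \<open>The triangles \<open>a\<^sub>i b\<^sub>i c\<^sub>i\<close> are 0 1 2, 3 4 5 and 6 7 8, with edges numbered 0 to 8; the edges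
  \<open>b\<^sub>1 a\<^sub>2\<close>, \<open>b\<^sub>2 a\<^sub>3\<close>, \<open>b\<^sub>3 a\<^sub>1\<close> have the numbers 9, 10, 11.\<close>

definition Delta1 :: "(nat, nat) mgraph" where
  "Delta1 = graph_of
     [(0,1), (1,2), (2,0), (3,4), (4,5), (5,3), (6,7), (7,8), (8,6), (1,3), (4,6), (7,0)]"

definition Delta2 :: "(nat, nat) mgraph" where
  "Delta2 = contract_onto 1 {9} Delta1"

definition Delta3 :: "(nat, nat) mgraph" where
  "Delta3 = contract_onto 4 {10} Delta2"

definition Delta4 :: "(nat, nat) mgraph" where
  "Delta4 = contract_onto 7 {11} Delta3"

end

theory Submission
  imports Defs
begin

text \<open>Fix an orientation and let \<open>f C\<close> tell whether \<open>J\<close> disagrees with the clockwise parity of the even circuit \<open>C\<close>.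
  Reversing the edges of a set \<open>X\<close> changes the parity of \<open>C\<close> by \<open>card (C \<inter> X)\<close> modulo 2, so \<open>J\<close>-compatible
  orientations exist if and only if \<open>f C\<close> is the parity of \<open>card (C \<inter> X)\<close> for some \<open>X\<close>; call \<open>f\<close> linear in this case.

  The even splittings of the nine graphs are the thetas with three even circuits, the subdivisions of \<open>K\<^sub>4\<close> with four
  odd triangles, and the rings of three odd digons, sorted by the parities of the lengths of their branches. In each
  of them every edge lies in an even number of the even circuits. Hence the number of clockwise even circuits
  modulo 2 does not depend on the orientation; by means of 2-colourings it is seen to be invariant under even
  splitting. The absence of the obstructions thus says that \<open>f\<close> sums to zero over the even circuits of every theta,
  \<open>K\<^sub>4\<close> and ring of this kind, which is clearly necessary for linearity.

  For sufficiency, a maximal biconnected edge set on which \<open>f\<close> is linear is enlarged by an ear. We may assume that \<open>f\<close>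
  vanishes on its even circuits and that the ear is an edge \<open>e\<close> with ends \<open>u\<close>, \<open>w\<close>; it remains to see that \<open>f\<close> is
  constant on the even circuits through \<open>e\<close>. Two paths from \<open>u\<close> to \<open>w\<close> that violate this and have the smallest
  possible union differ in exactly two disjoint odd digons, since every other configuration can be shortened by means
  of a theta, a \<open>K\<^sub>4\<close> or a ring. If moreover the segment between the digons is as short as possible, an ear avoiding one
  of its ends, which exists by biconnectivity, leads to a contradiction in every case.\<close>

section \<open>Paths and circuits as sets of edges\<close>

text \<open>The symmetric difference of two even circuits need not be a circuit, so linearity cannot
  be checked on a basis of the cycle space; only exchanges inside thetas, K4 and rings are
  available, and these preserve the parity of a path. An odd digon therefore blocks the comparison
  of two paths: its sides can be exchanged only together with those of another digon, which is why
  rings, whose relation exchanges sides in pairs, must be among the obstructions. The nine graphs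
  are the shortest representatives of the possible parity patterns. The branches of a theta with
  even circuits have equal parity: all odd (\<open>E1\<close>) or all even (\<open>O1\<close>). In a
  subdivided K4 with odd triangles the branch lengths increased by 1 sum to 0 modulo 2 over each
  triangle, so the even branches form a cut: empty (\<open>E2\<close>), the star of a vertex
  (\<open>O2\<close>) or the cut between two pairs of vertices (\<open>E3\<close>). In a ring each
  digon has an odd and an even side, shortened to 1 and 2, and 3, 2, 1 or 0 odd connecting paths
  lead to \<open>Delta1\<close>, \<open>Delta2\<close>, \<open>Delta3\<close>,
  \<open>Delta4\<close>.\<close>

inductive spath :: "('v, 'e) mgraph \<Rightarrow> 'v \<Rightarrow> 'v set \<Rightarrow> 'e set \<Rightarrow> 'v \<Rightarrow> bool" for G where
  nil: "spath G x {x} {} x"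
| step: "e \<in> edges G \<Longrightarrow> ends G e = {x, z} \<Longrightarrow> x \<notin> S \<Longrightarrow> spath G z S p y \<Longrightarrow>
    spath G x (insert x S) (insert e p) y"

lemma spath_ends: "spath G x S p y \<Longrightarrow> x \<in> S \<and> y \<in> S"
  by (induction rule: spath.induct) auto

lemma spath_start: "spath G x S p y \<Longrightarrow> x \<in> S"
  and spath_end: "spath G x S p y \<Longrightarrow> y \<in> S"
  using spath_ends by metis+

lemma spath_finite: "spath G x S p y \<Longrightarrow> finite S \<and> finite p"
  by (induction rule: spath.induct) auto

lemma spath_edges: "spath G x S p y \<Longrightarrow> p \<subseteq> edges G"
  by (induction rule: spath.induct) auto

lemma spath_ends_subset: "spath G x S p y \<Longrightarrow> e \<in> p \<Longrightarrow> ends G e \<subseteq> S"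
  by (induction rule: spath.induct) (auto dest: spath_start)

lemma spath_edge_ends:
  "spath G x S p y \<Longrightarrow> e \<in> p \<Longrightarrow> \<exists>a b. a \<noteq> b \<and> a \<in> S \<and> b \<in> S \<and> ends G e = {a, b}"
proof (induction rule: spath.induct)
  case (step e' x z S p y)
  show ?case
  proof (cases "e = e'")
    case True
    then show ?thesis using step spath_start[OF step(4)] by (metis insertCI)
  next
    case False
    then show ?thesis using step by (metis insertCI insertE)
  qed
qed auto

lemma spath_step_new: "ends G e = {x, z} \<Longrightarrow> x \<notin> S \<Longrightarrow> spath G z S p y \<Longrightarrow> e \<notin> p"
  using spath_ends_subset by fastforce

lemma spath_trivial: "spath G x S {} y \<longleftrightarrow> y = x \<and> S = {x}"
  by (auto elim: spath.cases intro: spath.nil)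

lemma spath_loop: "spath G x S p x \<longleftrightarrow> p = {} \<and> S = {x}"
proof
  assume "spath G x S p x"
  then show "p = {} \<and> S = {x}"
    by (cases) (auto dest: spath_end)
qed (auto intro: spath.nil)

lemma spath_empty_iff: "spath G x S p y \<Longrightarrow> p = {} \<longleftrightarrow> x = y"
  by (metis spath_loop spath_trivial)

lemma spath_single: "e \<in> edges G \<Longrightarrow> ends G e = {x, y} \<Longrightarrow> x \<noteq> y \<Longrightarrow> spath G x {x, y} {e} y"
  using spath.step[OF _ _ _ spath.nil, of e G x y] by simp

lemma spath_append:
  "spath G x S p z \<Longrightarrow> spath G z T q y \<Longrightarrow> S \<inter> T = {z} \<Longrightarrow> spath G x (S \<union> T) (p \<union> q) y"
proof (induction rule: spath.induct)
  case (nil x)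
  then show ?case using spath_start insert_absorb by (metis Un_empty_left Un_insert_left)
next
  case (step e x z' S p z)
  have "z \<in> S" using spath_end step by metis
  then have "S \<inter> T = {z}" "x \<notin> T" using step by auto
  then show ?case using step spath.step[of e G x z' "S \<union> T" "p \<union> q" y] by auto
qed

lemma spath_rev: "spath G x S p y \<Longrightarrow> spath G y S p x"
proof (induction rule: spath.induct)
  case (step e x z S p y)
  have "x \<noteq> z" using step spath_start by metis
  then have "spath G z {z, x} {e} x" using step spath_single by (metis insert_commute)
  moreover have "S \<inter> {z, x} = {z}" using step spath_start by fastforce
  ultimately have "spath G y (S \<union> {z, x}) (p \<union> {e}) x" using spath_append step by metis
  moreover have "S \<union> {z, x} = insert x S" using spath_start step by fastforce
  ultimately show ?case by simp
qed (rule spath.nil)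

lemma spath_split:
  "spath G x S p y \<Longrightarrow> z \<in> S \<Longrightarrow>
   \<exists>S1 S2 p1 p2. spath G x S1 p1 z \<and> spath G z S2 p2 y \<and> S1 \<union> S2 = S \<and> S1 \<inter> S2 = {z} \<and>
     p1 \<union> p2 = p \<and> p1 \<inter> p2 = {}"
proof (induction rule: spath.induct)
  case (nil x)
  then show ?case by (metis Int_absorb Un_absorb empty_iff insert_iff spath.nil)
next
  case (step e x z' S p y)
  show ?case
  proof (cases "z = x")
    case True
    then have "spath G x {x} {} z" "spath G z (insert x S) (insert e p) y"
      using step spath.step by (metis spath.nil, metis)
    then show ?thesis using True by blast
  next
    case False
    then obtain S1 S2 p1 p2 where *: "spath G z' S1 p1 z" "spath G z S2 p2 y" "S1 \<union> S2 = S"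
      "S1 \<inter> S2 = {z}" "p1 \<union> p2 = p" "p1 \<inter> p2 = {}" using step by blast
    then have "spath G x (insert x S1) (insert e p1) z" using step spath.step by (metis UnI1)
    moreover have "e \<notin> p" using spath_step_new step by metis
    moreover have "insert x S1 \<union> S2 = insert x S" "insert x S1 \<inter> S2 = {z}"
      "insert e p1 \<union> p2 = insert e p" "insert e p1 \<inter> p2 = {}"
      using * step(3) \<open>e \<notin> p\<close> by blast+
    ultimately show ?thesis using *(2) by blast
  qed
qed

text \<open>An edge of a path has two distinct ends, both on the path; a common edge would put two
  vertices into \<open>S \<inter> S'\<close>. Hence disjointness of edge sets has to be demanded
  separately only where two paths share two vertices.\<close>

lemma spath_disjoint:
  "spath G x S p y \<Longrightarrow> spath G x' S' p' y' \<Longrightarrow> S \<inter> S' \<subseteq> {z} \<Longrightarrow> p \<inter> p' = {}"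
proof -
  assume h: "spath G x S p y" "spath G x' S' p' y'" "S \<inter> S' \<subseteq> {z}"
  have False if e: "e \<in> p" "e \<in> p'" for e
  proof -
    obtain a b where "a \<noteq> b" "a \<in> S" "b \<in> S" "ends G e = {a, b}" using spath_edge_ends h(1) e(1) by metis
    moreover then have "a \<in> S'" "b \<in> S'" using spath_ends_subset[OF h(2) e(2)] by auto
    ultimately show False using h(3) by blast
  qed
  then show ?thesis by blast
qed

lemma spath_edge_decomp:
  assumes "spath G x S p y" "e \<in> p"
  shows "\<exists>a b S1 S2 p1 p2. spath G x S1 p1 a \<and> spath G b S2 p2 y \<and> S1 \<union> S2 = S \<and> S1 \<inter> S2 = {} \<and>
    ends G e = {a, b} \<and> insert e (p1 \<union> p2) = p \<and> p1 \<inter> p2 = {} \<and> e \<notin> p1 \<and> e \<notin> p2"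
  using assms
proof (induction rule: spath.induct)
  case (step e' x z S p y)
  have new: "e' \<notin> p" using spath_step_new step by metis
  show ?case
  proof (cases "e = e'")
    case True
    have "{x} \<union> S = insert x S" "{x} \<inter> S = {}" "insert e ({} \<union> p) = insert e' p" "{} \<inter> p = {}"
      using True step(3) by auto
    then show ?thesis using step(2,4) new True spath.nil[of G x] by blast
  next
    case False
    then obtain a b S1 S2 p1 p2 where *: "spath G z S1 p1 a" "spath G b S2 p2 y" "S1 \<union> S2 = S" "S1 \<inter> S2 = {}"
      "ends G e = {a, b}" "insert e (p1 \<union> p2) = p" "p1 \<inter> p2 = {}" "e \<notin> p1" "e \<notin> p2" using step by blast
    then have "spath G x (insert x S1) (insert e' p1) a" using step spath.step by (metis UnI1)
    moreover have "insert x S1 \<union> S2 = insert x S" "insert x S1 \<inter> S2 = {}"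
      "insert e (insert e' p1 \<union> p2) = insert e' p" "insert e' p1 \<inter> p2 = {}" "e \<notin> insert e' p1"
      using * step(3) new False by blast+
    ultimately show ?thesis using *(2,5,9) by blast
  qed
qed auto

lemma spath_mono:
  "spath G x S p y \<Longrightarrow> p \<subseteq> edges H \<Longrightarrow> (\<And>e. e \<in> p \<Longrightarrow> ends H e = ends G e) \<Longrightarrow> spath H x S p y"
  by (induction rule: spath.induct) (auto intro: spath.intros)

lemma spath_map:
  assumes "spath G x S p y" "inj_on \<alpha> S" "\<beta> ` p \<subseteq> edges H" "\<And>e. e \<in> p \<Longrightarrow> ends H (\<beta> e) = \<alpha> ` ends G e"
  shows "spath H (\<alpha> x) (\<alpha> ` S) (\<beta> ` p) (\<alpha> y)"
  using assms
proof (induction rule: spath.induct)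
  case (step e x z S p y)
  have "spath H (\<alpha> z) (\<alpha> ` S) (\<beta> ` p) (\<alpha> y)"
  proof (rule step.IH)
    show "inj_on \<alpha> S" using step.prems(1) by simp
    show "\<beta> ` p \<subseteq> edges H" using step.prems(2) by simp
    show "ends H (\<beta> e) = \<alpha> ` ends G e" if "e \<in> p" for e using step.prems(3) that by simp
  qed
  moreover have "\<beta> e \<in> edges H" "\<alpha> x \<notin> \<alpha> ` S" using step.prems(1,2) step.hyps(3) by auto
  moreover have "ends H (\<beta> e) = {\<alpha> x, \<alpha> z}" using step.prems(3)[of e] step.hyps(2) by simp
  ultimately show ?case
    using spath.step[of "\<beta> e" H "\<alpha> x" "\<alpha> z" "\<alpha> ` S" "\<beta> ` p" "\<alpha> y"] by simp
qed (auto intro: spath.nil)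

section \<open>Degrees in paths and circuits\<close>

definition incident :: "('v, 'e) mgraph \<Rightarrow> 'e set \<Rightarrow> 'v \<Rightarrow> 'e set" where
  "incident G C x = {e \<in> C. x \<in> ends G e}"

lemma incident_Un: "incident G (C \<union> D) x = incident G C x \<union> incident G D x"
  by (auto simp: incident_def)

lemma incident_insert: "incident G (insert e C) x = (if x \<in> ends G e then insert e (incident G C x) else incident G C x)"
  by (auto simp: incident_def)

lemma finite_incident: "finite C \<Longrightarrow> finite (incident G C x)"
  by (simp add: incident_def)

lemma card_incident_spath:
  assumes "spath G x S p y"
  shows "card (incident G p z) =
    (if z \<notin> S \<or> x = y then 0 else if z = x \<or> z = y then 1 else 2)"
  using assms
proof (induction arbitrary: rule: spath.induct)
  case (nil x)
  then show ?case by (simp add: incident_def)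
next
  case (step e x z' S p y)
  have e: "e \<notin> p" using spath_step_new step by metis
  have f: "finite (incident G p z)" using spath_finite[OF step(4)] finite_incident by metis
  have e2: "e \<notin> incident G p z" using e by (auto simp: incident_def)
  have in1: "z' \<in> S" "y \<in> S" using spath_ends[OF step(4)] by auto
  have xy: "x \<noteq> y" "x \<noteq> z'" using in1 step by auto
  have tr: "z' = y \<longrightarrow> S = {y}" using step spath_loop by metis
  show ?case using step.IH step.hyps f e2 in1 xy tr by (auto simp: incident_insert)
qed

text \<open>These are the circuits of length at least 2.\<close>

definition circ :: "('v, 'e) mgraph \<Rightarrow> 'e set \<Rightarrow> bool" where
  "circ G C \<longleftrightarrow> (\<exists>x y S T p q. x \<noteq> y \<and> spath G x S p y \<and> spath G x T q y \<and> S \<inter> T = {x, y} \<and>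
     p \<inter> q = {} \<and> C = p \<union> q)"

lemma circI:
  "x \<noteq> y \<Longrightarrow> spath G x S p y \<Longrightarrow> spath G x T q y \<Longrightarrow> S \<inter> T = {x, y} \<Longrightarrow> p \<inter> q = {} \<Longrightarrow> circ G (p \<union> q)"
  unfolding circ_def by blast

lemma circE:
  assumes "circ G C"
  obtains x y S T p q where "x \<noteq> y" "spath G x S p y" "spath G x T q y" "S \<inter> T = {x, y}"
    "p \<inter> q = {}" "C = p \<union> q"
  using assms unfolding circ_def by metis

text \<open>The two vertices at which \<open>circ\<close> cuts a circuit are arbitrary; this result
  allows any edge to be the cut. The remaining path runs from \<open>a\<close> back to
  \<open>x\<close>, along the other path to \<open>y\<close> and back to \<open>b\<close>.\<close>

lemma circ_edge_path:
  assumes "circ G C" "e \<in> C"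
  shows "\<exists>a b S. a \<noteq> b \<and> ends G e = {a, b} \<and> spath G a S (C - {e}) b"
proof -
  have *: "\<exists>a b S. a \<noteq> b \<and> ends G e = {a, b} \<and> spath G a S (p \<union> q - {e}) b"
    if h: "x \<noteq> y" "spath G x S p y" "spath G x T q y" "S \<inter> T = {x, y}" "p \<inter> q = {}" "e \<in> p" for x y S T p q
  proof -
    obtain a b S1 S2 p1 p2 where d: "spath G x S1 p1 a" "spath G b S2 p2 y" "S1 \<union> S2 = S" "S1 \<inter> S2 = {}"
      "ends G e = {a, b}" "insert e (p1 \<union> p2) = p" "p1 \<inter> p2 = {}" "e \<notin> p1" "e \<notin> p2"
      using spath_edge_decomp[OF h(2,6)] by blast
    have i: "x \<in> S1" "a \<in> S1" "y \<in> S2" "b \<in> S2" using d spath_ends by metis+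
    have "spath G a (S1 \<union> T) (p1 \<union> q) y"
    proof (rule spath_append[OF spath_rev[OF d(1)] h(3)])
      show "S1 \<inter> T = {x}" using h(4) d(3,4) i unfolding set_eq_iff Un_iff Int_iff insert_iff empty_iff by metis
    qed
    then have "spath G a ((S1 \<union> T) \<union> S2) ((p1 \<union> q) \<union> p2) b"
    proof (rule spath_append[OF _ spath_rev[OF d(2)]])
      show "(S1 \<union> T) \<inter> S2 = {y}" using h(4) d(3,4) i unfolding set_eq_iff Un_iff Int_iff insert_iff empty_iff by metis
    qed
    moreover have "p \<union> q - {e} = (p1 \<union> q) \<union> p2" using h(5,6) d(6,8,9) by blast
    moreover have "a \<noteq> b" using d(4) i by auto
    ultimately show ?thesis using d(5) by metis
  qed
  obtain x y S T p q where h: "x \<noteq> y" "spath G x S p y" "spath G x T q y" "S \<inter> T = {x, y}" "p \<inter> q = {}" "C = p \<union> q"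
    using assms unfolding circ_def by metis
  show ?thesis
  proof (cases "e \<in> p")
    case True
    show ?thesis using *[OF h(1-5) True] h by simp
  next
    case False
    have "T \<inter> S = {x, y}" "q \<inter> p = {}" "e \<in> q" using h assms False by auto
    from *[OF h(1,3,2) this] show ?thesis using h by (simp add: Un_commute)
  qed
qed

lemma circ_from_edge:
  assumes "spath G a S p b" "a \<noteq> b" "e \<in> edges G" "ends G e = {a, b}" "e \<notin> p"
  shows "circ G (insert e p)"
  using circI[OF assms(2,1) spath_single[OF assms(3,4,2)]] assms spath_ends[OF assms(1)] by auto

lemma circ_finite: "circ G C \<Longrightarrow> finite C"
  by (elim circE) (simp add: spath_finite)

lemma circ_edges: "circ G C \<Longrightarrow> C \<subseteq> edges G"
  by (elim circE) (simp add: spath_edges)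

lemma circ_nonempty: "circ G C \<Longrightarrow> C \<noteq> {}"
  by (elim circE) (simp add: spath_empty_iff)

text \<open>Each of the two paths contributes 1 at their common ends, and any other vertex lies on
  at most one of them. This condition at every vertex later serves to enumerate the circuits of
  concrete graphs, and to show that even coverings by circuits survive a splitting.\<close>

lemma circ_incident: "circ G C \<Longrightarrow> card (incident G C z) = 0 \<or> card (incident G C z) = 2"
proof -
  assume "circ G C"
  then obtain x y S T p q where h: "x \<noteq> y" "spath G x S p y" "spath G x T q y" "S \<inter> T = {x, y}"
    "p \<inter> q = {}" "C = p \<union> q" unfolding circ_def by metis
  have "incident G p z \<inter> incident G q z = {}" using h by (auto simp: incident_def)
  then have "card (incident G C z) = card (incident G p z) + card (incident G q z)"
    using spath_finite[OF h(2)] spath_finite[OF h(3)] unfolding h(6) incident_Un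
    by (intro card_Un_disjoint) (auto simp: finite_incident)
  also have "\<dots> = 0 \<or> \<dots> = 2"
    using h(1,4) spath_ends[OF h(2)] spath_ends[OF h(3)]
    unfolding card_incident_spath[OF h(2)] card_incident_spath[OF h(3)] by auto
  finally show ?thesis .
qed

lemma circ_incident_ge2:
  assumes "circ G C" "e \<in> C" "z \<in> ends G e"
  shows "card (incident G C z) = 2"
proof -
  have "finite (incident G C z)" "e \<in> incident G C z"
    using assms circ_finite finite_incident by (metis, auto simp: incident_def)
  then have "card (incident G C z) \<noteq> 0" by auto
  then show ?thesis using circ_incident assms by metis
qed

lemma circ_mono:
  assumes "circ G C" "C \<subseteq> edges H" "\<And>e. e \<in> C \<Longrightarrow> ends H e = ends G e"
  shows "circ H C"
proof -
  obtain x y S T p q where h: "x \<noteq> y" "spath G x S p y" "spath G x T q y" "S \<inter> T = {x, y}"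
    "p \<inter> q = {}" "C = p \<union> q" using assms(1) unfolding circ_def by metis
  have "spath H x S p y" using h(6) assms(2,3) by (intro spath_mono[OF h(2)]) simp_all
  moreover have "spath H x T q y" using h(6) assms(2,3) by (intro spath_mono[OF h(3)]) simp_all
  ultimately show ?thesis using circI h by metis
qed

text \<open>The start of a path has degree 1 in it, so a circuit inside the path avoids the first edge.\<close>

lemma spath_no_circ: "spath G x S p y \<Longrightarrow> circ G D \<Longrightarrow> \<not> D \<subseteq> p"
proof (induction rule: spath.induct)
  case (nil x)
  then show ?case using circ_nonempty by blast
next
  case (step e x z S p y)
  show ?case
  proof
    assume D: "D \<subseteq> insert e p"
    have "e \<notin> D"
    proof
      assume "e \<in> D"
      then have "card (incident G D x) = 2" using circ_incident_ge2 step by (metis insertI1)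
      moreover have "incident G D x \<subseteq> {e}" using D spath_ends_subset[OF step(4)] step(3)
        by (auto simp: incident_def)
      ultimately show False using card_mono[of "{e}" "incident G D x"] by simp
    qed
    then show False using D step by blast
  qed
qed

text \<open>If an edge of \<open>C\<close> were missing from \<open>D\<close>, then \<open>D\<close>
  would lie in the path that is left when this edge is removed from \<open>C\<close>.\<close>

lemma circ_minimal:
  assumes "circ G C" "circ G D" "D \<subseteq> C"
  shows "D = C"
proof (rule ccontr)
  assume "D \<noteq> C"
  then obtain e where e: "e \<in> C" "e \<notin> D" using assms by blast
  obtain a b S where "spath G a S (C - {e}) b" using circ_edge_path[OF assms(1) e(1)] by blast
  then have "\<not> D \<subseteq> C - {e}" using spath_no_circ assms(2) by metis
  then show False using assms(3) e(2) by blast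
qed

lemma circ_map:
  assumes "circ G C" "inj_on \<alpha> (\<Union>(ends G ` C))" "inj_on \<beta> C" "\<beta> ` C \<subseteq> edges H"
    "\<And>e. e \<in> C \<Longrightarrow> ends H (\<beta> e) = \<alpha> ` ends G e"
  shows "circ H (\<beta> ` C)"
proof -
  obtain e where e: "e \<in> C" using circ_nonempty assms(1) by blast
  obtain a b S where h: "a \<noteq> b" "ends G e = {a, b}" "spath G a S (C - {e}) b"
    using circ_edge_path[OF assms(1) e] by blast
  \<comment> \<open>As \<open>a \<noteq> b\<close>, every vertex of the path lies on an edge of it;
    so injectivity of \<open>\<alpha>\<close> on the ends of the edges of \<open>C\<close> covers
    the whole path.\<close>
  have S: "S \<subseteq> \<Union>(ends G ` C)"
  proof
    fix z assume z: "z \<in> S"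
    then have "card (incident G (C - {e}) z) \<noteq> 0" using h card_incident_spath[OF h(3), of z] by auto
    then have "incident G (C - {e}) z \<noteq> {}" by auto
    then show "z \<in> \<Union>(ends G ` C)" by (auto simp: incident_def)
  qed
  have "spath H (\<alpha> a) (\<alpha> ` S) (\<beta> ` (C - {e})) (\<alpha> b)"
    using assms S by (intro spath_map[OF h(3)]) (auto intro: inj_on_subset)
  moreover have "\<alpha> a \<noteq> \<alpha> b"
    using inj_onD[OF assms(2), of a b] h(1) S spath_ends[OF h(3)] by blast
  moreover have "\<beta> e \<notin> \<beta> ` (C - {e})" using assms e by (auto dest: inj_onD)
  ultimately have "circ H (insert (\<beta> e) (\<beta> ` (C - {e})))"
    using assms e h by (intro circ_from_edge[of H "\<alpha> a" "\<alpha> ` S" _ "\<alpha> b"]) auto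
  moreover have "insert (\<beta> e) (\<beta> ` (C - {e})) = \<beta> ` C" using e by auto
  ultimately show ?thesis by simp
qed

section \<open>Comparison with traversals\<close>

text \<open>The part of the traversal from position \<open>k\<close> on is a path back to the
  initial vertex. The induction runs downwards from \<open>k = length es\<close>, where the index
  wraps around to 0 and the path is trivial; \<open>k = 0\<close> is excluded because the entire
  traversal is closed.\<close>

lemma traversal_spath:
  assumes t: "circuit_traversal G vs es" and k: "1 \<le> k" "k \<le> length es" "2 \<le> length es"
  shows "spath G (vs ! (k mod length es)) (insert (vs ! 0) (set (drop k vs))) (set (drop k es)) (vs ! 0)"
  using k(2) k(1)
proof (induction k rule: inc_induct)
  case base
  have "length vs = length es" using t by (simp add: circuit_traversal_def)
  then show ?case by (simp add: spath.nil)
next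
  case (step n)
  have l: "length vs = length es" "distinct vs" using t by (auto simp: circuit_traversal_def)
  have IH: "spath G (vs ! (Suc n mod length es)) (insert (vs ! 0) (set (drop (Suc n) vs))) (set (drop (Suc n) es)) (vs ! 0)"
    using step by simp
  have d: "drop n vs = vs ! n # drop (Suc n) vs" "drop n es = es ! n # drop (Suc n) es"
    using step l by (auto simp: Cons_nth_drop_Suc)
  have "es ! n \<in> edges G" "ends G (es ! n) = {vs ! n, vs ! (Suc n mod length es)}"
    using t step by (auto simp: circuit_traversal_def)
  moreover have "vs ! n \<notin> insert (vs ! 0) (set (drop (Suc n) vs))"
  proof -
    have "vs ! n \<noteq> vs ! 0" using l step by (subst nth_eq_iff_index_eq) auto
    moreover have "distinct (drop n vs)" using l by simp
    ultimately show ?thesis using d by simp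
  qed
  ultimately have "spath G (vs ! n) (insert (vs ! n) (insert (vs ! 0) (set (drop (Suc n) vs))))
     (insert (es ! n) (set (drop (Suc n) es))) (vs ! 0)"
    using IH spath.step by metis
  then show ?case using d step by (simp add: insert_commute)
qed

lemma spath_lists:
  "spath G x S p y \<Longrightarrow> \<exists>vs es. length vs = Suc (length es) \<and> vs ! 0 = x \<and> vs ! length es = y \<and>
    distinct vs \<and> distinct es \<and> set vs = S \<and> set es = p \<and> (\<forall>i<length es. ends G (es ! i) = {vs ! i, vs ! Suc i})"
proof (induction rule: spath.induct)
  case (nil x)
  show ?case by (intro exI[of _ "[x]"] exI[of _ "[]"]) simp
next
  case (step e x z S p y)
  then obtain vs es where h: "length vs = Suc (length es)" "vs ! 0 = z" "vs ! length es = y" "distinct vs" "distinct es"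
    "set vs = S" "set es = p" "\<forall>i<length es. ends G (es ! i) = {vs ! i, vs ! Suc i}" by blast
  have "e \<notin> p" using spath_step_new step by metis
  then show ?case using h step by (intro exI[of _ "x # vs"] exI[of _ "e # es"]) (auto simp: less_Suc_eq_0_disj)
qed

text \<open>Two edge-disjoint paths between distinct vertices never form a loop, and loops are the
  only circuits lost in this way. Since a loop has odd length, the difference disappears for even
  circuits.\<close>

lemma circ_iff_circuit: "circ G C \<longleftrightarrow> circuit G C \<and> card C \<noteq> 1"
proof
  assume c: "circ G C"
  obtain e where e: "e \<in> C" using circ_nonempty c by blast
  obtain a b S where h: "a \<noteq> b" "ends G e = {a, b}" "spath G a S (C - {e}) b" using circ_edge_path[OF c e] by blast
  obtain vs es where l: "length vs = Suc (length es)" "vs ! 0 = a" "vs ! length es = b" "distinct vs" "distinct es"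
    "set es = C - {e}" "\<forall>i<length es. ends G (es ! i) = {vs ! i, vs ! Suc i}" using spath_lists[OF h(3)] by blast
  have "circuit_traversal G vs (es @ [e])"
    unfolding circuit_traversal_def
  proof (intro conjI allI impI)
    fix i assume i: "i < length (es @ [e])"
    show "ends G ((es @ [e]) ! i) = {vs ! i, vs ! ((i + 1) mod length (es @ [e]))}"
    proof (cases "i = length es")
      case True
      then show ?thesis using l h(2) by (simp add: insert_commute)
    next
      case False
      then show ?thesis using l(7) i by (simp add: nth_append)
    qed
  qed (use l e circ_edges[OF c] in auto)
  moreover have "set (es @ [e]) = C" using l e by auto
  moreover have "card C \<noteq> 1"
  proof
    assume "card C = 1"
    then have "C = {e}" using e by (auto simp: card_1_singleton_iff)
    then show False using h spath_empty_iff by fastforce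
  qed
  ultimately show "circuit G C \<and> card C \<noteq> 1" unfolding circuit_def by metis
next
  assume c: "circuit G C \<and> card C \<noteq> 1"
  then obtain vs es where t: "circuit_traversal G vs es" "set es = C" unfolding circuit_def by blast
  have len: "length es = card C" using t by (metis circuit_traversal_def distinct_card)
  have "es \<noteq> []" using t by (simp add: circuit_traversal_def)
  then have l2: "2 \<le> length es" using c len by (cases es) (auto simp: Suc_le_eq)
  have s: "spath G (vs ! 1) (insert (vs ! 0) (set (drop 1 vs))) (set (drop 1 es)) (vs ! 0)"
    using traversal_spath[OF t(1), of 1] l2 by simp
  have e: "ends G (es ! 0) = {vs ! 1, vs ! 0}" "es ! 0 \<in> edges G" "vs ! 1 \<noteq> vs ! 0"
    using t l2 by (auto simp: circuit_traversal_def nth_eq_iff_index_eq)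
  have es: "es = es ! 0 # drop 1 es" using l2 by (cases es) auto
  have "distinct es" using t by (simp add: circuit_traversal_def)
  then have "es ! 0 \<notin> set (drop 1 es)" using es by (metis distinct.simps(2))
  then have "circ G (insert (es ! 0) (set (drop 1 es)))" using circ_from_edge[OF s e(3,2,1)] by simp
  then show "circ G C" using t es by (metis list.simps(15))
qed

lemma even_circuits_circ: "even_circuits G = {C. circ G C \<and> even (card C)}"
  by (auto simp: even_circuits_def circ_iff_circuit)

section \<open>The three kinds of relations between even circuits\<close>

text \<open>With truth values read as elements of the field with two elements, \<open>f\<close> sums
  to zero over the three circuits. Edge-disjointness is a separate condition because two paths that
  meet in \<open>x\<close> and \<open>y\<close> only may be one and the same edge. The two parity
  conditions make all three circuits even.\<close>

definition theta_rel :: "('v, 'e) mgraph \<Rightarrow> ('e set \<Rightarrow> bool) \<Rightarrow> bool" where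
  "theta_rel G f \<longleftrightarrow> (\<forall>x y P Q R p q r.
     x \<noteq> y \<longrightarrow> spath G x P p y \<longrightarrow> spath G x Q q y \<longrightarrow> spath G x R r y \<longrightarrow>
     P \<inter> Q = {x, y} \<longrightarrow> P \<inter> R = {x, y} \<longrightarrow> Q \<inter> R = {x, y} \<longrightarrow> p \<inter> q = {} \<longrightarrow> p \<inter> r = {} \<longrightarrow> q \<inter> r = {} \<longrightarrow>
     even (card p + card q) \<longrightarrow> even (card q + card r) \<longrightarrow>
     f (p \<union> q) = (f (q \<union> r) \<noteq> f (p \<union> r)))"

text \<open>A subdivision of \<open>K\<^sub>4\<close> in which the four triangles are odd; \<open>pij\<close> joins the branch vertices
  \<open>xi\<close> and \<open>xj\<close>.\<close>

definition K4_rel :: "('v, 'e) mgraph \<Rightarrow> ('e set \<Rightarrow> bool) \<Rightarrow> bool" where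
  "K4_rel G f \<longleftrightarrow> (\<forall>x0 x1 x2 x3 P01 P02 P03 P12 P13 P23 p01 p02 p03 p12 p13 p23.
     spath G x0 P01 p01 x1 \<longrightarrow> spath G x0 P02 p02 x2 \<longrightarrow> spath G x0 P03 p03 x3 \<longrightarrow>
     spath G x1 P12 p12 x2 \<longrightarrow> spath G x1 P13 p13 x3 \<longrightarrow> spath G x2 P23 p23 x3 \<longrightarrow>
     P01 \<inter> P02 = {x0} \<longrightarrow> P01 \<inter> P03 = {x0} \<longrightarrow> P02 \<inter> P03 = {x0} \<longrightarrow>
     P01 \<inter> P12 = {x1} \<longrightarrow> P01 \<inter> P13 = {x1} \<longrightarrow> P12 \<inter> P13 = {x1} \<longrightarrow>
     P02 \<inter> P12 = {x2} \<longrightarrow> P02 \<inter> P23 = {x2} \<longrightarrow> P12 \<inter> P23 = {x2} \<longrightarrow>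
     P03 \<inter> P13 = {x3} \<longrightarrow> P03 \<inter> P23 = {x3} \<longrightarrow> P13 \<inter> P23 = {x3} \<longrightarrow>
     P01 \<inter> P23 = {} \<longrightarrow> P02 \<inter> P13 = {} \<longrightarrow> P03 \<inter> P12 = {} \<longrightarrow>
     odd (card p01 + card p12 + card p02) \<longrightarrow> odd (card p01 + card p13 + card p03) \<longrightarrow>
     odd (card p02 + card p23 + card p03) \<longrightarrow>
     f (p01 \<union> p12 \<union> p23 \<union> p03) = (f (p01 \<union> p13 \<union> p23 \<union> p02) \<noteq> f (p02 \<union> p12 \<union> p13 \<union> p03)))"

text \<open>A ring of three odd digons \<open>pi \<union> qi\<close> with ends \<open>si\<close>, \<open>ti\<close>; the connecting paths \<open>c12\<close>, \<open>c23\<close>,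
  \<open>c31\<close> may be trivial.\<close>

definition ring_rel :: "('v, 'e) mgraph \<Rightarrow> ('e set \<Rightarrow> bool) \<Rightarrow> bool" where
  "ring_rel G f \<longleftrightarrow> (\<forall>s1 t1 s2 t2 s3 t3 P1 Q1 P2 Q2 P3 Q3 C12 C23 C31 p1 q1 p2 q2 p3 q3 c12 c23 c31.
     s1 \<noteq> t1 \<longrightarrow> s2 \<noteq> t2 \<longrightarrow> s3 \<noteq> t3 \<longrightarrow>
     spath G s1 P1 p1 t1 \<longrightarrow> spath G s1 Q1 q1 t1 \<longrightarrow> spath G s2 P2 p2 t2 \<longrightarrow> spath G s2 Q2 q2 t2 \<longrightarrow>
     spath G s3 P3 p3 t3 \<longrightarrow> spath G s3 Q3 q3 t3 \<longrightarrow>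
     spath G t1 C12 c12 s2 \<longrightarrow> spath G t2 C23 c23 s3 \<longrightarrow> spath G t3 C31 c31 s1 \<longrightarrow>
     P1 \<inter> Q1 = {s1, t1} \<longrightarrow> P2 \<inter> Q2 = {s2, t2} \<longrightarrow> P3 \<inter> Q3 = {s3, t3} \<longrightarrow>
     (P1 \<union> Q1) \<inter> (P2 \<union> Q2) = {t1} \<inter> {s2} \<longrightarrow> (P2 \<union> Q2) \<inter> (P3 \<union> Q3) = {t2} \<inter> {s3} \<longrightarrow>
     (P3 \<union> Q3) \<inter> (P1 \<union> Q1) = {t3} \<inter> {s1} \<longrightarrow>
     (P1 \<union> Q1) \<inter> C12 = {t1} \<longrightarrow> (P2 \<union> Q2) \<inter> C12 = {s2} \<longrightarrow> (P3 \<union> Q3) \<inter> C12 = {} \<longrightarrow>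
     (P2 \<union> Q2) \<inter> C23 = {t2} \<longrightarrow> (P3 \<union> Q3) \<inter> C23 = {s3} \<longrightarrow> (P1 \<union> Q1) \<inter> C23 = {} \<longrightarrow>
     (P3 \<union> Q3) \<inter> C31 = {t3} \<longrightarrow> (P1 \<union> Q1) \<inter> C31 = {s1} \<longrightarrow> (P2 \<union> Q2) \<inter> C31 = {} \<longrightarrow>
     C12 \<inter> C23 = {} \<longrightarrow> C23 \<inter> C31 = {} \<longrightarrow> C31 \<inter> C12 = {} \<longrightarrow>
     odd (card p1 + card q1) \<longrightarrow> odd (card p2 + card q2) \<longrightarrow> odd (card p3 + card q3) \<longrightarrow>
     even (card p1 + card p2 + card p3 + card c12 + card c23 + card c31) \<longrightarrow>
     (f (p1 \<union> p2 \<union> p3 \<union> (c12 \<union> c23 \<union> c31)) \<noteq> f (p1 \<union> q2 \<union> q3 \<union> (c12 \<union> c23 \<union> c31))) =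
     (f (q1 \<union> p2 \<union> q3 \<union> (c12 \<union> c23 \<union> c31)) \<noteq> f (q1 \<union> q2 \<union> p3 \<union> (c12 \<union> c23 \<union> c31))))"

definition rels :: "('v, 'e) mgraph \<Rightarrow> ('e set \<Rightarrow> bool) \<Rightarrow> bool" where
  "rels G f \<longleftrightarrow> theta_rel G f \<and> K4_rel G f \<and> ring_rel G f"

lemma spath_disjoint0: "spath G x S p y \<Longrightarrow> spath G x' S' p' y' \<Longrightarrow> S \<inter> S' = {} \<Longrightarrow> p \<inter> p' = {}"
  and spath_disjoint1: "spath G x S p y \<Longrightarrow> spath G x' S' p' y' \<Longrightarrow> S \<inter> S' = {z} \<Longrightarrow> p \<inter> p' = {}"
  using spath_disjoint by (metis empty_subsetI, metis order_refl)

lemmas theta_relD = theta_rel_def[THEN iffD1, rule_format]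
lemmas K4_relD = K4_rel_def[THEN iffD1, rule_format]
lemmas ring_relD = ring_rel_def[THEN iffD1, rule_format]

section \<open>Where two paths meet and part\<close>

lemma spath_first_hit:
  "spath G x S p y \<Longrightarrow> y \<in> T \<Longrightarrow> \<exists>z S1 p1 S2 p2. spath G x S1 p1 z \<and> spath G z S2 p2 y \<and> S1 \<union> S2 = S \<and>
     S1 \<inter> S2 = {z} \<and> p1 \<union> p2 = p \<and> S1 \<inter> T = {z}"
proof (induction rule: spath.induct)
  case (nil x)
  then show ?case using spath.nil[of G x] by blast
next
  case (step e x z' S p y)
  show ?case
  proof (cases "x \<in> T")
    case True
    then have "{x} \<inter> T = {x}" "{x} \<union> insert x S = insert x S" "{x} \<inter> insert x S = {x}" "{} \<union> insert e p = insert e p" by auto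
    then show ?thesis using spath.nil[of G x] spath.step[OF step(1-4)] by blast
  next
    case False
    obtain z S1 p1 S2 p2 where *: "spath G z' S1 p1 z" "spath G z S2 p2 y" "S1 \<union> S2 = S"
      "S1 \<inter> S2 = {z}" "p1 \<union> p2 = p" "S1 \<inter> T = {z}" using step by blast
    have "spath G x (insert x S1) (insert e p1) z" using * step spath.step by (metis UnI1)
    moreover have "insert x S1 \<union> S2 = insert x S" "insert x S1 \<inter> S2 = {z}"
      "insert e p1 \<union> p2 = insert e p" "insert x S1 \<inter> T = {z}"
      using *(3-6) step(3) False by auto
    ultimately show ?thesis using *(2) by blast
  qed
qed

lemma spath_last_hit:
  assumes "spath G x S p y" "x \<in> T"
  shows "\<exists>z S1 p1 S2 p2. spath G x S1 p1 z \<and> spath G z S2 p2 y \<and> S1 \<union> S2 = S \<and>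
     S1 \<inter> S2 = {z} \<and> p1 \<union> p2 = p \<and> S2 \<inter> T = {z}"
proof -
  obtain z S1 p1 S2 p2 where "spath G y S1 p1 z" "spath G z S2 p2 x" "S1 \<union> S2 = S"
     "S1 \<inter> S2 = {z}" "p1 \<union> p2 = p" "S1 \<inter> T = {z}" using spath_first_hit[OF spath_rev[OF assms(1)] assms(2)] by metis
  then have "spath G x S2 p2 z" "spath G z S1 p1 y" "S2 \<union> S1 = S" "S2 \<inter> S1 = {z}" "p2 \<union> p1 = p" "S1 \<inter> T = {z}"
    using spath_rev by (metis, metis, blast+)
  then show ?thesis by blast
qed

text \<open>Here \<open>x\<close> is the vertex where the paths leave each other for the first time,
  \<open>r\<close> is the piece of the second path from \<open>x\<close> to its first return
  \<open>y\<close> to the first path, and \<open>m\<close> is the piece of the first path bypassed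
  by \<open>r\<close>. The rest \<open>d\<close> of the second path avoids \<open>c\<close>, and
  \<open>r\<close> apart from \<open>y\<close>, but it may cross \<open>m\<close> and
  \<open>b\<close> again.\<close>

lemma spath_first_diff:
  assumes "spath G u S q w" "spath G u S' q' w" "q \<noteq> q'"
  obtains x y C c M m B b R r D d where
    "spath G u C c x" "spath G x M m y" "spath G y B b w" "spath G x R r y" "spath G y D d w"
    "q = c \<union> m \<union> b" "q' = c \<union> r \<union> d" "S = C \<union> M \<union> B" "S' = C \<union> R \<union> D" "x \<noteq> y"
    "C \<inter> M = {x}" "M \<inter> B = {y}" "C \<inter> B = {}" "R \<inter> M = {x, y}" "R \<inter> B = {y}" "C \<inter> R = {x}" "R \<inter> D = {y}"
    "C \<inter> D = {}" "r \<inter> m = {}"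
proof -
  have "\<exists>x y C c M m B b R r D d. 
    spath G u C c x \<and> spath G x M m y \<and> spath G y B b w \<and> spath G x R r y \<and> spath G y D d w \<and>
    q = c \<union> m \<union> b \<and> q' = c \<union> r \<union> d \<and> S = C \<union> M \<union> B \<and> S' = C \<union> R \<union> D \<and> x \<noteq> y \<and>
    C \<inter> M = {x} \<and> M \<inter> B = {y} \<and> C \<inter> B = {} \<and> R \<inter> M = {x, y} \<and> R \<inter> B = {y} \<and> C \<inter> R = {x} \<and> R \<inter> D = {y} \<and>
    C \<inter> D = {} \<and> r \<inter> m = {}"
    using assms
  proof (induction arbitrary: S' q' rule: spath.induct)
    case (nil x)
    then show ?case using spath_loop by metis
  next
    case (step e u z S q w)
    have "u \<noteq> w" using step spath_end by metis
    then obtain e' z' S1 q1 where s: "S' = insert u S1" "q' = insert e' q1" "e' \<in> edges G" "ends G e' = {u, z'}"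
      "u \<notin> S1" "spath G z' S1 q1 w"
      by (auto intro: spath.cases[OF step.prems(1)])
    show ?case
    proof (cases "e = e'")
      case True
      then have z: "z = z'" using s(4) step(2) by (metis doubleton_eq_iff)
      have "spath G z S1 q1 w" "q \<noteq> q1" using s z True step.prems by auto
      from step.IH[OF this] obtain x y C c M m B b R r D d where h:
        "spath G z C c x" "spath G x M m y" "spath G y B b w" "spath G x R r y" "spath G y D d w"
        "q = c \<union> m \<union> b" "q1 = c \<union> r \<union> d" "S = C \<union> M \<union> B" "S1 = C \<union> R \<union> D" "x \<noteq> y"
        "C \<inter> M = {x}" "M \<inter> B = {y}" "C \<inter> B = {}" "R \<inter> M = {x, y}" "R \<inter> B = {y}" "C \<inter> R = {x}" "R \<inter> D = {y}"
        "C \<inter> D = {}" "r \<inter> m = {}" by (elim exE conjE) (rule that)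
      have n: "u \<notin> C" "u \<notin> M" "u \<notin> B" "u \<notin> R" "u \<notin> D" using h(8,9) s(5) step(3) by simp_all
      have "spath G u (insert u C) (insert e c) x" using spath.step[OF step(1,2) n(1) h(1)] .
      moreover have "insert e q = insert e c \<union> m \<union> b" "q' = insert e c \<union> r \<union> d" "insert u S = insert u C \<union> M \<union> B"
        "S' = insert u C \<union> R \<union> D" using h(6-9) s(1,2) True by simp_all
      moreover have "insert u C \<inter> M = {x}" "insert u C \<inter> B = {}" "insert u C \<inter> R = {x}" "insert u C \<inter> D = {}"
        using h(11,13,16,18) n by simp_all
      ultimately show ?thesis using h(2-5) h(10) h(12) h(14,15) h(17) h(19) by blast
    next
      case False
      have "w \<in> S" using spath_end step by metis
      from spath_first_hit[OF s(6) this] obtain y R r D d where h: "spath G z' R r y" "spath G y D d w" "R \<union> D = S1" "R \<inter> D = {y}"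
        "r \<union> d = q1" "R \<inter> S = {y}" by blast
      have "y \<in> S" using h(6) by blast
      from spath_split[OF step(4) this] obtain M B m b where k: "spath G z M m y" "spath G y B b w" "M \<union> B = S" "M \<inter> B = {y}"
        "m \<union> b = q" "m \<inter> b = {}" by blast
      have n: "u \<notin> R" "u \<notin> D" "u \<notin> M" "u \<notin> B" using h s k step(3) by auto
      have m: "spath G u (insert u M) (insert e m) y" using spath.step[OF step(1,2) n(3) k(1)] .
      have r: "spath G u (insert u R) (insert e' r) y" using spath.step[OF s(3,4) n(1) h(1)] .
      have "e' \<notin> m" using spath_step_new[OF s(4)] n(3) spath_ends_subset[OF k(1)] s(4) by blast
      moreover have "e \<notin> r" using spath_ends_subset[OF h(1)] step(2) n(1) by blast
      moreover have "R \<inter> M \<subseteq> {y}" using h(6) k(3) by blast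
      then have "r \<inter> m = {}" using spath_disjoint[OF h(1) k(1)] by blast
      ultimately have dis: "insert e' r \<inter> insert e m = {}" using False by blast
      have yM: "y \<in> M" "y \<in> B" "y \<in> R" "y \<in> D" using k(1,2) h(1,2) spath_ends by metis+
      have "y \<noteq> u" using yM n by blast
      moreover have "insert e q = {} \<union> insert e m \<union> b" "q' = {} \<union> insert e' r \<union> d" "insert u S = {u} \<union> insert u M \<union> B"
        "S' = {u} \<union> insert u R \<union> D" using h(3,5) k(3,5) s(1,2) by auto
      moreover have "{u} \<inter> insert u M = {u}" "{u} \<inter> insert u R = {u}" "{u} \<inter> B = {}" "{u} \<inter> D = {}"
        "insert u M \<inter> B = {y}" "insert u R \<inter> D = {y}" using n k(4) h(4) by auto
      moreover have "insert u R \<inter> insert u M = {u, y}" "insert u R \<inter> B = {y}" using n yM h(6) k(3) by auto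
      ultimately show ?thesis using spath.nil[of G u] m r k(2) h(2) dis by metis
    qed
  qed
  then show ?thesis using that by metis
qed

lemma Int_sym: "A \<inter> B = X \<Longrightarrow> B \<inter> A = X" by blast

lemma spath_card_append:
  "spath G x S p z \<Longrightarrow> spath G z' T q y \<Longrightarrow> S \<inter> T \<subseteq> {v} \<Longrightarrow> card (p \<union> q) = card p + card q"
  using spath_finite spath_disjoint by (metis card_Un_disjoint)

section \<open>Adding one edge\<close>

text \<open>The edge \<open>e\<close> with ends \<open>u\<close>, \<open>w\<close> is added to the edge set \<open>B\<close>. Once \<open>f\<close> vanishes on the even circuits
  in \<open>B\<close>, its values on the even circuits through \<open>e\<close> are compared via the paths from \<open>u\<close> to \<open>w\<close>.\<close>

locale edge_addition =
  fixes G :: "('v, 'e) mgraph" and f :: "'e set \<Rightarrow> bool" and B :: "'e set" and e :: 'e and u w :: 'v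
  assumes rels: "rels G f" and e: "e \<in> edges G" "ends G e = {u, w}" "u \<noteq> w" "e \<notin> B"
    and zero: "\<And>C. circ G C \<Longrightarrow> C \<subseteq> B \<Longrightarrow> even (card C) \<Longrightarrow> \<not> f C"
begin

abbreviation path where "path x S p y \<equiv> spath G x S p y \<and> p \<subseteq> B"

text \<open>This is what remains of a circuit through \<open>e\<close> when the stretch from
  \<open>x\<close> to \<open>y\<close> is removed; it serves as one branch of a theta, a K4 or a
  ring. The additional 1 in the length is \<open>e\<close> itself.\<close>

lemma closing_path:
  assumes "path u Sa a x" "path y Sb b w" "Sa \<inter> Sb = {}"
  shows "spath G x (Sa \<union> Sb) (insert e (a \<union> b)) y" "card (insert e (a \<union> b)) = Suc (card a + card b)"
proof -
  have "u \<in> Sa" "w \<in> Sb" using assms spath_ends by metis+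
  then have n: "u \<notin> Sb" "w \<notin> Sa" using assms by auto
  have "spath G u (insert u Sb) (insert e b) y"
    using spath.step[OF e(1,2) n(1)] spath_rev assms(2) by metis
  moreover have "Sa \<inter> insert u Sb = {u}" using assms(3) \<open>u \<in> Sa\<close> by auto
  ultimately have "spath G x (Sa \<union> insert u Sb) (a \<union> insert e b) y"
    using spath_append spath_rev assms(1) by metis
  then show "spath G x (Sa \<union> Sb) (insert e (a \<union> b)) y" using \<open>u \<in> Sa\<close> by (simp add: insert_absorb)
  have "finite a" "finite b" "a \<inter> b = {}" using assms spath_finite spath_disjoint0 by metis+
  moreover have "e \<notin> a \<union> b" using assms e(4) by blast
  ultimately show "card (insert e (a \<union> b)) = Suc (card a + card b)" by (simp add: card_Un_disjoint)
qed

text \<open>The stretches \<open>m\<close> and \<open>r\<close> and the closing path through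
  \<open>e\<close> form a theta with even circuits. The circuit \<open>m \<union> r\<close> lies in
  \<open>B\<close>, where \<open>f\<close> vanishes, so the other two circuits have the same
  value.\<close>

lemma theta_move:
  assumes p: "path u Sa a x" "path x Sm m y" "path y Sb b w" "path x Sr r y" and "x \<noteq> y"
    and i: "Sa \<inter> Sm = {x}" "Sm \<inter> Sb = {y}" "Sa \<inter> Sb = {}" "Sr \<inter> Sm = {x, y}" "Sa \<inter> Sr = {x}" "Sr \<inter> Sb = {y}"
    and d: "r \<inter> m = {}" and ev: "even (card m + card r)" "odd (card a + card m + card b)"
  shows "f (insert e (a \<union> m \<union> b)) = f (insert e (a \<union> r \<union> b))"
proof -
  note c = closing_path[OF p(1,3) i(3)]
  have i2: "Sm \<inter> (Sa \<union> Sb) = {x, y}" "Sr \<inter> (Sa \<union> Sb) = {x, y}"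
    by (simp_all add: Int_Un_distrib i i[THEN Int_sym] insert_commute)
  note P = p[THEN conjunct1]
  have "a \<inter> m = {}" "m \<inter> b = {}" "a \<inter> r = {}" "r \<inter> b = {}"
    using spath_disjoint1[OF P(1,2) i(1)] spath_disjoint1[OF P(2,3) i(2)] spath_disjoint1[OF P(1,4) i(5)]
      spath_disjoint1[OF P(4,3) i(6)] by simp_all
  then have d2: "m \<inter> insert e (a \<union> b) = {}" "r \<inter> insert e (a \<union> b) = {}" using e(4) p by auto
  have d1: "m \<inter> r = {}" and i1: "Sm \<inter> Sr = {x, y}" using d i(4) by (simp_all add: Int_commute)
  have "even (card r + card (insert e (a \<union> b)))" using c(2) ev by presburger
  then have "f (m \<union> r) = (f (r \<union> insert e (a \<union> b)) \<noteq> f (m \<union> insert e (a \<union> b)))"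
    using theta_relD[OF _ assms(5) P(2,4) c(1) i1 i2 d1 d2 ev(1)] rels unfolding rels_def by metis
  moreover have "\<not> f (m \<union> r)"
  proof (rule zero)
    show "circ G (m \<union> r)" using circI[OF assms(5) P(2,4) i1 d1] .
    show "even (card (m \<union> r))" using ev(1) P(2,4) d1 spath_finite by (metis card_Un_disjoint)
  qed (use p in auto)
  moreover have "r \<union> insert e (a \<union> b) = insert e (a \<union> r \<union> b)" "m \<union> insert e (a \<union> b) = insert e (a \<union> m \<union> b)" by auto
  ultimately show ?thesis by metis
qed

text \<open>The branch vertices are \<open>x\<close>, \<open>z\<close>, \<open>y\<close>,
  \<open>z'\<close>: the ears \<open>r\<close> and \<open>r'\<close> cross each other over the
  stretch \<open>m1\<close>, \<open>m2\<close>, \<open>m3\<close>, and the sixth branch is the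
  closing path through \<open>e\<close>. One of the three even circuits avoids \<open>e\<close> and
  has value zero; the other two pass \<open>m2\<close> in opposite directions.\<close>

lemma K4_move:
  assumes p: "path u Sa a x" "path x S1 m1 z" "path z S2 m2 y" "path y S3 m3 z'" "path z' Sb b w"
      "path x Sr r y" "path z Sr' r' z'"
    and i: "Sa \<inter> S1 = {x}" "Sa \<inter> S2 = {}" "Sa \<inter> S3 = {}" "Sa \<inter> Sb = {}" "Sa \<inter> Sr = {x}" "Sa \<inter> Sr' = {}"
      "S1 \<inter> S2 = {z}" "S1 \<inter> S3 = {}" "S1 \<inter> Sb = {}" "S1 \<inter> Sr = {x}" "S1 \<inter> Sr' = {z}"
      "S2 \<inter> S3 = {y}" "S2 \<inter> Sb = {}" "S2 \<inter> Sr = {y}" "S2 \<inter> Sr' = {z}"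
      "S3 \<inter> Sb = {z'}" "S3 \<inter> Sr = {y}" "S3 \<inter> Sr' = {z'}" "Sb \<inter> Sr = {}" "Sb \<inter> Sr' = {z'}" "Sr \<inter> Sr' = {}"
    and odd: "odd (card m1 + card m2 + card r)" "odd (card m2 + card m3 + card r')"
      "odd (card a + card m1 + card m2 + card m3 + card b)"
  shows "f (insert e (a \<union> m1 \<union> m2 \<union> m3 \<union> b)) = f (insert e (a \<union> r \<union> m2 \<union> r' \<union> b))"
proof -
  note P = p[THEN conjunct1]
  note c = closing_path[OF p(1,5) i(4)]
  have j: "S1 \<inter> (Sa \<union> Sb) = {x}" "Sr \<inter> (Sa \<union> Sb) = {x}" "S3 \<inter> (Sa \<union> Sb) = {z'}" "Sr' \<inter> (Sa \<union> Sb) = {z'}"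
    "S2 \<inter> (Sa \<union> Sb) = {}" by (simp_all add: Int_Un_distrib i i[THEN Int_sym])
  have t: "odd (card m1 + card r' + card (insert e (a \<union> b)))" "odd (card r + card m3 + card (insert e (a \<union> b)))"
    "odd (card r + card m2 + card m1)" using odd c(2) by presburger+
  have "f (r \<union> m2 \<union> r' \<union> insert e (a \<union> b)) = (f (r \<union> m3 \<union> r' \<union> m1) \<noteq> f (m1 \<union> m2 \<union> m3 \<union> insert e (a \<union> b)))"
    by (rule K4_relD[OF _ P(6,2) c(1) spath_rev[OF P(3)] P(4,7) _ j(2,1) _ _ _ _ _ _ j(3,4)[THEN Int_sym] _ _ _ j(5)[THEN Int_sym] t(3,2,1)])
      (use rels in \<open>simp_all add: rels_def i i[THEN Int_sym]\<close>)
  moreover have "\<not> f (r \<union> m3 \<union> r' \<union> m1)"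
  proof (rule zero)
    have 1: "spath G x (S1 \<union> Sr') (m1 \<union> r') z'" by (rule spath_append[OF P(2,7) i(11)])
    have 2: "spath G x (Sr \<union> S3) (r \<union> m3) z'" by (rule spath_append[OF P(6,4)]) (simp add: i i[THEN Int_sym])
    have k: "(Sr \<union> S3) \<inter> (S1 \<union> Sr') = {x, z'}"
      by (simp add: Int_Un_distrib Int_Un_distrib2 i i[THEN Int_sym] insert_commute)
    have l: "r \<inter> m1 = {}" "r \<inter> r' = {}" "m3 \<inter> m1 = {}" "m3 \<inter> r' = {}" "r \<inter> m3 = {}" "m1 \<inter> r' = {}"
      using spath_disjoint1[OF P(2,6) i(10)] spath_disjoint0[OF P(6,7) i(21)] spath_disjoint0[OF P(2,4) i(8)]
       spath_disjoint1[OF P(4,7) i(18)] spath_disjoint1[OF P(4,6) i(17)] spath_disjoint1[OF P(2,7) i(11)] by blast+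
    have ne: "x \<noteq> z'" using i(5,19) spath_ends[OF P(5)] spath_ends[OF P(6)] by blast
    have "(r \<union> m3) \<inter> (m1 \<union> r') = {}" using l by blast
    from circI[OF ne 2 1 k this] show "circ G (r \<union> m3 \<union> r' \<union> m1)" by (simp add: Un_ac)
    have "card (r \<union> m3 \<union> r' \<union> m1) = card r + card m3 + card r' + card m1"
      using P[THEN spath_finite] by (simp add: card_Un_disjoint Int_Un_distrib2 l l[THEN Int_sym])
    then show "even (card (r \<union> m3 \<union> r' \<union> m1))" using odd by presburger
  qed (use p in auto)
  moreover have "r \<union> m2 \<union> r' \<union> insert e (a \<union> b) = insert e (a \<union> r \<union> m2 \<union> r' \<union> b)"
    "m1 \<union> m2 \<union> m3 \<union> insert e (a \<union> b) = insert e (a \<union> m1 \<union> m2 \<union> m3 \<union> b)" by auto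
  ultimately show ?thesis by metis
qed

text \<open>The closing path through \<open>e\<close> is the third connecting path of the ring, so
  all four even circuits contain \<open>e\<close> and none of the four values is known in
  advance.\<close>

lemma ring_move:
  assumes p: "path u Sa a x1" "path x1 M1 m1 y1" "path x1 R1 r1 y1" "path y1 N1 n1 x2" "path x2 M2 m2 y2" "path x2 R2 r2 y2"
     "path y2 N2 n2 x3" "path x3 M3 m3 y3" "path x3 R3 r3 y3" "path y3 Sb b w"
    and ne: "x1 \<noteq> y1" "x2 \<noteq> y2" "x3 \<noteq> y3"
    and d: "M1 \<inter> R1 = {x1, y1}" "M2 \<inter> R2 = {x2, y2}" "M3 \<inter> R3 = {x3, y3}"
    and i: "Sa \<inter> (M1 \<union> R1) = {x1}" "Sa \<inter> N1 = {}" "Sa \<inter> (M2 \<union> R2) = {}" "Sa \<inter> N2 = {}" "Sa \<inter> (M3 \<union> R3) = {}" "Sa \<inter> Sb = {}"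
      "(M1 \<union> R1) \<inter> N1 = {y1}" "(M1 \<union> R1) \<inter> (M2 \<union> R2) = {y1} \<inter> {x2}" "(M1 \<union> R1) \<inter> N2 = {}" "(M1 \<union> R1) \<inter> (M3 \<union> R3) = {}"
      "(M1 \<union> R1) \<inter> Sb = {}" "N1 \<inter> (M2 \<union> R2) = {x2}" "N1 \<inter> N2 = {}" "N1 \<inter> (M3 \<union> R3) = {}" "N1 \<inter> Sb = {}"
      "(M2 \<union> R2) \<inter> N2 = {y2}" "(M2 \<union> R2) \<inter> (M3 \<union> R3) = {y2} \<inter> {x3}" "(M2 \<union> R2) \<inter> Sb = {}"
      "N2 \<inter> (M3 \<union> R3) = {x3}" "N2 \<inter> Sb = {}" "(M3 \<union> R3) \<inter> Sb = {y3}"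
    and odd: "odd (card m1 + card r1)" "odd (card m2 + card r2)" "odd (card m3 + card r3)"
      "odd (card a + card m1 + card n1 + card m2 + card n2 + card m3 + card b)"
  shows "(f (insert e (a \<union> m1 \<union> n1 \<union> m2 \<union> n2 \<union> m3 \<union> b)) \<noteq> f (insert e (a \<union> m1 \<union> n1 \<union> r2 \<union> n2 \<union> r3 \<union> b))) =
     (f (insert e (a \<union> r1 \<union> n1 \<union> m2 \<union> n2 \<union> r3 \<union> b)) \<noteq> f (insert e (a \<union> r1 \<union> n1 \<union> r2 \<union> n2 \<union> m3 \<union> b)))"
proof -
  note P = p[THEN conjunct1]
  note c = closing_path[OF p(1,10) i(6)]
  have "y3 \<notin> Sa" "x1 \<notin> Sb" using i(6) spath_ends[OF P(1)] spath_ends[OF P(10)] by blast+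
  then have y: "(M3 \<union> R3) \<inter> (M1 \<union> R1) = {y3} \<inter> {x1}" using i(10)[THEN Int_sym] spath_ends[OF P(1)] by auto
  have j: "(M1 \<union> R1) \<inter> (Sa \<union> Sb) = {x1}" "(M2 \<union> R2) \<inter> (Sa \<union> Sb) = {}" "(M3 \<union> R3) \<inter> (Sa \<union> Sb) = {y3}"
    "N1 \<inter> (Sa \<union> Sb) = {}" "N2 \<inter> (Sa \<union> Sb) = {}"
    using i by (simp_all add: Int_Un_distrib[of _ Sa Sb] i[THEN Int_sym])
  have ev: "even (card m1 + card m2 + card m3 + card n1 + card n2 + card (insert e (a \<union> b)))" using odd c(2) by presburger
  have "(f (m1 \<union> m2 \<union> m3 \<union> (n1 \<union> n2 \<union> insert e (a \<union> b))) \<noteq> f (m1 \<union> r2 \<union> r3 \<union> (n1 \<union> n2 \<union> insert e (a \<union> b)))) =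
     (f (r1 \<union> m2 \<union> r3 \<union> (n1 \<union> n2 \<union> insert e (a \<union> b))) \<noteq> f (r1 \<union> r2 \<union> m3 \<union> (n1 \<union> n2 \<union> insert e (a \<union> b))))"
    by (rule ring_relD[OF _ ne P(2,3,5,6,8,9,4,7) spath_rev[OF c(1)] d i(8,17) y i(7) i(12)[THEN Int_sym] i(14)[THEN Int_sym]
       i(16) i(19)[THEN Int_sym] i(9) j(3,1,2) i(13) j(5) j(4)[THEN Int_sym] odd(1,2,3) ev])
      (use rels in \<open>simp add: rels_def\<close>)
  moreover have "m \<union> m' \<union> m'' \<union> (n1 \<union> n2 \<union> insert e (a \<union> b)) = insert e (a \<union> m \<union> n1 \<union> m' \<union> n2 \<union> m'' \<union> b)" for m m' m'' by auto
  ultimately show ?thesis by simp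
qed

end

lemma spath_app:
  assumes "spath G x S p z" "spath G z T q y" "S \<inter> T = {z}"
  shows "spath G x (S \<union> T) (p \<union> q) y" "card (p \<union> q) = card p + card q"
  using spath_append[OF assms] spath_card_append[OF assms(1,2)] assms(3) by auto

lemma spath_app3:
  assumes "spath G x Sa a x'" "spath G x' Sm m y'" "spath G y' Sb b y" "Sa \<inter> Sm = {x'}" "Sm \<inter> Sb = {y'}" "Sa \<inter> Sb = {}"
  shows "spath G x (Sa \<union> Sm \<union> Sb) (a \<union> m \<union> b) y" "card (a \<union> m \<union> b) = card a + card m + card b"
    "a \<inter> m = {}" "m \<inter> b = {}" "a \<inter> b = {}"
proof -
  have i: "(Sa \<union> Sm) \<inter> Sb = {y'}" using assms by (simp add: Int_Un_distrib2)
  note 1 = spath_app[OF assms(1,2,4)] 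
  show "spath G x (Sa \<union> Sm \<union> Sb) (a \<union> m \<union> b) y" "card (a \<union> m \<union> b) = card a + card m + card b"
    using spath_app[OF 1(1) assms(3) i] 1 by auto
  show "a \<inter> m = {}" "m \<inter> b = {}" "a \<inter> b = {}"
    using spath_disjoint1[OF assms(1,2,4)] spath_disjoint1[OF assms(2,3,5)] spath_disjoint0[OF assms(1,3,6)] by auto
qed

lemma spath_disjoint2:
  "spath G x S p y \<Longrightarrow> spath G x' S' p' y' \<Longrightarrow> S \<inter> S' = {z} \<inter> {z'} \<Longrightarrow> p \<inter> p' = {}"
  by (rule spath_disjoint[where z = z]) auto

lemma Int_sub2: "R \<subseteq> S \<Longrightarrow> R' \<subseteq> S' \<Longrightarrow> S \<inter> S' = X \<Longrightarrow> R \<inter> R' = X \<inter> R \<inter> R'" by blast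

lemma spath_verts: "spath G x S p y \<Longrightarrow> S = insert x (\<Union>(ends G ` p))"
proof (induction rule: spath.induct)
  case (step e x z S p y)
  have "insert x S = insert x (insert z (\<Union>(ends G ` p)))" using step.IH by simp
  also have "\<dots> = insert x (\<Union>(ends G ` insert e p))" using step.hyps(2) by auto
  finally show ?case .
qed simp

text \<open>Two paths \<open>W1 A P D W2\<close> and \<open>W1 A' P D' W2\<close> from \<open>u\<close> to \<open>w\<close> that differ in two odd digons.\<close>

locale stuck_pair = edge_addition +
  fixes W1 SW1 s1 A SA A' SA' t1 P SP t2 D SD D' SD' s2 W2 SW2
  assumes paths: "path u SW1 W1 s1" "path s1 SA A t1" "path s1 SA' A' t1" "path t1 SP P t2" "path t2 SD D s2"
      "path t2 SD' D' s2" "path s2 SW2 W2 w"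
    and ne: "s1 \<noteq> t1" "t2 \<noteq> s2"
    and dig: "SA \<inter> SA' = {s1, t1}" "SD \<inter> SD' = {t2, s2}" "A \<inter> A' = {}" "D \<inter> D' = {}"
    and disj: "SW1 \<inter> SA = {s1}" "SW1 \<inter> SA' = {s1}" "SW1 \<inter> SP = {}" "SW1 \<inter> SD = {}" "SW1 \<inter> SD' = {}" "SW1 \<inter> SW2 = {}"
      "SA \<inter> SP = {t1}" "SA' \<inter> SP = {t1}" "SA \<inter> SD = {t1} \<inter> {t2}" "SA \<inter> SD' = {t1} \<inter> {t2}" "SA' \<inter> SD = {t1} \<inter> {t2}"
      "SA' \<inter> SD' = {t1} \<inter> {t2}" "SA \<inter> SW2 = {}" "SA' \<inter> SW2 = {}" "SP \<inter> SD = {t2}" "SP \<inter> SD' = {t2}" "SP \<inter> SW2 = {}"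
      "SD \<inter> SW2 = {s2}" "SD' \<inter> SW2 = {s2}"
    and odd: "odd (card A + card A')" "odd (card D + card D')" "odd (card W1 + card A + card P + card D + card W2)"
    and neq: "f (insert e (W1 \<union> A \<union> P \<union> D \<union> W2)) \<noteq> f (insert e (W1 \<union> A' \<union> P \<union> D' \<union> W2))"

section \<open>Two paths with smallest possible union\<close>

locale minimal_pair = edge_addition +
  fixes q S q' S'
  assumes q: "path u S q w" "odd (card q)" and q': "path u S' q' w" "odd (card q')"
    and differ: "f (insert e q) \<noteq> f (insert e q')"
    and minimal: "\<And>k T. path u T k w \<Longrightarrow> odd (card k) \<Longrightarrow> k \<union> q' \<subset> q \<union> q' \<Longrightarrow> f (insert e k) = f (insert e q')"
begin

text \<open>A path contains no circuit, so \<open>C\<close> cannot lie in \<open>q'\<close> and has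
  an edge of \<open>q\<close> that belongs neither to \<open>q'\<close> nor to \<open>k\<close>.
  Thus \<open>k \<union> q'\<close> is smaller than \<open>q \<union> q'\<close>, and minimality
  applies to \<open>k\<close>. Each new path constructed below comes with such a circuit.\<close>

lemma reduce:
  assumes "path u T k w" "odd (card k)" "k \<subseteq> q \<union> q'" "circ G C" "C \<subseteq> q' \<union> (q - k)"
  shows "f (insert e k) = f (insert e q')"
proof -
  have "\<not> C \<subseteq> q'" using spath_no_circ q'(1) assms(4) by metis
  then obtain g where "g \<in> q" "g \<notin> k" "g \<notin> q'" using assms(5) by blast
  then have "k \<union> q' \<subset> q \<union> q'" using assms(3) by blast
  then show ?thesis using minimal assms(1,2) by metis
qed

text \<open>If \<open>m\<close> and \<open>r\<close> had the same parity, a theta would exchange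
  \<open>m\<close> for \<open>r\<close>, and the circuit \<open>m \<union> r\<close> would witness
  that the new path has a smaller union with \<open>q'\<close>.\<close>

lemma ear_odd:
  assumes p: "path u Sa a x" "path x Sm m y" "path y Sb b w" "path x Sr r y" and "x \<noteq> y"
    and i: "Sa \<inter> Sm = {x}" "Sm \<inter> Sb = {y}" "Sa \<inter> Sb = {}" "Sr \<inter> Sm = {x, y}" "Sa \<inter> Sr = {x}" "Sr \<inter> Sb = {y}"
    and d: "r \<inter> m = {}" and qq: "q = a \<union> m \<union> b" and r: "r \<subseteq> q'"
  shows "odd (card m + card r)"
proof
  assume ev: "even (card m + card r)"
  note P = p[THEN conjunct1]
  note k = spath_app3[OF P(1,4,3) i(5,6,3)] and k' = spath_app3[OF P(1,2,3) i(1,2,3)]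
  have o: "odd (card a + card m + card b)" using q(2) k'(2) qq by simp
  have "f (insert e (a \<union> m \<union> b)) = f (insert e (a \<union> r \<union> b))" using theta_move[OF p assms(5) i d ev o] .
  moreover have "f (insert e (a \<union> r \<union> b)) = f (insert e q')"
  proof (rule reduce)
    show "path u (Sa \<union> Sr \<union> Sb) (a \<union> r \<union> b) w" using k(1) p by simp
    show "odd (card (a \<union> r \<union> b))" using k(2) o ev by presburger
    show "circ G (m \<union> r)" using circI[OF assms(5) P(2,4)] i(4) d by (simp add: Int_commute)
    show "a \<union> r \<union> b \<subseteq> q \<union> q'" using qq r by blast
    show "m \<union> r \<subseteq> q' \<union> (q - (a \<union> r \<union> b))" using qq r d k'(3,4) by blast
  qed
  ultimately show False using differ qq by simp
qed

text \<open>If the second path returned to \<open>m\<close> after \<open>y\<close>, a piece of it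
  would be an ear that crosses \<open>r\<close>, and the two ears would yield a K4 with odd
  triangles. The exchange in it replaces \<open>m1\<close> and \<open>m3\<close> by \<open>r\<close>
  and \<open>r'\<close>, and the circuit formed by these four pieces is the one required by
  \<open>reduce\<close>.\<close>

lemma no_crossing:
  assumes p: "path u Sa a x" "path x Sm m y" "path y Sb b w" "path x Sr r y" "path y Sd d w" and "x \<noteq> y"
    and i: "Sa \<inter> Sm = {x}" "Sm \<inter> Sb = {y}" "Sa \<inter> Sb = {}" "Sr \<inter> Sm = {x, y}" "Sa \<inter> Sr = {x}" "Sr \<inter> Sb = {y}"
      "Sr \<inter> Sd = {y}" "Sa \<inter> Sd = {}"
    and d: "r \<inter> m = {}" and qq: "q = a \<union> m \<union> b" and r: "r \<subseteq> q'" "d \<subseteq> q'"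
  shows "Sd \<inter> Sm = {y}"
proof (rule ccontr)
  assume "Sd \<inter> Sm \<noteq> {y}"
  note P = p[THEN conjunct1]
  have yy: "y \<in> Sm" "y \<in> Sd" "x \<in> Sm" "x \<in> Sa" "y \<in> Sb" "x \<in> Sr" "y \<in> Sr" "w \<in> Sb"
    using P spath_ends by metis+
  \<comment> \<open>\<open>z\<close> is the last vertex of \<open>d\<close> on \<open>m\<close>.
    Behind it the second path no longer meets \<open>m\<close>, so its piece \<open>r'\<close> up to
    the first vertex \<open>z'\<close> on \<open>b\<close> is an ear spanning
    \<open>y\<close>.\<close>
  obtain z D1 d1 D2 d2 where z: "spath G y D1 d1 z" "spath G z D2 d2 w" "D1 \<union> D2 = Sd" "D1 \<inter> D2 = {z}" "d1 \<union> d2 = d" "D2 \<inter> Sm = {z}"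
    using spath_last_hit[OF P(5) yy(1)] by metis
  have zy: "z \<noteq> y"
  proof
    assume "z = y"
    then have "D1 = {y}" using z(1) spath_loop by metis
    then have "D2 = Sd" using z(3,4) \<open>z = y\<close> by auto
    then show False using z(6) \<open>z = y\<close> \<open>Sd \<inter> Sm \<noteq> {y}\<close> by simp
  qed
  have zz: "z \<in> Sm" "z \<in> D2" "y \<in> D1" "w \<in> D2" using z spath_ends by (blast, metis+)
  obtain z' R' r' D3 d3 where z': "spath G z R' r' z'" "spath G z' D3 d3 w" "R' \<union> D3 = D2" "R' \<inter> D3 = {z'}" "r' \<union> d3 = d2" "R' \<inter> Sb = {z'}"
    using spath_first_hit[OF z(2) yy(8)] by metis
  have z'': "z' \<in> Sb" "z' \<in> R'" "z \<in> R'" using z' spath_ends by (blast, metis+)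
  have R'D: "R' \<subseteq> Sd" "R' \<subseteq> D2" using z'(3) z(3) by auto
  have yR': "y \<notin> R'" using Int_sub2[OF subset_refl R'D(2) z(4)] zz(3) zy by auto
  have xz: "x \<noteq> z" using zz(2) z(3) i(8) yy(4) by blast
  obtain S1 S2 m1 m2 where m: "spath G x S1 m1 z" "spath G z S2 m2 y" "S1 \<union> S2 = Sm" "S1 \<inter> S2 = {z}" "m1 \<union> m2 = m" "m1 \<inter> m2 = {}"
    using spath_split[OF P(2) zz(1)] by metis
  obtain S3 S4 m3 b' where b: "spath G y S3 m3 z'" "spath G z' S4 b' w" "S3 \<union> S4 = Sb" "S3 \<inter> S4 = {z'}" "m3 \<union> b' = b" "m3 \<inter> b' = {}"
    using spath_split[OF P(3) z''(1)] by metis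
  have me: "x \<in> S1" "z \<in> S1" "z \<in> S2" "y \<in> S2" "y \<in> S3" "z' \<in> S3" "z' \<in> S4" using m b spath_ends by metis+
  have ni: "x \<notin> S2" "y \<notin> S1" "y \<notin> S4" using m(4) me xz zy b(4) yR' z''(2) by auto
  have sub: "m1 \<subseteq> B" "m2 \<subseteq> B" "m3 \<subseteq> B" "b' \<subseteq> B" "r' \<subseteq> B" using p m(5) b(5) z(5) z'(5) by auto
  have sb: "S1 \<subseteq> Sm" "S2 \<subseteq> Sm" "S3 \<subseteq> Sb" "S4 \<subseteq> Sb" using m(3) b(3) by auto
  have I: "Sa \<inter> S1 = {x}" "Sa \<inter> S2 = {}" "Sa \<inter> S3 = {}" "Sa \<inter> S4 = {}" "Sa \<inter> R' = {}"
    "S1 \<inter> S3 = {}" "S1 \<inter> S4 = {}" "S1 \<inter> Sr = {x}" "S1 \<inter> R' = {z}" "S2 \<inter> S3 = {y}" "S2 \<inter> S4 = {}" "S2 \<inter> Sr = {y}"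
    "S2 \<inter> R' = {z}" "S3 \<inter> Sr = {y}" "S3 \<inter> R' = {z'}" "S4 \<inter> Sr = {}" "S4 \<inter> R' = {z'}" "Sr \<inter> R' = {}"
    using Int_sub2[OF subset_refl sb(1) i(1)] Int_sub2[OF subset_refl sb(2) i(1)] Int_sub2[OF subset_refl sb(3) i(3)]
      Int_sub2[OF subset_refl sb(4) i(3)] Int_sub2[OF subset_refl R'D(1) i(8)] Int_sub2[OF sb(1) sb(3) i(2)]
      Int_sub2[OF sb(1) sb(4) i(2)] Int_sub2[OF sb(1) subset_refl i(4)[THEN Int_sym]] Int_sub2[OF sb(1) R'D(2) z(6)[THEN Int_sym]]
      Int_sub2[OF sb(2) sb(3) i(2)] Int_sub2[OF sb(2) sb(4) i(2)] Int_sub2[OF sb(2) subset_refl i(4)[THEN Int_sym]]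
      Int_sub2[OF sb(2) R'D(2) z(6)[THEN Int_sym]] Int_sub2[OF sb(3) subset_refl i(6)[THEN Int_sym]]
      Int_sub2[OF sb(3) subset_refl z'(6)[THEN Int_sym]] Int_sub2[OF sb(4) subset_refl i(6)[THEN Int_sym]]
      Int_sub2[OF sb(4) subset_refl z'(6)[THEN Int_sym]] Int_sub2[OF subset_refl R'D(1) i(7)]
    by (simp_all add: me ni yy yR' z'' zz)
  have o: "odd (card a + card m1 + card m2 + card m3 + card b')"
  proof -
    have "card m = card m1 + card m2" using spath_app(2)[OF m(1,2,4)] m(5) by simp
    moreover have "card b = card m3 + card b'" using spath_app(2)[OF b(1,2,4)] b(5) by simp
    moreover have "card q = card a + card m + card b" using spath_app3(2)[OF P(1,2,3) i(1,2,3)] qq by simp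
    ultimately show ?thesis using q(2) by presburger
  qed
  have o1: "odd (card m1 + card m2 + card r)"
    using ear_odd[OF p(1-4) assms(6) i(1-6) d qq r(1)] spath_app(2)[OF m(1,2,4)] m(5) by simp
  have pre: "path u (Sa \<union> S1) (a \<union> m1) z" using spath_app(1)[OF P(1) m(1) I(1)] p sub by simp
  have mid: "path z (S2 \<union> S3) (m2 \<union> m3) z'" using spath_app(1)[OF m(2) b(1) I(10)] sub by simp
  have r'q: "r' \<subseteq> q'" using z'(5) z(5) r(2) by auto
  have dd: "r' \<inter> m2 = {}" "r' \<inter> m3 = {}" "m1 \<inter> m3 = {}" "r \<inter> m1 = {}" "r \<inter> r' = {}" "r \<inter> m3 = {}" "m1 \<inter> r' = {}" "a \<inter> m1 = {}" "a \<inter> m3 = {}"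
    "m1 \<inter> b' = {}" "m2 \<inter> m3 = {}"
    using spath_disjoint1[OF m(2) z'(1) I(13)] spath_disjoint1[OF b(1) z'(1) I(15)] spath_disjoint0[OF m(1) b(1) I(6)]
      spath_disjoint1[OF m(1) P(4) I(8)] spath_disjoint0[OF P(4) z'(1) I(18)] spath_disjoint1[OF b(1) P(4) I(14)]
      spath_disjoint1[OF m(1) z'(1) I(9)] spath_disjoint1[OF P(1) m(1) I(1)] spath_disjoint0[OF P(1) b(1) I(3)]
      spath_disjoint0[OF m(1) b(2) I(7)] spath_disjoint1[OF m(2) b(1) I(10)] by blast+
  \<comment> \<open>The parity condition for ears holds for \<open>r'\<close> as well, which
    bypasses the stretch \<open>m2 \<union> m3\<close> of \<open>q\<close>.\<close>
  have "odd (card (m2 \<union> m3) + card r')"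
  proof (rule ear_odd[OF pre mid _ _ _])
    show "path z' S4 b' w" "path z R' r' z'" using b z' sub by auto
    show "z \<noteq> z'" using I(6) me by blast
    show "(Sa \<union> S1) \<inter> (S2 \<union> S3) = {z}" "(S2 \<union> S3) \<inter> S4 = {z'}" "(Sa \<union> S1) \<inter> S4 = {}" "R' \<inter> (S2 \<union> S3) = {z, z'}"
      "(Sa \<union> S1) \<inter> R' = {z}" "R' \<inter> S4 = {z'}"
      by (simp_all add: Int_Un_distrib Int_Un_distrib2 I I[THEN Int_sym] m(4) b(4) insert_commute)
    show "r' \<inter> (m2 \<union> m3) = {}" using dd by blast
    show "q = a \<union> m1 \<union> (m2 \<union> m3) \<union> b'" using qq m(5) b(5) by blast
  qed (rule r'q)
  then have o2: "odd (card m2 + card m3 + card r')" using spath_app(2)[OF m(2) b(1) I(10)] by simp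
  have eq: "f (insert e (a \<union> m1 \<union> m2 \<union> m3 \<union> b')) = f (insert e (a \<union> r \<union> m2 \<union> r' \<union> b'))"
    by (rule K4_move[of Sa a x S1 m1 z S2 m2 y S3 m3 z' S4 b' Sr r R' r'])
      (use o1 o2 o in \<open>simp_all only: P m b z' sub p I i(5) m(4) b(4) simp_thms\<close>)
  \<comment> \<open>The new path traverses \<open>m2\<close> backwards, from \<open>y\<close> to
    \<open>z\<close>.\<close>
  have k1: "spath G u (Sa \<union> Sr \<union> S2) (a \<union> r \<union> m2) z"
    by (rule spath_app3(1)[OF P(1,4) spath_rev[OF m(2)]]) (simp_all add: I I[THEN Int_sym] i)
  have k2: "card (a \<union> r \<union> m2) = card a + card r + card m2"
    by (rule spath_app3(2)[OF P(1,4) spath_rev[OF m(2)]]) (simp_all add: I I[THEN Int_sym] i)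
  have k3: "spath G u (Sa \<union> Sr \<union> S2 \<union> R' \<union> S4) (a \<union> r \<union> m2 \<union> r' \<union> b') w"
    by (rule spath_app3(1)[OF k1 z'(1) b(2)]) (simp_all add: Int_Un_distrib2 I I[THEN Int_sym] i)
  have k4: "card (a \<union> r \<union> m2 \<union> r' \<union> b') = card (a \<union> r \<union> m2) + card r' + card b'"
    by (rule spath_app3(2)[OF k1 z'(1) b(2)]) (simp_all add: Int_Un_distrib2 I I[THEN Int_sym] i)
  have "f (insert e (a \<union> r \<union> m2 \<union> r' \<union> b')) = f (insert e q')"
  proof (rule reduce)
    show "path u (Sa \<union> Sr \<union> S2 \<union> R' \<union> S4) (a \<union> r \<union> m2 \<union> r' \<union> b') w" using k3 p sub by simp
    show "odd (card (a \<union> r \<union> m2 \<union> r' \<union> b'))" using k2 k4 o1 o2 o by presburger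
    show "a \<union> r \<union> m2 \<union> r' \<union> b' \<subseteq> q \<union> q'" using qq m(5) b(5) r r'q by blast
    have c1: "spath G x (S1 \<union> R') (m1 \<union> r') z'" by (rule spath_append[OF m(1) z'(1) I(9)])
    have c2: "spath G x (Sr \<union> S3) (r \<union> m3) z'" by (rule spath_append[OF P(4) b(1)]) (simp add: I[THEN Int_sym])
    have "x \<noteq> z'" using I(4) me i(3) yy z'' by blast
    moreover have "(S1 \<union> R') \<inter> (Sr \<union> S3) = {x, z'}" by (simp add: Int_Un_distrib Int_Un_distrib2 I I[THEN Int_sym] insert_commute)
    moreover have "(m1 \<union> r') \<inter> (r \<union> m3) = {}" using dd by blast
    ultimately show "circ G ((m1 \<union> r') \<union> (r \<union> m3))" using circI c1 c2 by metis
    have "m1 \<inter> (a \<union> r \<union> m2 \<union> r' \<union> b') = {}" "m3 \<inter> (a \<union> r \<union> m2 \<union> r' \<union> b') = {}"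
      by (simp_all add: Int_Un_distrib dd dd[THEN Int_sym] m(6) b(6))
    moreover have "m1 \<subseteq> q" "m3 \<subseteq> q" using qq m(5) b(5) by auto
    ultimately show "(m1 \<union> r') \<union> (r \<union> m3) \<subseteq> q' \<union> (q - (a \<union> r \<union> m2 \<union> r' \<union> b'))" 
      using r'q r(1) by blast
  qed
  then show False using eq differ qq m(5) b(5) by (metis Un_assoc)
qed

text \<open>Each parting of the two paths produces an odd digon. One digon alone would give
  \<open>q\<close> and \<open>q'\<close> lengths of different parity, and two digons with a common
  end are the pair wanted. A third digon closes a ring through \<open>e\<close>, in which the three
  paths other than \<open>q\<close> have the value of \<open>q'\<close> by minimality, so that
  \<open>q\<close> has it too.\<close>

lemma stuck_exists:
  "\<exists>W1 SW1 s1 A SA A' SA' t1 P SP t2 D SD D' SD' s2 W2 SW2.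
     stuck_pair G f B e u w W1 SW1 s1 A SA A' SA' t1 P SP t2 D SD D' SD' s2 W2 SW2"
proof -
  have neq: "q \<noteq> q'" using differ by auto
  obtain x y Sa a Sm m Sb b Sr r Sd d where
    1: "spath G u Sa a x" "spath G x Sm m y" "spath G y Sb b w" "spath G x Sr r y" "spath G y Sd d w"
    "q = a \<union> m \<union> b" "q' = a \<union> r \<union> d" "S = Sa \<union> Sm \<union> Sb" "S' = Sa \<union> Sr \<union> Sd" "x \<noteq> y"
    "Sa \<inter> Sm = {x}" "Sm \<inter> Sb = {y}" "Sa \<inter> Sb = {}" "Sr \<inter> Sm = {x, y}" "Sr \<inter> Sb = {y}" "Sa \<inter> Sr = {x}" "Sr \<inter> Sd = {y}"
    "Sa \<inter> Sd = {}" "r \<inter> m = {}" by (rule spath_first_diff[OF q(1)[THEN conjunct1] q'(1)[THEN conjunct1] neq]) (rule that)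
  have sub: "a \<subseteq> B" "m \<subseteq> B" "b \<subseteq> B" "r \<subseteq> B" "d \<subseteq> B" using q q' 1(6,7) by auto
  have rq: "r \<subseteq> q'" "d \<subseteq> q'" using 1(7) by auto
  have odd1: "odd (card m + card r)"
    by (rule ear_odd[of Sa a x Sm m y Sb b Sr r]) (simp_all add: 1(1-5,10-16,19) sub 1(6) rq)
  have nc1: "Sd \<inter> Sm = {y}"
    by (rule no_crossing[of Sa a x Sm m y Sb b Sr r Sd d]) (simp_all add: 1(1-5,10-19) sub 1(6) rq)
  have cq: "card q = card a + card m + card b" using spath_app3(2)[OF 1(1,2,3,11,12,13)] 1(6) by simp
  have cq': "card q' = card a + card r + card d" using spath_app3(2)[OF 1(1,4,5,16,17,18)] 1(7) by simp
  \<comment> \<open>With a single digon the lengths of \<open>q\<close> and \<open>q'\<close> would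
    differ by an odd number.\<close>
  have bd: "b \<noteq> d"
  proof
    assume "b = d"
    then show False using cq cq' odd1 q(2) q'(2) by presburger
  qed
  obtain x2 y2 Sa2 a2 Sm2 m2 Sb2 b2 Sr2 r2 Sd2 d2 where
    2: "spath G y Sa2 a2 x2" "spath G x2 Sm2 m2 y2" "spath G y2 Sb2 b2 w" "spath G x2 Sr2 r2 y2" "spath G y2 Sd2 d2 w"
    "b = a2 \<union> m2 \<union> b2" "d = a2 \<union> r2 \<union> d2" "Sb = Sa2 \<union> Sm2 \<union> Sb2" "Sd = Sa2 \<union> Sr2 \<union> Sd2" "x2 \<noteq> y2"
    "Sa2 \<inter> Sm2 = {x2}" "Sm2 \<inter> Sb2 = {y2}" "Sa2 \<inter> Sb2 = {}" "Sr2 \<inter> Sm2 = {x2, y2}" "Sr2 \<inter> Sb2 = {y2}" "Sa2 \<inter> Sr2 = {x2}" "Sr2 \<inter> Sd2 = {y2}"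
    "Sa2 \<inter> Sd2 = {}" "r2 \<inter> m2 = {}" by (rule spath_first_diff[OF 1(3,5) bd]) (rule that)
  have sub2: "a2 \<subseteq> B" "m2 \<subseteq> B" "b2 \<subseteq> B" "r2 \<subseteq> B" "d2 \<subseteq> B" using sub 2(6,7) by auto
  have rq2: "r2 \<subseteq> q'" "d2 \<subseteq> q'" using 2(7) rq by auto
  have mem: "y \<in> Sa2" "x2 \<in> Sa2" "x2 \<in> Sm2" "x2 \<in> Sr2" "y2 \<in> Sm2" "y2 \<in> Sb2" "y2 \<in> Sd2" "y \<in> Sm" "y \<in> Sr" "y2 \<in> Sr2"
    using 1(2,4) 2(1-5) spath_ends by metis+
  have ym: "y \<in> Sm2 \<longleftrightarrow> y = x2" "y \<in> Sr2 \<longleftrightarrow> y = x2" "y \<notin> Sb2" "y \<notin> Sd2"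
    using 2(11,13,16,18) mem by blast+
  have sb: "Sa2 \<subseteq> Sb" "Sm2 \<subseteq> Sb" "Sb2 \<subseteq> Sb" "Sr2 \<subseteq> Sd" "Sd2 \<subseteq> Sd" using 2(8,9) by auto
  note r = Int_sub2[OF subset_refl]
  have J: "Sa \<inter> Sa2 = {}" "Sa \<inter> Sm2 = {}" "Sa \<inter> Sb2 = {}" "Sa \<inter> Sr2 = {}" "Sa \<inter> Sd2 = {}"
    using r[OF sb(1) 1(13)] r[OF sb(2) 1(13)] r[OF sb(3) 1(13)] r[OF sb(4) 1(18)] r[OF sb(5) 1(18)] by simp_all
  have K: "Sm \<inter> Sa2 = {y}" "Sr \<inter> Sa2 = {y}" 
    using r[OF sb(1) 1(12)] r[OF sb(1) 1(15)] by (simp_all add: mem)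
  have K2: "Sm \<inter> Sm2 = {y} \<inter> {x2}" "Sr \<inter> Sm2 = {y} \<inter> {x2}" "Sm \<inter> Sr2 = {y} \<inter> {x2}" "Sr \<inter> Sr2 = {y} \<inter> {x2}"
    "Sm \<inter> Sb2 = {}" "Sr \<inter> Sb2 = {}" "Sm \<inter> Sd2 = {}" "Sr \<inter> Sd2 = {}"
    using r[OF sb(2) 1(12)] r[OF sb(2) 1(15)] r[OF sb(4) nc1[THEN Int_sym]] r[OF sb(4) 1(17)]
      r[OF sb(3) 1(12)] r[OF sb(3) 1(15)] r[OF sb(5) nc1[THEN Int_sym]] r[OF sb(5) 1(17)]
    by (simp_all add: mem ym Int_insert_left)
  note JK = J K K2 J[THEN Int_sym] K[THEN Int_sym] K2[THEN Int_sym]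
  have pre: "path u (Sa \<union> Sm \<union> Sa2) (a \<union> m \<union> a2) x2"
    using spath_app3(1)[OF 1(1,2) 2(1) 1(11) K(1) J(1)] sub sub2 by simp
  have precard: "card (a \<union> m \<union> a2) = card a + card m + card a2"
    using spath_app3(2)[OF 1(1,2) 2(1) 1(11) K(1) J(1)] .
  have L: "(Sa \<union> Sm \<union> Sa2) \<inter> Sm2 = {x2}" "(Sa \<union> Sm \<union> Sa2) \<inter> Sb2 = {}" "(Sa \<union> Sm \<union> Sa2) \<inter> Sr2 = {x2}" "(Sa \<union> Sm \<union> Sa2) \<inter> Sd2 = {}"
    by (auto simp: Int_Un_distrib2 JK 2(11,13,16,18))
  have qq2: "q = (a \<union> m \<union> a2) \<union> m2 \<union> b2" using 1(6) 2(6) by auto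
  have odd2: "odd (card m2 + card r2)"
    by (rule ear_odd[of "Sa \<union> Sm \<union> Sa2" "a \<union> m \<union> a2" x2 Sm2 m2 y2 Sb2 b2 Sr2 r2]) (simp_all add: pre sub sub2 2(2-5,10-16,19) L qq2 rq2)
  have nc2: "Sd2 \<inter> Sm2 = {y2}"
    by (rule no_crossing[of "Sa \<union> Sm \<union> Sa2" "a \<union> m \<union> a2" x2 Sm2 m2 y2 Sb2 b2 Sr2 r2 Sd2 d2]) (simp_all add: pre sub sub2 2(2-5,10-19) L qq2 rq2)
  have cb: "card b = card a2 + card m2 + card b2" using spath_app3(2)[OF 2(1,2,3,11,12,13)] 2(6) by simp
  show ?thesis
  proof (cases "b2 = d2")
    case True
    have "Sb2 = Sd2" using spath_verts 2(3,5) True by metis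
    then have "Sr2 \<inter> Sb2 = {y2}" using 2(17) by simp
    have "stuck_pair G f B e u w a Sa x m Sm r Sr y a2 Sa2 x2 m2 Sm2 r2 Sr2 y2 b2 Sb2"
    proof unfold_locales
      show "f (insert e (a \<union> m \<union> a2 \<union> m2 \<union> b2)) \<noteq> f (insert e (a \<union> r \<union> a2 \<union> r2 \<union> b2))"
        using differ 1(6,7) 2(6,7) True by (simp add: Un_assoc)
      show "odd (card a + card m + card a2 + card m2 + card b2)" using cq cb q(2) by presburger
    qed (use odd1 odd2 \<open>Sr2 \<inter> Sb2 = {y2}\<close> in \<open>simp_all only: 1(1-5,10-19) 2(1-5,10-19) 1(14,19)[THEN Int_sym] 2(14,19)[THEN Int_sym] sub sub2 JK simp_thms not_False_eq_True\<close>)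
    then show ?thesis by blast
  next
    case False
    obtain x3 y3 Sa3 a3 Sm3 m3 Sb3 b3 Sr3 r3 Sd3 d3 where
      3: "spath G y2 Sa3 a3 x3" "spath G x3 Sm3 m3 y3" "spath G y3 Sb3 b3 w" "spath G x3 Sr3 r3 y3" "spath G y3 Sd3 d3 w"
      "b2 = a3 \<union> m3 \<union> b3" "d2 = a3 \<union> r3 \<union> d3" "Sb2 = Sa3 \<union> Sm3 \<union> Sb3" "Sd2 = Sa3 \<union> Sr3 \<union> Sd3" "x3 \<noteq> y3"
      "Sa3 \<inter> Sm3 = {x3}" "Sm3 \<inter> Sb3 = {y3}" "Sa3 \<inter> Sb3 = {}" "Sr3 \<inter> Sm3 = {x3, y3}" "Sr3 \<inter> Sb3 = {y3}" "Sa3 \<inter> Sr3 = {x3}" "Sr3 \<inter> Sd3 = {y3}"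
      "Sa3 \<inter> Sd3 = {}" "r3 \<inter> m3 = {}" by (rule spath_first_diff[OF 2(3,5) False]) (rule that)
    have mem3: "y2 \<in> Sa3" "x3 \<in> Sa3" "x3 \<in> Sm3" "x3 \<in> Sr3" "y3 \<in> Sm3" "y3 \<in> Sr3" using 3(1-5) spath_ends by metis+
    have ym3: "y2 \<in> Sm3 \<longleftrightarrow> y2 = x3" "y2 \<in> Sr3 \<longleftrightarrow> y2 = x3" "y2 \<notin> Sb3" "y2 \<notin> Sd3"
      using 3(11,13,16,18) mem3 by blast+
    have sub3: "a3 \<subseteq> B" "m3 \<subseteq> B" "b3 \<subseteq> B" "r3 \<subseteq> B" "d3 \<subseteq> B" using sub2 3(6,7) by auto
    have rq3: "r3 \<subseteq> q'" using 3(7) rq2 by auto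
    have sb3: "Sa3 \<subseteq> Sb2" "Sm3 \<subseteq> Sb2" "Sb3 \<subseteq> Sb2" "Sr3 \<subseteq> Sd2" using 3(8,9) by auto
    have J3: "Sa \<inter> Sa3 = {}" "Sa \<inter> Sm3 = {}" "Sa \<inter> Sb3 = {}" "Sa \<inter> Sr3 = {}"
      "Sm \<inter> Sa3 = {}" "Sm \<inter> Sm3 = {}" "Sm \<inter> Sb3 = {}" "Sm \<inter> Sr3 = {}"
      "Sr \<inter> Sa3 = {}" "Sr \<inter> Sm3 = {}" "Sr \<inter> Sb3 = {}" "Sr \<inter> Sr3 = {}"
      "Sa2 \<inter> Sa3 = {}" "Sa2 \<inter> Sm3 = {}" "Sa2 \<inter> Sb3 = {}" "Sa2 \<inter> Sr3 = {}"
      using r[OF sb3(1) J(3)] r[OF sb3(2) J(3)] r[OF sb3(3) J(3)] r[OF sb3(4) J(5)]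
       r[OF sb3(1) K2(5)] r[OF sb3(2) K2(5)] r[OF sb3(3) K2(5)] r[OF sb3(4) K2(7)]
       r[OF sb3(1) K2(6)] r[OF sb3(2) K2(6)] r[OF sb3(3) K2(6)] r[OF sb3(4) K2(8)]
       r[OF sb3(1) 2(13)] r[OF sb3(2) 2(13)] r[OF sb3(3) 2(13)] r[OF sb3(4) 2(18)] by simp_all
    have L3: "Sm2 \<inter> Sa3 = {y2}" "Sr2 \<inter> Sa3 = {y2}" "Sm2 \<inter> Sb3 = {}" "Sr2 \<inter> Sb3 = {}"
      "Sm2 \<inter> Sm3 = {y2} \<inter> {x3}" "Sr2 \<inter> Sm3 = {y2} \<inter> {x3}" "Sm2 \<inter> Sr3 = {y2} \<inter> {x3}" "Sr2 \<inter> Sr3 = {y2} \<inter> {x3}"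
      using r[OF sb3(1) 2(12)] r[OF sb3(1) 2(15)] r[OF sb3(3) 2(12)] r[OF sb3(3) 2(15)]
       r[OF sb3(2) 2(12)] r[OF sb3(2) 2(15)] r[OF sb3(4) nc2[THEN Int_sym]] r[OF sb3(4) 2(17)] by (simp_all add: mem mem3 ym3 Int_insert_left)
    note all = 1(11-18) 2(11-18) 3(11-18) J K K2 J3 L3
    note all' = all all[THEN Int_sym]
    \<comment> \<open>This treats all eight choices of sides in the three digons at once; four of
      them occur in the ring relation.\<close>
    have P7: "path u (Sa \<union> K1 \<union> Sa2 \<union> K2 \<union> Sa3 \<union> K3 \<union> Sb3) (a \<union> k1 \<union> a2 \<union> k2 \<union> a3 \<union> k3 \<union> b3) w \<and>
        card (a \<union> k1 \<union> a2 \<union> k2 \<union> a3 \<union> k3 \<union> b3) = card a + card k1 + card a2 + card k2 + card a3 + card k3 + card b3"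
      if k: "K1 = Sm \<and> k1 = m \<or> K1 = Sr \<and> k1 = r" "K2 = Sm2 \<and> k2 = m2 \<or> K2 = Sr2 \<and> k2 = r2"
        "K3 = Sm3 \<and> k3 = m3 \<or> K3 = Sr3 \<and> k3 = r3" for K1 k1 K2 k2 K3 k3
    proof -
      have p: "path x K1 k1 y" "path x2 K2 k2 y2" "path x3 K3 k3 y3" using k 1(2,4) 2(2,4) 3(2,4) sub sub2 sub3 by auto
      have "Sa \<inter> K1 = {x} \<and> K1 \<inter> Sa2 = {y} \<and> K1 \<inter> Sa3 = {} \<and> K1 \<inter> Sb3 = {}"
        using k(1) by (elim disjE conjE) (simp_all add: all')
      then have i1: "Sa \<inter> K1 = {x}" "K1 \<inter> Sa2 = {y}" "K1 \<inter> Sa3 = {}" "K1 \<inter> Sb3 = {}" by simp_all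
      have "Sa \<inter> K2 = {} \<and> Sa2 \<inter> K2 = {x2} \<and> K2 \<inter> Sa3 = {y2} \<and> K2 \<inter> Sb3 = {}"
        using k(2) by (elim disjE conjE) (simp_all add: all')
      then have i2: "Sa \<inter> K2 = {}" "Sa2 \<inter> K2 = {x2}" "K2 \<inter> Sa3 = {y2}" "K2 \<inter> Sb3 = {}" by simp_all
      have "Sa \<inter> K3 = {} \<and> Sa2 \<inter> K3 = {} \<and> Sa3 \<inter> K3 = {x3} \<and> K3 \<inter> Sb3 = {y3}"
        using k(3) by (elim disjE conjE) (simp_all add: all')
      then have i3: "Sa \<inter> K3 = {}" "Sa2 \<inter> K3 = {}" "Sa3 \<inter> K3 = {x3}" "K3 \<inter> Sb3 = {y3}" by simp_all
      have "K1 \<inter> K2 = {y} \<inter> {x2} \<and> K1 \<inter> K3 = {} \<and> K2 \<inter> K3 = {y2} \<inter> {x3}"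
        using k by (elim disjE conjE) (simp_all add: all')
      then have i4: "K1 \<inter> K2 = {y} \<inter> {x2}" "K1 \<inter> K3 = {}" "K2 \<inter> K3 = {y2} \<inter> {x3}" by simp_all
      note s1 = spath_app3[OF 1(1) p(1)[THEN conjunct1] 2(1) i1(1,2) J(1)]
      have 0: "(Sa \<union> K1 \<union> Sa2) \<inter> K2 = {x2}" "(Sa \<union> K1 \<union> Sa2) \<inter> Sa3 = {}" by (auto simp add: Int_Un_distrib2 i1 i2 i4 J3)
      note s2 = spath_app3[OF s1(1) p(2)[THEN conjunct1] 3(1) 0(1) i2(3) 0(2)]
      have 00: "(Sa \<union> K1 \<union> Sa2 \<union> K2 \<union> Sa3) \<inter> K3 = {x3}" "(Sa \<union> K1 \<union> Sa2 \<union> K2 \<union> Sa3) \<inter> Sb3 = {}"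
        by (auto simp add: Int_Un_distrib2 i1 i2 i3 i4 J3 3(13))
      note s3 = spath_app3[OF s2(1) p(3)[THEN conjunct1] 3(3) 00(1) i3(4) 00(2)]
      show ?thesis using s3(1,2) s2(2) s1(2) p sub sub2 sub3 by simp
    qed
    have qq3: "q = a \<union> m \<union> a2 \<union> m2 \<union> a3 \<union> m3 \<union> b3" using qq2 3(6) by auto
    have oq: "odd (card a + card m + card a2 + card m2 + card a3 + card m3 + card b3)"
      using P7[of Sm m Sm2 m2 Sm3 m3] q(2) qq3 by simp
    have pre3: "path u (Sa \<union> Sm \<union> Sa2 \<union> Sm2 \<union> Sa3) (a \<union> m \<union> a2 \<union> m2 \<union> a3) x3"
    proof -
      have "(Sa \<union> Sm \<union> Sa2) \<inter> Sa3 = {}" by (simp add: Int_Un_distrib2 J3)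
      from spath_app3(1)[OF pre[THEN conjunct1] 2(2) 3(1) L(1) L3(1) this]
      show ?thesis using sub sub2 sub3 by simp
    qed
    have odd3: "odd (card m3 + card r3)"
      by (rule ear_odd[OF pre3, of Sm3 m3 y3 Sb3 b3 Sr3 r3]) (auto simp: 3(2-5,10) sub3 rq3 qq3 Int_Un_distrib2 all' 3(19))
    have ring: "(f (insert e (a \<union> m \<union> a2 \<union> m2 \<union> a3 \<union> m3 \<union> b3)) \<noteq> f (insert e (a \<union> m \<union> a2 \<union> r2 \<union> a3 \<union> r3 \<union> b3))) =
      (f (insert e (a \<union> r \<union> a2 \<union> m2 \<union> a3 \<union> r3 \<union> b3)) \<noteq> f (insert e (a \<union> r \<union> a2 \<union> r2 \<union> a3 \<union> m3 \<union> b3)))"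
      by (rule ring_move[of Sa a x Sm m y Sr r Sa2 a2 x2 Sm2 m2 y2 Sr2 r2 Sa3 a3 x3 Sm3 m3 y3 Sr3 r3 Sb3 b3])
        (use oq odd1 odd2 odd3 in \<open>simp_all only: 1(1-5,10) 2(1-4,10) 3(1-4,10) sub sub2 sub3 simp_thms Int_Un_distrib Int_Un_distrib2 all' Un_absorb Un_empty_right Un_empty_left insert_commute not_False_eq_True\<close>)
    have cm: "circ G (m \<union> r)" using circI[OF 1(10,2,4)] 1(14)[THEN Int_sym] 1(19)[THEN Int_sym] by simp
    have cm2: "circ G (m2 \<union> r2)" using circI[OF 2(10,2,4)] 2(14)[THEN Int_sym] 2(19)[THEN Int_sym] by simp
    have dm: "m \<inter> a = {}" "m \<inter> a2 = {}" "m \<inter> m2 = {}" "m \<inter> r2 = {}" "m \<inter> a3 = {}" "m \<inter> m3 = {}" "m \<inter> r3 = {}" "m \<inter> b3 = {}"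
      using spath_disjoint1[OF 1(2,1) all'(1)[THEN Int_sym]] spath_disjoint1[OF 1(2) 2(1) K(1)] spath_disjoint2[OF 1(2) 2(2) K2(1)]
        spath_disjoint2[OF 1(2) 2(4) K2(3)] spath_disjoint0[OF 1(2) 3(1) J3(5)] spath_disjoint0[OF 1(2) 3(2) J3(6)]
        spath_disjoint0[OF 1(2) 3(4) J3(8)] spath_disjoint0[OF 1(2) 3(3) J3(7)] by simp_all
    have dm2: "m2 \<inter> a = {}" "m2 \<inter> m = {}" "m2 \<inter> a2 = {}" "m2 \<inter> a3 = {}" "m2 \<inter> r3 = {}" "m2 \<inter> b3 = {}"
      using spath_disjoint0[OF 1(1) 2(2) J(2)] dm(3) spath_disjoint1[OF 2(1,2,11)] spath_disjoint1[OF 2(2) 3(1) L3(1)]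
       spath_disjoint2[OF 2(2) 3(4) L3(7)] spath_disjoint0[OF 2(2) 3(3) L3(3)] by blast+
    have rr: "r \<inter> m = {}" "m \<inter> r = {}" "m2 \<inter> r2 = {}" using 1(19) 2(19) by auto
    have mq: "m \<subseteq> q" "m2 \<subseteq> q" "a \<union> a2 \<union> a3 \<union> b3 \<union> m3 \<subseteq> q" using qq3 by auto
    \<comment> \<open>Each of the three remaining paths of the ring relation omits \<open>m\<close>
      or \<open>m2\<close>; the digon with this side is the circuit that \<open>reduce\<close> asks
      for.\<close>
    have "f (insert e (a \<union> r \<union> a2 \<union> r2 \<union> a3 \<union> m3 \<union> b3)) = f (insert e q')"
    proof (rule reduce[OF _ _ _ cm])
      show "path u (Sa \<union> Sr \<union> Sa2 \<union> Sr2 \<union> Sa3 \<union> Sm3 \<union> Sb3) (a \<union> r \<union> a2 \<union> r2 \<union> a3 \<union> m3 \<union> b3) w"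
        using P7[of Sr r Sr2 r2 Sm3 m3] by simp
      show "odd (card (a \<union> r \<union> a2 \<union> r2 \<union> a3 \<union> m3 \<union> b3))" using P7[of Sr r Sr2 r2 Sm3 m3] oq odd1 odd2 by auto
      show "a \<union> r \<union> a2 \<union> r2 \<union> a3 \<union> m3 \<union> b3 \<subseteq> q \<union> q'" using mq rq rq2 by auto
      have "m \<inter> (a \<union> r \<union> a2 \<union> r2 \<union> a3 \<union> m3 \<union> b3) = {}" by (simp add: Int_Un_distrib dm rr)
      then show "m \<union> r \<subseteq> q' \<union> (q - (a \<union> r \<union> a2 \<union> r2 \<union> a3 \<union> m3 \<union> b3))" using mq(1) rq(1) by blast
    qed
    moreover have "f (insert e (a \<union> r \<union> a2 \<union> m2 \<union> a3 \<union> r3 \<union> b3)) = f (insert e q')"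
    proof (rule reduce[OF _ _ _ cm])
      show "path u (Sa \<union> Sr \<union> Sa2 \<union> Sm2 \<union> Sa3 \<union> Sr3 \<union> Sb3) (a \<union> r \<union> a2 \<union> m2 \<union> a3 \<union> r3 \<union> b3) w"
        using P7[of Sr r Sm2 m2 Sr3 r3] by simp
      show "odd (card (a \<union> r \<union> a2 \<union> m2 \<union> a3 \<union> r3 \<union> b3))" using P7[of Sr r Sm2 m2 Sr3 r3] oq odd1 odd3 by auto
      show "a \<union> r \<union> a2 \<union> m2 \<union> a3 \<union> r3 \<union> b3 \<subseteq> q \<union> q'" using mq rq rq3 by auto
      have "m \<inter> (a \<union> r \<union> a2 \<union> m2 \<union> a3 \<union> r3 \<union> b3) = {}" by (simp add: Int_Un_distrib dm rr)
      then show "m \<union> r \<subseteq> q' \<union> (q - (a \<union> r \<union> a2 \<union> m2 \<union> a3 \<union> r3 \<union> b3))" using mq(1) rq(1) by blast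
    qed
    moreover have "f (insert e (a \<union> m \<union> a2 \<union> r2 \<union> a3 \<union> r3 \<union> b3)) = f (insert e q')"
    proof (rule reduce[OF _ _ _ cm2])
      show "path u (Sa \<union> Sm \<union> Sa2 \<union> Sr2 \<union> Sa3 \<union> Sr3 \<union> Sb3) (a \<union> m \<union> a2 \<union> r2 \<union> a3 \<union> r3 \<union> b3) w"
        using P7[of Sm m Sr2 r2 Sr3 r3] by simp
      show "odd (card (a \<union> m \<union> a2 \<union> r2 \<union> a3 \<union> r3 \<union> b3))" using P7[of Sm m Sr2 r2 Sr3 r3] oq odd2 odd3 by auto
      show "a \<union> m \<union> a2 \<union> r2 \<union> a3 \<union> r3 \<union> b3 \<subseteq> q \<union> q'" using mq rq2 rq3 by auto
      have "m2 \<inter> (a \<union> m \<union> a2 \<union> r2 \<union> a3 \<union> r3 \<union> b3) = {}" by (simp add: Int_Un_distrib dm2 rr)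
      then show "m2 \<union> r2 \<subseteq> q' \<union> (q - (a \<union> m \<union> a2 \<union> r2 \<union> a3 \<union> r3 \<union> b3))" using mq(2) rq2(1) by blast
    qed
    ultimately show ?thesis using ring differ qq3 by simp
  qed
qed

end

text \<open>The induction supplies minimality: if there were no stuck pair, every path whose union
  with \<open>q'\<close> is smaller would have the value of \<open>q'\<close>.\<close>

lemma (in edge_addition) stuck_if_not_constant:
  assumes "path u S q w" "odd (card q)" "path u S' q' w" "odd (card q')" "f (insert e q) \<noteq> f (insert e q')"
  shows "\<exists>W1 SW1 s1 A SA A' SA' t1 P SP t2 D SD D' SD' s2 W2 SW2.
     stuck_pair G f B e u w W1 SW1 s1 A SA A' SA' t1 P SP t2 D SD D' SD' s2 W2 SW2"
  using assms
proof (induction "card (q \<union> q')" arbitrary: q S rule: less_induct)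
  case less
  show ?case
  proof (rule ccontr)
    assume no: "\<not> ?thesis"
    interpret minimal_pair G f B e u w q S q' S'
    proof
      fix k T assume k: "path u T k w" "odd (card k)" "k \<union> q' \<subset> q \<union> q'"
      have "finite (q \<union> q')"
        using spath_finite[OF less.prems(1)[THEN conjunct1]] spath_finite[OF less.prems(3)[THEN conjunct1]] by simp
      then have "card (k \<union> q') < card (q \<union> q')" by (rule psubset_card_mono[OF _ k(3)])
      note IH = less.hyps[OF this k(1,2) less.prems(3,4)]
      show "f (insert e k) = f (insert e q')"
      proof (rule ccontr)
        assume "f (insert e k) \<noteq> f (insert e q')"
        from notE[OF no IH[OF this]] show False .
      qed
    qed (use less.prems in auto)
    show False using no stuck_exists by simp
  qed
qed

section \<open>Ears attached to a pair of odd digons\<close>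

lemma Int_sub2': "R \<subseteq> S \<Longrightarrow> R' \<subseteq> S' \<Longrightarrow> S \<inter> S' = {y} \<inter> {z} \<Longrightarrow> R \<inter> R' = ({y} \<inter> R) \<inter> ({z} \<inter> R')" by auto

lemma disjoint_neq: "S \<inter> T = {} \<Longrightarrow> x \<in> S \<Longrightarrow> y \<in> T \<Longrightarrow> x \<noteq> y" by auto

lemma notin: "S \<inter> T = X \<Longrightarrow> v \<notin> X \<Longrightarrow> v \<in> S \<Longrightarrow> v \<notin> T" by auto

definition reach :: "('v, 'e) mgraph \<Rightarrow> 'e set \<Rightarrow> 'v \<Rightarrow> ('v \<times> 'v) set" where
  "reach G A t = {(x, y). \<exists>g\<in>A. ends G g = {x, y} \<and> x \<noteq> t \<and> y \<noteq> t}\<^sup>*"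

text \<open>The ear leaves the digon with sides \<open>a \<union> b\<close> and \<open>a'\<close> at
  the inner vertex \<open>r\<close> of one side. The continuation from \<open>r\<close> to
  \<open>w\<close> is cut in two ways: at \<open>z\<close>, where it joins the first path, and at
  \<open>y\<close>, where it joins the second; this covers ears ending on either side of the other
  digon or behind it. The two paths are compared through an intermediate path that uses the ear: by
  two theta exchanges if \<open>R\<close> has the parity of \<open>b \<union> M\<close>, and
  otherwise by a K4 exchange followed by a theta exchange.\<close>

lemma (in edge_addition) main_move:
  assumes p: "path u Sk k s" "path s Sa a r" "path r Sb b t" "path t SM M z" "path z Sn n w" "path s Sa' a' t" "path r SR R z"
    and p': "path r S\<rho> \<rho> y" "path y Sn0 n0 w" "path t Sm' m' y" and Rn: "R \<union> n = \<rho> \<union> n0"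
    and i: "Sk \<inter> Sa = {s}" "Sk \<inter> Sb = {}" "Sk \<inter> SM = {}" "Sk \<inter> Sn = {}" "Sk \<inter> Sa' = {s}" "Sk \<inter> SR = {}"
      "Sa \<inter> Sb = {r}" "Sa \<inter> SM = {}" "Sa \<inter> Sn = {}" "Sa \<inter> Sa' = {s}" "Sa \<inter> SR = {r}"
      "Sb \<inter> SM = {t}" "Sb \<inter> Sn = {}" "Sb \<inter> Sa' = {t}" "Sb \<inter> SR = {r}"
      "SM \<inter> Sn = {z}" "SM \<inter> Sa' = {t}" "SM \<inter> SR = {z}" "Sn \<inter> Sa' = {}" "Sn \<inter> SR = {z}" "Sa' \<inter> SR = {}"
    and j: "Sk \<inter> S\<rho> = {}" "Sk \<inter> Sm' = {}" "Sk \<inter> Sn0 = {}" "Sa \<inter> S\<rho> = {r}" "Sa \<inter> Sm' = {}" "Sa \<inter> Sn0 = {}"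
      "Sa' \<inter> S\<rho> = {}" "Sa' \<inter> Sm' = {t}" "Sa' \<inter> Sn0 = {}" "S\<rho> \<inter> Sm' = {y}" "S\<rho> \<inter> Sn0 = {y}" "Sm' \<inter> Sn0 = {y}"
      "Sb \<inter> S\<rho> = {r}" "Sb \<inter> Sm' = {t}" "Sb \<inter> Sn0 = {}"
    and odd: "odd (card a + card b + card a')" "odd (card k + card a + card b + card M + card n)"
      "odd (card k + card a' + card m' + card n0)"
  shows "f (insert e (k \<union> a \<union> b \<union> M \<union> n)) = f (insert e (k \<union> a' \<union> m' \<union> n0))"
proof -
  note P = p[THEN conjunct1] and P' = p'[THEN conjunct1]
  note ii = i i[THEN Int_sym] j j[THEN Int_sym]
  have cR: "card R + card n = card \<rho> + card n0"
    using spath_app(2)[OF P(7,5) i(20)[THEN Int_sym]] spath_app(2)[OF P'(1,2) j(11)] Rn by simp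
  have sy: "s \<noteq> y" "t \<noteq> y" "r \<noteq> z"
    using disjoint_neq[OF j(6) spath_start[OF P(2)] spath_start[OF P'(2)]] disjoint_neq[OF j(15) spath_end[OF P(3)] spath_start[OF P'(2)]]
      disjoint_neq[OF i(8) spath_end[OF P(2)] spath_end[OF P(4)]] by auto
  have ka: "path u (Sk \<union> Sa) (k \<union> a) r" using spath_app(1)[OF P(1,2) i(1)] p by simp
  have ka': "path u (Sk \<union> Sa') (k \<union> a') t" using spath_app(1)[OF P(1,6) i(5)] p by simp
  have bM: "path r (Sb \<union> SM) (b \<union> M) z" using spath_app(1)[OF P(3,4) i(12)] p by simp
  have ar: "path s (Sa \<union> S\<rho>) (a \<union> \<rho>) y" using spath_app(1)[OF P(2) P'(1) j(4)] p p' by simp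
  have am: "path s (Sa' \<union> Sm') (a' \<union> m') y" using spath_app(1)[OF P(6) P'(3) j(8)] p p' by simp
  have br: "path t (Sb \<union> S\<rho>) (b \<union> \<rho>) y" using spath_app(1)[OF spath_rev[OF P(3)] P'(1) j(13)] p p' by simp
  have cards: "card (k \<union> a) = card k + card a" "card (k \<union> a') = card k + card a'" "card (b \<union> M) = card b + card M"
    "card (a \<union> \<rho>) = card a + card \<rho>" "card (a' \<union> m') = card a' + card m'" "card (b \<union> \<rho>) = card b + card \<rho>"
    using spath_app(2)[OF P(1,2) i(1)] spath_app(2)[OF P(1,6) i(5)] spath_app(2)[OF P(3,4) i(12)]
     spath_app(2)[OF P(2) P'(1) j(4)] spath_app(2)[OF P(6) P'(3) j(8)] spath_app(2)[OF spath_rev[OF P(3)] P'(1) j(13)] by simp_all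
  have dd: "R \<inter> b = {}" "R \<inter> M = {}" "a' \<inter> a = {}" "a' \<inter> \<rho> = {}" "m' \<inter> a = {}" "m' \<inter> \<rho> = {}" "m' \<inter> b = {}"
    using spath_disjoint1[OF P(7,3) i(15)[THEN Int_sym]] spath_disjoint1[OF P(7,4) i(18)[THEN Int_sym]]
      spath_disjoint1[OF P(6,2) i(10)[THEN Int_sym]] spath_disjoint0[OF P(6) P'(1) j(7)]
      spath_disjoint0[OF P'(3) P(2) j(5)[THEN Int_sym]] spath_disjoint1[OF P'(3,1) j(10)[THEN Int_sym]]
      spath_disjoint1[OF P'(3) P(3) j(14)[THEN Int_sym]] by simp_all
  show ?thesis
  proof (cases "even (card R + card b + card M)")
    case True
    have 1: "f (insert e (k \<union> a \<union> (b \<union> M) \<union> n)) = f (insert e (k \<union> a \<union> R \<union> n))"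
      by (rule theta_move[OF ka bM p(5,7) sy(3)])
        (use True odd cards in \<open>simp_all add: Int_Un_distrib Int_Un_distrib2 ii dd insert_commute\<close>, presburger+)
    have 2: "f (insert e (k \<union> (a \<union> \<rho>) \<union> n0)) = f (insert e (k \<union> (a' \<union> m') \<union> n0))"
      by (rule theta_move[OF p(1) ar p'(2) am sy(1)])
        (use True odd cards cR in \<open>simp_all add: Int_Un_distrib Int_Un_distrib2 ii dd insert_commute\<close>, presburger+)
    have "k \<union> a \<union> R \<union> n = k \<union> (a \<union> \<rho>) \<union> n0" using Rn by blast
    then show ?thesis using 1 2 by (simp add: Un_assoc)
  next
    case False
    have 1: "f (insert e (k \<union> a \<union> b \<union> M \<union> n)) = f (insert e (k \<union> a' \<union> b \<union> R \<union> n))"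
      by (rule K4_move[OF p(1,2,3,4,5,6,7) i odd(1) _ odd(2)]) (use False in presburger)
    have 2: "f (insert e (k \<union> a' \<union> (b \<union> \<rho>) \<union> n0)) = f (insert e (k \<union> a' \<union> m' \<union> n0))"
      by (rule theta_move[OF ka' br p'(2) p'(3) sy(2)])
        (use False odd cards cR in \<open>simp_all add: Int_Un_distrib Int_Un_distrib2 ii dd insert_commute\<close>, presburger+)
    have "k \<union> a' \<union> b \<union> R \<union> n = k \<union> a' \<union> (b \<union> \<rho>) \<union> n0" using Rn by blast
    then show ?thesis using 1 2 by simp
  qed
qed

context stuck_pair
begin

text \<open>Exchanging the two paths, and reversing both of them as in \<open>mirror\<close>, are
  the symmetries that reduce the number of positions of an ear to be treated.\<close>

lemma swap: "stuck_pair G f B e u w W1 SW1 s1 A' SA' A SA t1 P SP t2 D' SD' D SD s2 W2 SW2"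
proof unfold_locales
  show "odd (card W1 + card A' + card P + card D' + card W2)" using odd by presburger
  show "f (insert e (W1 \<union> A' \<union> P \<union> D' \<union> W2)) \<noteq> f (insert e (W1 \<union> A \<union> P \<union> D \<union> W2))" using neq by simp
qed (use odd(1,2) in \<open>simp_all only: paths ne dig dig[THEN Int_sym] disj add.commute simp_thms not_False_eq_True\<close>)

lemma flip: "edge_addition G f B e w u"
proof
  show "ends G e = {w, u}" using e(2) by (simp add: insert_commute)
qed (use e rels zero in auto)

lemma mirror: "stuck_pair G f B e w u W2 SW2 s2 D SD D' SD' t2 P SP t1 A SA A' SA' s1 W1 SW1"
proof -
  interpret fl: edge_addition G f B e w u by (rule flip)
  show ?thesis
  proof unfold_locales
    show "odd (card W2 + card D + card P + card A + card W1)" using odd by presburger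
    have "W1 \<union> A \<union> P \<union> D \<union> W2 = W2 \<union> D \<union> P \<union> A \<union> W1" "W1 \<union> A' \<union> P \<union> D' \<union> W2 = W2 \<union> D' \<union> P \<union> A' \<union> W1" by blast+
    then show "f (insert e (W2 \<union> D \<union> P \<union> A \<union> W1)) \<noteq> f (insert e (W2 \<union> D' \<union> P \<union> A' \<union> W1))" using neq by metis
    show "SA \<inter> SA' = {t1, s1}" "SD \<inter> SD' = {s2, t2}" using dig by auto
    show "SD \<inter> SA = {t2} \<inter> {t1}" "SD \<inter> SA' = {t2} \<inter> {t1}" "SD' \<inter> SA = {t2} \<inter> {t1}" "SD' \<inter> SA' = {t2} \<inter> {t1}"
      using disj(9-12) by auto
  qed (use odd(1,2) in \<open>simp_all only: paths paths[THEN conjunct1, THEN spath_rev] ne ne[symmetric] dig disj disj[THEN Int_sym] simp_thms not_False_eq_True\<close>)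
qed

lemma mem: "s1 \<in> SW1" "s1 \<in> SA" "s1 \<in> SA'" "t1 \<in> SA" "t1 \<in> SA'" "t1 \<in> SP" "t2 \<in> SP" "t2 \<in> SD" "t2 \<in> SD'"
  "s2 \<in> SD" "s2 \<in> SD'" "s2 \<in> SW2"
  using paths spath_ends by metis+

lemma nomem: "s1 \<notin> SP" "s1 \<notin> SD" "s1 \<notin> SD'" "s1 \<notin> SW2" "t1 \<notin> SW1" "t1 \<notin> SW2" "t2 \<notin> SW1" "t2 \<notin> SW2"
  "s2 \<notin> SW1" "s2 \<notin> SA" "s2 \<notin> SA'" "s2 \<notin> SP"
  using notin[OF disj(7), of s1] notin[OF disj(9), of s1] notin[OF disj(10), of s1] notin[OF disj(6), of s1]
    notin[OF disj(3)[THEN Int_sym], of t1] notin[OF disj(17), of t1] notin[OF disj(3)[THEN Int_sym], of t2] notin[OF disj(17), of t2]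
    notin[OF disj(6)[THEN Int_sym], of s2] notin[OF disj(13)[THEN Int_sym], of s2] notin[OF disj(14)[THEN Int_sym], of s2]
    notin[OF disj(17)[THEN Int_sym], of s2] mem ne by simp_all

lemma only_A: "v \<in> SA \<Longrightarrow> v \<noteq> s1 \<Longrightarrow> v \<noteq> t1 \<Longrightarrow> v \<notin> SW1 \<and> v \<notin> SA' \<and> v \<notin> SP \<and> v \<notin> SD \<and> v \<notin> SD' \<and> v \<notin> SW2"
  using notin[OF disj(1)[THEN Int_sym], of v] notin[OF dig(1), of v] notin[OF disj(7), of v] notin[OF disj(9), of v] notin[OF disj(10), of v]
    notin[OF disj(13), of v] by simp

lemma only_D: "v \<in> SD \<Longrightarrow> v \<noteq> t2 \<Longrightarrow> v \<noteq> s2 \<Longrightarrow> v \<notin> SW1 \<and> v \<notin> SA \<and> v \<notin> SA' \<and> v \<notin> SP \<and> v \<notin> SD' \<and> v \<notin> SW2"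
  using notin[OF disj(4)[THEN Int_sym], of v] notin[OF dig(2), of v] notin[OF disj(9)[THEN Int_sym], of v] notin[OF disj(11)[THEN Int_sym], of v]
    notin[OF disj(15)[THEN Int_sym], of v] notin[OF disj(18), of v] by simp

lemma only_P: "v \<in> SP \<Longrightarrow> v \<noteq> t1 \<Longrightarrow> v \<notin> SW1 \<and> v \<notin> SA \<and> v \<notin> SA' \<and> v \<notin> SW2 \<and> (v \<in> SD \<longleftrightarrow> v = t2) \<and> (v \<in> SD' \<longleftrightarrow> v = t2)"
  using notin[OF disj(3)[THEN Int_sym], of v] notin[OF disj(7)[THEN Int_sym], of v] notin[OF disj(8)[THEN Int_sym], of v]
    notin[OF disj(17), of v] notin[OF disj(15), of v] notin[OF disj(16), of v] mem by auto

lemma only_W1: "v \<in> SW1 \<Longrightarrow> (v \<in> SA \<longleftrightarrow> v = s1) \<and> (v \<in> SA' \<longleftrightarrow> v = s1) \<and> v \<notin> SP \<and> v \<notin> SD \<and> v \<notin> SD' \<and> v \<notin> SW2"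
  using notin[OF disj(1), of v] notin[OF disj(2), of v] notin[OF disj(3), of v] notin[OF disj(4), of v] notin[OF disj(5), of v] notin[OF disj(6), of v]
    mem by auto

lemma only_W2: "v \<in> SW2 \<Longrightarrow> (v \<in> SD \<longleftrightarrow> v = s2) \<and> (v \<in> SD' \<longleftrightarrow> v = s2) \<and> v \<notin> SP \<and> v \<notin> SA \<and> v \<notin> SA' \<and> v \<notin> SW1"
  using notin[OF disj(18)[THEN Int_sym], of v] notin[OF disj(19)[THEN Int_sym], of v] notin[OF disj(17)[THEN Int_sym], of v]
    notin[OF disj(13)[THEN Int_sym], of v] notin[OF disj(14)[THEN Int_sym], of v] notin[OF disj(6)[THEN Int_sym], of v] mem by auto

end

text \<open>Edge-disjointness is stated in addition to the condition on vertices: a single edge of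
  one of the two paths meets them in its two ends only, but it is not an ear.\<close>

locale stuck_ear = stuck_pair +
  fixes r1 SR R r2
  assumes R: "path r1 SR R r2" "r1 \<noteq> r2"
    and ear: "SR \<inter> (SW1 \<union> SA \<union> SA' \<union> SP \<union> SD \<union> SD' \<union> SW2) = {r1, r2}"
    and R_disj: "R \<inter> (W1 \<union> A \<union> A' \<union> P \<union> D \<union> D' \<union> W2) = {}"
begin

lemma SR: "SR \<inter> SW1 = {r1, r2} \<inter> SW1" "SR \<inter> SA = {r1, r2} \<inter> SA" "SR \<inter> SA' = {r1, r2} \<inter> SA'" "SR \<inter> SP = {r1, r2} \<inter> SP"
   "SR \<inter> SD = {r1, r2} \<inter> SD" "SR \<inter> SD' = {r1, r2} \<inter> SD'" "SR \<inter> SW2 = {r1, r2} \<inter> SW2" "r1 \<in> SR" "r2 \<in> SR"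
  using ear by auto

lemma swap_ear: "stuck_ear G f B e u w W1 SW1 s1 A' SA' A SA t1 P SP t2 D' SD' D SD s2 W2 SW2 r1 SR R r2"
proof -
  interpret sw: stuck_pair G f B e u w W1 SW1 s1 A' SA' A SA t1 P SP t2 D' SD' D SD s2 W2 SW2 by (rule swap)
  show ?thesis
  proof
    show "SR \<inter> (SW1 \<union> SA' \<union> SA \<union> SP \<union> SD' \<union> SD \<union> SW2) = {r1, r2}" using ear by (simp add: Un_ac)
    show "R \<inter> (W1 \<union> A' \<union> A \<union> P \<union> D' \<union> D \<union> W2) = {}" using R_disj by (simp add: Un_ac)
  qed (use R in auto)
qed

lemma mirror_ear: "stuck_ear G f B e w u W2 SW2 s2 D SD D' SD' t2 P SP t1 A SA A' SA' s1 W1 SW1 r2 SR R r1"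
proof -
  interpret mi: stuck_pair G f B e w u W2 SW2 s2 D SD D' SD' t2 P SP t1 A SA A' SA' s1 W1 SW1 by (rule mirror)
  show ?thesis
  proof
    show "SR \<inter> (SW2 \<union> SD \<union> SD' \<union> SP \<union> SA \<union> SA' \<union> SW1) = {r2, r1}" using ear by (simp add: Un_ac insert_commute)
    show "R \<inter> (W2 \<union> D \<union> D' \<union> P \<union> A \<union> A' \<union> W1) = {}" using R_disj by (simp add: Un_ac)
  qed (use R spath_rev in \<open>auto simp: \<close>)
qed

text \<open>The ear joins the first path at \<open>r2\<close>, inside \<open>D\<close>, while the
  second path is joined only behind the digon, at \<open>s2\<close>; this is the reason for two cuts
  in \<open>main_move\<close>.\<close>

lemma ear_A_D:
  assumes r1: "r1 \<in> SA" "r1 \<noteq> s1" "r1 \<noteq> t1" and r2: "r2 \<in> SD" "r2 \<noteq> t2" "r2 \<noteq> s2"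
  shows False
proof -
  note P = paths[THEN conjunct1]
  obtain Sa Sb a b where a: "spath G s1 Sa a r1" "spath G r1 Sb b t1" "Sa \<union> Sb = SA" "Sa \<inter> Sb = {r1}" "a \<union> b = A"
    using spath_split[OF P(2) r1(1)] by metis
  obtain Sc Sd c d where c: "spath G t2 Sc c r2" "spath G r2 Sd d s2" "Sc \<union> Sd = SD" "Sc \<inter> Sd = {r2}" "c \<union> d = D"
    using spath_split[OF P(5) r2(1)] by metis
  have s: "Sa \<subseteq> SA" "Sb \<subseteq> SA" "Sc \<subseteq> SD" "Sd \<subseteq> SD" using a(3) c(3) by auto
  have sub: "a \<subseteq> B" "b \<subseteq> B" "c \<subseteq> B" "d \<subseteq> B" using paths a(5) c(5) by auto
  have m1: "s1 \<in> Sa" "r1 \<in> Sa" "r1 \<in> Sb" "t1 \<in> Sb" "t2 \<in> Sc" "r2 \<in> Sc" "r2 \<in> Sd" "s2 \<in> Sd" using a c spath_ends by metis+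
  then have m2: "s1 \<notin> Sb" "t1 \<notin> Sa" "s2 \<notin> Sc" "t2 \<notin> Sd"
    using notin[OF a(4), of s1] notin[OF a(4)[THEN Int_sym], of t1] notin[OF c(4), of t2] notin[OF c(4)[THEN Int_sym], of s2] r1 r2 by auto
  note o1 = only_A[OF r1] and o2 = only_D[OF r2]
  have m3: "r2 \<notin> Sa" "r2 \<notin> Sb" "r1 \<notin> Sc" "r1 \<notin> Sd" using o1 o2 s by auto
  note M = m1 m2 m3 mem nomem o1 o2 r1 r2 SR(8,9)
  note x = subset_refl
  \<comment> \<open>All intersections of the pieces are obtained by restricting the known
    intersections to the parts of the split segments; the membership facts \<open>M\<close> then
    evaluate what is left of the common vertices.\<close>
  note I0 = Int_sub2[OF x s(1) disj(1)] Int_sub2[OF x s(2) disj(1)] disj(2,3) Int_sub2[OF x s(3) disj(4)] Int_sub2[OF x s(4) disj(4)] disj(5,6)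
    a(4) Int_sub2[OF s(1) x dig(1)] Int_sub2[OF s(2) x dig(1)] Int_sub2[OF s(1) x disj(7)] Int_sub2[OF s(2) x disj(7)] disj(8)
    Int_sub2'[OF s(1,3) disj(9)] Int_sub2'[OF s(1,4) disj(9)] Int_sub2'[OF s(2,3) disj(9)] Int_sub2'[OF s(2,4) disj(9)]
    Int_sub2'[OF s(1) x disj(10)] Int_sub2'[OF s(2) x disj(10)] Int_sub2'[OF x s(3) disj(11)] Int_sub2'[OF x s(4) disj(11)] disj(12)
    Int_sub2[OF s(1) x disj(13)] Int_sub2[OF s(2) x disj(13)] disj(14) Int_sub2[OF x s(3) disj(15)] Int_sub2[OF x s(4) disj(15)] disj(16,17)
    Int_sub2[OF s(3) x disj(18)] Int_sub2[OF s(4) x disj(18)] disj(19) c(4) Int_sub2[OF s(3) x dig(2)] Int_sub2[OF s(4) x dig(2)]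
    SR(1,3,4,6,7) Int_sub2[OF x s(1) SR(2)] Int_sub2[OF x s(2) SR(2)] Int_sub2[OF x s(3) SR(5)] Int_sub2[OF x s(4) SR(5)]
  note I1 = I0[simplified M Int_insert_left Int_empty_left Int_empty_right if_True if_False simp_thms]
  note I = I1 I1[THEN Int_sym]
  have p1: "path t1 (SP \<union> Sc) (P \<union> c) r2" using spath_app(1)[OF P(4) c(1)] paths sub by (simp add: I)
  have cards: "card A = card a + card b" "card D = card c + card d" "card (P \<union> c) = card P + card c"
    "card (d \<union> W2) = card d + card W2" "card (P \<union> D') = card P + card D'"
    using spath_app(2)[OF a(1,2,4)] spath_app(2)[OF c(1,2,4)] spath_app(2)[OF P(4) c(1)] spath_app(2)[OF c(2) P(7)]
      spath_app(2)[OF P(4,6)] a(5) c(5) by (simp_all add: I)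
  have p2: "path r2 (Sd \<union> SW2) (d \<union> W2) w" using spath_app(1)[OF c(2) P(7)] paths sub by (simp add: I)
  have p3: "path r1 (SR \<union> Sd) (R \<union> d) s2" using spath_app(1)[OF R(1)[THEN conjunct1] c(2)] R sub by (simp add: I)
  have p4: "path t1 (SP \<union> SD') (P \<union> D') s2" using spath_app(1)[OF P(4,6)] paths sub by (simp add: I)
  have p5: "path s1 Sa a r1" "path r1 Sb b t1" using a sub by auto
  have "f (insert e (W1 \<union> a \<union> b \<union> (P \<union> c) \<union> (d \<union> W2))) = f (insert e (W1 \<union> A' \<union> (P \<union> D') \<union> W2))"
    by (rule main_move[OF paths(1) p5 p1 p2 paths(3) R(1) p3 paths(7) p4])
      (use odd cards in \<open>auto simp: Int_Un_distrib Int_Un_distrib2 I\<close>)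
  moreover have "W1 \<union> a \<union> b \<union> (P \<union> c) \<union> (d \<union> W2) = W1 \<union> A \<union> P \<union> D \<union> W2" using a(5) c(5) by blast
  ultimately show False using neq by (simp add: Un_assoc)
qed

text \<open>Now the second path is joined at \<open>r2\<close>, inside \<open>D'\<close>, and the
  first path only at \<open>s2\<close>, so the two cuts change roles compared with an ear that ends
  in \<open>D\<close>.\<close>

lemma ear_A_D':
  assumes r1: "r1 \<in> SA" "r1 \<noteq> s1" "r1 \<noteq> t1" and r2: "r2 \<in> SD'" "r2 \<noteq> t2" "r2 \<noteq> s2"
  shows False
proof -
  interpret sw: stuck_pair G f B e u w W1 SW1 s1 A' SA' A SA t1 P SP t2 D' SD' D SD s2 W2 SW2 by (rule swap)
  note P = paths[THEN conjunct1]
  obtain Sa Sb a b where a: "spath G s1 Sa a r1" "spath G r1 Sb b t1" "Sa \<union> Sb = SA" "Sa \<inter> Sb = {r1}" "a \<union> b = A"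
    using spath_split[OF P(2) r1(1)] by metis
  obtain Sc Sd c d where c: "spath G t2 Sc c r2" "spath G r2 Sd d s2" "Sc \<union> Sd = SD'" "Sc \<inter> Sd = {r2}" "c \<union> d = D'"
    using spath_split[OF P(6) r2(1)] by metis
  have s: "Sa \<subseteq> SA" "Sb \<subseteq> SA" "Sc \<subseteq> SD'" "Sd \<subseteq> SD'" using a(3) c(3) by auto
  have sub: "a \<subseteq> B" "b \<subseteq> B" "c \<subseteq> B" "d \<subseteq> B" using paths a(5) c(5) by auto
  have m1: "s1 \<in> Sa" "r1 \<in> Sa" "r1 \<in> Sb" "t1 \<in> Sb" "t2 \<in> Sc" "r2 \<in> Sc" "r2 \<in> Sd" "s2 \<in> Sd" using a c spath_ends by metis+
  then have m2: "s1 \<notin> Sb" "t1 \<notin> Sa" "s2 \<notin> Sc" "t2 \<notin> Sd"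
    using notin[OF a(4), of s1] notin[OF a(4)[THEN Int_sym], of t1] notin[OF c(4), of t2] notin[OF c(4)[THEN Int_sym], of s2] r1 r2 by auto
  note o1 = only_A[OF r1] and o2 = sw.only_D[OF r2]
  have m3: "r2 \<notin> Sa" "r2 \<notin> Sb" "r1 \<notin> Sc" "r1 \<notin> Sd" using o1 o2 s by auto
  note M = m1 m2 m3 mem nomem o1 o2 r1 r2 SR(8,9)
  note x = subset_refl
  note I0 = Int_sub2[OF x s(1) disj(1)] Int_sub2[OF x s(2) disj(1)] disj(2) disj(3) disj(4) Int_sub2[OF x s(3) disj(5)]
    Int_sub2[OF x s(4) disj(5)] disj(6) Int_sub2[OF s(1) x disj(7)] Int_sub2[OF s(2) x disj(7)] disj(8)
    Int_sub2'[OF s(1) x disj(9)] Int_sub2'[OF s(2) x disj(9)] Int_sub2'[OF s(1) s(3) disj(10)]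
    Int_sub2'[OF s(1) s(4) disj(10)] Int_sub2'[OF s(2) s(3) disj(10)] Int_sub2'[OF s(2) s(4) disj(10)] disj(11)
    Int_sub2'[OF x s(3) disj(12)] Int_sub2'[OF x s(4) disj(12)] Int_sub2[OF s(1) x disj(13)] Int_sub2[OF s(2) x disj(13)]
    disj(14) disj(15) Int_sub2[OF x s(3) disj(16)] Int_sub2[OF x s(4) disj(16)] disj(17) disj(18) Int_sub2[OF s(3) x disj(19)]
    Int_sub2[OF s(4) x disj(19)] Int_sub2[OF s(1) x dig(1)] Int_sub2[OF s(2) x dig(1)] Int_sub2[OF x s(3) dig(2)]
    Int_sub2[OF x s(4) dig(2)] SR(1) Int_sub2[OF x s(1) SR(2)] Int_sub2[OF x s(2) SR(2)] SR(3) SR(4) SR(5)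
    Int_sub2[OF x s(3) SR(6)] Int_sub2[OF x s(4) SR(6)] SR(7)
  note I1 = I0[simplified M Int_insert_left Int_empty_left Int_empty_right if_True if_False simp_thms]
  note I = a(4) c(4) a(4)[THEN Int_sym] c(4)[THEN Int_sym] I1 I1[THEN Int_sym]
  have cards: "card A = card a + card b" "card D' = card c + card d" "card (P \<union> c) = card P + card c"
    "card (d \<union> W2) = card d + card W2" "card (P \<union> D) = card P + card D"
    using spath_app(2)[OF a(1,2,4)] spath_app(2)[OF c(1,2,4)] spath_app(2)[OF P(4) c(1)] spath_app(2)[OF c(2) P(7)]
      spath_app(2)[OF P(4,5)] a(5) c(5) by (simp_all add: I)
  have p1: "path t1 (SP \<union> Sc) (P \<union> c) r2" using spath_app(1)[OF P(4) c(1)] paths sub by (simp add: I)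
  have p2: "path r2 (Sd \<union> SW2) (d \<union> W2) w" using spath_app(1)[OF c(2) P(7)] paths sub by (simp add: I)
  have p3: "path r1 (SR \<union> Sd) (R \<union> d) s2" using spath_app(1)[OF R(1)[THEN conjunct1] c(2)] R sub by (simp add: I)
  have p4: "path t1 (SP \<union> SD) (P \<union> D) s2" using spath_app(1)[OF P(4,5)] paths sub by (simp add: I)
  have p5: "path s1 Sa a r1" "path r1 Sb b t1" using a sub by auto
  have "f (insert e (W1 \<union> a \<union> b \<union> (P \<union> D) \<union> W2)) = f (insert e (W1 \<union> A' \<union> (P \<union> c) \<union> (d \<union> W2)))"
    by (rule main_move[OF paths(1) p5 p4 paths(7) paths(3) p3 R(1) p2 p1])
      (use odd cards in \<open>auto simp: Int_Un_distrib Int_Un_distrib2 I\<close>)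
  moreover have "W1 \<union> a \<union> b \<union> (P \<union> D) \<union> W2 = W1 \<union> A \<union> P \<union> D \<union> W2" "W1 \<union> A' \<union> (P \<union> c) \<union> (d \<union> W2) = W1 \<union> A' \<union> P \<union> D' \<union> W2"
    using a(5) c(5) by blast+
  ultimately show False using neq by simp
qed

text \<open>Behind \<open>s2\<close> the two paths coincide, so both are joined at the same vertex
  \<open>r2\<close>.\<close>

lemma ear_A_W2:
  assumes r1: "r1 \<in> SA" "r1 \<noteq> s1" "r1 \<noteq> t1" and r2: "r2 \<in> SW2"
  shows False
proof -
  note P = paths[THEN conjunct1]
  obtain Sa Sb a b where a: "spath G s1 Sa a r1" "spath G r1 Sb b t1" "Sa \<union> Sb = SA" "Sa \<inter> Sb = {r1}" "a \<union> b = A"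
    using spath_split[OF P(2) r1(1)] by metis
  obtain Sc Sd c d where c: "spath G s2 Sc c r2" "spath G r2 Sd d w" "Sc \<union> Sd = SW2" "Sc \<inter> Sd = {r2}" "c \<union> d = W2"
    using spath_split[OF P(7) r2(1)] by metis
  have s: "Sa \<subseteq> SA" "Sb \<subseteq> SA" "Sc \<subseteq> SW2" "Sd \<subseteq> SW2" using a(3) c(3) by auto
  have sub: "a \<subseteq> B" "b \<subseteq> B" "c \<subseteq> B" "d \<subseteq> B" using paths a(5) c(5) by auto
  have m1: "s1 \<in> Sa" "r1 \<in> Sa" "r1 \<in> Sb" "t1 \<in> Sb" "s2 \<in> Sc" "r2 \<in> Sc" "r2 \<in> Sd" using a c spath_ends by metis+
  then have m2: "s1 \<notin> Sb" "t1 \<notin> Sa" "s2 \<in> Sd \<longleftrightarrow> r2 = s2"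
    using notin[OF a(4), of s1] notin[OF a(4)[THEN Int_sym], of t1] notin[OF c(4), of s2] r1 by auto
  note o1 = only_A[OF r1] and o2 = only_W2[OF r2]
  have m3: "r2 \<notin> Sa" "r2 \<notin> Sb" "r1 \<notin> Sc" "r1 \<notin> Sd" using o1 o2 s by auto
  note M = m1 m2 m3 mem nomem o1 o2 r1 r2 SR(8,9)
  note x = subset_refl
  note I0 = Int_sub2[OF x s(1) disj(1)] Int_sub2[OF x s(2) disj(1)] disj(2) disj(3) disj(4) disj(5)
    Int_sub2[OF x s(3) disj(6)] Int_sub2[OF x s(4) disj(6)] Int_sub2[OF s(1) x disj(7)] Int_sub2[OF s(2) x disj(7)] disj(8)
    Int_sub2'[OF s(1) x disj(9)] Int_sub2'[OF s(2) x disj(9)] Int_sub2'[OF s(1) x disj(10)] Int_sub2'[OF s(2) x disj(10)]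
    disj(11) disj(12) Int_sub2[OF s(1) s(3) disj(13)] Int_sub2[OF s(1) s(4) disj(13)] Int_sub2[OF s(2) s(3) disj(13)]
    Int_sub2[OF s(2) s(4) disj(13)] Int_sub2[OF x s(3) disj(14)] Int_sub2[OF x s(4) disj(14)] disj(15) disj(16)
    Int_sub2[OF x s(3) disj(17)] Int_sub2[OF x s(4) disj(17)] Int_sub2[OF x s(3) disj(18)] Int_sub2[OF x s(4) disj(18)]
    Int_sub2[OF x s(3) disj(19)] Int_sub2[OF x s(4) disj(19)] Int_sub2[OF s(1) x dig(1)] Int_sub2[OF s(2) x dig(1)] dig(2)
    SR(1) Int_sub2[OF x s(1) SR(2)] Int_sub2[OF x s(2) SR(2)] SR(3) SR(4) SR(5) SR(6) Int_sub2[OF x s(3) SR(7)]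
    Int_sub2[OF x s(4) SR(7)]
  note I1 = I0[simplified M Int_insert_left Int_empty_left Int_empty_right if_True if_False simp_thms]
  note I = a(4) c(4) a(4)[THEN Int_sym] c(4)[THEN Int_sym] I1 I1[THEN Int_sym]
  note p1 = spath_app3(1)[OF P(4,5) c(1)] spath_app3(1)[OF P(4,6) c(1)]
  have cards: "card A = card a + card b" "card W2 = card c + card d" "card (P \<union> D \<union> c) = card P + card D + card c"
     "card (P \<union> D' \<union> c) = card P + card D' + card c"
    using spath_app(2)[OF a(1,2,4)] spath_app(2)[OF c(1,2,4)] spath_app3(2)[OF P(4,5) c(1)] spath_app3(2)[OF P(4,6) c(1)] a(5) c(5)
    by (simp_all add: I)
  have p1: "path t1 (SP \<union> SD \<union> Sc) (P \<union> D \<union> c) r2" "path t1 (SP \<union> SD' \<union> Sc) (P \<union> D' \<union> c) r2"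
    using spath_app3(1)[OF P(4,5) c(1)] spath_app3(1)[OF P(4,6) c(1)] paths sub by (simp_all add: I)
  have p5: "path s1 Sa a r1" "path r1 Sb b t1" "path r2 Sd d w" using a c sub by auto
  have "f (insert e (W1 \<union> a \<union> b \<union> (P \<union> D \<union> c) \<union> d)) = f (insert e (W1 \<union> A' \<union> (P \<union> D' \<union> c) \<union> d))"
    by (rule main_move[OF paths(1) p5(1,2) p1(1) p5(3) paths(3) R(1) R(1) p5(3) p1(2)])
      (use odd cards in \<open>auto simp: Int_Un_distrib Int_Un_distrib2 I\<close>)
  moreover have "W1 \<union> a \<union> b \<union> (P \<union> D \<union> c) \<union> d = W1 \<union> A \<union> P \<union> D \<union> W2" "W1 \<union> A' \<union> (P \<union> D' \<union> c) \<union> d = W1 \<union> A' \<union> P \<union> D' \<union> W2"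
    using a(5) c(5) by blast+
  ultimately show False using neq by simp
qed

text \<open>Depending on the parity of the ear, \<open>b \<union> c\<close> is replaced by
  \<open>R\<close> in the first path, or \<open>A' \<union> c\<close> by \<open>a \<union> R\<close>
  in the second. In both cases the new pair of paths differs in an odd digon that ends at
  \<open>r2\<close> and in the old digon of \<open>D\<close> and \<open>D'\<close>, so the
  connecting path shrinks from \<open>P\<close> to \<open>d\<close>.\<close>

lemma ear_A_P:
  assumes r1: "r1 \<in> SA" "r1 \<noteq> s1" "r1 \<noteq> t1" and r2: "r2 \<in> SP" "r2 \<noteq> t1"
  shows "\<exists>W1 SW1 s1 A SA A' SA' t1 P' SP t2 D SD D' SD' s2 W2 SW2.
    stuck_pair G f B e u w W1 SW1 s1 A SA A' SA' t1 P' SP t2 D SD D' SD' s2 W2 SW2 \<and> card P' < card P"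
proof -
  note P = paths[THEN conjunct1]
  obtain Sa Sb a b where a: "spath G s1 Sa a r1" "spath G r1 Sb b t1" "Sa \<union> Sb = SA" "Sa \<inter> Sb = {r1}" "a \<union> b = A" "a \<inter> b = {}"
    using spath_split[OF P(2) r1(1)] by metis
  obtain Sc Sd c d where c: "spath G t1 Sc c r2" "spath G r2 Sd d t2" "Sc \<union> Sd = SP" "Sc \<inter> Sd = {r2}" "c \<union> d = P" "c \<inter> d = {}"
    using spath_split[OF P(4) r2(1)] by metis
  have t12: "t1 \<noteq> t2"
  proof
    assume "t1 = t2"
    then have "SP = {t1}" using P(4) spath_loop by metis
    then show False using r2 by simp
  qed
  have smaller: "card d < card P"
  proof (rule psubset_card_mono)
    show "finite P" using spath_finite[OF P(4)] by simp
    have "c \<noteq> {}" using spath_empty_iff[OF c(1)] r2 by auto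
    then show "d \<subset> P" using c(5,6) by blast
  qed
  have s: "Sa \<subseteq> SA" "Sb \<subseteq> SA" "Sc \<subseteq> SP" "Sd \<subseteq> SP" using a(3) c(3) by auto
  have sub: "a \<subseteq> B" "b \<subseteq> B" "c \<subseteq> B" "d \<subseteq> B" "R \<subseteq> B" using paths a(5) c(5) R by auto
  have m1: "s1 \<in> Sa" "r1 \<in> Sa" "r1 \<in> Sb" "t1 \<in> Sb" "t1 \<in> Sc" "r2 \<in> Sc" "r2 \<in> Sd" "t2 \<in> Sd" using a c spath_ends by metis+
  then have m2: "s1 \<notin> Sb" "t1 \<notin> Sa" "t1 \<notin> Sd" "t2 \<in> Sc \<longleftrightarrow> r2 = t2"
    using notin[OF a(4), of s1] notin[OF a(4)[THEN Int_sym], of t1] notin[OF c(4), of t1] notin[OF c(4)[THEN Int_sym], of t2] r1 r2 by auto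
  note o1 = only_A[OF r1] and o2 = only_P[OF r2]
  have m3: "r2 \<notin> Sa" "r2 \<notin> Sb" "r1 \<notin> Sc" "r1 \<notin> Sd" using o1 o2 s by auto
  note M = m1 m2 m3 mem nomem o1 o2 r1 r2 SR(8,9) t12
  note x = subset_refl
  note I0 = Int_sub2[OF x s(1) disj(1)] Int_sub2[OF x s(2) disj(1)] disj(2) Int_sub2[OF x s(3) disj(3)]
    Int_sub2[OF x s(4) disj(3)] disj(4) disj(5) disj(6) Int_sub2[OF s(1) s(3) disj(7)] Int_sub2[OF s(1) s(4) disj(7)]
    Int_sub2[OF s(2) s(3) disj(7)] Int_sub2[OF s(2) s(4) disj(7)] Int_sub2[OF x s(3) disj(8)] Int_sub2[OF x s(4) disj(8)]
    Int_sub2'[OF s(1) x disj(9)] Int_sub2'[OF s(2) x disj(9)] Int_sub2'[OF s(1) x disj(10)] Int_sub2'[OF s(2) x disj(10)]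
    disj(11) disj(12) Int_sub2[OF s(1) x disj(13)] Int_sub2[OF s(2) x disj(13)] disj(14) Int_sub2[OF s(3) x disj(15)]
    Int_sub2[OF s(4) x disj(15)] Int_sub2[OF s(3) x disj(16)] Int_sub2[OF s(4) x disj(16)] Int_sub2[OF s(3) x disj(17)]
    Int_sub2[OF s(4) x disj(17)] disj(18) disj(19) Int_sub2[OF s(1) x dig(1)] Int_sub2[OF s(2) x dig(1)] dig(2) SR(1)
    Int_sub2[OF x s(1) SR(2)] Int_sub2[OF x s(2) SR(2)] SR(3) Int_sub2[OF x s(3) SR(4)] Int_sub2[OF x s(4) SR(4)] SR(5) SR(6)
    SR(7)
  note I1 = I0[simplified M Int_insert_left Int_empty_left Int_empty_right if_True if_False simp_thms]
  note I = a(4) c(4) a(4)[THEN Int_sym] c(4)[THEN Int_sym] I1 I1[THEN Int_sym]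
  have p5: "path s1 Sa a r1" "path r1 Sb b t1" "path t1 Sc c r2" "path r2 Sd d t2" using a c sub by auto
  note R1 = R(1)[THEN conjunct1]
  have cards: "card A = card a + card b" "card P = card c + card d" "card (b \<union> c) = card b + card c" "card (A' \<union> c) = card A' + card c"
     "card (a \<union> R) = card a + card R" "card (W1 \<union> a) = card W1 + card a" "card (d \<union> D \<union> W2) = card d + card D + card W2"
     "card (d \<union> D' \<union> W2) = card d + card D' + card W2"
    using spath_app(2)[OF a(1,2,4)] spath_app(2)[OF c(1,2,4)] spath_app(2)[OF a(2) c(1)] spath_app(2)[OF P(3) c(1)]
      spath_app(2)[OF a(1) R1] spath_app(2)[OF P(1) a(1)] spath_app3(2)[OF c(2) P(5,7)] spath_app3(2)[OF c(2) P(6,7)] a(5) c(5)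
    by (simp_all add: I)
  have p6: "path r1 (Sb \<union> Sc) (b \<union> c) r2" "path s1 (SA' \<union> Sc) (A' \<union> c) r2" "path s1 (Sa \<union> SR) (a \<union> R) r2" "path u (SW1 \<union> Sa) (W1 \<union> a) r1"
    "path r2 (Sd \<union> SD \<union> SW2) (d \<union> D \<union> W2) w" "path r2 (Sd \<union> SD' \<union> SW2) (d \<union> D' \<union> W2) w"
    using spath_app(1)[OF a(2) c(1)] spath_app(1)[OF P(3) c(1)] spath_app(1)[OF a(1) R1] spath_app(1)[OF P(1) a(1)]
      spath_app3(1)[OF c(2) P(5,7)] spath_app3(1)[OF c(2) P(6,7)] paths sub by (simp_all add: I)
  have dd: "R \<inter> b = {}" "R \<inter> c = {}" "R \<inter> A' = {}" "a \<inter> A' = {}" using R_disj a(5) c(5) dig(3) by auto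
  have dac: "a \<inter> c = {}" using spath_disjoint0[OF a(1) c(1)] I by simp
  note dis = dd dd[THEN Int_sym] dac dac[THEN Int_sym]
  have rr: "r1 \<noteq> r2" "s1 \<noteq> r2" using R(2) nomem(1) r2 by auto
  have eqs: "W1 \<union> a \<union> (b \<union> c) \<union> (d \<union> D \<union> W2) = W1 \<union> A \<union> P \<union> D \<union> W2" "W1 \<union> (A' \<union> c) \<union> (d \<union> D' \<union> W2) = W1 \<union> A' \<union> P \<union> D' \<union> W2"
    using a(5) c(5) by blast+
  note conds = Int_Un_distrib Int_Un_distrib2 I dis insert_commute
  show ?thesis
  proof (cases "even (card R + card b + card c)")
    case True
    have ev: "even (card (b \<union> c) + card R)" "odd (card (W1 \<union> a) + card (b \<union> c) + card (d \<union> D \<union> W2))"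
      "odd (card (a \<union> R) + card (A' \<union> c))" "odd (card W1 + card (a \<union> R) + card d + card D + card W2)" using True odd cards by presburger+
    have "f (insert e (W1 \<union> a \<union> (b \<union> c) \<union> (d \<union> D \<union> W2))) = f (insert e (W1 \<union> a \<union> R \<union> (d \<union> D \<union> W2)))"
      by (rule theta_move[OF p6(4) p6(1) p6(5) R(1) rr(1) _ _ _ _ _ _ _ ev(1,2)]) (simp_all add: conds t12 mem)
    moreover have "W1 \<union> (a \<union> R) \<union> d \<union> D \<union> W2 = W1 \<union> a \<union> R \<union> (d \<union> D \<union> W2)"
      "W1 \<union> (A' \<union> c) \<union> d \<union> D' \<union> W2 = W1 \<union> A' \<union> P \<union> D' \<union> W2" using c(5) by blast+
    ultimately have nq: "f (insert e (W1 \<union> (a \<union> R) \<union> d \<union> D \<union> W2)) \<noteq> f (insert e (W1 \<union> (A' \<union> c) \<union> d \<union> D' \<union> W2))"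
      using neq unfolding eqs by simp
    have "stuck_pair G f B e u w W1 SW1 s1 (a \<union> R) (Sa \<union> SR) (A' \<union> c) (SA' \<union> Sc) r2 d Sd t2 D SD D' SD' s2 W2 SW2"
      by unfold_locales ((rule nq ev odd(2) paths p5 p6 rr ne dig disj | force simp: conds t12 mem)+)
    then show ?thesis using smaller by blast
  next
    case False
    have ev: "even (card (A' \<union> c) + card (a \<union> R))" "odd (card W1 + card (A' \<union> c) + card (d \<union> D' \<union> W2))"
      "odd (card (b \<union> c) + card R)" "odd (card (W1 \<union> a) + card (b \<union> c) + card d + card D + card W2)" using False odd cards by presburger+
    have "f (insert e (W1 \<union> (A' \<union> c) \<union> (d \<union> D' \<union> W2))) = f (insert e (W1 \<union> (a \<union> R) \<union> (d \<union> D' \<union> W2)))"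
      by (rule theta_move[OF paths(1) p6(2) p6(6) p6(3) rr(2) _ _ _ _ _ _ _ ev(1,2)]) (simp_all add: conds t12 mem)
    moreover have "(W1 \<union> a) \<union> (b \<union> c) \<union> d \<union> D \<union> W2 = W1 \<union> A \<union> P \<union> D \<union> W2"
      "(W1 \<union> a) \<union> R \<union> d \<union> D' \<union> W2 = W1 \<union> (a \<union> R) \<union> (d \<union> D' \<union> W2)" using a(5) c(5) by blast+
    ultimately have nq: "f (insert e ((W1 \<union> a) \<union> (b \<union> c) \<union> d \<union> D \<union> W2)) \<noteq> f (insert e ((W1 \<union> a) \<union> R \<union> d \<union> D' \<union> W2))"
      using neq unfolding eqs by simp
    have "stuck_pair G f B e u w (W1 \<union> a) (SW1 \<union> Sa) r1 (b \<union> c) (Sb \<union> Sc) R SR r2 d Sd t2 D SD D' SD' s2 W2 SW2"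
      by unfold_locales ((rule nq ev odd(2) paths p5 p6 R rr ne dig disj | force simp: conds t12 mem)+)
    then show ?thesis using smaller by blast
  qed
qed

text \<open>Under the parity assumption the ear replaces \<open>b \<union> A \<union> c\<close> in
  the first path, and the odd digon with sides \<open>R\<close> and
  \<open>b \<union> A' \<union> c\<close> supersedes the first one. For the opposite parity
  \<open>A\<close> and \<open>A'\<close> are exchanged, as the digon is odd; the decompositions are
  assumptions so that both uses refer to the same pieces.\<close>

lemma ear_W1_P:
  assumes r1: "r1 \<in> SW1" and r2: "r2 \<in> SP" "r2 \<noteq> t1"
    and a: "spath G u Sa a r1" "spath G r1 Sb b s1" "Sa \<union> Sb = SW1" "Sa \<inter> Sb = {r1}" "a \<union> b = W1"
    and c: "spath G t1 Sc c r2" "spath G r2 Sd d t2" "Sc \<union> Sd = SP" "Sc \<inter> Sd = {r2}" "c \<union> d = P" "c \<inter> d = {}"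
    and ev: "even (card R + card b + card A + card c)"
  shows "\<exists>W1 SW1 s1 A SA A' SA' t1 P' SP t2 D SD D' SD' s2 W2 SW2.
    stuck_pair G f B e u w W1 SW1 s1 A SA A' SA' t1 P' SP t2 D SD D' SD' s2 W2 SW2 \<and> card P' < card P"
proof -
  note P = paths[THEN conjunct1]
  have t12: "t1 \<noteq> t2"
  proof
    assume "t1 = t2"
    then have "SP = {t1}" using P(4) spath_loop by metis
    then show False using r2 by simp
  qed
  have smaller: "card d < card P"
  proof (rule psubset_card_mono)
    show "finite P" using spath_finite[OF P(4)] by simp
    have "c \<noteq> {}" using spath_empty_iff[OF c(1)] r2 by auto
    then show "d \<subset> P" using c(5,6) by blast
  qed
  have s: "Sa \<subseteq> SW1" "Sb \<subseteq> SW1" "Sc \<subseteq> SP" "Sd \<subseteq> SP" using a(3) c(3) by auto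
  have sub: "a \<subseteq> B" "b \<subseteq> B" "c \<subseteq> B" "d \<subseteq> B" "R \<subseteq> B" using paths a(5) c(5) R by auto
  have m1: "r1 \<in> Sa" "r1 \<in> Sb" "s1 \<in> Sb" "t1 \<in> Sc" "r2 \<in> Sc" "r2 \<in> Sd" "t2 \<in> Sd" using a c spath_ends by metis+
  then have m2: "s1 \<in> Sa \<longleftrightarrow> r1 = s1" "t1 \<notin> Sd" "t2 \<in> Sc \<longleftrightarrow> r2 = t2"
    using notin[OF a(4)[THEN Int_sym], of s1] notin[OF c(4), of t1] notin[OF c(4)[THEN Int_sym], of t2] r2 by auto
  note o1 = only_W1[OF r1] and o2 = only_P[OF r2]
  have m3: "r2 \<notin> Sa" "r2 \<notin> Sb" "r1 \<notin> Sc" "r1 \<notin> Sd" using o1 o2 s by auto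
  note M = m1 m2 m3 mem nomem o1 o2 r1 r2 SR(8,9) t12
  note x = subset_refl
  note I0 = Int_sub2[OF s(1) x disj(1)] Int_sub2[OF s(2) x disj(1)] Int_sub2[OF s(1) x disj(2)] Int_sub2[OF s(2) x disj(2)]
    Int_sub2[OF s(1) s(3) disj(3)] Int_sub2[OF s(1) s(4) disj(3)] Int_sub2[OF s(2) s(3) disj(3)]
    Int_sub2[OF s(2) s(4) disj(3)] Int_sub2[OF s(1) x disj(4)] Int_sub2[OF s(2) x disj(4)] Int_sub2[OF s(1) x disj(5)]
    Int_sub2[OF s(2) x disj(5)] Int_sub2[OF s(1) x disj(6)] Int_sub2[OF s(2) x disj(6)] Int_sub2[OF x s(3) disj(7)]
    Int_sub2[OF x s(4) disj(7)] Int_sub2[OF x s(3) disj(8)] Int_sub2[OF x s(4) disj(8)] disj(9) disj(10) disj(11) disj(12)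
    disj(13) disj(14) Int_sub2[OF s(3) x disj(15)] Int_sub2[OF s(4) x disj(15)] Int_sub2[OF s(3) x disj(16)]
    Int_sub2[OF s(4) x disj(16)] Int_sub2[OF s(3) x disj(17)] Int_sub2[OF s(4) x disj(17)] disj(18) disj(19) dig(1) dig(2)
    Int_sub2[OF x s(1) SR(1)] Int_sub2[OF x s(2) SR(1)] SR(2) SR(3) Int_sub2[OF x s(3) SR(4)] Int_sub2[OF x s(4) SR(4)] SR(5)
    SR(6) SR(7)
  note I1 = I0[simplified M Int_insert_left Int_empty_left Int_empty_right if_True if_False simp_thms]
  note I = a(4) c(4) a(4)[THEN Int_sym] c(4)[THEN Int_sym] I1 I1[THEN Int_sym]
  have p5: "path u Sa a r1" "path r1 Sb b s1" "path t1 Sc c r2" "path r2 Sd d t2" using a c sub by auto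
  note R1 = R(1)[THEN conjunct1]
  have cards: "card W1 = card a + card b" "card P = card c + card d" "card (b \<union> A \<union> c) = card b + card A + card c"
     "card (b \<union> A' \<union> c) = card b + card A' + card c" "card (d \<union> D \<union> W2) = card d + card D + card W2"
    using spath_app(2)[OF a(1,2,4)] spath_app(2)[OF c(1,2,4)] spath_app3(2)[OF a(2) P(2) c(1)] spath_app3(2)[OF a(2) P(3) c(1)]
      spath_app3(2)[OF c(2) P(5,7)] a(5) c(5)
    by (simp_all add: I)
  have p6: "path r1 (Sb \<union> SA \<union> Sc) (b \<union> A \<union> c) r2" "path r1 (Sb \<union> SA' \<union> Sc) (b \<union> A' \<union> c) r2"
    "path r2 (Sd \<union> SD \<union> SW2) (d \<union> D \<union> W2) w"
    using spath_app3(1)[OF a(2) P(2) c(1)] spath_app3(1)[OF a(2) P(3) c(1)]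
      spath_app3(1)[OF c(2) P(5,7)] paths sub by (simp_all add: I)
  have dis: "R \<inter> b = {}" "R \<inter> c = {}" "R \<inter> A = {}" "R \<inter> A' = {}" using R_disj a(5) c(5) by auto
  have eqs: "a \<union> (b \<union> A \<union> c) \<union> (d \<union> D \<union> W2) = W1 \<union> A \<union> P \<union> D \<union> W2" "a \<union> (b \<union> A' \<union> c) \<union> d \<union> D' \<union> W2 = W1 \<union> A' \<union> P \<union> D' \<union> W2"
    using a(5) c(5) by blast+
  note conds = Int_Un_distrib Int_Un_distrib2 I dis insert_commute
  have ev: "even (card (b \<union> A \<union> c) + card R)" "odd (card a + card (b \<union> A \<union> c) + card (d \<union> D \<union> W2))"
    "odd (card R + card (b \<union> A' \<union> c))" "odd (card a + card R + card d + card D + card W2)" using ev odd cards by presburger+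
  have "f (insert e (a \<union> (b \<union> A \<union> c) \<union> (d \<union> D \<union> W2))) = f (insert e (a \<union> R \<union> (d \<union> D \<union> W2)))"
    by (rule theta_move[OF p5(1) p6(1) p6(3) R(1) R(2) _ _ _ _ _ _ _ ev(1,2)]) (simp_all add: conds t12 mem)
  moreover have "a \<union> R \<union> d \<union> D \<union> W2 = a \<union> R \<union> (d \<union> D \<union> W2)" by blast
  ultimately have nq: "f (insert e (a \<union> R \<union> d \<union> D \<union> W2)) \<noteq> f (insert e (a \<union> (b \<union> A' \<union> c) \<union> d \<union> D' \<union> W2))"
    using neq unfolding eqs by simp
  have "stuck_pair G f B e u w a Sa r1 R SR (b \<union> A' \<union> c) (Sb \<union> SA' \<union> Sc) r2 d Sd t2 D SD D' SD' s2 W2 SW2"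
    by unfold_locales ((rule nq ev odd(2) paths p5 p6 R ne dig disj | force simp: conds t12 mem)+)
  then show ?thesis using smaller by blast
qed

text \<open>If the ear has the parity of the stretch between its ends, both paths are exchanged for
  the same shortcut. Otherwise the ear and the closing path through \<open>e\<close> form a third
  odd digon; the two circuits of the ring relation that use the ear lie in \<open>B\<close> and have
  value zero, so the two through \<open>e\<close> agree.\<close>

lemma ear_W1_W2:
  assumes r1: "r1 \<in> SW1" and r2: "r2 \<in> SW2"
  shows False
proof -
  note P = paths[THEN conjunct1]
  obtain Sa Sb a b where a: "spath G u Sa a r1" "spath G r1 Sb b s1" "Sa \<union> Sb = SW1" "Sa \<inter> Sb = {r1}" "a \<union> b = W1" "a \<inter> b = {}"
    using spath_split[OF P(1) r1] by metis
  obtain Sc Sd c d where c: "spath G s2 Sc c r2" "spath G r2 Sd d w" "Sc \<union> Sd = SW2" "Sc \<inter> Sd = {r2}" "c \<union> d = W2"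
    using spath_split[OF P(7) r2(1)] by metis
  have s: "Sa \<subseteq> SW1" "Sb \<subseteq> SW1" "Sc \<subseteq> SW2" "Sd \<subseteq> SW2" using a(3) c(3) by auto
  have sub: "a \<subseteq> B" "b \<subseteq> B" "c \<subseteq> B" "d \<subseteq> B" using paths a(5) c(5) by auto
  have m1: "r1 \<in> Sa" "r1 \<in> Sb" "s1 \<in> Sb" "s2 \<in> Sc" "r2 \<in> Sc" "r2 \<in> Sd" using a c spath_ends by metis+
  then have m2: "s1 \<in> Sa \<longleftrightarrow> r1 = s1" "s2 \<in> Sd \<longleftrightarrow> r2 = s2"
    using notin[OF a(4)[THEN Int_sym], of s1] notin[OF c(4), of s2] by auto
  note o1 = only_W1[OF r1] and o2 = only_W2[OF r2]
  have m3: "r2 \<notin> Sa" "r2 \<notin> Sb" "r1 \<notin> Sc" "r1 \<notin> Sd" using o1 o2 s by auto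
  note M = m1 m2 m3 mem nomem o1 o2 r1 r2 SR(8,9)
  note x = subset_refl
  note I0 = Int_sub2[OF s(1) x disj(1)] Int_sub2[OF s(2) x disj(1)] Int_sub2[OF s(1) x disj(2)] Int_sub2[OF s(2) x disj(2)]
    Int_sub2[OF s(1) x disj(3)] Int_sub2[OF s(2) x disj(3)] Int_sub2[OF s(1) x disj(4)] Int_sub2[OF s(2) x disj(4)]
    Int_sub2[OF s(1) x disj(5)] Int_sub2[OF s(2) x disj(5)] Int_sub2[OF s(1) s(3) disj(6)] Int_sub2[OF s(1) s(4) disj(6)]
    Int_sub2[OF s(2) s(3) disj(6)] Int_sub2[OF s(2) s(4) disj(6)] disj(7) disj(8) disj(9) disj(10) disj(11) disj(12)
    Int_sub2[OF x s(3) disj(13)] Int_sub2[OF x s(4) disj(13)] Int_sub2[OF x s(3) disj(14)] Int_sub2[OF x s(4) disj(14)]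
    disj(15) disj(16) Int_sub2[OF x s(3) disj(17)] Int_sub2[OF x s(4) disj(17)] Int_sub2[OF x s(3) disj(18)]
    Int_sub2[OF x s(4) disj(18)] Int_sub2[OF x s(3) disj(19)] Int_sub2[OF x s(4) disj(19)] dig(1) dig(2)
    Int_sub2[OF x s(1) SR(1)] Int_sub2[OF x s(2) SR(1)] SR(2) SR(3) SR(4) SR(5) SR(6) Int_sub2[OF x s(3) SR(7)]
    Int_sub2[OF x s(4) SR(7)]
  note I1 = I0[simplified M Int_insert_left Int_empty_left Int_empty_right if_True if_False simp_thms]
  note I = a(4) c(4) a(4)[THEN Int_sym] c(4)[THEN Int_sym] I1 I1[THEN Int_sym]
  have p5: "path u Sa a r1" "path r1 Sb b s1" "path s2 Sc c r2" "path r2 Sd d w" using a c sub by auto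
  note R1 = R(1)[THEN conjunct1]
  have mid: "path r1 (Sb \<union> X \<union> SP \<union> Y \<union> Sc) (b \<union> k \<union> P \<union> l \<union> c) r2 \<and> card (b \<union> k \<union> P \<union> l \<union> c) = card b + card k + card P + card l + card c"
    if "X = SA \<and> k = A \<or> X = SA' \<and> k = A'" "Y = SD \<and> l = D \<or> Y = SD' \<and> l = D'" for X Y k l
  proof -
    have 0: "spath G s1 X k t1" "spath G t2 Y l s2" "k \<subseteq> B" "l \<subseteq> B" using that paths by auto
    have "Sb \<inter> X = {s1} \<and> X \<inter> SP = {t1} \<and> X \<inter> Sc = {}" using that(1) by (elim disjE conjE) (simp_all add: I)
    moreover have "Sb \<inter> Y = {} \<and> SP \<inter> Y = {t2} \<and> Y \<inter> Sc = {s2}" using that(2) by (elim disjE conjE) (simp_all add: I)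
    moreover have "X \<inter> Y = {t1} \<inter> {t2}" using that by (elim disjE conjE) (simp_all add: I)
    ultimately have i: "Sb \<inter> X = {s1}" "X \<inter> SP = {t1}" "Sb \<inter> SP = {}" "(Sb \<union> X \<union> SP) \<inter> Y = {t2}" "Y \<inter> Sc = {s2}" "(Sb \<union> X \<union> SP) \<inter> Sc = {}"
      by (auto simp: Int_Un_distrib2 I)
    note x1 = spath_app3[OF a(2) 0(1) P(4) i(1-3)]
    note x2 = spath_app3[OF x1(1) 0(2) c(1) i(4-6)]
    show ?thesis using x1(2) x2(1,2) 0 sub paths by simp
  qed
  have m11: "path r1 (Sb \<union> SA \<union> SP \<union> SD \<union> Sc) (b \<union> A \<union> P \<union> D \<union> c) r2" and k11: "card (b \<union> A \<union> P \<union> D \<union> c) = card b + card A + card P + card D + card c"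
    and m22: "path r1 (Sb \<union> SA' \<union> SP \<union> SD' \<union> Sc) (b \<union> A' \<union> P \<union> D' \<union> c) r2" and k22: "card (b \<union> A' \<union> P \<union> D' \<union> c) = card b + card A' + card P + card D' + card c"
    using mid[of SA A SD D] mid[of SA' A' SD' D'] by blast+
  have cW: "card W1 = card a + card b" "card W2 = card c + card d"
    using spath_app(2)[OF a(1,2,4)] spath_app(2)[OF c(1,2,4)] a(5) c(5) by (simp_all add: I)
  have dis: "R \<inter> b = {}" "R \<inter> c = {}" "R \<inter> A = {}" "R \<inter> A' = {}" "R \<inter> P = {}" "R \<inter> D = {}" "R \<inter> D' = {}" using R_disj a(5) c(5) by auto
  have eqs: "a \<union> (b \<union> A \<union> P \<union> D \<union> c) \<union> d = W1 \<union> A \<union> P \<union> D \<union> W2" "a \<union> (b \<union> A' \<union> P \<union> D' \<union> c) \<union> d = W1 \<union> A' \<union> P \<union> D' \<union> W2"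
    using a(5) c(5) by blast+
  note conds = Int_Un_distrib Int_Un_distrib2 I dis
  have oB: "odd (card a + card (b \<union> A \<union> P \<union> D \<union> c) + card d)" "odd (card a + card (b \<union> A' \<union> P \<union> D' \<union> c) + card d)"
    using odd cW k11 k22 by presburger+
  show False
  proof (cases "even (card (b \<union> A \<union> P \<union> D \<union> c) + card R)")
    case True
    then have True': "even (card (b \<union> A' \<union> P \<union> D' \<union> c) + card R)" using oB by presburger
    have "f (insert e (a \<union> (b \<union> A \<union> P \<union> D \<union> c) \<union> d)) = f (insert e (a \<union> R \<union> d))"
      by (rule theta_move[OF p5(1) m11 p5(4) R(1) R(2) _ _ _ _ _ _ _ True oB(1)]) (auto simp: conds)
    moreover have "f (insert e (a \<union> (b \<union> A' \<union> P \<union> D' \<union> c) \<union> d)) = f (insert e (a \<union> R \<union> d))"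
      by (rule theta_move[OF p5(1) m22 p5(4) R(1) R(2) _ _ _ _ _ _ _ True' oB(2)]) (auto simp: conds)
    ultimately show False using neq unfolding eqs by simp
  next
    case False
    have ad: "Sa \<inter> Sd = {}" by (simp add: I)
    note E = closing_path[OF p5(1,4) ad]
    have ev: "even (card A + card D + card (insert e (a \<union> d)) + card P + card c + card b)" using odd E(2) cW by presburger
    have od: "odd (card (insert e (a \<union> d)) + card R)" using E(2) oB False by presburger
    have ring: "(f (A \<union> D \<union> insert e (a \<union> d) \<union> (P \<union> c \<union> b)) \<noteq> f (A \<union> D' \<union> R \<union> (P \<union> c \<union> b))) =
      (f (A' \<union> D \<union> R \<union> (P \<union> c \<union> b)) \<noteq> f (A' \<union> D' \<union> insert e (a \<union> d) \<union> (P \<union> c \<union> b)))"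
      by (rule ring_relD[OF _ ne R(2)[symmetric] P(2,3,5,6) spath_rev[OF E(1)] spath_rev[OF R1] P(4) c(1) a(2) dig(1,2) _ _ _ _ _ _ _ _ _ _ _ _ _ _ _ _
         odd(1,2) od ev]) (use rels in \<open>simp_all add: rels_def conds insert_commute, auto?\<close>)
    have zz: "\<not> f (R \<union> (b \<union> k \<union> P \<union> l \<union> c))"
      if k: "X = SA \<and> k = A \<or> X = SA' \<and> k = A'" "Y = SD \<and> l = D \<or> Y = SD' \<and> l = D'" and o: "odd (card k + card l + card A + card D)" for X Y k l
    proof (rule zero)
      note m = mid[OF k]
      have i: "SR \<inter> (Sb \<union> X \<union> SP \<union> Y \<union> Sc) = {r1, r2}" using k by (elim disjE conjE) (auto simp: conds)
      have d: "R \<inter> (b \<union> k \<union> P \<union> l \<union> c) = {}" using k by (elim disjE conjE) (simp_all add: conds)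
      show "circ G (R \<union> (b \<union> k \<union> P \<union> l \<union> c))" using circI[OF R(2) R1 _ i d] m by blast
      show "R \<union> (b \<union> k \<union> P \<union> l \<union> c) \<subseteq> B" using m R by simp
      have "card (R \<union> (b \<union> k \<union> P \<union> l \<union> c)) = card R + card (b \<union> k \<union> P \<union> l \<union> c)"
        using d spath_finite[OF R1] m spath_finite by (metis card_Un_disjoint)
      then show "even (card (R \<union> (b \<union> k \<union> P \<union> l \<union> c)))" using m[THEN conjunct2] k11 False o by presburger
    qed
    have "odd (card A + card D' + card A + card D)" "odd (card A' + card D + card A + card D)" using odd by presburger+
    then have "\<not> f (R \<union> (b \<union> A \<union> P \<union> D' \<union> c))" "\<not> f (R \<union> (b \<union> A' \<union> P \<union> D \<union> c))"
      using zz[of SA A SD' D'] zz[of SA' A' SD D] by blast+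
    moreover have "A \<union> D' \<union> R \<union> (P \<union> c \<union> b) = R \<union> (b \<union> A \<union> P \<union> D' \<union> c)" "A' \<union> D \<union> R \<union> (P \<union> c \<union> b) = R \<union> (b \<union> A' \<union> P \<union> D \<union> c)"
      "A \<union> D \<union> insert e (a \<union> d) \<union> (P \<union> c \<union> b) = insert e (W1 \<union> A \<union> P \<union> D \<union> W2)"
      "A' \<union> D' \<union> insert e (a \<union> d) \<union> (P \<union> c \<union> b) = insert e (W1 \<union> A' \<union> P \<union> D' \<union> W2)" using a(5) c(5) by blast+
    ultimately show False using neq ring by simp
  qed
qed

end

lemma (in edge_addition) reach_path:
  assumes "(x, y) \<in> reach G A t" "x \<noteq> t" "A \<subseteq> edges G"
  shows "\<exists>S p. spath G x S p y \<and> p \<subseteq> A \<and> t \<notin> S"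
  using assms unfolding reach_def
proof (induction rule: rtrancl_induct)
  case base
  then show ?case using spath.nil[of G x] by blast
next
  case (step y z)
  then obtain S p where p: "spath G x S p y" "p \<subseteq> A" "t \<notin> S" by blast
  obtain g where g: "g \<in> A" "ends G g = {y, z}" "y \<noteq> t" "z \<noteq> t" using step.hyps by blast
  show ?case
  proof (cases "z \<in> S")
    case True
    obtain S1 p1 S2 p2 where "spath G x S1 p1 z" "S1 \<union> S2 = S" "p1 \<union> p2 = p"
      using spath_split[OF p(1) True] by metis
    then show ?thesis using p by blast
  next
    case False
    then have "y \<noteq> z" using spath_end[OF p(1)] by auto
    moreover have "S \<inter> {y, z} = {y}" using False spath_end[OF p(1)] by auto
    ultimately have "spath G x (S \<union> {y, z}) (p \<union> {g}) z"
      using spath_append[OF p(1) spath_single] g assms(3) by blast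
    moreover have "p \<union> {g} \<subseteq> A" "t \<notin> S \<union> {y, z}" using p g by auto
    ultimately show ?thesis by blast
  qed
qed

text \<open>A path from \<open>X\<close> to \<open>Y\<close> is cut at its first vertex in
  \<open>Y\<close> and then at the last vertex in \<open>X\<close> before it.\<close>

lemma (in edge_addition) reach_ear:
  assumes "(x, y) \<in> reach G A t" "x \<noteq> t" "A \<subseteq> edges G" "x \<in> X" "y \<in> Y" "X \<inter> Y = {}"
  obtains r1 r2 S R where "r1 \<in> X" "r2 \<in> Y" "spath G r1 S R r2" "R \<subseteq> A" "t \<notin> S" "S \<inter> X = {r1}" "S \<inter> Y = {r2}"
proof -
  obtain S p where p: "spath G x S p y" "p \<subseteq> A" "t \<notin> S" using reach_path assms(1-3) by blast
  obtain r2 S1 p1 S2 p2 where 1: "spath G x S1 p1 r2" "S1 \<union> S2 = S" "p1 \<union> p2 = p" "S1 \<inter> Y = {r2}"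
    using spath_first_hit[OF p(1) assms(5)] by metis
  obtain r1 S3 p3 S4 p4 where 2: "spath G r1 S4 p4 r2" "S3 \<union> S4 = S1" "p3 \<union> p4 = p1" "S4 \<inter> X = {r1}"
    using spath_last_hit[OF 1(1) assms(4)] by metis
  have "r2 \<in> S4" using spath_end[OF 2(1)] .
  then have "S4 \<inter> Y = {r2}" using 1(4) 2(2) by auto
  moreover have "r1 \<in> X" "r2 \<in> Y" using 2(4) 1(4) by auto
  ultimately show ?thesis using that 2 1(2,3) p by blast
qed

context stuck_ear
begin

text \<open>The vertex \<open>t1\<close> separates the part of the configuration with
  \<open>r1\<close> from the part with \<open>r2\<close>. Ears that end on \<open>P\<close> give a
  shorter connecting path; all others are contradictory, those from \<open>W1\<close> into the
  second digon being mirror images of ears from the first digon to \<open>W2\<close>.\<close>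

lemma ear_shortens:
  assumes r1: "r1 \<in> SW1 \<union> SA \<union> SA'" "r1 \<noteq> t1" and r2: "r2 \<in> SP \<union> SD \<union> SD' \<union> SW2" "r2 \<noteq> t1"
  shows "\<exists>W1 SW1 s1 A SA A' SA' t1 P' SP t2 D SD D' SD' s2 W2 SW2.
    stuck_pair G f B e u w W1 SW1 s1 A SA A' SA' t1 P' SP t2 D SD D' SD' s2 W2 SW2 \<and> card P' < card P"
proof -
  interpret sw: stuck_ear G f B e u w W1 SW1 s1 A' SA' A SA t1 P SP t2 D' SD' D SD s2 W2 SW2 r1 SR R r2 by (rule swap_ear)
  interpret mi: stuck_ear G f B e w u W2 SW2 s2 D SD D' SD' t2 P SP t1 A SA A' SA' s1 W1 SW1 r2 SR R r1 by (rule mirror_ear)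
  interpret ms: stuck_ear G f B e w u W2 SW2 s2 D' SD' D SD t2 P SP t1 A' SA' A SA s1 W1 SW1 r2 SR R r1 by (rule sw.mirror_ear)
  consider (W) "r1 \<in> SW1" | (A) "r1 \<in> SA" "r1 \<noteq> s1" | (A') "r1 \<in> SA'" "r1 \<noteq> s1" using r1 mem(1) by blast
  then show ?thesis
  proof cases
    case W
    consider (P) "r2 \<in> SP" | (D) "r2 \<in> SD" "r2 \<noteq> t2" "r2 \<noteq> s2" | (D') "r2 \<in> SD'" "r2 \<noteq> t2" "r2 \<noteq> s2" | (W2) "r2 \<in> SW2"
      using r2 mem by blast
    then show ?thesis
    proof cases
      case P
      note p = paths[THEN conjunct1]
      obtain Sa Sb a b where a: "spath G u Sa a r1" "spath G r1 Sb b s1" "Sa \<union> Sb = SW1" "Sa \<inter> Sb = {r1}" "a \<union> b = W1" "a \<inter> b = {}"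
        using spath_split[OF p(1) W] by metis
      obtain Sc Sd c d where c: "spath G t1 Sc c r2" "spath G r2 Sd d t2" "Sc \<union> Sd = SP" "Sc \<inter> Sd = {r2}" "c \<union> d = P" "c \<inter> d = {}"
        using spath_split[OF p(4) P] by metis
      show ?thesis
      proof (cases "even (card R + card b + card A + card c)")
        case True
        show ?thesis by (rule ear_W1_P[OF W P r2(2) a(1-5) c True])
      next
        case False
        then have "even (card R + card b + card A' + card c)" using odd(1) by presburger
        from sw.ear_W1_P[OF W P r2(2) a(1-5) c this] show ?thesis .
      qed
    next
      case D
      then show ?thesis using mi.ear_A_W2[OF _ _ _ W] by blast
    next
      case D'
      then show ?thesis using ms.ear_A_W2[OF _ _ _ W] by blast
    next
      case W2
      then show ?thesis using ear_W1_W2[OF W] by blast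
    qed
  next
    case A
    consider (P) "r2 \<in> SP" | (D) "r2 \<in> SD" "r2 \<noteq> t2" "r2 \<noteq> s2" | (D') "r2 \<in> SD'" "r2 \<noteq> t2" "r2 \<noteq> s2" | (W2) "r2 \<in> SW2"
      using r2 mem by blast
    then show ?thesis
      using ear_A_P[OF A r1(2) _ r2(2)] ear_A_D[OF A r1(2)] ear_A_D'[OF A r1(2)] ear_A_W2[OF A r1(2)] by cases auto
  next
    case A'
    consider (P) "r2 \<in> SP" | (D) "r2 \<in> SD" "r2 \<noteq> t2" "r2 \<noteq> s2" | (D') "r2 \<in> SD'" "r2 \<noteq> t2" "r2 \<noteq> s2" | (W2) "r2 \<in> SW2"
      using r2 mem by blast
    then show ?thesis
      using sw.ear_A_P[OF A' r1(2) _ r2(2)] sw.ear_A_D'[OF A' r1(2)] sw.ear_A_D[OF A' r1(2)] sw.ear_A_W2[OF A' r1(2)] by cases auto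
  qed
qed

end

text \<open>Since the digons are circuits, an ear as above exists as soon as \<open>t1\<close> does not separate the circuits
  in \<open>B\<close>; so the connecting path \<open>P\<close> could be shortened forever.\<close>

lemma (in edge_addition) no_stuck_pair:
  assumes conn: "\<And>t x y C D. circ G C \<Longrightarrow> C \<subseteq> B \<Longrightarrow> circ G D \<Longrightarrow> D \<subseteq> B \<Longrightarrow> x \<in> \<Union>(ends G ` C) \<Longrightarrow> y \<in> \<Union>(ends G ` D) \<Longrightarrow>
      t \<noteq> x \<Longrightarrow> t \<noteq> y \<Longrightarrow> (x, y) \<in> reach G B t" and B: "B \<subseteq> edges G"
  shows "\<not> stuck_pair G f B e u w W1 SW1 s1 A SA A' SA' t1 P SP t2 D SD D' SD' s2 W2 SW2"
proof (induction "card P" arbitrary: W1 SW1 s1 A SA A' SA' t1 P SP t2 D SD D' SD' s2 W2 SW2 rule: less_induct)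
  case less
  show ?case
  proof
    assume "stuck_pair G f B e u w W1 SW1 s1 A SA A' SA' t1 P SP t2 D SD D' SD' s2 W2 SW2"
    then interpret st: stuck_pair G f B e u w W1 SW1 s1 A SA A' SA' t1 P SP t2 D SD D' SD' s2 W2 SW2 .
    note p = st.paths[THEN conjunct1]
    have cA: "circ G (A \<union> A')" "circ G (D \<union> D')"
      using circI[OF st.ne(1) p(2,3) st.dig(1,3)] circI[OF st.ne(2) p(5,6) st.dig(2,4)] by auto
    have s: "s1 \<in> \<Union>(ends G ` (A \<union> A'))" "s2 \<in> \<Union>(ends G ` (D \<union> D'))"
    proof -
      have "card (incident G A s1) = 1" using card_incident_spath[OF p(2), of s1] st.mem st.ne by simp
      then have "incident G A s1 \<noteq> {}" by auto
      then show "s1 \<in> \<Union>(ends G ` (A \<union> A'))" by (auto simp: incident_def)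
      have "card (incident G D s2) = 1" using card_incident_spath[OF p(5), of s2] st.mem st.ne by simp
      then have "incident G D s2 \<noteq> {}" by auto
      then show "s2 \<in> \<Union>(ends G ` (D \<union> D'))" by (auto simp: incident_def)
    qed
    have t1s2: "t1 \<noteq> s2" using st.mem(4) st.nomem(10) by auto
    \<comment> \<open>These are the parts of the configuration on either side of \<open>t1\<close>.
      Removing \<open>t1\<close> makes them disjoint.\<close>
    define X where "X = SW1 \<union> SA \<union> SA' - {t1}"
    define Y where "Y = SP \<union> SD \<union> SD' \<union> SW2 - {t1}"
    have XY: "X \<inter> Y = {}"
    proof -
      have "v \<notin> SP \<union> SD \<union> SD' \<union> SW2" if v: "v \<in> SW1 \<or> v \<in> SA \<or> v \<in> SA'" "v \<noteq> t1" for v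
      proof (cases "v \<in> SW1")
        case True
        then show ?thesis using st.only_W1[OF True] by simp
      next
        case False
        then have "v \<noteq> s1" using st.mem(1) by auto
        then show ?thesis using v(1) False st.only_A[OF _ _ v(2)] stuck_pair.only_A[OF st.swap _ _ v(2)] by auto
      qed
      then show ?thesis unfolding X_def Y_def by blast
    qed
    have "A \<union> A' \<subseteq> B" "D \<union> D' \<subseteq> B" using st.paths by auto
    then have "(s1, s2) \<in> reach G B t1" using conn[OF cA(1) _ cA(2) _ s] st.ne t1s2 by auto
    moreover have "s1 \<in> X" "s2 \<in> Y" using st.mem st.ne t1s2 by (auto simp: X_def Y_def)
    ultimately obtain r1 r2 SR R where r: "r1 \<in> X" "r2 \<in> Y" "spath G r1 SR R r2" "R \<subseteq> B" "t1 \<notin> SR" "SR \<inter> X = {r1}" "SR \<inter> Y = {r2}"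
      using reach_ear[of s1 s2 B t1 X Y] st.ne B XY by metis
    have XYU: "SW1 \<union> SA \<union> SA' \<union> SP \<union> SD \<union> SD' \<union> SW2 \<subseteq> X \<union> Y \<union> {t1}" by (auto simp: X_def Y_def)
    interpret stuck_ear G f B e u w W1 SW1 s1 A SA A' SA' t1 P SP t2 D SD D' SD' s2 W2 SW2 r1 SR R r2
    proof
      show "path r1 SR R r2" using r by simp
      show "r1 \<noteq> r2" using r XY by auto
      have "{r1, r2} \<subseteq> SR" using spath_ends[OF r(3)] by simp
      moreover have "{r1, r2} \<subseteq> SW1 \<union> SA \<union> SA' \<union> SP \<union> SD \<union> SD' \<union> SW2" using r(1,2) by (auto simp: X_def Y_def)
      moreover have "SR \<inter> (X \<union> Y \<union> {t1}) = {r1, r2}" using r(5-7) by (auto simp: Int_Un_distrib)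
      ultimately show "SR \<inter> (SW1 \<union> SA \<union> SA' \<union> SP \<union> SD \<union> SD' \<union> SW2) = {r1, r2}" using XYU by blast
      \<comment> \<open>A common edge would have both ends on \<open>R\<close> and in the same part,
        whereas \<open>R\<close> avoids \<open>t1\<close> and meets each part in one vertex
        only.\<close>
      have no: "g \<notin> K" if g: "g \<in> R" and K: "spath G x S K y" "S - {t1} \<subseteq> X \<or> S - {t1} \<subseteq> Y" for g K S x y
      proof
        assume gK: "g \<in> K"
        obtain v v' where v: "v \<noteq> v'" "v \<in> SR" "v' \<in> SR" "ends G g = {v, v'}" using spath_edge_ends[OF r(3) g] by blast
        have "v \<in> S" "v' \<in> S" using spath_ends_subset[OF K(1) gK] v(4) by auto
        then have "{v, v'} \<subseteq> SR \<inter> X \<or> {v, v'} \<subseteq> SR \<inter> Y" using K(2) v r(5) by auto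
        then show False using v(1) r(6,7) by auto
      qed
      have sX: "SW1 - {t1} \<subseteq> X" "SA - {t1} \<subseteq> X" "SA' - {t1} \<subseteq> X" "SP - {t1} \<subseteq> Y" "SD - {t1} \<subseteq> Y" "SD' - {t1} \<subseteq> Y" "SW2 - {t1} \<subseteq> Y"
        by (auto simp: X_def Y_def)
      show "R \<inter> (W1 \<union> A \<union> A' \<union> P \<union> D \<union> D' \<union> W2) = {}"
        using no[OF _ p(1)] no[OF _ p(2)] no[OF _ p(3)] no[OF _ p(4)] no[OF _ p(5)] no[OF _ p(6)] no[OF _ p(7)] sX by auto
    qed
    have "r1 \<in> SW1 \<union> SA \<union> SA'" "r1 \<noteq> t1" "r2 \<in> SP \<union> SD \<union> SD' \<union> SW2" "r2 \<noteq> t1" using r(1,2) by (auto simp: X_def Y_def)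
    from ear_shortens[OF this] less.hyps show False by blast
  qed
qed

section \<open>Linearity\<close>

definition linear_on :: "('v, 'e) mgraph \<Rightarrow> ('e set \<Rightarrow> bool) \<Rightarrow> 'e set \<Rightarrow> bool" where
  "linear_on G f A \<longleftrightarrow> (\<exists>X. \<forall>C. circ G C \<longrightarrow> C \<subseteq> A \<longrightarrow> even (card C) \<longrightarrow> f C = odd (card (C \<inter> X)))"

definition vset :: "('v, 'e) mgraph \<Rightarrow> 'e set \<Rightarrow> 'v set" where
  "vset G A = \<Union>(ends G ` A)"

lemma vset_Un: "vset G (A \<union> B) = vset G A \<union> vset G B"
  by (simp add: vset_def)

lemma vset_mono: "A \<subseteq> B \<Longrightarrow> vset G A \<subseteq> vset G B"
  by (auto simp: vset_def)

lemma spath_vset: "spath G x S p y \<Longrightarrow> S = insert x (vset G p)"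
  using spath_verts by (simp add: vset_def)

definition biconnected :: "('v, 'e) mgraph \<Rightarrow> 'e set \<Rightarrow> bool" where
  "biconnected G A \<longleftrightarrow> (\<forall>t. \<forall>x\<in>vset G A - {t}. \<forall>y\<in>vset G A - {t}. (x, y) \<in> reach G A t)"

lemma parity_Un:
  "finite p \<Longrightarrow> finite q \<Longrightarrow> p \<inter> q = {} \<Longrightarrow>
    odd (card ((p \<union> q) \<inter> X)) = (odd (card (p \<inter> X)) \<noteq> odd (card (q \<inter> X)))"
  by (subst Int_Un_distrib2, subst card_Un_disjoint) auto

lemma Un_Int_sub4:
  "(A \<union> B) \<inter> (C \<union> D) = X \<Longrightarrow> X \<subseteq> Y \<Longrightarrow> A \<inter> C \<subseteq> Y"
  "(A \<union> B) \<inter> (C \<union> D) = X \<Longrightarrow> X \<subseteq> Y \<Longrightarrow> A \<inter> D \<subseteq> Y"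
  "(A \<union> B) \<inter> (C \<union> D) = X \<Longrightarrow> X \<subseteq> Y \<Longrightarrow> B \<inter> C \<subseteq> Y"
  "(A \<union> B) \<inter> (C \<union> D) = X \<Longrightarrow> X \<subseteq> Y \<Longrightarrow> B \<inter> D \<subseteq> Y"
  by auto

lemma Un_Int_sub2:
  "(A \<union> B) \<inter> C = X \<Longrightarrow> X \<subseteq> Y \<Longrightarrow> A \<inter> C \<subseteq> Y"
  "(A \<union> B) \<inter> C = X \<Longrightarrow> X \<subseteq> Y \<Longrightarrow> B \<inter> C \<subseteq> Y"
  by auto

text \<open>The parity of \<open>card (C \<inter> X)\<close> is additive over the branches, and each
  branch occurs in an even number of the circuits of a relation. So this parity satisfies all three
  relations itself and may be added to \<open>f\<close>.\<close>

lemma rels_shift: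
  assumes "rels G f"
  shows "rels G (\<lambda>C. f C \<noteq> odd (card (C \<inter> X)))"
proof -
  define par where "par = (\<lambda>C. odd (card (C \<inter> X)))"
  have par: "par (p \<union> q) = (par p \<noteq> par q)" if "finite p" "finite q" "p \<inter> q = {}" for p q
    using parity_Un[OF that] by (simp add: par_def)
  let ?h = "\<lambda>C. f C \<noteq> par C"
  have "theta_rel G ?h"
    unfolding theta_rel_def
  proof (intro allI impI)
    fix x y P Q R p q r
    assume a: "x \<noteq> y" "spath G x P p y" "spath G x Q q y" "spath G x R r y" "P \<inter> Q = {x, y}" "P \<inter> R = {x, y}" "Q \<inter> R = {x, y}"
      "p \<inter> q = {}" "p \<inter> r = {}" "q \<inter> r = {}" "even (card p + card q)" "even (card q + card r)"
    have "f (p \<union> q) = (f (q \<union> r) \<noteq> f (p \<union> r))"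
      using theta_relD[OF _ a] assms unfolding rels_def by blast
    then show "?h (p \<union> q) = (?h (q \<union> r) \<noteq> ?h (p \<union> r))"
      using a(2-4)[THEN spath_finite] a(8-10) by (simp add: par) argo
  qed
  moreover have "K4_rel G ?h"
    unfolding K4_rel_def
  proof (intro allI impI)
    fix x0 x1 x2 x3 P01 P02 P03 P12 P13 P23 p01 p02 p03 p12 p13 p23
    assume p: "spath G x0 P01 p01 x1" "spath G x0 P02 p02 x2" "spath G x0 P03 p03 x3"
     "spath G x1 P12 p12 x2" "spath G x1 P13 p13 x3" "spath G x2 P23 p23 x3"
     and i: "P01 \<inter> P02 = {x0}" "P01 \<inter> P03 = {x0}" "P02 \<inter> P03 = {x0}"
     "P01 \<inter> P12 = {x1}" "P01 \<inter> P13 = {x1}" "P12 \<inter> P13 = {x1}"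
     "P02 \<inter> P12 = {x2}" "P02 \<inter> P23 = {x2}" "P12 \<inter> P23 = {x2}"
     "P03 \<inter> P13 = {x3}" "P03 \<inter> P23 = {x3}" "P13 \<inter> P23 = {x3}"
     "P01 \<inter> P23 = {}" "P02 \<inter> P13 = {}" "P03 \<inter> P12 = {}"
     and o: "odd (card p01 + card p12 + card p02)" "odd (card p01 + card p13 + card p03)"
     "odd (card p02 + card p23 + card p03)"
    have d: "p01 \<inter> p02 = {}" "p01 \<inter> p03 = {}" "p02 \<inter> p03 = {}" "p01 \<inter> p12 = {}" "p01 \<inter> p13 = {}" "p12 \<inter> p13 = {}"
      "p02 \<inter> p12 = {}" "p02 \<inter> p23 = {}" "p12 \<inter> p23 = {}" "p03 \<inter> p13 = {}" "p03 \<inter> p23 = {}" "p13 \<inter> p23 = {}"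
      "p01 \<inter> p23 = {}" "p02 \<inter> p13 = {}" "p03 \<inter> p12 = {}"
      using spath_disjoint1[OF p(1,2) i(1)] spath_disjoint1[OF p(1,3) i(2)] spath_disjoint1[OF p(2,3) i(3)]
        spath_disjoint1[OF p(1,4) i(4)] spath_disjoint1[OF p(1,5) i(5)] spath_disjoint1[OF p(4,5) i(6)]
        spath_disjoint1[OF p(2,4) i(7)] spath_disjoint1[OF p(2,6) i(8)] spath_disjoint1[OF p(4,6) i(9)]
        spath_disjoint1[OF p(3,5) i(10)] spath_disjoint1[OF p(3,6) i(11)] spath_disjoint1[OF p(5,6) i(12)]
        spath_disjoint0[OF p(1,6) i(13)] spath_disjoint0[OF p(2,5) i(14)] spath_disjoint0[OF p(3,4) i(15)] by simp_all
    have "f (p01 \<union> p12 \<union> p23 \<union> p03) = (f (p01 \<union> p13 \<union> p23 \<union> p02) \<noteq> f (p02 \<union> p12 \<union> p13 \<union> p03))"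
      using K4_relD[OF _ p i o] assms unfolding rels_def by blast
    then show "?h (p01 \<union> p12 \<union> p23 \<union> p03) = (?h (p01 \<union> p13 \<union> p23 \<union> p02) \<noteq> ?h (p02 \<union> p12 \<union> p13 \<union> p03))"
      using p[THEN spath_finite] by (simp add: par Int_Un_distrib2 d d[THEN Int_sym]) argo
  qed
  moreover have "ring_rel G ?h"
    unfolding ring_rel_def
  proof (intro allI impI)
    fix s1 t1 s2 t2 s3 t3 P1 Q1 P2 Q2 P3 Q3 C12 C23 C31 p1 q1 p2 q2 p3 q3 c12 c23 c31
    assume n: "s1 \<noteq> t1" "s2 \<noteq> t2" "s3 \<noteq> t3"
    and p: "spath G s1 P1 p1 t1" "spath G s1 Q1 q1 t1" "spath G s2 P2 p2 t2" "spath G s2 Q2 q2 t2"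
     "spath G s3 P3 p3 t3" "spath G s3 Q3 q3 t3"
     "spath G t1 C12 c12 s2" "spath G t2 C23 c23 s3" "spath G t3 C31 c31 s1"
    and i: "P1 \<inter> Q1 = {s1, t1}" "P2 \<inter> Q2 = {s2, t2}" "P3 \<inter> Q3 = {s3, t3}"
     "(P1 \<union> Q1) \<inter> (P2 \<union> Q2) = {t1} \<inter> {s2}" "(P2 \<union> Q2) \<inter> (P3 \<union> Q3) = {t2} \<inter> {s3}"
     "(P3 \<union> Q3) \<inter> (P1 \<union> Q1) = {t3} \<inter> {s1}"
     "(P1 \<union> Q1) \<inter> C12 = {t1}" "(P2 \<union> Q2) \<inter> C12 = {s2}" "(P3 \<union> Q3) \<inter> C12 = {}"
     "(P2 \<union> Q2) \<inter> C23 = {t2}" "(P3 \<union> Q3) \<inter> C23 = {s3}" "(P1 \<union> Q1) \<inter> C23 = {}"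
     "(P3 \<union> Q3) \<inter> C31 = {t3}" "(P1 \<union> Q1) \<inter> C31 = {s1}" "(P2 \<union> Q2) \<inter> C31 = {}"
     "C12 \<inter> C23 = {}" "C23 \<inter> C31 = {}" "C31 \<inter> C12 = {}"
    and o: "odd (card p1 + card q1)" "odd (card p2 + card q2)" "odd (card p3 + card q3)"
     "even (card p1 + card p2 + card p3 + card c12 + card c23 + card c31)"
    note u = Un_Int_sub4[OF i(4) Int_lower1] Un_Int_sub4[OF i(5) Int_lower1] Un_Int_sub4[OF i(6) Int_lower1]
    have l: "p1 \<inter> p2 = {}" "p1 \<inter> q2 = {}" "q1 \<inter> p2 = {}" "q1 \<inter> q2 = {}" "p2 \<inter> p3 = {}" "p2 \<inter> q3 = {}" "q2 \<inter> p3 = {}" "q2 \<inter> q3 = {}" "p3 \<inter> p1 = {}" "p3 \<inter> q1 = {}" "q3 \<inter> p1 = {}" "q3 \<inter> q1 = {}"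
      using spath_disjoint[OF p(1,3) u(1)] spath_disjoint[OF p(1,4) u(2)] spath_disjoint[OF p(2,3) u(3)] spath_disjoint[OF p(2,4) u(4)] spath_disjoint[OF p(3,5) u(5)] spath_disjoint[OF p(3,6) u(6)] spath_disjoint[OF p(4,5) u(7)] spath_disjoint[OF p(4,6) u(8)] spath_disjoint[OF p(5,1) u(9)] spath_disjoint[OF p(5,2) u(10)] spath_disjoint[OF p(6,1) u(11)] spath_disjoint[OF p(6,2) u(12)] by (simp_all only:)
    note v = Un_Int_sub2[OF i(7) subset_refl] Un_Int_sub2[OF i(8) subset_refl] Un_Int_sub2[OF i(9) empty_subsetI[of "{t1}"]]
      Un_Int_sub2[OF i(12) empty_subsetI[of "{t1}"]] Un_Int_sub2[OF i(10) subset_refl] Un_Int_sub2[OF i(11) subset_refl]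
      Un_Int_sub2[OF i(14) subset_refl] Un_Int_sub2[OF i(15) empty_subsetI[of "{t1}"]] Un_Int_sub2[OF i(13) subset_refl]
    have m: "p1 \<inter> c12 = {}" "q1 \<inter> c12 = {}" "p2 \<inter> c12 = {}" "q2 \<inter> c12 = {}" "p3 \<inter> c12 = {}" "q3 \<inter> c12 = {}" "p1 \<inter> c23 = {}" "q1 \<inter> c23 = {}" "p2 \<inter> c23 = {}" "q2 \<inter> c23 = {}" "p3 \<inter> c23 = {}" "q3 \<inter> c23 = {}" "p1 \<inter> c31 = {}" "q1 \<inter> c31 = {}" "p2 \<inter> c31 = {}" "q2 \<inter> c31 = {}" "p3 \<inter> c31 = {}" "q3 \<inter> c31 = {}"
      using spath_disjoint[OF p(1,7) v(1)] spath_disjoint[OF p(2,7) v(2)] spath_disjoint[OF p(3,7) v(3)] spath_disjoint[OF p(4,7) v(4)] spath_disjoint[OF p(5,7) v(5)] spath_disjoint[OF p(6,7) v(6)] spath_disjoint[OF p(1,8) v(7)] spath_disjoint[OF p(2,8) v(8)] spath_disjoint[OF p(3,8) v(9)] spath_disjoint[OF p(4,8) v(10)] spath_disjoint[OF p(5,8) v(11)] spath_disjoint[OF p(6,8) v(12)] spath_disjoint[OF p(1,9) v(13)] spath_disjoint[OF p(2,9) v(14)] spath_disjoint[OF p(3,9) v(15)] spath_disjoint[OF p(4,9) v(16)] spath_disjoint[OF p(5,9) v(17)] spath_disjoint[OF p(6,9) v(18)] by (simp_all only:)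
    have c: "c12 \<inter> c23 = {}" "c23 \<inter> c31 = {}" "c31 \<inter> c12 = {}"
      using spath_disjoint0[OF p(7,8) i(16)] spath_disjoint0[OF p(8,9) i(17)] spath_disjoint0[OF p(9,7) i(18)] by simp_all
    note d = l m c
    have "(f (p1 \<union> p2 \<union> p3 \<union> (c12 \<union> c23 \<union> c31)) \<noteq> f (p1 \<union> q2 \<union> q3 \<union> (c12 \<union> c23 \<union> c31))) =
     (f (q1 \<union> p2 \<union> q3 \<union> (c12 \<union> c23 \<union> c31)) \<noteq> f (q1 \<union> q2 \<union> p3 \<union> (c12 \<union> c23 \<union> c31)))"
      using ring_relD[OF _ n p i o] assms unfolding rels_def by blast
    then show "(?h (p1 \<union> p2 \<union> p3 \<union> (c12 \<union> c23 \<union> c31)) \<noteq> ?h (p1 \<union> q2 \<union> q3 \<union> (c12 \<union> c23 \<union> c31))) =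
     (?h (q1 \<union> p2 \<union> q3 \<union> (c12 \<union> c23 \<union> c31)) \<noteq> ?h (q1 \<union> q2 \<union> p3 \<union> (c12 \<union> c23 \<union> c31)))"
      using p[THEN spath_finite] by (simp add: par Int_Un_distrib Int_Un_distrib2 d d[THEN Int_sym]) argo
  qed
  ultimately show ?thesis unfolding rels_def par_def by simp
qed

text \<open>After subtraction of a linear function, \<open>f\<close> vanishes on the even circuits
  in \<open>B\<close> and takes a constant value on those through \<open>e\<close>; this value
  decides whether \<open>e\<close> joins \<open>X\<close>. The connectivity condition speaks of
  vertices on circuits only, because \<open>B\<close> will be a biconnected set with a pendant path
  attached.\<close>

lemma linear_on_insert:
  assumes rels: "rels G f" and B: "B \<subseteq> edges G" and lin: "linear_on G f B" and e: "e \<in> edges G" "e \<notin> B" "ends G e = {u, w}" "u \<noteq> w"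
    and conn: "\<And>t x y C D. circ G C \<Longrightarrow> C \<subseteq> B \<Longrightarrow> circ G D \<Longrightarrow> D \<subseteq> B \<Longrightarrow> x \<in> vset G C \<Longrightarrow> y \<in> vset G D \<Longrightarrow>
      t \<noteq> x \<Longrightarrow> t \<noteq> y \<Longrightarrow> (x, y) \<in> reach G B t"
  shows "linear_on G f (insert e B)"
proof -
  obtain X' where X': "circ G C \<Longrightarrow> C \<subseteq> B \<Longrightarrow> even (card C) \<Longrightarrow> f C = odd (card (C \<inter> X'))" for C
    using lin unfolding linear_on_def by blast
  \<comment> \<open>No circuit in \<open>B\<close> contains \<open>e\<close>, so membership of
    \<open>e\<close> can be reset here and decided at the end.\<close>
  define X where "X = X' - {e}"
  have X: "f C = odd (card (C \<inter> X))" if "circ G C" "C \<subseteq> B" "even (card C)" for C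
  proof -
    have "C \<inter> X = C \<inter> X'" using that(2) e(2) by (auto simp: X_def)
    then show ?thesis using X' that by simp
  qed
  define h where "h = (\<lambda>C. f C \<noteq> odd (card (C \<inter> X)))"
  interpret edge_addition G h B e u w
  proof
    show "rels G h" using rels_shift[OF rels] by (simp add: h_def)
  qed (use e X in \<open>auto simp: h_def\<close>)
  have no: "\<not> stuck_pair G h B e u w W1 SW1 s1 A SA A' SA' t1 P SP t2 D SD D' SD' s2 W2 SW2" for W1 SW1 s1 A SA A' SA' t1 P SP t2 D SD D' SD' s2 W2 SW2
  proof (rule no_stuck_pair[OF _ B])
    fix t x y C D assume "circ G C" "C \<subseteq> B" "circ G D" "D \<subseteq> B" "x \<in> \<Union>(ends G ` C)" "y \<in> \<Union>(ends G ` D)" "t \<noteq> x" "t \<noteq> y"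
    then show "(x, y) \<in> reach G B t" using conn[of C D x y t] by (simp add: vset_def)
  qed
  have const: "h (insert e q) = h (insert e q')" if "path u S q w" "odd (card q)" "path u S' q' w" "odd (card q')" for S q S' q'
  proof (rule ccontr)
    assume "h (insert e q) \<noteq> h (insert e q')"
    from stuck_if_not_constant[OF that this] no show False by blast
  qed
  have C: "\<exists>S. path u S (C - {e}) w \<and> odd (card (C - {e})) \<and> insert e (C - {e}) = C"
    if h: "circ G C" "C \<subseteq> insert e B" "even (card C)" "e \<in> C" for C
  proof -
    obtain a b S where s: "ends G e = {a, b}" "spath G a S (C - {e}) b" using circ_edge_path[OF h(1,4)] by blast
    have "(a = u \<and> b = w) \<or> (a = w \<and> b = u)" using s(1) e(2) by (simp add: doubleton_eq_iff) blast
    then have "spath G u S (C - {e}) w" using s(2) spath_rev[OF s(2)] by auto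
    moreover have "odd (card (C - {e}))" using h(3) card_Suc_Diff1[OF circ_finite[OF h(1)] h(4)] by (metis even_Suc)
    ultimately show ?thesis using h(2,4) by blast
  qed
  \<comment> \<open>The common value of \<open>h\<close> on the even circuits through
    \<open>e\<close>, and \<open>False\<close> if there are none.\<close>
  define c where "c \<longleftrightarrow> (\<exists>C. circ G C \<and> C \<subseteq> insert e B \<and> even (card C) \<and> e \<in> C \<and> h C)"
  have hc: "h D = c" if D: "circ G D" "D \<subseteq> insert e B" "even (card D)" "e \<in> D" for D
  proof
    show "h D \<Longrightarrow> c" using D c_def by blast
    assume c
    then obtain C' where C': "circ G C'" "C' \<subseteq> insert e B" "even (card C')" "e \<in> C'" "h C'" unfolding c_def by blast
    show "h D" using C[OF D] C[OF C'(1-4)] const C'(5) by metis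
  qed
  show ?thesis
    unfolding linear_on_def
  proof (intro exI allI impI)
    fix D assume D: "circ G D" "D \<subseteq> insert e B" "even (card D)"
    show "f D = odd (card (D \<inter> (if c then insert e X else X)))"
    proof (cases "e \<in> D")
      case True
      have "f D = (c \<noteq> odd (card (D \<inter> X)))" using hc[OF D True] by (auto simp: h_def)
      moreover have "D \<inter> insert e X = insert e (D \<inter> X)" "e \<notin> D \<inter> X" "finite (D \<inter> X)"
        using True circ_finite[OF D(1)] by (auto simp: X_def)
      ultimately show ?thesis by auto
    next
      case False
      then have "D \<inter> (if c then insert e X else X) = D \<inter> X" by auto
      moreover have "D \<subseteq> B" using D False by auto
      ultimately show ?thesis using X D by simp
    qed
  qed
qed

section \<open>Biconnected edge sets and their ears\<close>

lemma reach_refl: "(x, x) \<in> reach G A t"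
  by (simp add: reach_def)

lemma reach_trans: "(x, y) \<in> reach G A t \<Longrightarrow> (y, z) \<in> reach G A t \<Longrightarrow> (x, z) \<in> reach G A t"
  unfolding reach_def by (rule rtrancl_trans)

lemma reach_sym: "(x, y) \<in> reach G A t \<Longrightarrow> (y, x) \<in> reach G A t"
proof -
  have "sym ({(x, y). \<exists>g\<in>A. ends G g = {x, y} \<and> x \<noteq> t \<and> y \<noteq> t})"
    by (auto simp: sym_def insert_commute)
  then have "sym (reach G A t)" unfolding reach_def by (rule sym_rtrancl)
  then show "(x, y) \<in> reach G A t \<Longrightarrow> (y, x) \<in> reach G A t" by (rule symD)
qed

lemma reach_mono: "A \<subseteq> A' \<Longrightarrow> (x, y) \<in> reach G A t \<Longrightarrow> (x, y) \<in> reach G A' t"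
  unfolding reach_def by (rule subsetD[OF rtrancl_mono]) auto

lemma spath_reach: "spath G x S p y \<Longrightarrow> t \<notin> S \<Longrightarrow> v \<in> S \<Longrightarrow> (x, v) \<in> reach G p t"
proof (induction rule: spath.induct)
  case (nil x)
  then show ?case using reach_refl by simp
next
  case (step e x z S p y)
  show ?case
  proof (cases "v = x")
    case True
    then show ?thesis using reach_refl by simp
  next
    case False
    then have "(z, v) \<in> reach G p t" using step by auto
    then have "(z, v) \<in> reach G (insert e p) t" by (rule reach_mono[OF subset_insertI])
    moreover have "x \<noteq> t" "z \<noteq> t" using step.prems spath_start[OF step.hyps(4)] by auto
    then have "(x, z) \<in> reach G (insert e p) t" using step.hyps(2) unfolding reach_def by (intro r_into_rtrancl) auto
    ultimately show ?thesis using reach_trans by metis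
  qed
qed

lemma biconnected_circ:
  assumes "circ G C"
  shows "biconnected G C"
  unfolding biconnected_def
proof (intro allI ballI)
  fix t x y assume xy: "x \<in> vset G C - {t}" "y \<in> vset G C - {t}"
  \<comment> \<open>A path through all vertices other than \<open>t\<close>: the circuit is cut at
    an edge incident with \<open>t\<close> and the end \<open>t\<close> of the resulting path is
    dropped, or at any edge if \<open>t\<close> is not on the circuit.\<close>
  have "\<exists>a S p b. spath G a S p b \<and> p \<subseteq> C \<and> t \<notin> S \<and> vset G C - {t} \<subseteq> S"
  proof (cases "t \<in> vset G C")
    case True
    then obtain e where e: "e \<in> C" "t \<in> ends G e" unfolding vset_def by blast
    obtain a b S where s: "a \<noteq> b" "ends G e = {a, b}" "spath G a S (C - {e}) b" using circ_edge_path[OF assms e(1)] by blast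
    obtain b' where s': "t \<noteq> b'" "ends G e = {t, b'}" "spath G t S (C - {e}) b'"
      using s e(2) spath_rev[OF s(3)] by (metis insertE insert_commute singletonD)
    have vS: "vset G C \<subseteq> S"
    proof -
      have "vset G C = ends G e \<union> vset G (C - {e})" using e(1) by (auto simp: vset_def)
      then show ?thesis using s'(2) spath_vset[OF s'(3)] spath_ends[OF s'(3)] by auto
    qed
    from s'(3) show ?thesis
    proof (cases rule: spath.cases)
      case nil
      then show ?thesis using s'(1) by simp
    next
      case (step g z S' p)
      then show ?thesis using vS by blast
    qed
  next
    case False
    obtain e where e: "e \<in> C" using circ_nonempty assms by blast
    obtain a b S where s: "a \<noteq> b" "ends G e = {a, b}" "spath G a S (C - {e}) b" using circ_edge_path[OF assms e(1)] by blast
    have "vset G C = ends G e \<union> vset G (C - {e})" using e(1) by (auto simp: vset_def)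
    then have "vset G C = S" using s(2) spath_vset[OF s(3)] spath_ends[OF s(3)] by auto
    then show ?thesis using s(3) False by blast
  qed
  then obtain a S p b where "spath G a S p b" "p \<subseteq> C" "t \<notin> S" "x \<in> S" "y \<in> S" using xy by blast
  then show "(x, y) \<in> reach G C t" using spath_reach reach_sym reach_trans reach_mono by metis
qed

text \<open>From an inner vertex of the ear one can reach \<open>A\<close> along \<open>p1\<close>
  or along \<open>p2\<close>, and the deleted vertex \<open>t\<close> blocks at most one of
  them.\<close>

lemma biconnected_ear:
  assumes A: "biconnected G A" and P: "spath G u S P w" "u \<noteq> w" "S \<inter> vset G A = {u, w}"
  shows "biconnected G (A \<union> P)"
  unfolding biconnected_def
proof (intro allI ballI)
  fix t x y assume xy: "x \<in> vset G (A \<union> P) - {t}" "y \<in> vset G (A \<union> P) - {t}"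
  have "\<exists>z \<in> vset G A - {t}. (x, z) \<in> reach G (A \<union> P) t" if x: "x \<in> vset G (A \<union> P) - {t}" for x
  proof (cases "x \<in> vset G A")
    case True
    then show ?thesis using x reach_refl[of x G "A \<union> P" t] by blast
  next
    case False
    then have "x \<in> S" using x spath_vset[OF P(1)] by (auto simp: vset_Un)
    from spath_split[OF P(1) this] obtain S1 S2 p1 p2 where s: "spath G u S1 p1 x" "spath G x S2 p2 w" "S1 \<inter> S2 = {x}" "p1 \<union> p2 = P"
      by metis
    have "t \<notin> S1 \<or> t \<notin> S2" using s(3) x by auto
    moreover have "u \<in> S1" "w \<in> S2" using s spath_ends by metis+
    moreover have "u \<in> vset G A" "w \<in> vset G A" using P(3) by auto
    moreover have "(x, u) \<in> reach G p1 t" if "t \<notin> S1" using spath_reach[OF spath_rev[OF s(1)] that] calculation by simp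
    moreover have "(x, w) \<in> reach G p2 t" if "t \<notin> S2" using spath_reach[OF s(2) that] calculation by simp
    moreover have "p1 \<subseteq> A \<union> P" "p2 \<subseteq> A \<union> P" using s(4) by auto
    ultimately show ?thesis using reach_mono by (metis DiffI singletonD)
  qed
  then obtain z z' where "z \<in> vset G A - {t}" "(x, z) \<in> reach G (A \<union> P) t" "z' \<in> vset G A - {t}" "(y, z') \<in> reach G (A \<union> P) t"
    using xy by meson
  moreover then have "(z, z') \<in> reach G (A \<union> P) t"
    using A reach_mono[OF Un_upper1] unfolding biconnected_def by metis
  ultimately show "(x, y) \<in> reach G (A \<union> P) t" using reach_trans reach_sym by metis
qed

lemma spath_edge_between_ends:
  assumes "spath G a S p b" "h \<in> p" "ends G h = {a, b}"
  shows "p = {h}"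
proof -
  obtain c d S1 S2 p1 p2 where d: "spath G a S1 p1 c" "spath G d S2 p2 b" "S1 \<inter> S2 = {}"
     "ends G h = {c, d}" "insert h (p1 \<union> p2) = p" using spath_edge_decomp[OF assms(1,2)] by metis
  have "a \<in> S1" "c \<in> S1" "d \<in> S2" "b \<in> S2" using d spath_ends by metis+
  then have "c = a" "d = b" using d(3,4) assms(3) by (auto simp: doubleton_eq_iff)
  then have "p1 = {}" "p2 = {}" using d spath_loop by metis+
  then show ?thesis using d(5) by simp
qed

text \<open>A vertex of \<open>A\<close> strictly inside the path splits it, and the part with
  \<open>g\<close> is shorter. If there is none, the path itself is the ear: an edge of
  \<open>A\<close> on it would join its ends and hence be the whole path, but \<open>g\<close> is
  not in \<open>A\<close>.\<close>

lemma ear_in_path: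
  assumes "spath G a S p b" "a \<in> vset G A" "b \<in> vset G A" "g \<in> p" "g \<notin> A"
  shows "\<exists>u T P w. spath G u T P w \<and> u \<noteq> w \<and> T \<inter> vset G A = {u, w} \<and> P \<inter> A = {} \<and> P \<subseteq> p \<and> P \<noteq> {}"
  using assms
proof (induction "card S" arbitrary: a b S p rule: less_induct)
  case less
  show ?case
  proof (cases "S \<inter> vset G A = {a, b}")
    case True
    have "p \<inter> A = {}"
    proof (rule ccontr)
      assume "p \<inter> A \<noteq> {}"
      then obtain h where h: "h \<in> p" "h \<in> A" by blast
      obtain x y where xy: "x \<noteq> y" "ends G h = {x, y}" using spath_edge_ends[OF less.prems(1) h(1)] by blast
      have "ends G h \<subseteq> S \<inter> vset G A" using spath_ends_subset[OF less.prems(1) h(1)] h(2) by (auto simp: vset_def)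
      then have "ends G h = {a, b}" using xy True by auto
      then have "p = {h}" using spath_edge_between_ends less.prems(1) h(1) by metis
      then show False using less.prems(4,5) h by simp
    qed
    moreover have "a \<noteq> b" using spath_empty_iff[OF less.prems(1)] less.prems(4) by auto
    ultimately show ?thesis using less.prems True by blast
  next
    case False
    then obtain v where v: "v \<in> S" "v \<in> vset G A" "v \<noteq> a" "v \<noteq> b" using spath_ends[OF less.prems(1)] less.prems(2,3) by blast
    from spath_split[OF less.prems(1) v(1)] obtain S1 S2 p1 p2 where s: "spath G a S1 p1 v" "spath G v S2 p2 b" "S1 \<union> S2 = S" "S1 \<inter> S2 = {v}"
      "p1 \<union> p2 = p" by metis
    have "finite S" using spath_finite[OF less.prems(1)] by simp
    moreover have "a \<in> S1" "b \<in> S2" using s spath_ends by metis+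
    then have "S1 \<subset> S" "S2 \<subset> S" using s(3,4) v by auto
    ultimately have c: "card S1 < card S" "card S2 < card S" using psubset_card_mono by metis+
    from less.prems(4) s(5) consider "g \<in> p1" | "g \<in> p2" by blast
    then show ?thesis
    proof cases
      case 1
      from less.hyps[OF c(1) s(1) less.prems(2) v(2) 1 less.prems(5)] s(5) show ?thesis by blast
    next
      case 2
      from less.hyps[OF c(2) s(2) v(2) less.prems(3) 2 less.prems(5)] s(5) show ?thesis by blast
    qed
  qed
qed

text \<open>The free end of the path has degree at most one in any circuit considered, so the first
  edge is in no circuit; the induction strips off the path edge by edge.\<close>

lemma pendant_path_no_circ:
  "spath G z S p w \<Longrightarrow> S \<inter> vset G A = {w} \<Longrightarrow> circ G C \<Longrightarrow> C \<subseteq> A \<union> p \<Longrightarrow> C \<subseteq> A"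
proof (induction rule: spath.induct)
  case (step e z z' S p w)
  have "e \<notin> C"
  proof
    assume "e \<in> C"
    then have "card (incident G C z) = 2" using circ_incident_ge2 step by (metis insertI1)
    moreover have "z \<noteq> w" using step.hyps(3) spath_end[OF step.hyps(4)] by auto
    then have "z \<notin> vset G A" using step.prems(1) by auto
    then have "incident G C z \<subseteq> {e}" using step.prems(3) spath_ends_subset[OF step.hyps(4)] step.hyps(3)
      by (auto simp: incident_def vset_def)
    ultimately show False using card_mono[of "{e}" "incident G C z"] by simp
  qed
  then have "C \<subseteq> A \<union> p" using step.prems(3) by auto
  moreover have "S \<inter> vset G A = {w}" using step.prems(1) spath_end[OF step.hyps(4)] by auto
  ultimately show ?case using step by blast
qed simp

text \<open>Without its first edge the ear is a pendant path, which creates no circuit, so linearity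
  is retained; only the first edge requires a comparison of paths. At that moment all circuits still
  lie in \<open>A\<close>, whose biconnectedness provides the connectivity condition.\<close>

lemma linear_on_ear:
  assumes rels: "rels G f" and A: "A \<subseteq> edges G" "biconnected G A" "linear_on G f A"
    and P: "spath G u S P w" "u \<noteq> w" "S \<inter> vset G A = {u, w}" "P \<inter> A = {}"
  shows "linear_on G f (A \<union> P)"
  using P(1)
proof (cases rule: spath.cases)
  case nil
  then show ?thesis using P(2) by simp
next
  case (step e z S' p)
  have zu: "z \<noteq> u" using step spath_start by metis
  have ep: "e \<notin> p" using spath_step_new step by metis
  have "S' \<inter> vset G A = {w}" using P(3) step spath_end[OF step(6)] P(2) by auto
  then have circ: "C \<subseteq> A" if "circ G C" "C \<subseteq> A \<union> p" for C using pendant_path_no_circ step(6) that by metis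
  have "linear_on G f (insert e (A \<union> p))"
  proof (rule linear_on_insert[OF rels _ _ step(3) _ step(4) zu[symmetric]])
    show "A \<union> p \<subseteq> edges G" using A spath_edges[OF step(6)] by simp
    show "linear_on G f (A \<union> p)" using A(3) circ unfolding linear_on_def by metis
    show "e \<notin> A \<union> p" using ep P(4) step by auto
    fix t x y C D assume h: "circ G C" "C \<subseteq> A \<union> p" "circ G D" "D \<subseteq> A \<union> p" "x \<in> vset G C" "y \<in> vset G D" "t \<noteq> x" "t \<noteq> y"
    have "x \<in> vset G A - {t}" "y \<in> vset G A - {t}" using h(5-8) vset_mono[OF circ[OF h(1,2)], of G] vset_mono[OF circ[OF h(3,4)], of G] by auto
    then have "(x, y) \<in> reach G A t" using A(2) unfolding biconnected_def by blast
    then show "(x, y) \<in> reach G (A \<union> p) t" using reach_mono by (metis Un_upper1)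
  qed
  then show ?thesis using step by simp
qed

text \<open>A maximal set \<open>A\<close> grown from a circuit behaves like a block: a circuit that
  meets both \<open>A\<close> and its complement would contain a further ear. So every circuit lies
  in \<open>A\<close> or in \<open>E - A\<close>, and the sets \<open>X\<close> for these two, the
  second one given by induction, can be combined.\<close>

theorem linear_on_edges:
  assumes "rels G f" "finite E" "E \<subseteq> edges G"
  shows "linear_on G f E"
  using assms(2,3)
proof (induction "card E" arbitrary: E rule: less_induct)
  case less
  show ?case
  proof (cases "\<exists>C. circ G C \<and> C \<subseteq> E")
    case False
    then show ?thesis unfolding linear_on_def by blast
  next
    case True
    then obtain C0 where C0: "circ G C0" "C0 \<subseteq> E" by blast
    define F where "F = {A. C0 \<subseteq> A \<and> A \<subseteq> E \<and> biconnected G A \<and> linear_on G f A}"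
    have "finite F" using less.prems(1) by (auto simp: F_def intro: finite_subset[of _ "Pow E"])
    moreover have "C0 \<in> F"
    proof -
      obtain e where e: "e \<in> C0" using circ_nonempty[OF C0(1)] by blast
      \<comment> \<open>\<open>C0\<close> contains no other circuit, so one of its edges suffices to
        adjust the parity.\<close>
      have "linear_on G f C0" unfolding linear_on_def
      proof (intro exI allI impI)
        fix C assume "circ G C" "C \<subseteq> C0" "even (card C)"
        then have "C = C0" using circ_minimal C0 by metis
        moreover have "C0 \<inter> {e} = {e}" using e by auto
        ultimately show "f C = odd (card (C \<inter> (if f C0 then {e} else {})))" by simp
      qed
      then show ?thesis using C0 biconnected_circ by (simp add: F_def)
    qed
    ultimately obtain A where A: "A \<in> F" "\<And>A'. A' \<in> F \<Longrightarrow> A \<subseteq> A' \<Longrightarrow> A' = A"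
      using finite_has_maximal by (metis empty_iff)
    have A': "C0 \<subseteq> A" "A \<subseteq> E" "biconnected G A" "linear_on G f A" using A(1) by (auto simp: F_def)
    have dich: "C \<subseteq> A \<or> C \<subseteq> E - A" if C: "circ G C" "C \<subseteq> E" for C
    proof (rule ccontr)
      assume no: "\<not> ?thesis"
      then obtain e g where e: "e \<in> C" "e \<in> A" "g \<in> C" "g \<notin> A" using C(2) by blast
      obtain a b S where s: "ends G e = {a, b}" "spath G a S (C - {e}) b" using circ_edge_path[OF C(1) e(1)] by blast
      have "a \<in> vset G A" "b \<in> vset G A" "g \<in> C - {e}" using s(1) e by (auto simp: vset_def)
      from ear_in_path[OF s(2) this e(4)] obtain u T P w where
        P: "spath G u T P w" "u \<noteq> w" "T \<inter> vset G A = {u, w}" "P \<inter> A = {}" "P \<subseteq> C - {e}" "P \<noteq> {}" by blast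
      have "A \<union> P \<in> F"
        using A' P(5) C(2) biconnected_ear[OF A'(3) P(1-3)] linear_on_ear[OF assms(1) _ A'(3,4) P(1-4)] less.prems(2) by (auto simp: F_def)
      then show False using A(2) P(4,6) by blast
    qed
    have "A \<noteq> {}" using A' circ_nonempty[OF C0(1)] by auto
    then have "card (E - A) < card E" using A'(2) less.prems(1) by (intro psubset_card_mono) auto
    then have "linear_on G f (E - A)" using less by auto
    then obtain X2 where X2: "circ G C \<Longrightarrow> C \<subseteq> E - A \<Longrightarrow> even (card C) \<Longrightarrow> f C = odd (card (C \<inter> X2))" for C unfolding linear_on_def by blast
    obtain X1 where X1: "circ G C \<Longrightarrow> C \<subseteq> A \<Longrightarrow> even (card C) \<Longrightarrow> f C = odd (card (C \<inter> X1))" for C using A'(4) unfolding linear_on_def by blast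
    show ?thesis unfolding linear_on_def
    proof (intro exI allI impI)
      fix C assume C: "circ G C" "C \<subseteq> E" "even (card C)"
      have "C \<subseteq> A \<Longrightarrow> C \<inter> ((A \<inter> X1) \<union> (X2 - A)) = C \<inter> X1" "C \<subseteq> E - A \<Longrightarrow> C \<inter> ((A \<inter> X1) \<union> (X2 - A)) = C \<inter> X2" by auto
      then show "f C = odd (card (C \<inter> ((A \<inter> X1) \<union> (X2 - A))))" using dich[OF C(1,2)] X1 X2 C by metis
    qed
  qed
qed

section \<open>Clockwise parity via 2-colourings\<close>

text \<open>A 2-colouring of the vertices that is proper on \<open>C\<close> turns the count of
  agreeing edges, which depends on a traversal, into a count over the edge set.\<close>

definition proper :: "('v, 'e) mgraph \<Rightarrow> ('v \<Rightarrow> bool) \<Rightarrow> 'e set \<Rightarrow> bool" where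
  "proper G c C \<longleftrightarrow> (\<forall>e\<in>C. \<exists>x y. ends G e = {x, y} \<and> c x \<noteq> c y)"

lemma even_card_less_eq:
  "even (card {i. i < n \<and> P i = Q i}) = even (n + card {i. i < n \<and> P i} + card {i. i < n \<and> Q i})"
proof (induction n)
  case (Suc n)
  have *: "card {i. i < Suc n \<and> R i} = card {i. i < n \<and> R i} + of_bool (R n)" for R
  proof -
    have "{i. i < Suc n \<and> R i} = (if R n then insert n {i. i < n \<and> R i} else {i. i < n \<and> R i})"
      by (auto simp: less_Suc_eq)
    then show ?thesis by simp
  qed
  show ?case unfolding * using Suc by auto
qed simp

lemma even_card_neq:
  assumes "finite A"
  shows "even (card {x \<in> A. P x \<noteq> Q x}) = (even (card {x \<in> A. P x}) = even (card {x \<in> A. Q x}))"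
  using assms
proof (induction A)
  case (insert a A)
  have *: "card {x \<in> insert a A. R x} = card {x \<in> A. R x} + of_bool (R a)" for R
  proof -
    have "{x \<in> insert a A. R x} = (if R a then insert a {x \<in> A. R x} else {x \<in> A. R x})" by auto
    then show ?thesis using insert by simp
  qed
  show ?case unfolding * using insert by auto
qed simp

lemma card_alternating:
  assumes "\<And>i. i < n \<Longrightarrow> P i = (b \<noteq> odd i)" "even n"
  shows "card {i. i < n \<and> P i} = n div 2"
proof -
  have *: "card {i. i < 2 * m \<and> (b \<noteq> odd i)} = m" for m
  proof (induction m)
    case (Suc m)
    have "{i. i < 2 * Suc m \<and> (b \<noteq> odd i)} = insert (if b then 2 * m else Suc (2 * m)) {i. i < 2 * m \<and> (b \<noteq> odd i)}"
      by (auto simp: less_Suc_eq)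
    then show ?case using Suc by simp
  qed simp
  obtain m where m: "n = 2 * m" using assms(2) by blast
  have "{i. i < n \<and> P i} = {i. i < 2 * m \<and> (b \<noteq> odd i)}" using assms(1) m by auto
  then show ?thesis using *[of m] m by simp
qed

lemma oriented_ends:
  assumes "orientation G d" "e \<in> edges G" "ends G e = {x, y}"
  shows "d e = (x, y) \<or> d e = (y, x)"
proof -
  have "{fst (d e), snd (d e)} = {x, y}" using assms by (simp add: orientation_def)
  then show ?thesis by (auto simp: doubleton_eq_iff prod_eq_iff)
qed

lemma tail_eq: "a = (x, y) \<or> a = (y, x) \<Longrightarrow> c x \<noteq> c y \<Longrightarrow> a = (x, y) \<longleftrightarrow> c (fst a) = c x"
  and tail_neq: "a = (x, y) \<or> a = (y, x) \<Longrightarrow> a' = (x, y) \<or> a' = (y, x) \<Longrightarrow> c x \<noteq> c y \<Longrightarrow> a \<noteq> a' \<longleftrightarrow> c (fst a) \<noteq> c (fst a')"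
  by auto

text \<open>An edge agrees with the traversal if and only if its tail has the colour of the vertex
  at which the traversal enters the edge. These vertices alternate in colour, which accounts for
  half the length; what remains is the number of edges whose tail has colour
  \<open>True\<close>.\<close>

lemma agreeing_parity:
  assumes t: "circuit_traversal G vs es" and d: "orientation G d" and c: "proper G c (set es)" and ev: "even (length es)"
  shows "even (card (agreeing d vs es)) = even (card {e \<in> set es. c (fst (d e))} + length es div 2)"
proof -
  let ?n = "length es"
  have E: "es ! i \<in> edges G" "ends G (es ! i) = {vs ! i, vs ! ((i + 1) mod ?n)}" if "i < ?n" for i
    using t that by (auto simp: circuit_traversal_def)
  have ne: "c (vs ! i) \<noteq> c (vs ! ((i + 1) mod ?n))" if i: "i < ?n" for i
  proof -
    obtain x y where "ends G (es ! i) = {x, y}" "c x \<noteq> c y" using c i unfolding proper_def by (meson nth_mem)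
    then show ?thesis using E(2)[OF i] by (auto simp: doubleton_eq_iff)
  qed
  have alt: "c (vs ! i) = (c (vs ! 0) \<noteq> odd i)" if "i < ?n" for i
    using that
  proof (induction i)
    case (Suc i)
    then show ?case using ne[of i] by auto
  qed simp
  have ag: "d (es ! i) = (vs ! i, vs ! ((i + 1) mod ?n)) \<longleftrightarrow> c (fst (d (es ! i))) = c (vs ! i)" if i: "i < ?n" for i
    by (rule tail_eq[OF oriented_ends[OF d E[OF i]] ne[OF i]])
  have 1: "agreeing d vs es = {i. i < ?n \<and> c (fst (d (es ! i))) = c (vs ! i)}"
    using ag by (auto simp: agreeing_def)
  have 2: "card {i. i < ?n \<and> c (vs ! i)} = ?n div 2" using card_alternating[OF alt ev] by simp
  have "bij_betw (\<lambda>i. es ! i) {i. i < ?n \<and> c (fst (d (es ! i)))} {e \<in> set es. c (fst (d e))}"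
    using t by (auto simp: bij_betw_def inj_on_def circuit_traversal_def nth_eq_iff_index_eq in_set_conv_nth image_def)
  then have 3: "card {i. i < ?n \<and> c (fst (d (es ! i)))} = card {e \<in> set es. c (fst (d e))}" by (rule bij_betw_same_card)
  show ?thesis unfolding 1 even_card_less_eq 2 3 using ev by auto
qed

lemma clockwise_parity_proper:
  assumes d: "orientation G d" and C: "C \<in> even_circuits G" and c: "proper G c C"
  shows "clockwise_parity G d C = Clockwise_even \<longleftrightarrow> even (card {e \<in> C. c (fst (d e))} + card C div 2)"
proof -
  obtain vs es where t: "circuit_traversal G vs es" "set es = C" using C unfolding even_circuits_def circuit_def by blast
  have "even (card (agreeing d vs' es')) = even (card {e \<in> C. c (fst (d e))} + card C div 2)"
    if "circuit_traversal G vs' es'" "set es' = C" for vs' es'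
  proof -
    have "length es' = card C" using that by (metis circuit_traversal_def distinct_card)
    then show ?thesis using agreeing_parity[OF that(1) d] that(2) c C by (simp add: even_circuits_def)
  qed
  then show ?thesis unfolding clockwise_parity_def using t by auto
qed

lemma even_circuit_proper:
  assumes "C \<in> even_circuits G"
  obtains c where "proper G c C"
proof -
  obtain vs es where t: "circuit_traversal G vs es" "set es = C" using assms unfolding even_circuits_def circuit_def by blast
  let ?n = "length es"
  have len: "?n = card C" using t by (metis circuit_traversal_def distinct_card)
  have ev: "even ?n" using len assms by (simp add: even_circuits_def)
  \<comment> \<open>The colours alternate along the traversal, and they fit at the wrap-around
    because the length is even.\<close>
  let ?c = "\<lambda>v. \<exists>i<?n. even i \<and> vs ! i = v"
  have v: "?c (vs ! i) = even i" if "i < ?n" for i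
    using t(1) that by (auto simp: circuit_traversal_def nth_eq_iff_index_eq)
  have "proper G ?c C" unfolding proper_def
  proof
    fix e assume "e \<in> C"
    then obtain i where i: "i < ?n" "e = es ! i" using t(2) by (metis in_set_conv_nth)
    have "ends G e = {vs ! i, vs ! ((i + 1) mod ?n)}" using t(1) i by (simp add: circuit_traversal_def)
    moreover have "?n > 0" using i(1) by linarith
    then have "(i + 1) mod ?n < ?n" by simp
    then have "?c (vs ! ((i + 1) mod ?n)) = even ((i + 1) mod ?n)" by (rule v)
    moreover have "even ((i + 1) mod ?n) = odd i" using ev by (simp add: dvd_mod_iff)
    ultimately show "\<exists>x y. ends G e = {x, y} \<and> ?c x \<noteq> ?c y" using v[OF i(1)] by blast
  qed
  then show ?thesis using that by blast
qed

text \<open>With one 2-colouring for both orientations, the edges on which they differ are exactly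
  those whose tails change colour.\<close>

lemma clockwise_parity_flip:
  assumes d: "orientation G d" "orientation G d'" and C: "C \<in> even_circuits G"
  shows "(clockwise_parity G d C = Clockwise_even) = ((clockwise_parity G d' C = Clockwise_even) = even (card {e \<in> C. d e \<noteq> d' e}))"
proof -
  obtain c where c: "proper G c C" using even_circuit_proper C by blast
  have fin: "finite C" "C \<subseteq> edges G" using C circ_finite[of G C] circ_edges[of G C] by (simp_all add: even_circuits_circ)
  have "d e \<noteq> d' e \<longleftrightarrow> c (fst (d e)) \<noteq> c (fst (d' e))" if e: "e \<in> C" for e
  proof -
    obtain x y where xy: "ends G e = {x, y}" "c x \<noteq> c y" using c e unfolding proper_def by blast
    have "e \<in> edges G" using e fin by blast
    then show ?thesis using tail_neq[OF oriented_ends[OF d(1) _ xy(1)] oriented_ends[OF d(2) _ xy(1)] xy(2)] by blast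
  qed
  then have "{e \<in> C. d e \<noteq> d' e} = {e \<in> C. c (fst (d e)) \<noteq> c (fst (d' e))}" by blast
  then have "even (card {e \<in> C. d e \<noteq> d' e}) = (even (card {e \<in> C. c (fst (d e))}) = even (card {e \<in> C. c (fst (d' e))}))"
    using even_card_neq[OF fin(1), of "\<lambda>e. c (fst (d e))" "\<lambda>e. c (fst (d' e))"] by simp
  then show ?thesis unfolding clockwise_parity_proper[OF d(1) C c] clockwise_parity_proper[OF d(2) C c] by auto
qed

lemma even_circuits_finite: "finite (edges G) \<Longrightarrow> finite (even_circuits G)"
  by (rule finite_subset[of _ "Pow (edges G)"]) (auto simp: even_circuits_circ dest: circ_edges)

text \<open>Double counting of the pairs of a set \<open>h C\<close> and an element of it that
  satisfies \<open>P\<close>: every element occurs an even number of times.\<close>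

lemma even_sum_flip:
  assumes "finite \<C>" "\<And>C. C \<in> \<C> \<Longrightarrow> finite (h C)" "finite (\<Union>C\<in>\<C>. h C)" "\<And>e. even (card {C \<in> \<C>. e \<in> h C})"
  shows "even (card {C \<in> \<C>. odd (card {e \<in> h C. P e})})"
proof -
  have "even (\<Sum>C\<in>\<C>. card {e \<in> h C. P e}) = even (card {C \<in> \<C>. odd (card {e \<in> h C. P e})})"
    using assms(1) by (simp add: even_sum_iff)
  moreover have "(\<Sum>C\<in>\<C>. card {e \<in> h C. P e}) = (\<Sum>C\<in>\<C>. \<Sum>e\<in>(\<Union>C\<in>\<C>. h C). of_bool (e \<in> h C \<and> P e))"
  proof (rule sum.cong[OF refl])
    fix C assume C: "C \<in> \<C>"
    have "(\<Sum>e\<in>(\<Union>C\<in>\<C>. h C). of_bool (e \<in> h C \<and> P e)) = card ((\<Union>C\<in>\<C>. h C) \<inter> {e. e \<in> h C \<and> P e})"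
      using assms(3) by (simp add: sum_of_bool_eq)
    moreover have "(\<Union>C\<in>\<C>. h C) \<inter> {e. e \<in> h C \<and> P e} = {e \<in> h C. P e}" using C by blast
    ultimately show "card {e \<in> h C. P e} = (\<Sum>e\<in>(\<Union>C\<in>\<C>. h C). of_bool (e \<in> h C \<and> P e))" by simp
  qed
  moreover have "\<dots> = (\<Sum>e\<in>(\<Union>C\<in>\<C>. h C). \<Sum>C\<in>\<C>. of_bool (e \<in> h C \<and> P e))" by (rule sum.swap)
  moreover have "even (\<Sum>e\<in>(\<Union>C\<in>\<C>. h C). \<Sum>C\<in>\<C>. of_bool (e \<in> h C \<and> P e) :: nat)"
  proof (rule dvd_sum)
    fix e
    have "(\<Sum>C\<in>\<C>. of_bool (e \<in> h C \<and> P e) :: nat) = card (\<C> \<inter> {C. e \<in> h C \<and> P e})"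
      using assms(1) by simp
    moreover have "\<C> \<inter> {C. e \<in> h C \<and> P e} = (if P e then {C \<in> \<C>. e \<in> h C} else {})" by auto
    ultimately show "even (\<Sum>C\<in>\<C>. of_bool (e \<in> h C \<and> P e) :: nat)" using assms(4) by simp
  qed
  ultimately show ?thesis by metis
qed

section \<open>Even vertex splittings\<close>

locale splitting = K: multigraph K for K :: "('v, 'e) mgraph" +
  fixes L :: "('v, 'e) mgraph" and v e f
  assumes v: "degree K v = 2" and ef: "e \<in> edges K" "f \<in> edges K" "e \<noteq> f" "v \<in> ends K e" "v \<in> ends K f"
    and L: "L = contract_onto v {e, f} K"
begin

text \<open>The edges \<open>e\<close> and \<open>f\<close> already account for the degree 2, so
  \<open>v\<close> has no further edge and no loop.\<close>

lemma at_v: "{g \<in> edges K. v \<in> ends K g} = {e, f}" "g \<in> edges K \<Longrightarrow> ends K g \<noteq> {v}"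
proof -
  let ?A = "{g \<in> edges K. v \<in> ends K g}" and ?B = "{g \<in> edges K. ends K g = {v}}"
  have fin: "finite ?A" "finite ?B" using K.finite_edges by auto
  have sub: "{e, f} \<subseteq> ?A" using ef by auto
  have "card {e, f} = 2" using ef by simp
  then have "2 \<le> card ?A" using card_mono[OF fin(1) sub] by simp
  then have c: "card ?A = 2" "card ?B = 0" using v unfolding degree_def by auto
  then show "?A = {e, f}" using card_subset_eq[OF fin(1) sub] \<open>card {e, f} = 2\<close> by auto
  show "g \<in> edges K \<Longrightarrow> ends K g \<noteq> {v}" using c(2) fin(2) by auto
qed

lemma other_end:
  assumes "g \<in> edges K" "v \<in> ends K g"
  shows "\<exists>x. x \<noteq> v \<and> ends K g = {v, x}"
proof -
  have "card (ends K g) \<in> {1, 2}" using K.card_ends assms by simp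
  then consider a where "ends K g = {a}" | a b where "ends K g = {a, b}" "a \<noteq> b"
    by (auto simp: card_1_singleton_iff card_2_iff)
  then show ?thesis using assms at_v(2)[OF assms(1)] by cases auto
qed

lemma at_v': "g \<in> edges K \<Longrightarrow> v \<in> ends K g \<Longrightarrow> g = e \<or> g = f"
proof -
  assume "g \<in> edges K" "v \<in> ends K g"
  then have "g \<in> {g \<in> edges K. v \<in> ends K g}" by simp
  then show ?thesis by (simp only: at_v(1)) simp
qed

text \<open>\<open>u\<close> and \<open>w\<close> are the far ends of \<open>e\<close> and
  \<open>f\<close>. They may coincide; then \<open>e\<close> and \<open>f\<close> form a
  digon.\<close>

definition u where "u = (SOME x. x \<noteq> v \<and> ends K e = {v, x})"
definition w where "w = (SOME x. x \<noteq> v \<and> ends K f = {v, x})"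

lemma ends_e: "u \<noteq> v" "ends K e = {v, u}" and ends_f: "w \<noteq> v" "ends K f = {v, w}"
  using someI_ex[OF other_end[OF ef(1,4)]] someI_ex[OF other_end[OF ef(2,5)]] by (auto simp: u_def w_def)

definition r where "r x = (if x \<in> {u, v, w} then v else x)"

lemma L_simps: "verts L = r ` verts K" "edges L = edges K - {e, f}" "ends L g = r ` ends K g"
proof -
  have "(\<Union>g\<in>{e, f}. ends K g) = {u, v, w}" using ends_e ends_f by auto
  then have *: "(\<lambda>x. if x \<in> (\<Union>g\<in>{e, f}. ends K g) then v else x) = r" by (auto simp: r_def fun_eq_iff)
  show "verts L = r ` verts K" "edges L = edges K - {e, f}" "ends L g = r ` ends K g"
    by (simp_all only: L contract_onto_def Let_def * mgraph.select_convs)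
qed

lemma multigraph_L: "multigraph L"
proof
  show "finite (verts L)" "finite (edges L)" using K.finite_verts K.finite_edges by (simp_all add: L_simps)
  fix g assume g: "g \<in> edges L"
  then have gK: "g \<in> edges K" by (simp add: L_simps)
  show "ends L g \<subseteq> verts L" using K.ends_subset[OF gK] by (auto simp: L_simps)
  have c: "card (ends K g) \<in> {1, 2}" using K.card_ends[OF gK] .
  then have "finite (ends K g)" "ends K g \<noteq> {}" by (auto intro: card_ge_0_finite)
  then have "card (ends L g) \<le> card (ends K g)" "card (ends L g) \<noteq> 0"
    by (simp_all add: L_simps card_image_le)
  then show "card (ends L g) \<in> {1, 2}" using c by auto
qed

lemma r_range: "r x = v \<or> r x \<notin> {u, v, w}"
  by (auto simp: r_def)

lemma r_eq: "r x \<noteq> v \<Longrightarrow> r x = x"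
  by (auto simp: r_def)

lemma lift_edge:
  assumes "g \<in> edges L" "ends L g = {x, y}" "x \<noteq> v" "y \<noteq> v"
  shows "ends K g = {x, y}"
proof -
  have "r z = z" if "z \<in> ends K g" for z
  proof (rule r_eq)
    have "r z \<in> {x, y}" using that assms(2) L_simps(3)[of g] by blast
    then show "r z \<noteq> v" using assms(3,4) by auto
  qed
  then have "r ` ends K g = ends K g" by simp
  then show ?thesis using assms(2) L_simps(3) by simp
qed

lemma lift_edge_v:
  assumes "g \<in> edges L" "ends L g = {v, x}" "x \<noteq> v"
  shows "\<exists>z\<in>{u, w}. ends K g = {z, x}"
proof -
  have g: "g \<in> edges K" "g \<notin> {e, f}" using assms(1) by (auto simp: L_simps)
  then have vg: "v \<notin> ends K g" using at_v'[of g] by blast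
  have im: "r ` ends K g = {v, x}" using assms(2) L_simps(3) by simp
  then have "v \<in> r ` ends K g" "x \<in> r ` ends K g" by simp_all
  then obtain a b where a: "a \<in> ends K g" "v = r a" and b: "b \<in> ends K g" "x = r b" by blast
  have bx: "b = x" using b r_eq[of b] assms(3) by simp
  have "a \<noteq> b" using a b assms(3) by auto
  moreover have "card (ends K g) \<le> 2" using K.card_ends[OF g(1)] by auto
  moreover have "finite (ends K g)" using K.card_ends[OF g(1)] by (auto intro: card_ge_0_finite)
  ultimately have "ends K g = {a, b}" using a(1) b(1) card_seteq[of "ends K g" "{a, b}"] by auto
  moreover have "a \<in> {u, w}" using a vg by (auto simp: r_def split: if_splits)
  ultimately show ?thesis using bx by blast
qed

lemma lift_path: "spath L x S m y \<Longrightarrow> v \<notin> S \<Longrightarrow> spath K x S m y"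
proof (induction rule: spath.induct)
  case (step g x z S p y)
  have "z \<in> S" using spath_start step by metis
  then have "ends K g = {x, z}" using lift_edge step by auto
  then show ?case using step spath.step[of g K x z S p y] by (simp add: L_simps)
qed (rule spath.nil)

lemma spath_L_range: "spath L x S m y \<Longrightarrow> m \<noteq> {} \<Longrightarrow> z \<in> S \<Longrightarrow> z = v \<or> z \<notin> {u, v, w}"
proof -
  assume a: "spath L x S m y" "m \<noteq> {}" "z \<in> S"
  have "x \<noteq> y" using a spath_empty_iff by metis
  then have "card (incident L m z) \<noteq> 0" using card_incident_spath[OF a(1), of z] a(3) by simp
  then have "incident L m z \<noteq> {}" by auto
  then obtain g where "z \<in> ends L g" by (auto simp: incident_def)
  then show ?thesis using r_range by (auto simp: L_simps)
qed

text \<open>A circuit that avoids the contracted vertex lifts to itself. Otherwise its two edges at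
  that vertex end in \<open>u\<close> or \<open>w\<close> before the contraction: if they end in the
  same vertex, \<open>D\<close> is a circuit already, and if not, the gap between \<open>u\<close>
  and \<open>w\<close> is bridged by \<open>e\<close> and \<open>f\<close>.\<close>

lemma lift_circuit:
  assumes "D \<in> even_circuits L"
  shows "\<exists>C. C \<in> even_circuits K \<and> C \<inter> edges L = D \<and> (C = D \<or> C = D \<union> {e, f})"
proof -
  have D: "circ L D" "even (card D)" using assms by (auto simp: even_circuits_circ)
  have Dsub: "D \<subseteq> edges L" "D \<subseteq> edges K" "e \<notin> D" "f \<notin> D" "finite D"
    using circ_edges[OF D(1)] circ_finite[OF D(1)] by (auto simp: L_simps)
  have "circ K D \<or> circ K (D \<union> {e, f})"
  proof (cases "v \<in> vset L D")
    case False
    obtain g where g: "g \<in> D" using circ_nonempty[OF D(1)] by blast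
    obtain a b S where s: "a \<noteq> b" "ends L g = {a, b}" "spath L a S (D - {g}) b" using circ_edge_path[OF D(1) g] by blast
    have ab: "a \<noteq> v" "b \<noteq> v" using False g s(2) by (auto simp: vset_def)
    have "S = insert a (vset L (D - {g}))" using spath_vset[OF s(3)] .
    then have "v \<notin> S" using False ab vset_mono[of "D - {g}" D L] by auto
    then have "spath K a S (D - {g}) b" using lift_path s(3) by simp
    moreover have "ends K g = {a, b}" using lift_edge[OF _ s(2) ab] g Dsub by auto
    ultimately have "circ K (insert g (D - {g}))" using circ_from_edge[of K a S "D - {g}" b g] s(1) g Dsub by auto
    then show ?thesis using g by (simp add: insert_absorb)
  next
    case True
    then obtain g where g: "g \<in> D" "v \<in> ends L g" by (auto simp: vset_def)
    obtain a b S where s: "a \<noteq> b" "ends L g = {a, b}" "spath L a S (D - {g}) b" using circ_edge_path[OF D(1) g(1)] by blast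
    obtain b' where s': "b' \<noteq> v" "ends L g = {v, b'}" "spath L v S (D - {g}) b'"
    proof (cases "a = v")
      case True
      then show ?thesis using that[of b] s by auto
    next
      case False
      then have "b = v" using s(2) g(2) by auto
      then show ?thesis using that[of a] s spath_rev[OF s(3)] by (auto simp: insert_commute)
    qed
    obtain h z S' m where st: "S = insert v S'" "D - {g} = insert h m" "h \<in> edges L" "ends L h = {v, z}" "v \<notin> S'" "spath L z S' m b'"
      using s'(1) by (cases rule: spath.cases[OF s'(3)]) auto
    have hm: "h \<notin> m" using spath_step_new[OF st(4,5,6)] .
    have Dm: "D = insert g (insert h m)" "g \<noteq> h" "g \<notin> m" using st(2) g(1) by auto
    have z: "z \<in> S'" "b' \<in> S'" using spath_ends[OF st(6)] by auto
    then have zv: "z \<noteq> v" using st(5) by auto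
    have mK: "spath K z S' m b'" using lift_path[OF st(6,5)] .
    obtain o1 where o1: "o1 \<in> {u, w}" "ends K g = {o1, b'}" using lift_edge_v[OF _ s'(2,1)] g(1) Dsub by auto
    obtain o2 where o2: "o2 \<in> {u, w}" "ends K h = {o2, z}" using lift_edge_v[OF st(3,4) zv] by auto
    \<comment> \<open>Edges of \<open>L\<close> end in \<open>v\<close> or outside
      \<open>{u, v, w}\<close>, so a path of \<open>L\<close> that avoids \<open>v\<close> avoids
      all three merged vertices.\<close>
    have uwS: "u \<notin> S'" "w \<notin> S'"
    proof -
      have "x \<notin> {u, v, w}" if x: "x \<in> S'" for x
      proof (cases "m = {}")
        case True
        then have "x = z" using st(6) x by (simp add: spath_trivial)
        moreover have "z \<in> ends L h" using st(4) by simp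
        ultimately show ?thesis using r_range zv by (auto simp: L_simps)
      next
        case False
        then show ?thesis using spath_L_range[OF st(6) False x] st(5) x by auto
      qed
      then show "u \<notin> S'" "w \<notin> S'" by auto
    qed
    have o1S: "o1 \<notin> S'" "o2 \<notin> S'" using o1 o2 uwS by auto
    have gh: "g \<in> edges K" "h \<in> edges K" using Dm Dsub by auto
    have p: "spath K o2 (insert o2 S') (insert h m) b'" using spath.step[OF gh(2) o2(2) o1S(2) mK] .
    show ?thesis
    proof (cases "o1 = o2")
      case True
      have "circ K (insert g (insert h m))"
        by (rule circ_from_edge[OF p _ gh(1)]) (use True o1 o1S z Dm in auto)
      then show ?thesis using Dm by simp
    next
      case False
      have ob: "b' \<noteq> o1" using z o1S by auto
      have q: "spath K b' {b', o1} {g} o1" using spath_single[OF gh(1) _ ob] o1(2) by (simp add: insert_commute)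
      have "insert o2 S' \<inter> {b', o1} = {b'}" using z o1S False by auto
      from spath_append[OF p q this] have pq: "spath K o2 (insert o2 S' \<union> {b', o1}) (insert h m \<union> {g}) o1" .
      have uw: "u \<noteq> w" using False o1 o2 by auto
      have vS: "v \<notin> insert o2 S' \<union> {b', o1}" using st(5) s'(1) o1 o2 ends_e ends_f by auto
      have "spath K u {u, v} {e} v" "spath K v {v, w} {f} w"
        using spath_single[OF ef(1), of u v] spath_single[OF ef(2), of v w] ends_e ends_f by (auto simp: insert_commute)
      moreover have "{u, v} \<inter> {v, w} = {v}" using uw ends_e ends_f by auto
      ultimately have "spath K u ({u, v} \<union> {v, w}) ({e} \<union> {f}) w" using spath_append by metis
      moreover have "(o2 = u \<and> o1 = w) \<or> (o2 = w \<and> o1 = u)" using False o1 o2 by auto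
      ultimately have t: "spath K o2 ({u, v} \<union> {v, w}) ({e} \<union> {f}) o1" using spath_rev[of K u _ _ w] by blast
      have "circ K ((insert h m \<union> {g}) \<union> ({e} \<union> {f}))"
      proof (rule circI[OF False[symmetric] pq t])
        have "{u, w} = {o1, o2}" using False o1 o2 by auto
        then have "{u, v} \<union> {v, w} = insert v {o1, o2}" by auto
        then show "(insert o2 S' \<union> {b', o1}) \<inter> ({u, v} \<union> {v, w}) = {o2, o1}" using vS by auto
        show "(insert h m \<union> {g}) \<inter> ({e} \<union> {f}) = {}" using Dm Dsub by auto
      qed
      moreover have "(insert h m \<union> {g}) \<union> ({e} \<union> {f}) = D \<union> {e, f}" using Dm by auto
      ultimately show ?thesis by simp
    qed
  qed
  moreover have "even (card (D \<union> {e, f}))" using D(2) Dsub ef by (simp add: card_Un_disjoint)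
  moreover have "D \<inter> edges L = D" "(D \<union> {e, f}) \<inter> edges L = D" using Dsub by (auto simp: L_simps)
  ultimately show ?thesis using D(2) by (auto simp: even_circuits_circ)
qed

lemma circ_e_f:
  assumes "circ K C"
  shows "e \<in> C \<longleftrightarrow> f \<in> C"
proof -
  have "incident K C v = C \<inter> {g \<in> edges K. v \<in> ends K g}" using circ_edges[OF assms] by (auto simp: incident_def)
  then have "incident K C v = C \<inter> {e, f}" using at_v(1) by simp
  then show ?thesis using circ_incident[OF assms, of v] ef(3) by (cases "e \<in> C"; cases "f \<in> C") auto
qed

text \<open>As \<open>v\<close> has degree 2, a circuit contains both or none of \<open>e\<close>
  and \<open>f\<close>. So the candidates for a lift are \<open>D\<close> and
  \<open>D \<union> {e, f}\<close>; they are nested, and no circuit properly contains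
  another.\<close>

lemma corresponding:
  assumes "D \<in> even_circuits L"
  shows "corresponding_circuit K L D \<in> even_circuits K" "corresponding_circuit K L D \<inter> edges L = D"
    "corresponding_circuit K L D = D \<or> corresponding_circuit K L D = D \<union> {e, f}"
    and "\<And>C. C \<in> even_circuits K \<Longrightarrow> C \<inter> edges L = D \<Longrightarrow> corresponding_circuit K L D = C"
proof -
  obtain C where C: "C \<in> even_circuits K" "C \<inter> edges L = D" "C = D \<or> C = D \<union> {e, f}" using lift_circuit[OF assms] by blast
  have ex: "X = D \<or> X = D \<union> {e, f}" if "X \<in> even_circuits K" "X \<inter> edges L = D" for X
  proof -
    have "circ K X" using that by (simp add: even_circuits_circ)
    then have "X \<subseteq> edges K" "e \<in> X \<longleftrightarrow> f \<in> X" using circ_edges circ_e_f by auto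
    then show ?thesis using that(2) by (auto simp: L_simps)
  qed
  have uniq: "X = C" if X: "X \<in> even_circuits K" "X \<inter> edges L = D" for X
  proof -
    have "X \<subseteq> C \<or> C \<subseteq> X" using ex[OF X] C(3) by auto
    then show ?thesis using circ_minimal X(1) C(1) by (auto simp: even_circuits_circ)
  qed
  have cc: "corresponding_circuit K L D = C"
    unfolding corresponding_circuit_def
  proof (rule the_equality)
    show "C \<in> even_circuits K \<and> C \<inter> edges L = D" using C by simp
    show "X = C" if "X \<in> even_circuits K \<and> X \<inter> edges L = D" for X using uniq that by simp
  qed
  show "corresponding_circuit K L D \<in> even_circuits K" "corresponding_circuit K L D \<inter> edges L = D"
    "corresponding_circuit K L D = D \<or> corresponding_circuit K L D = D \<union> {e, f}"
    unfolding cc using C by simp_all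
  show "corresponding_circuit K L D = X" if "X \<in> even_circuits K" "X \<inter> edges L = D" for X
    unfolding cc using uniq[OF that] by simp
qed

lemma orientation_L:
  assumes "orientation K d"
  shows "orientation L (\<lambda>g. (r (fst (d g)), r (snd (d g))))"
proof -
  have "{r (fst (d g)), r (snd (d g))} = ends L g" if "g \<in> edges L" for g
  proof -
    have "{fst (d g), snd (d g)} = ends K g" using assms that by (auto simp: orientation_def L_simps)
    then show ?thesis by (metis L_simps(3) image_empty image_insert)
  qed
  then show ?thesis by (simp add: orientation_def)
qed

text \<open>Passing through \<open>e\<close> and \<open>f\<close> adds 1 to half the length, and the
  number of new tails of colour \<open>True\<close> is even exactly if \<open>e\<close> and
  \<open>f\<close> both leave \<open>v\<close> or both enter it. So the parity changes precisely
  when the lift contains \<open>e\<close> and the two edges do not form a directed path through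
  \<open>v\<close>.\<close>

lemma parity_splitting:
  assumes d: "orientation K d" and D: "D \<in> even_circuits L"
  shows "(clockwise_parity K d (corresponding_circuit K L D) = Clockwise_even) =
    ((clockwise_parity L (\<lambda>g. (r (fst (d g)), r (snd (d g)))) D = Clockwise_even) \<noteq>
     (e \<in> corresponding_circuit K L D \<and> (fst (d e) = v) = (fst (d f) = v)))"
proof -
  let ?C = "corresponding_circuit K L D"
  let ?d = "\<lambda>g. (r (fst (d g)), r (snd (d g)))"
  note C = corresponding[OF D]
  obtain c where c: "proper L c D" using even_circuit_proper D by blast
  \<comment> \<open>The ends \<open>u\<close> and \<open>w\<close> inherit the colour of the
    contracted vertex through \<open>r\<close>, and the restored vertex \<open>v\<close> receives
    the other colour.\<close>
  define c' where "c' = (\<lambda>x. if x = v then \<not> c v else c (r x))"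
  have Dsub: "D \<subseteq> edges K" "e \<notin> D" "f \<notin> D" "finite D"
    using D circ_edges[of L D] circ_finite[of L D] by (auto simp: even_circuits_circ L_simps)
  have vD: "v \<notin> ends K g" if "g \<in> D" for g using at_v'[of g] that Dsub by blast
  have cuw: "c' u = c v" "c' w = c v" "c' v = (\<not> c v)" using ends_e ends_f by (auto simp: c'_def r_def)
  have "proper K c' ?C" unfolding proper_def
  proof
    fix g assume g: "g \<in> ?C"
    show "\<exists>x y. ends K g = {x, y} \<and> c' x \<noteq> c' y"
    proof (cases "g \<in> D")
      case True
      obtain x y where xy: "ends L g = {x, y}" "c x \<noteq> c y" using c True unfolding proper_def by blast
      have gK: "g \<in> edges K" using True Dsub by auto
      have im: "r ` ends K g = {x, y}" using xy(1) L_simps(3) by simp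
      then have "x \<in> r ` ends K g" "y \<in> r ` ends K g" by simp_all
      then obtain a b where ab: "a \<in> ends K g" "x = r a" "b \<in> ends K g" "y = r b" by blast
      have "a \<noteq> b" using ab xy(2) by auto
      moreover have "card (ends K g) \<le> 2" "finite (ends K g)" using K.card_ends[OF gK] by (auto intro: card_ge_0_finite)
      ultimately have "ends K g = {a, b}" using ab card_seteq[of "ends K g" "{a, b}"] by auto
      moreover have "c' a \<noteq> c' b" using ab vD[OF True] xy(2) by (auto simp: c'_def)
      ultimately show ?thesis by blast
    next
      case False
      then have "g = e \<or> g = f" using g C(3) by auto
      then show ?thesis using ends_e ends_f cuw by auto
    qed
  qed
  note 1 = clockwise_parity_proper[OF d C(1) this] and 2 = clockwise_parity_proper[OF orientation_L[OF d] D c]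
  have tail: "c' (fst (d g)) = c (fst (?d g))" if "g \<in> D" for g
  proof -
    have "fst (d g) \<in> ends K g" using d that Dsub by (auto simp: orientation_def)
    then show ?thesis using vD[OF that] by (auto simp: c'_def)
  qed
  show ?thesis
  proof (cases "?C = D")
    case True
    have "{g \<in> D. c' (fst (d g))} = {g \<in> D. c (fst (?d g))}" using tail by auto
    then show ?thesis using 1 2 True Dsub by simp
  next
    case False
    then have CD: "?C = D \<union> {e, f}" using C(3) by simp
    have "{g \<in> ?C. c' (fst (d g))} = {g \<in> D. c (fst (?d g))} \<union> {g \<in> {e, f}. c' (fst (d g))}" using tail CD by auto
    then have "card {g \<in> ?C. c' (fst (d g))} = card {g \<in> D. c (fst (?d g))} + card {g \<in> {e, f}. c' (fst (d g))}"
      using Dsub by (simp only:) (rule card_Un_disjoint, auto)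
    moreover have "card ?C div 2 = card D div 2 + 1" using CD Dsub ef(3) by (simp add: card_Un_disjoint)
    moreover have "even (card {g \<in> {e, f}. c' (fst (d g))}) = ((fst (d e) = v) \<noteq> (fst (d f) = v) \<longleftrightarrow> False)"
    proof -
      have "fst (d e) \<in> {v, u}" "fst (d f) \<in> {v, w}" using d ef ends_e ends_f by (auto simp: orientation_def)
      then have "c' (fst (d e)) = ((fst (d e) = v) \<noteq> c v)" "c' (fst (d f)) = ((fst (d f) = v) \<noteq> c v)" using cuw ends_e ends_f by auto
      moreover have "{g \<in> {e, f}. c' (fst (d g))} = (if c' (fst (d e)) then {e} else {}) \<union> (if c' (fst (d f)) then {f} else {})" by auto
      ultimately show ?thesis using ef(3) by auto
    qed
    moreover have "e \<in> ?C" using CD by simp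
    ultimately show ?thesis using 1 2 by (simp, argo)
  qed
qed

text \<open>In this case \<open>{e, f}\<close> is a circuit of \<open>K\<close>; a lift that
  contained it would be equal to it, and nothing would be left for \<open>D\<close>.\<close>

lemma u_eq_w:
  assumes "D \<in> even_circuits L" "u = w"
  shows "e \<notin> corresponding_circuit K L D"
proof
  assume e: "e \<in> corresponding_circuit K L D"
  note C = corresponding[OF assms(1)]
  have cC: "circ K (corresponding_circuit K L D)" using C(1) by (simp add: even_circuits_circ)
  have "circ K (insert e {f})"
    using spath_single[OF ef(2), of v u] ends_e ends_f assms(2) ef by (intro circ_from_edge[of K v "{v, u}" _ u]) auto
  moreover have "insert e {f} \<subseteq> corresponding_circuit K L D" using e circ_e_f[OF cC] by simp
  ultimately have "corresponding_circuit K L D = {e, f}" using circ_minimal[OF cC] by auto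
  then have "D = {}" using C(2) by (auto simp: L_simps)
  then show False using circ_nonempty[of L D] assms(1) by (simp add: even_circuits_circ)
qed

end

section \<open>Even splittings\<close>

lemma even_card_xor_family:
  assumes "finite \<D>" "even (card {D \<in> \<D>. R D})" "\<And>D. D \<in> \<D> \<Longrightarrow> P D = (Q D \<noteq> R D)"
  shows "even (card {D \<in> \<D>. P D}) = even (card {D \<in> \<D>. Q D})"
proof -
  have "{D \<in> \<D>. P D} = {D \<in> \<D>. Q D \<noteq> R D}" using assms(3) by auto
  then show ?thesis using even_card_neq[OF assms(1), of Q R] assms(2) by auto
qed

locale base_graph =
  F: multigraph F for F :: "('a, 'b) mgraph" +
  assumes even_cover: "even (card {D \<in> even_circuits F. i \<in> D})"
begin

abbreviation "EC \<equiv> even_circuits F"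

lemma finite_EC: "finite EC"
  using even_circuits_finite F.finite_edges by blast

lemma parity_indep:
  assumes "orientation F d" "orientation F d'"
  shows "even (card {D \<in> EC. clockwise_parity F d D = Clockwise_even}) = even (card {D \<in> EC. clockwise_parity F d' D = Clockwise_even})"
proof (rule even_card_xor_family[OF finite_EC])
  have "finite (\<Union>C\<in>EC. C)" using F.finite_edges by (rule finite_subset[rotated]) (auto simp: even_circuits_circ dest: circ_edges)
  then show "even (card {D \<in> EC. odd (card {e \<in> D. d e \<noteq> d' e})})"
    using even_cover finite_EC by (intro even_sum_flip) (auto simp: even_circuits_circ dest: circ_finite)
  show "(clockwise_parity F d D = Clockwise_even) = ((clockwise_parity F d' D = Clockwise_even) \<noteq> odd (card {e \<in> D. d e \<noteq> d' e}))"
    if "D \<in> EC" for D using clockwise_parity_flip[OF assms that] by auto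
qed

text \<open>The invariant along a sequence of splittings. The even covering of the edges of
  \<open>H\<close> belongs to it because it keeps the number of clockwise even circuits unchanged
  modulo 2 in the next step, and injectivity permits counting over the circuits of \<open>F\<close>.
  The orientation \<open>dF\<close> stays existential since all orientations of \<open>F\<close>
  give the same parity.\<close>

definition transfers :: "('v, 'e) mgraph \<Rightarrow> ('b set \<Rightarrow> 'e set) \<Rightarrow> bool" where
  "transfers H \<phi> \<longleftrightarrow> inj_on \<phi> EC \<and> \<phi> ` EC \<subseteq> even_circuits H \<and> (\<forall>g. even (card {D \<in> EC. g \<in> \<phi> D})) \<and>
    (\<forall>d. orientation H d \<longrightarrow> (\<exists>dF. orientation F dF \<and> even (card {D \<in> EC. clockwise_parity H d (\<phi> D) = Clockwise_even}) =
      even (card {D \<in> EC. clockwise_parity F dF D = Clockwise_even})))"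

lemma transfers_iso:
  assumes "graph_iso \<alpha> \<beta> F H"
  shows "transfers H (\<lambda>D. \<beta> ` D)"
proof -
  have b: "bij_betw \<alpha> (verts F) (verts H)" "bij_betw \<beta> (edges F) (edges H)" "\<And>i. i \<in> edges F \<Longrightarrow> ends H (\<beta> i) = \<alpha> ` ends F i"
    using assms by (auto simp: graph_iso_def)
  have inj: "inj_on \<alpha> (verts F)" "inj_on \<beta> (edges F)" using b by (auto simp: bij_betw_def)
  have sub: "D \<subseteq> edges F" if "D \<in> EC" for D using that circ_edges by (auto simp: even_circuits_circ)
  have "inj_on ((`) \<beta>) EC" using inj(2) sub by (auto intro!: inj_onI simp: inj_on_image_eq_iff)
  moreover have EH: "\<beta> ` D \<in> even_circuits H" if D: "D \<in> EC" for D
  proof -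
    have "circ H (\<beta> ` D)"
    proof (rule circ_map)
      show "circ F D" using D by (simp add: even_circuits_circ)
      show "inj_on \<alpha> (\<Union> (ends F ` D))" by (rule inj_on_subset[OF inj(1)]) (use F.ends_subset sub[OF D] in auto)
      show "inj_on \<beta> D" using inj_on_subset[OF inj(2) sub[OF D]] .
      show "\<beta> ` D \<subseteq> edges H" using b(2) sub[OF D] by (auto simp: bij_betw_def)
    qed (use b(3) sub[OF D] in auto)
    moreover have "card (\<beta> ` D) = card D" by (rule card_image[OF inj_on_subset[OF inj(2) sub[OF D]]])
    ultimately show ?thesis using D by (simp add: even_circuits_circ)
  qed
  moreover have "even (card {D \<in> EC. g \<in> \<beta> ` D})" for g
  proof (cases "\<exists>i\<in>edges F. g = \<beta> i")
    case True
    then obtain i where i: "i \<in> edges F" "g = \<beta> i" by blast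
    have "{D \<in> EC. g \<in> \<beta> ` D} = {D \<in> EC. i \<in> D}" using i sub inj(2) by (auto dest!: inj_onD)
    then show ?thesis using even_cover by simp
  next
    case False
    then have 0: "{D \<in> EC. g \<in> \<beta> ` D} = {}" using sub by auto
    show ?thesis unfolding 0 by simp
  qed
  moreover have "\<exists>dF. orientation F dF \<and> even (card {D \<in> EC. clockwise_parity H d (\<beta> ` D) = Clockwise_even}) =
      even (card {D \<in> EC. clockwise_parity F dF D = Clockwise_even})" if d: "orientation H d" for d
  proof -
    let ?\<alpha> = "inv_into (verts F) \<alpha>"
    have \<alpha>: "?\<alpha> (\<alpha> x) = x" if "x \<in> verts F" for x using inv_into_f_f[OF inj(1) that] .
    define dF where "dF = (\<lambda>i. (?\<alpha> (fst (d (\<beta> i))), ?\<alpha> (snd (d (\<beta> i)))))"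
    have dF: "orientation F dF" unfolding orientation_def
    proof
      fix i assume i: "i \<in> edges F"
      have "\<beta> i \<in> edges H" using b(2) i by (auto simp: bij_betw_def)
      then have "{fst (d (\<beta> i)), snd (d (\<beta> i))} = \<alpha> ` ends F i" using d b(3)[OF i] by (simp add: orientation_def)
      then have "?\<alpha> ` {fst (d (\<beta> i)), snd (d (\<beta> i))} = ?\<alpha> ` \<alpha> ` ends F i" by simp
      moreover have "?\<alpha> ` \<alpha> ` ends F i = ends F i" using \<alpha> F.ends_subset[OF i] by (force simp: image_image)
      ultimately show "{fst (dF i), snd (dF i)} = ends F i" by (simp add: dF_def)
    qed
    have "(clockwise_parity H d (\<beta> ` D) = Clockwise_even) = (clockwise_parity F dF D = Clockwise_even)" if D: "D \<in> EC" for D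
    proof -
      obtain c where c: "proper F c D" using even_circuit_proper D by blast
      have c': "proper H (\<lambda>x. c (?\<alpha> x)) (\<beta> ` D)" unfolding proper_def
      proof
        fix g assume "g \<in> \<beta> ` D"
        then obtain i where i: "i \<in> D" "g = \<beta> i" by blast
        obtain x y where xy: "ends F i = {x, y}" "c x \<noteq> c y" using c i unfolding proper_def by blast
        have iF: "i \<in> edges F" using sub[OF D] i by auto
        then have "x \<in> verts F" "y \<in> verts F" using F.ends_subset xy by auto
        then have "ends H g = {\<alpha> x, \<alpha> y}" "c (?\<alpha> (\<alpha> x)) \<noteq> c (?\<alpha> (\<alpha> y))" using b(3)[OF iF] i xy \<alpha> by auto
        then show "\<exists>x y. ends H g = {x, y} \<and> c (?\<alpha> x) \<noteq> c (?\<alpha> y)" by blast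
      qed
      have "{g \<in> \<beta> ` D. c (?\<alpha> (fst (d g)))} = \<beta> ` {i \<in> D. c (fst (dF i))}" by (auto simp: dF_def)
      moreover have "card (\<beta> ` {i \<in> D. c (fst (dF i))}) = card {i \<in> D. c (fst (dF i))}" "card (\<beta> ` D) = card D"
        using sub[OF D] by (auto intro!: card_image inj_on_subset[OF inj(2)])
      ultimately show ?thesis
        unfolding clockwise_parity_proper[OF d EH[OF D] c'] clockwise_parity_proper[OF dF D c] by simp
    qed
    then have "{D \<in> EC. clockwise_parity H d (\<beta> ` D) = Clockwise_even} = {D \<in> EC. clockwise_parity F dF D = Clockwise_even}" by blast
    then show ?thesis using dF by auto
  qed
  ultimately show ?thesis unfolding transfers_def by blast
qed

text \<open>Whether \<open>e\<close> and \<open>f\<close> are directed in a row through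
  \<open>v\<close> does not depend on the circuit. So the number of circuits whose parity changes is
  zero or the number of lifts that contain \<open>e\<close>, and it suffices that the latter is
  even.\<close>

lemma transfers_step:
  assumes "multigraph K" "even_vertex_splitting K L" "transfers L \<phi>"
  shows "transfers K (\<lambda>D. corresponding_circuit K L (\<phi> D))"
proof -
  obtain v e f where s: "degree K v = 2" "e \<in> edges K" "f \<in> edges K" "e \<noteq> f" "v \<in> ends K e" "v \<in> ends K f" "L = contract_onto v {e, f} K"
    using assms(2) unfolding even_vertex_splitting_def by blast
  interpret splitting K L v e f using assms(1) s by (simp add: splitting_def splitting_axioms_def)
  have t: "inj_on \<phi> EC" "\<And>D. D \<in> EC \<Longrightarrow> \<phi> D \<in> even_circuits L" "\<And>g. even (card {D \<in> EC. g \<in> \<phi> D})"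
    "\<And>d. orientation L d \<Longrightarrow> \<exists>dF. orientation F dF \<and> even (card {D \<in> EC. clockwise_parity L d (\<phi> D) = Clockwise_even}) =
      even (card {D \<in> EC. clockwise_parity F dF D = Clockwise_even})"
    using assms(3) unfolding transfers_def by auto
  let ?\<psi> = "\<lambda>D. corresponding_circuit K L (\<phi> D)"
  have \<psi>: "?\<psi> D \<in> even_circuits K" "?\<psi> D \<inter> edges L = \<phi> D" if "D \<in> EC" for D using corresponding(1,2)[OF t(2)[OF that]] by simp_all
  have c: "circ K (?\<psi> D)" if "D \<in> EC" for D using \<psi>(1)[OF that] by (simp add: even_circuits_circ)
  have inj: "inj_on ?\<psi> EC" using t(1) \<psi>(2) by (intro inj_onI) (metis inj_onD)
  have evL: "even (card {D \<in> EC. g \<in> ?\<psi> D})" if "g \<noteq> e" "g \<noteq> f" for g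
  proof -
    have "g \<in> ?\<psi> D \<longleftrightarrow> g \<in> \<phi> D" if "D \<in> EC" for D
      using \<psi>(2)[OF that] circ_edges[OF c[OF that]] \<open>g \<noteq> e\<close> \<open>g \<noteq> f\<close> by (auto simp: L_simps)
    then have "{D \<in> EC. g \<in> ?\<psi> D} = {D \<in> EC. g \<in> \<phi> D}" by blast
    then show ?thesis using t(3) by simp
  qed
  have eve: "even (card {D \<in> EC. e \<in> ?\<psi> D})"
  proof (cases "u = w")
    case True
    then have 0: "{D \<in> EC. e \<in> ?\<psi> D} = {}" using u_eq_w t(2) by blast
    show ?thesis unfolding 0 by simp
  next
    case False
    let ?I = "incident K (edges K) u"
    have fin: "finite ?I" by (rule finite_incident[OF K.finite_edges])
    have eI: "e \<in> ?I" "f \<notin> ?I" using ef ends_e ends_f False by (auto simp: incident_def)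
    \<comment> \<open>Each lift has 0 or 2 edges at \<open>u\<close>, so the covering numbers of the
      edges at \<open>u\<close> have an even sum. All of them except that of \<open>e\<close> are
      known to be even, \<open>f\<close> not being among these edges.\<close>
    have "even (\<Sum>D\<in>EC. card (incident K (?\<psi> D) u))"
    proof (rule dvd_sum)
      fix D assume "D \<in> EC"
      then show "even (card (incident K (?\<psi> D) u))" using circ_incident[OF c, of D u] by auto
    qed
    also have "(\<Sum>D\<in>EC. card (incident K (?\<psi> D) u)) = (\<Sum>D\<in>EC. \<Sum>g\<in>?I. of_bool (g \<in> ?\<psi> D))"
    proof (rule sum.cong[OF refl])
      fix D assume D: "D \<in> EC"
      have "incident K (?\<psi> D) u = ?I \<inter> {g. g \<in> ?\<psi> D}" using circ_edges[OF c[OF D]] by (auto simp: incident_def)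
      then show "card (incident K (?\<psi> D) u) = (\<Sum>g\<in>?I. of_bool (g \<in> ?\<psi> D))" using fin by (simp add: sum_of_bool_eq)
    qed
    also have "\<dots> = (\<Sum>g\<in>?I. \<Sum>D\<in>EC. of_bool (g \<in> ?\<psi> D))" by (rule sum.swap)
    also have "\<dots> = (\<Sum>g\<in>?I. card {D \<in> EC. g \<in> ?\<psi> D})" using finite_EC by (simp add: sum_of_bool_eq Int_def)
    also have "\<dots> = card {D \<in> EC. e \<in> ?\<psi> D} + (\<Sum>g\<in>?I - {e}. card {D \<in> EC. g \<in> ?\<psi> D})" by (rule sum.remove[OF fin eI(1)])
    finally have "even (card {D \<in> EC. e \<in> ?\<psi> D} + (\<Sum>g\<in>?I - {e}. card {D \<in> EC. g \<in> ?\<psi> D}))" .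
    moreover have "even (\<Sum>g\<in>?I - {e}. card {D \<in> EC. g \<in> ?\<psi> D})" using evL eI(2) by (intro dvd_sum) auto
    ultimately show ?thesis by simp
  qed
  moreover have "{D \<in> EC. f \<in> ?\<psi> D} = {D \<in> EC. e \<in> ?\<psi> D}" using circ_e_f[OF c] by blast
  ultimately have ev: "even (card {D \<in> EC. g \<in> ?\<psi> D})" for g using evL[of g] by (cases "g = e"; cases "g = f") simp_all
  moreover have "\<exists>dF. orientation F dF \<and> even (card {D \<in> EC. clockwise_parity K d (?\<psi> D) = Clockwise_even}) =
      even (card {D \<in> EC. clockwise_parity F dF D = Clockwise_even})" if d: "orientation K d" for d
  proof -
    let ?d = "\<lambda>g. (r (fst (d g)), r (snd (d g)))"
    have "even (card {D \<in> EC. clockwise_parity K d (?\<psi> D) = Clockwise_even}) = even (card {D \<in> EC. clockwise_parity L ?d (\<phi> D) = Clockwise_even})"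
    proof (rule even_card_xor_family[OF finite_EC])
      show "even (card {D \<in> EC. e \<in> ?\<psi> D \<and> (fst (d e) = v) = (fst (d f) = v)})"
        using eve by (cases "(fst (d e) = v) = (fst (d f) = v)") simp_all
    qed (use parity_splitting[OF d] t(2) in blast)
    then show ?thesis using t(4)[OF orientation_L[OF d]] by auto
  qed
  ultimately show ?thesis unfolding transfers_def using inj \<psi>(1) by blast
qed

lemma multigraph_step:
  assumes "multigraph K" "even_vertex_splitting K L"
  shows "multigraph L"
proof -
  obtain v e f where s: "degree K v = 2" "e \<in> edges K" "f \<in> edges K" "e \<noteq> f" "v \<in> ends K e" "v \<in> ends K f" "L = contract_onto v {e, f} K"
    using assms(2) unfolding even_vertex_splitting_def by blast
  interpret splitting K L v e f using assms(1) s by (simp add: splitting_def splitting_axioms_def)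
  show ?thesis by (rule multigraph_L)
qed

lemma even_splitting_transfers: "even_splitting F H \<phi> \<Longrightarrow> multigraph H \<Longrightarrow> transfers H \<phi>"
proof (induction rule: even_splitting.induct)
  case (iso \<alpha> \<beta> H)
  then show ?case using transfers_iso by blast
next
  case (step L \<phi> K)
  then show ?case using transfers_step multigraph_step by blast
qed

lemma even_splitting_parity:
  assumes "even_splitting F H \<phi>" "multigraph H" "orientation H d" "orientation F d0"
  shows "inj_on \<phi> EC" "\<phi> ` EC \<subseteq> even_circuits H"
    "even (card {D \<in> EC. clockwise_parity H d (\<phi> D) = Clockwise_even}) = even (card {D \<in> EC. clockwise_parity F d0 D = Clockwise_even})"
  using even_splitting_transfers[OF assms(1,2)] assms(3,4) parity_indep unfolding transfers_def by blast+

end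

section \<open>Subdivisions of a model graph\<close>

text \<open>The graph \<open>H\<close> is obtained from the model with the edge list \<open>ps\<close> by replacing the \<open>i\<close>-th edge with the
  path \<open>\<pi> i\<close> through the vertex set \<open>\<sigma> i\<close>. A path may be trivial, in which case the ends of that edge are
  identified; the trivial edges have to form a matching.\<close>

abbreviation joins :: "(nat \<times> nat) list \<Rightarrow> nat \<Rightarrow> nat set" where
  "joins ps i \<equiv> {fst (ps ! i), snd (ps ! i)}"

definition frame :: "(nat \<times> nat) list \<Rightarrow> ('v, 'e) mgraph \<Rightarrow> (nat \<Rightarrow> 'v) \<Rightarrow> (nat \<Rightarrow> 'v set) \<Rightarrow> (nat \<Rightarrow> 'e set) \<Rightarrow> bool" where
  "frame ps H \<nu> \<sigma> \<pi> \<longleftrightarrow>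
    (\<forall>i<length ps. spath H (\<nu> (fst (ps ! i))) (\<sigma> i) (\<pi> i) (\<nu> (snd (ps ! i)))) \<and>
    (\<forall>i<length ps. \<forall>j<i. \<sigma> i \<inter> \<sigma> j \<subseteq> \<nu> ` joins ps i \<inter> \<nu> ` joins ps j \<and> \<pi> i \<inter> \<pi> j = {}) \<and>
    (\<forall>x\<in>\<Union>i<length ps. joins ps i. \<forall>y\<in>\<Union>i<length ps. joins ps i.
       \<nu> x = \<nu> y \<longleftrightarrow> x = y \<or> (\<exists>i<length ps. \<pi> i = {} \<and> {x, y} = joins ps i)) \<and>
    edges H = (\<Union>i<length ps. \<pi> i) \<and> verts H = (\<Union>i<length ps. \<sigma> i)"

lemma frameD:
  assumes "frame ps H \<nu> \<sigma> \<pi>"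
  shows "i < length ps \<Longrightarrow> spath H (\<nu> (fst (ps ! i))) (\<sigma> i) (\<pi> i) (\<nu> (snd (ps ! i)))"
    "i < length ps \<Longrightarrow> j < length ps \<Longrightarrow> i \<noteq> j \<Longrightarrow> \<sigma> i \<inter> \<sigma> j \<subseteq> \<nu> ` joins ps i"
    "i < length ps \<Longrightarrow> j < length ps \<Longrightarrow> i \<noteq> j \<Longrightarrow> \<sigma> i \<inter> \<sigma> j \<subseteq> \<nu> ` joins ps j"
    "i < length ps \<Longrightarrow> j < length ps \<Longrightarrow> i \<noteq> j \<Longrightarrow> \<pi> i \<inter> \<pi> j = {}"
    "i < length ps \<Longrightarrow> j < length ps \<Longrightarrow> x \<in> joins ps i \<Longrightarrow> y \<in> joins ps j \<Longrightarrow>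
       \<nu> x = \<nu> y \<longleftrightarrow> x = y \<or> (\<exists>k<length ps. \<pi> k = {} \<and> {x, y} = joins ps k)"
    "edges H = (\<Union>i<length ps. \<pi> i)" "verts H = (\<Union>i<length ps. \<sigma> i)"
proof -
  note a1 = assms[unfolded frame_def, THEN conjunct1, rule_format]
    and a2 = assms[unfolded frame_def, THEN conjunct2, THEN conjunct1, rule_format]
    and a3 = assms[unfolded frame_def, THEN conjunct2, THEN conjunct2, THEN conjunct1, rule_format]
    and a4 = assms[unfolded frame_def, THEN conjunct2, THEN conjunct2, THEN conjunct2]
  show "i < length ps \<Longrightarrow> spath H (\<nu> (fst (ps ! i))) (\<sigma> i) (\<pi> i) (\<nu> (snd (ps ! i)))" by (rule a1)
  have "\<sigma> i \<inter> \<sigma> j \<subseteq> \<nu> ` joins ps i \<inter> \<nu> ` joins ps j \<and> \<pi> i \<inter> \<pi> j = {}" if "i < length ps" "j < length ps" "i \<noteq> j"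
  proof (cases "j < i")
    case True
    then show ?thesis using a2[OF that(1)] by blast
  next
    case False
    then have "i < j" using that by simp
    then have "\<sigma> j \<inter> \<sigma> i \<subseteq> \<nu> ` joins ps j \<inter> \<nu> ` joins ps i \<and> \<pi> j \<inter> \<pi> i = {}" using a2[OF that(2)] by blast
    then show ?thesis by (simp only: Int_commute)
  qed
  then show "i < length ps \<Longrightarrow> j < length ps \<Longrightarrow> i \<noteq> j \<Longrightarrow> \<sigma> i \<inter> \<sigma> j \<subseteq> \<nu> ` joins ps i"
    "i < length ps \<Longrightarrow> j < length ps \<Longrightarrow> i \<noteq> j \<Longrightarrow> \<sigma> i \<inter> \<sigma> j \<subseteq> \<nu> ` joins ps j"
    "i < length ps \<Longrightarrow> j < length ps \<Longrightarrow> i \<noteq> j \<Longrightarrow> \<pi> i \<inter> \<pi> j = {}" by blast+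
  show "i < length ps \<Longrightarrow> j < length ps \<Longrightarrow> x \<in> joins ps i \<Longrightarrow> y \<in> joins ps j \<Longrightarrow>
       \<nu> x = \<nu> y \<longleftrightarrow> x = y \<or> (\<exists>k<length ps. \<pi> k = {} \<and> {x, y} = joins ps k)"
    by (rule a3) auto
  show "edges H = (\<Union>i<length ps. \<pi> i)" "verts H = (\<Union>i<length ps. \<sigma> i)" using a4 by simp_all
qed

lemma frame_ends:
  assumes "frame ps H \<nu> \<sigma> \<pi>" "i < length ps" "x \<in> joins ps i"
  shows "\<nu> x \<in> \<sigma> i"
  using spath_ends[OF frameD(1)[OF assms(1,2)]] assms(3) by auto

lemma spath_two_steps:
  assumes "spath H x S p y" "2 \<le> card p"
  obtains e f v z T q where "e \<in> edges H" "f \<in> edges H" "e \<noteq> f" "ends H e = {x, v}" "ends H f = {v, z}"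
    "spath H z T q y" "S = insert x (insert v T)" "p = insert e (insert f q)" "x \<noteq> v" "x \<notin> T" "v \<notin> T" "e \<notin> q" "f \<notin> q"
  using assms(1)
proof (cases rule: spath.cases)
  case nil
  then show ?thesis using assms(2) by simp
next
  case (step e v S1 p1)
  show ?thesis
    using step(6)
  proof (cases rule: spath.cases)
    case nil
    then have "card p \<le> 1" using step by simp
    then show ?thesis using assms(2) by simp
  next
    case st: (step f z T q)
    have "e \<notin> p1" using spath_step_new[OF step(4,5,6)] .
    moreover have "f \<notin> q" using spath_step_new[OF st(4,5,6)] .
    ultimately show ?thesis using that[of e f v z T q] step st by auto
  qed
qed

text \<open>The two initial edges of the \<open>i\<close>-th path are contracted. If they are the
  whole path, its ends become identified; the last condition then guarantees that no other path
  joins these ends, since it would close up, and that the trivial edges remain a matching.\<close>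

lemma frame_contract:
  assumes H: "multigraph H" and fr: "frame ps H \<nu> \<sigma> \<pi>" and i: "i < length ps" and c: "2 \<le> card (\<pi> i)"
    and loopfree: "fst (ps ! i) \<noteq> snd (ps ! i)"
    and two: "card (\<pi> i) = 2 \<longrightarrow> (\<forall>j<length ps. j \<noteq> i \<longrightarrow> joins ps j \<noteq> joins ps i \<and> (\<pi> j = {} \<longrightarrow> joins ps j \<inter> joins ps i = {}))"
  shows "\<exists>L v e f \<nu>' \<sigma>'. splitting H L v e f \<and> frame ps L \<nu>' \<sigma>' (\<lambda>j. \<pi> j - {e, f}) \<and> {e, f} \<subseteq> \<pi> i"
proof -
  define n where "n = length ps"
  let ?a = "fst (ps ! i)" and ?b = "snd (ps ! i)"
  define x y where "x = \<nu> ?a" and "y = \<nu> ?b"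
  have p: "spath H x (\<sigma> i) (\<pi> i) y" using frameD(1)[OF fr i] by (simp add: x_def y_def)
  obtain e f v z T q where s: "e \<in> edges H" "f \<in> edges H" "e \<noteq> f" "ends H e = {x, v}" "ends H f = {v, z}"
    "spath H z T q y" "\<sigma> i = insert x (insert v T)" "\<pi> i = insert e (insert f q)" "x \<noteq> v" "x \<notin> T" "v \<notin> T" "e \<notin> q" "f \<notin> q"
    using spath_two_steps[OF p c] by metis
  have zT: "z \<in> T" "y \<in> T" using spath_ends[OF s(6)] by auto
  have vy: "v \<noteq> y" "z \<noteq> x" "z \<noteq> v" using zT s by auto
  have Ei: "\<nu> ` joins ps i = {x, y}" by (simp add: x_def y_def)
  have vj: "v \<notin> \<sigma> j" if "j < length ps" "j \<noteq> i" for j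
    using frameD(2)[OF fr i that(1)] that(2) Ei s(7,9) vy by auto
  have efj: "e \<notin> \<pi> j" "f \<notin> \<pi> j" if "j < length ps" "j \<noteq> i" for j
    using frameD(4)[OF fr i that(1)] that(2) s(8) by auto
  have at_v: "{g \<in> edges H. v \<in> ends H g} = {e, f}"
  proof -
    have "g = e \<or> g = f" if g: "g \<in> edges H" "v \<in> ends H g" for g
    proof -
      obtain j where j: "j < length ps" "g \<in> \<pi> j" using g frameD(6)[OF fr] by auto
      have "v \<in> \<sigma> j" using spath_ends_subset[OF frameD(1)[OF fr j(1)] j(2)] g(2) by auto
      then have "j = i" using vj j(1) by auto
      then have "g = e \<or> g = f \<or> g \<in> q" using j(2) s(8) by auto
      moreover have "g \<notin> q" using spath_ends_subset[OF s(6), of g] g(2) s(11) by auto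
      ultimately show ?thesis by auto
    qed
    then show ?thesis using s by auto
  qed
  have loops: "{g \<in> edges H. ends H g = {v}} = {}"
  proof -
    have "ends H g \<noteq> {v}" if g: "g \<in> edges H" for g
    proof -
      obtain j where j: "j < length ps" "g \<in> \<pi> j" using g frameD(6)[OF fr] by auto
      then show ?thesis using spath_edge_ends[OF frameD(1)[OF fr j(1)] j(2)] by (auto simp: doubleton_eq_iff)
    qed
    then show ?thesis by auto
  qed
  define L where "L = contract_onto v {e, f} H"
  have "degree H v = 2" unfolding degree_def at_v loops using s(3) by simp
  then have sp: "splitting H L v e f"
    using H s(1-5) by (simp add: splitting_def splitting_axioms_def L_def)
  interpret splitting H L v e f by (rule sp)
  have uw: "u = x" "w = z" using ends_e ends_f s(4,5,9) vy by (auto simp: doubleton_eq_iff)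
  have r: "r x = v" "r v = v" "r z = v" "\<And>t. t \<notin> {x, v, z} \<Longrightarrow> r t = t" "\<And>t. r t = v \<longleftrightarrow> t \<in> {x, v, z}"
    by (auto simp: r_def uw)
  have r_inj: "s = t \<or> (s \<in> {x, v, z} \<and> t \<in> {x, v, z})" if "r s = r t" for s t
    using that by (auto simp: r_def uw split: if_splits)
  have trivial_q: "q = {} \<longleftrightarrow> z = y" using spath_empty_iff[OF s(6)] .
  have card_q: "q = {} \<Longrightarrow> card (\<pi> i) = 2" using s by simp
  \<comment> \<open>If the path collapses, no trivial edge of the model touches its ends, so before
    the contraction \<open>\<nu>\<close> identifies them with no other model vertex.\<close>
  have kernel_i: "p \<in> joins ps j \<Longrightarrow> j < length ps \<Longrightarrow> k \<in> joins ps i \<Longrightarrow> q = {} \<Longrightarrow> \<nu> p = \<nu> k \<Longrightarrow> p = k" for p j k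
  proof -
    assume a: "p \<in> joins ps j" "j < length ps" "k \<in> joins ps i" "q = {}" "\<nu> p = \<nu> k"
    have "p = k \<or> (\<exists>l<length ps. \<pi> l = {} \<and> {p, k} = joins ps l)" using frameD(5)[OF fr a(2) i a(1,3)] a(5) by simp
    moreover have False if l: "l < length ps" "\<pi> l = {}" "{p, k} = joins ps l" for l
    proof -
      have "l \<noteq> i" using l(2) s(8) by auto
      then have "joins ps l \<inter> joins ps i = {}" using mp[OF two card_q[OF a(4)]] l by blast
      then show False using l(3) a(3) by blast
    qed
    ultimately show "p = k" by blast
  qed
  \<comment> \<open>The contraction could merge two vertices of another path only if that path
    contained both \<open>x\<close> and \<open>z\<close>. Then \<open>z = y\<close>, the
    \<open>i\<close>-th path collapses, and the \<open>j\<close>-th edge of the model would be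
    parallel to the \<open>i\<close>-th.\<close>
  have inj: "inj_on r (\<sigma> j)" if j: "j < length ps" "j \<noteq> i" for j
  proof (rule inj_onI, rule ccontr)
    fix s' t assume st: "s' \<in> \<sigma> j" "t \<in> \<sigma> j" "r s' = r t" "s' \<noteq> t"
    then have xz: "x \<in> \<sigma> j" "z \<in> \<sigma> j" using r_inj[OF st(3)] vj[OF j] by auto
    then have "z \<in> \<sigma> i \<inter> \<sigma> j" "x \<in> \<sigma> i \<inter> \<sigma> j" using zT s(7) by auto
    then have "z \<in> {x, y}" "x \<in> \<nu> ` joins ps j" "z \<in> \<nu> ` joins ps j"
      using frameD(2)[OF fr i j(1)] frameD(3)[OF fr i j(1)] j(2) unfolding Ei by auto
    then have zy: "z = y" "x \<in> \<nu> ` joins ps j" "y \<in> \<nu> ` joins ps j" using vy by auto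
    then have q0: "q = {}" using trivial_q by simp
    obtain k where k: "k \<in> joins ps j" "x = \<nu> k" using zy(2) by (rule imageE) (rule that)
    obtain l where l: "l \<in> joins ps j" "y = \<nu> l" using zy(3) by (rule imageE) (rule that)
    have kl: "k \<in> joins ps j" "l \<in> joins ps j" "\<nu> k = \<nu> ?a" "\<nu> l = \<nu> ?b" using k l by (simp_all add: x_def y_def)
    have "k = ?a" "l = ?b" using kernel_i[OF kl(1) j(1) _ q0 kl(3)] kernel_i[OF kl(2) j(1) _ q0 kl(4)] by auto
    then have "joins ps j = joins ps i" using kl(1,2) loopfree by auto
    then show False using mp[OF two card_q[OF q0]] j by blast
  qed
  have frame: "frame ps L (\<lambda>t. r (\<nu> t)) (\<lambda>j. r ` \<sigma> j) (\<lambda>j. \<pi> j - {e, f})"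
    unfolding frame_def
  proof (intro conjI allI impI ballI)
    fix j assume j: "j < length ps"
    show "spath L (r (\<nu> (fst (ps ! j)))) (r ` \<sigma> j) (\<pi> j - {e, f}) (r (\<nu> (snd (ps ! j))))"
    proof (cases "j = i")
      case True
      have "inj_on r T" using s(10,11) r_inj by (auto intro!: inj_onI)
      then have "spath L (r z) (r ` T) ((\<lambda>g. g) ` q) (r y)"
        by (rule spath_map[OF s(6)]) (use s spath_edges[OF s(6)] in \<open>auto simp: L_simps\<close>)
      moreover have "r ` \<sigma> i = r ` T" unfolding s(7) image_insert r(1,2) using imageI[OF zT(1), of r] r(3) by auto
      moreover have "\<pi> i - {e, f} = q" using s by auto
      ultimately show ?thesis using True r(1,3) by (simp add: x_def y_def)
    next
      case False
      have "\<pi> j - {e, f} = \<pi> j" using efj[OF j False] by auto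
      moreover have "spath L (r (\<nu> (fst (ps ! j)))) (r ` \<sigma> j) ((\<lambda>g. g) ` \<pi> j) (r (\<nu> (snd (ps ! j))))"
        by (rule spath_map[OF frameD(1)[OF fr j] inj[OF j False]])
          (use spath_edges[OF frameD(1)[OF fr j]] efj[OF j False] in \<open>auto simp: L_simps\<close>)
      ultimately show ?thesis by simp
    qed
  next
    fix j k assume jk: "j < length ps" "k < j"
    then have jk': "j < length ps" "k < length ps" "j \<noteq> k" "k \<noteq> j" by auto
    have key: "t \<in> (\<lambda>t. r (\<nu> t)) ` joins ps l"
      if l: "l < length ps" "l' < length ps" "l \<noteq> l'" "t \<in> r ` \<sigma> l" "t \<in> r ` \<sigma> l'" for t l l'
    proof (cases "t = v")
      case True
      show ?thesis
      proof (cases "l = i")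
        case True
        then show ?thesis using \<open>t = v\<close> r(1) by (auto simp: x_def)
      next
        case False
        obtain t' where t': "t' \<in> \<sigma> l" "r t' = v" using l(4) True by auto
        then have "t' \<in> \<sigma> i" using r(5) s(7) zT by auto
        then have "t' \<in> \<nu> ` joins ps l" using frameD(3)[OF fr i l(1)] False t'(1) by auto
        then show ?thesis using t'(2) True by auto
      qed
    next
      case False
      obtain t1 t2 where t: "t1 \<in> \<sigma> l" "t2 \<in> \<sigma> l'" "t = r t1" "t = r t2" using l(4,5) by auto
      then have "t1 = t" "t2 = t" using False r_eq[of t1] r_eq[of t2] by auto
      then have "t \<in> \<sigma> l \<inter> \<sigma> l'" using t(1,2) by simp
      then have "t \<in> \<nu> ` joins ps l" by (rule subsetD[OF frameD(2)[OF fr l(1-3)]])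
      then obtain a where a: "a \<in> joins ps l" "t = \<nu> a" by blast
      have "t = r (\<nu> a)" by (metis a(2) \<open>t1 = t\<close> t(3))
      then show ?thesis using a(1) by blast
    qed
    show "r ` \<sigma> j \<inter> r ` \<sigma> k \<subseteq> (\<lambda>t. r (\<nu> t)) ` joins ps j \<inter> (\<lambda>t. r (\<nu> t)) ` joins ps k"
      using key[OF jk'(1-3)] key[OF jk'(2,1,4)] by blast
    show "(\<pi> j - {e, f}) \<inter> (\<pi> k - {e, f}) = {}" using frameD(4)[OF fr jk'(1-3)] by auto
  next
    fix p p' assume pp: "p \<in> (\<Union>i<length ps. joins ps i)" "p' \<in> (\<Union>i<length ps. joins ps i)"
    obtain j where j: "j < length ps" "p \<in> joins ps j" using pp(1) by auto
    obtain j' where j': "j' < length ps" "p' \<in> joins ps j'" using pp(2) by auto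
    have nuv: "\<nu> t \<in> {x, v, z} \<Longrightarrow> \<nu> t = x \<or> (\<nu> t = y \<and> z = y)" if t: "l < length ps" "t \<in> joins ps l" for t l
    proof -
      assume a: "\<nu> t \<in> {x, v, z}"
      have "\<nu> t \<in> {x, y}"
      proof (cases "l = i")
        case True
        then show ?thesis using t(2) by (auto simp: x_def y_def)
      next
        case False
        have "\<nu> t \<in> \<sigma> i" using a s(7) zT by auto
        then show ?thesis using frameD(2)[OF fr i t(1)] False frame_ends[OF fr t] Ei by auto
      qed
      then show ?thesis using a vy by auto
    qed
    have old: "\<nu> p = \<nu> p' \<longleftrightarrow> p = p' \<or> (\<exists>k<length ps. \<pi> k = {} \<and> {p, p'} = joins ps k)"
      using frameD(5)[OF fr j(1) j'(1) j(2) j'(2)] .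
    have empty: "\<pi> k - {e, f} = {} \<longleftrightarrow> \<pi> k = {} \<or> (k = i \<and> q = {})" if "k < length ps" for k
      using efj[OF that] s(8,12,13) by (cases "k = i") auto
    show "r (\<nu> p) = r (\<nu> p') \<longleftrightarrow> p = p' \<or> (\<exists>k<length ps. \<pi> k - {e, f} = {} \<and> {p, p'} = joins ps k)"
    proof
      assume a: "r (\<nu> p) = r (\<nu> p')"
      show "p = p' \<or> (\<exists>k<length ps. \<pi> k - {e, f} = {} \<and> {p, p'} = joins ps k)"
      proof (cases "\<nu> p = \<nu> p'")
        case True
        then show ?thesis using old empty by blast
      next
        case False
        then have b: "\<nu> p = x \<or> (\<nu> p = y \<and> z = y)" "\<nu> p' = x \<or> (\<nu> p' = y \<and> z = y)"
          using r_inj[OF a] nuv[OF j] nuv[OF j'] by auto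
        then have zy: "z = y" using False by auto
        then have q0: "q = {}" using trivial_q by simp
        have "(\<nu> p = \<nu> ?a \<and> \<nu> p' = \<nu> ?b) \<or> (\<nu> p = \<nu> ?b \<and> \<nu> p' = \<nu> ?a)" using b False by (auto simp: x_def y_def)
        then have "(p = ?a \<and> p' = ?b) \<or> (p = ?b \<and> p' = ?a)"
          using kernel_i[OF j(2,1) _ q0] kernel_i[OF j'(2,1) _ q0] by auto
        then have "{p, p'} = joins ps i" by auto
        then show ?thesis using i empty[OF i] q0 by blast
      qed
    next
      assume a: "p = p' \<or> (\<exists>k<length ps. \<pi> k - {e, f} = {} \<and> {p, p'} = joins ps k)"
      show "r (\<nu> p) = r (\<nu> p')"
      proof (cases "\<nu> p = \<nu> p'")
        case False
        then obtain k where k: "k < length ps" "\<pi> k - {e, f} = {}" "{p, p'} = joins ps k" using a by blast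
        then have "k = i" "q = {}" using old False empty[OF k(1)] by auto
        then have "{\<nu> p, \<nu> p'} = {x, y}" "z = y" using k(3) Ei trivial_q by (metis image_empty image_insert, simp)
        then have "\<nu> p \<in> {x, v, z}" "\<nu> p' \<in> {x, v, z}" by blast+
        then have "r (\<nu> p) = v" "r (\<nu> p') = v" using r(5) by blast+
        then show ?thesis by simp
      qed simp
    qed
  next
    show "edges L = (\<Union>j<length ps. \<pi> j - {e, f})" using frameD(6)[OF fr] by (auto simp: L_simps)
    show "verts L = (\<Union>j<length ps. r ` \<sigma> j)" using frameD(7)[OF fr] by (auto simp: L_simps)
  qed
  have "{e, f} \<subseteq> \<pi> i" using s(8) by auto
  then show ?thesis using sp frame by blast
qed

lemma spath_iso:
  "spath F x S p y \<Longrightarrow> spath H x' S' p' y' \<Longrightarrow> card p = card p' \<Longrightarrow>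
   \<exists>\<alpha> \<beta>. bij_betw \<alpha> S S' \<and> bij_betw \<beta> p p' \<and> \<alpha> x = x' \<and> \<alpha> y = y' \<and> (\<forall>g\<in>p. ends H (\<beta> g) = \<alpha> ` ends F g)"
proof (induction arbitrary: x' S' p' rule: spath.induct)
  case (nil x)
  then have "p' = {}" using spath_finite[OF nil.prems(1)] by simp
  then have "y' = x'" "S' = {x'}" using nil.prems(1) by (simp_all add: spath_trivial)
  then show ?case using \<open>p' = {}\<close> by (intro exI[of _ "\<lambda>_. x'"] exI[of _ "\<lambda>_. undefined"]) (auto simp: bij_betw_def)
next
  case (step g x z S p y)
  have gp: "g \<notin> p" using spath_step_new step by metis
  have fin: "finite p" using spath_finite step by metis
  from step.prems(1) show ?case
  proof (cases rule: spath.cases)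
    case nil
    then show ?thesis using step.prems(2) gp fin by simp
  next
    case st: (step g' z' S1 p1)
    have gp': "g' \<notin> p1" using spath_step_new[OF st(4,5,6)] .
    have fin': "finite p1" using spath_finite[OF st(6)] by simp
    have "card p = card p1" using step.prems(2) st(2) gp gp' fin fin' by simp
    from step.IH[OF st(6) this] obtain \<alpha> \<beta> where h: "bij_betw \<alpha> S S1" "bij_betw \<beta> p p1" "\<alpha> z = z'" "\<alpha> y = y'"
      "\<forall>h\<in>p. ends H (\<beta> h) = \<alpha> ` ends F h" by blast
    have yz: "z \<in> S" "y \<in> S" using spath_ends[OF step.hyps(4)] by auto
    have 1: "bij_betw (\<alpha>(x := x')) (insert x S) S'"
    proof -
      have "bij_betw (\<alpha>(x := x')) S S1" using h(1) step.hyps(3) by (subst bij_betw_cong[where g = \<alpha>]) auto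
      then show ?thesis using notIn_Un_bij_betw[of x S "\<alpha>(x := x')" S1] step.hyps(3) st by auto
    qed
    have 2: "bij_betw (\<beta>(g := g')) (insert g p) p'"
    proof -
      have "bij_betw (\<beta>(g := g')) p p1" using h(2) gp by (subst bij_betw_cong[where g = \<beta>]) auto
      then show ?thesis using notIn_Un_bij_betw[of g p "\<beta>(g := g')" p1] gp gp' st by auto
    qed
    have 3: "\<forall>h\<in>insert g p. ends H ((\<beta>(g := g')) h) = (\<alpha>(x := x')) ` ends F h"
    proof
      fix h' assume h': "h' \<in> insert g p"
      show "ends H ((\<beta>(g := g')) h') = (\<alpha>(x := x')) ` ends F h'"
      proof (cases "h' = g")
        case True
        have "x \<noteq> z" using yz step.hyps(3) by auto
        then show ?thesis using True st h(3) step.hyps(2) by auto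
      next
        case False
        then have hp: "h' \<in> p" using h' by simp
        then have "x \<notin> ends F h'" using spath_ends_subset[OF step.hyps(4)] step.hyps(3) by blast
        then have "(\<alpha>(x := x')) ` ends F h' = \<alpha> ` ends F h'" by (intro image_cong) auto
        then show ?thesis using h(5) hp False by simp
      qed
    qed
    have 4: "(\<alpha>(x := x')) x = x'" "(\<alpha>(x := x')) y = y'" using h(4) yz step.hyps(3) by auto
    show ?thesis using 1 2 3 4 by blast
  qed
qed

text \<open>Isomorphisms of the single paths are glued together. They agree where paths meet,
  because this happens only at images of model vertices, and since equal lengths mean the same
  trivial edges, \<open>\<nu>1\<close> and \<open>\<nu>2\<close> identify the same model
  vertices.\<close>

lemma frame_iso:
  assumes F: "frame ps F \<nu>1 \<sigma>1 \<pi>1" and H: "frame ps H \<nu>2 \<sigma>2 \<pi>2" and c: "\<And>i. i < length ps \<Longrightarrow> card (\<pi>1 i) = card (\<pi>2 i)"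
  shows "\<exists>\<alpha> \<beta>. graph_iso \<alpha> \<beta> F H \<and> (\<forall>i<length ps. \<beta> ` \<pi>1 i = \<pi>2 i)"
proof -
  have "\<forall>i. \<exists>ab. i < length ps \<longrightarrow> bij_betw (fst ab) (\<sigma>1 i) (\<sigma>2 i) \<and> bij_betw (snd ab) (\<pi>1 i) (\<pi>2 i) \<and>
     fst ab (\<nu>1 (fst (ps ! i))) = \<nu>2 (fst (ps ! i)) \<and> fst ab (\<nu>1 (snd (ps ! i))) = \<nu>2 (snd (ps ! i)) \<and>
     (\<forall>g\<in>\<pi>1 i. ends H (snd ab g) = fst ab ` ends F g)"
  proof
    fix i
    show "\<exists>ab. i < length ps \<longrightarrow> bij_betw (fst ab) (\<sigma>1 i) (\<sigma>2 i) \<and> bij_betw (snd ab) (\<pi>1 i) (\<pi>2 i) \<and>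
     fst ab (\<nu>1 (fst (ps ! i))) = \<nu>2 (fst (ps ! i)) \<and> fst ab (\<nu>1 (snd (ps ! i))) = \<nu>2 (snd (ps ! i)) \<and>
     (\<forall>g\<in>\<pi>1 i. ends H (snd ab g) = fst ab ` ends F g)"
    proof (cases "i < length ps")
      case True
      from spath_iso[OF frameD(1)[OF F True] frameD(1)[OF H True] c[OF True]]
      obtain \<alpha> \<beta> where "bij_betw \<alpha> (\<sigma>1 i) (\<sigma>2 i)" "bij_betw \<beta> (\<pi>1 i) (\<pi>2 i)" "\<alpha> (\<nu>1 (fst (ps ! i))) = \<nu>2 (fst (ps ! i))"
        "\<alpha> (\<nu>1 (snd (ps ! i))) = \<nu>2 (snd (ps ! i))" "\<forall>g\<in>\<pi>1 i. ends H (\<beta> g) = \<alpha> ` ends F g" by blast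
      then show ?thesis by (intro exI[of _ "(\<alpha>, \<beta>)"]) simp
    qed simp
  qed
  then obtain ab where ab: "\<forall>i. i < length ps \<longrightarrow> bij_betw (fst (ab i)) (\<sigma>1 i) (\<sigma>2 i) \<and> bij_betw (snd (ab i)) (\<pi>1 i) (\<pi>2 i) \<and>
     fst (ab i) (\<nu>1 (fst (ps ! i))) = \<nu>2 (fst (ps ! i)) \<and> fst (ab i) (\<nu>1 (snd (ps ! i))) = \<nu>2 (snd (ps ! i)) \<and>
     (\<forall>g\<in>\<pi>1 i. ends H (snd (ab i) g) = fst (ab i) ` ends F g)"
    by (elim choice[THEN exE])
  define A where "A i = fst (ab i)" for i
  define B where "B i = snd (ab i)" for i
  have A: "bij_betw (A i) (\<sigma>1 i) (\<sigma>2 i)" and B: "bij_betw (B i) (\<pi>1 i) (\<pi>2 i)" and A\<nu>: "\<And>x. x \<in> joins ps i \<Longrightarrow> A i (\<nu>1 x) = \<nu>2 x"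
    and AB: "\<And>g. g \<in> \<pi>1 i \<Longrightarrow> ends H (B i g) = A i ` ends F g" if "i < length ps" for i
    using ab[rule_format, OF that] by (auto simp: A_def B_def)
  have triv: "\<pi>1 i = {} \<longleftrightarrow> \<pi>2 i = {}" if "i < length ps" for i
    using B[OF that] by (auto simp: bij_betw_def)
  have ker: "\<nu>1 x = \<nu>1 y \<longleftrightarrow> \<nu>2 x = \<nu>2 y" if "i < length ps" "j < length ps" "x \<in> joins ps i" "y \<in> joins ps j" for x y i j
    unfolding frameD(5)[OF F that] frameD(5)[OF H that] using triv by blast
  have consistent: "A i x = A j x" if ij: "i < length ps" "j < length ps" "x \<in> \<sigma>1 i" "x \<in> \<sigma>1 j" for i j x
  proof (cases "i = j")
    case False
    obtain a b where ab: "a \<in> joins ps i" "x = \<nu>1 a" "b \<in> joins ps j" "x = \<nu>1 b"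
      using frameD(2)[OF F ij(1,2) False] frameD(3)[OF F ij(1,2) False] ij(3,4) by blast
    then show ?thesis using A\<nu>[OF ij(1) ab(1)] A\<nu>[OF ij(2) ab(3)] ker[OF ij(1,2) ab(1,3)] by metis
  qed simp
  define \<alpha> where "\<alpha> x = A (SOME i. i < length ps \<and> x \<in> \<sigma>1 i) x" for x
  define \<beta> where "\<beta> g = B (SOME i. i < length ps \<and> g \<in> \<pi>1 i) g" for g
  have \<alpha>: "\<alpha> x = A i x" if "i < length ps" "x \<in> \<sigma>1 i" for x i
    unfolding \<alpha>_def using someI[of "\<lambda>i. i < length ps \<and> x \<in> \<sigma>1 i" i] that consistent by blast
  have \<beta>: "\<beta> g = B i g" if "i < length ps" "g \<in> \<pi>1 i" for g i
  proof -
    let ?k = "SOME i. i < length ps \<and> g \<in> \<pi>1 i"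
    have "?k < length ps \<and> g \<in> \<pi>1 ?k" using someI[of "\<lambda>i. i < length ps \<and> g \<in> \<pi>1 i" i] that by blast
    then have "?k = i" using frameD(4)[OF F, of ?k i] that by blast
    then show ?thesis by (simp add: \<beta>_def)
  qed
  have im\<alpha>: "\<alpha> ` \<sigma>1 i = \<sigma>2 i" if "i < length ps" for i
  proof -
    have "\<alpha> ` \<sigma>1 i = A i ` \<sigma>1 i" using \<alpha>[OF that] by (intro image_cong) auto
    then show ?thesis using A[OF that] by (simp add: bij_betw_def)
  qed
  have im\<beta>: "\<beta> ` \<pi>1 i = \<pi>2 i" if "i < length ps" for i
  proof -
    have "\<beta> ` \<pi>1 i = B i ` \<pi>1 i" using \<beta>[OF that] by (intro image_cong) auto
    then show ?thesis using B[OF that] by (simp add: bij_betw_def)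
  qed
  have "inj_on \<alpha> (verts F)"
  proof (rule inj_onI)
    fix x y assume "x \<in> verts F" "y \<in> verts F" and eq: "\<alpha> x = \<alpha> y"
    then obtain i j where ij: "i < length ps" "x \<in> \<sigma>1 i" "j < length ps" "y \<in> \<sigma>1 j" using frameD(7)[OF F] by auto
    show "x = y"
    proof (cases "i = j")
      case True
      then show ?thesis using eq \<alpha>[OF ij(1,2)] \<alpha>[OF ij(3,4)] A[OF ij(1)] ij by (auto simp: bij_betw_def dest: inj_onD)
    next
      case False
      have "\<alpha> x \<in> \<sigma>2 i" "\<alpha> y \<in> \<sigma>2 j" using im\<alpha>[OF ij(1)] im\<alpha>[OF ij(3)] ij(2,4) by blast+
      then have "\<alpha> x \<in> \<sigma>2 i" "\<alpha> x \<in> \<sigma>2 j" using eq by simp_all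
      then obtain a b where ab: "a \<in> joins ps i" "\<alpha> x = \<nu>2 a" "b \<in> joins ps j" "\<alpha> x = \<nu>2 b"
        using frameD(2)[OF H ij(1,3) False] frameD(3)[OF H ij(1,3) False] by blast
      have "A i x = A i (\<nu>1 a)" using \<alpha>[OF ij(1,2)] A\<nu>[OF ij(1) ab(1)] ab(2) by simp
      then have x: "x = \<nu>1 a" using A[OF ij(1)] ij(2) frame_ends[OF F ij(1) ab(1)] by (auto simp: bij_betw_def dest: inj_onD)
      have "A j y = A j (\<nu>1 b)" using \<alpha>[OF ij(3,4)] A\<nu>[OF ij(3) ab(3)] ab(4) eq by simp
      then have y: "y = \<nu>1 b" using A[OF ij(3)] ij(4) frame_ends[OF F ij(3) ab(3)] by (auto simp: bij_betw_def dest: inj_onD)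
      show ?thesis using x y ker[OF ij(1,3) ab(1,3)] ab(2,4) by simp
    qed
  qed
  moreover have "\<alpha> ` verts F = verts H" unfolding frameD(7)[OF F] frameD(7)[OF H] using im\<alpha> by (auto simp: image_UN)
  moreover have "inj_on \<beta> (edges F)"
  proof (rule inj_onI)
    fix g h assume "g \<in> edges F" "h \<in> edges F" and eq: "\<beta> g = \<beta> h"
    then obtain i j where ij: "i < length ps" "g \<in> \<pi>1 i" "j < length ps" "h \<in> \<pi>1 j" using frameD(6)[OF F] by auto
    have "\<beta> g \<in> \<pi>2 i" "\<beta> h \<in> \<pi>2 j" using im\<beta>[OF ij(1)] im\<beta>[OF ij(3)] ij(2,4) by blast+
    then have "\<beta> g \<in> \<pi>2 i" "\<beta> g \<in> \<pi>2 j" using eq by simp_all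
    then have "i = j" using frameD(4)[OF H ij(1,3)] by blast
    then show "g = h" using eq \<beta>[OF ij(1,2)] \<beta>[OF ij(3,4)] B[OF ij(1)] ij by (auto simp: bij_betw_def dest: inj_onD)
  qed
  moreover have "\<beta> ` edges F = edges H" unfolding frameD(6)[OF F] frameD(6)[OF H] using im\<beta> by (auto simp: image_UN)
  moreover have "ends H (\<beta> g) = \<alpha> ` ends F g" if g: "g \<in> edges F" for g
  proof -
    obtain i where i: "i < length ps" "g \<in> \<pi>1 i" using g frameD(6)[OF F] by auto
    have "ends F g \<subseteq> \<sigma>1 i" using spath_ends_subset[OF frameD(1)[OF F i(1)] i(2)] .
    then have "\<alpha> ` ends F g = A i ` ends F g" using \<alpha>[OF i(1)] by (intro image_cong) auto
    then show ?thesis using \<beta>[OF i] AB[OF i] by simp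
  qed
  ultimately have "graph_iso \<alpha> \<beta> F H" unfolding graph_iso_def bij_betw_def by blast
  then show ?thesis using im\<beta> by blast
qed

text \<open>Paths that are too long lose two edges at a time until all lengths are those of
  \<open>F\<close>; read backwards, each contraction is a splitting. The hypothesis on circuits
  ranges over all frames with suitable lengths because it is used at every stage: it recognises the
  union of the paths with index in \<open>I\<close> as the corresponding circuit.\<close>

lemma frame_even_splitting:
  fixes H :: "('v, 'e) mgraph"
  assumes F: "frame ps F \<nu>1 \<sigma>1 \<pi>1" and "frame ps H \<nu> \<sigma> \<pi>" "multigraph H"
    and "\<And>i. i < length ps \<Longrightarrow> card (\<pi>1 i) \<le> card (\<pi> i) \<and> even (card (\<pi> i) + card (\<pi>1 i))"
    and loopfree: "\<And>i. i < length ps \<Longrightarrow> fst (ps ! i) \<noteq> snd (ps ! i)"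
    and matching: "\<And>i j. i < length ps \<Longrightarrow> j < length ps \<Longrightarrow> j \<noteq> i \<Longrightarrow> card (\<pi>1 i) = 0 \<Longrightarrow>
       joins ps j \<noteq> joins ps i \<and> (card (\<pi>1 j) = 0 \<longrightarrow> joins ps j \<inter> joins ps i = {})"
    and circuits: "\<And>(H :: ('v, 'e) mgraph) \<nu> \<sigma> \<pi> I. frame ps H \<nu> \<sigma> \<pi> \<Longrightarrow>
      (\<And>i. i < length ps \<Longrightarrow> card (\<pi>1 i) \<le> card (\<pi> i) \<and> even (card (\<pi> i) + card (\<pi>1 i))) \<Longrightarrow> I \<in> \<I> \<Longrightarrow> I \<subseteq> {..<length ps} \<and> (\<Union>i\<in>I. \<pi> i) \<in> even_circuits H"
  shows "\<exists>\<phi>. even_splitting F H \<phi> \<and> (\<forall>I\<in>\<I>. \<phi> (\<Union>i\<in>I. \<pi>1 i) = (\<Union>i\<in>I. \<pi> i))"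
  using assms(2-4)
proof (induction "card (edges H)" arbitrary: H \<nu> \<sigma> \<pi> rule: less_induct)
  case less
  note fr = less.prems(1)
  show ?case
  proof (cases "\<forall>i<length ps. card (\<pi>1 i) = card (\<pi> i)")
    case True
    then obtain \<alpha> \<beta> where iso: "graph_iso \<alpha> \<beta> F H" "\<forall>i<length ps. \<beta> ` \<pi>1 i = \<pi> i" using frame_iso[OF F fr] by blast
    have "\<beta> ` (\<Union>i\<in>I. \<pi>1 i) = (\<Union>i\<in>I. \<pi> i)" if "I \<in> \<I>" for I
    proof -
      have "I \<subseteq> {..<length ps}" using circuits[OF fr less.prems(3) that] by blast
      then have "(\<Union>i\<in>I. \<beta> ` \<pi>1 i) = (\<Union>i\<in>I. \<pi> i)" using iso(2) by (intro SUP_cong) auto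
      then show ?thesis by (simp only: image_UN)
    qed
    then show ?thesis using even_splitting.iso[OF iso(1)] by (intro exI[of _ "\<lambda>D. \<beta> ` D"]) simp
  next
    case False
    then obtain i where i: "i < length ps" "card (\<pi>1 i) \<noteq> card (\<pi> i)" by blast
    have ge: "card (\<pi>1 i) + 2 \<le> card (\<pi> i)"
    proof -
      have "card (\<pi> i) \<noteq> Suc (card (\<pi>1 i))"
      proof
        assume "card (\<pi> i) = Suc (card (\<pi>1 i))"
        then show False using less.prems(3)[OF i(1)] by simp
      qed
      then show ?thesis using less.prems(3)[OF i(1)] i(2) by linarith
    qed
    have fin: "finite (\<pi> j)" if "j < length ps" for j using spath_finite[OF frameD(1)[OF fr that]] by simp
    have two: "card (\<pi> i) = 2 \<longrightarrow> (\<forall>j<length ps. j \<noteq> i \<longrightarrow> joins ps j \<noteq> joins ps i \<and> (\<pi> j = {} \<longrightarrow> joins ps j \<inter> joins ps i = {}))"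
    proof (intro allI impI)
      fix j assume j: "card (\<pi> i) = 2" "j < length ps" "j \<noteq> i"
      then have "card (\<pi>1 i) = 0" using ge by simp
      note m = matching[OF i(1) j(2,3) this]
      have "\<pi> j = {} \<Longrightarrow> card (\<pi>1 j) = 0" using less.prems(3)[OF j(2)] by simp
      then show "joins ps j \<noteq> joins ps i \<and> (\<pi> j = {} \<longrightarrow> joins ps j \<inter> joins ps i = {})" using m by blast
    qed
    have "2 \<le> card (\<pi> i)" using ge by simp
    from frame_contract[OF less.prems(2) fr i(1) this loopfree[OF i(1)] two]
    obtain L v e f \<nu>' \<sigma>' where LL: "splitting H L v e f" "frame ps L \<nu>' \<sigma>' (\<lambda>j. \<pi> j - {e, f})" "{e, f} \<subseteq> \<pi> i" by (elim exE conjE) (rule that)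
    interpret splitting H L v e f by (rule LL(1))
    have ci: "card (\<pi> i) = card (\<pi> i - {e, f}) + 2"
    proof -
      have "card (\<pi> i - {e, f}) = card (\<pi> i) - card {e, f}" by (rule card_Diff_subset) (use LL(3) in auto)
      then show ?thesis using ge ef(3) by simp
    qed
    have cj: "\<pi> j - {e, f} = \<pi> j" if "j < length ps" "j \<noteq> i" for j using frameD(4)[OF fr that(1) i(1) that(2)] LL(3) by auto
    have card: "card (\<pi>1 j) \<le> card (\<pi> j - {e, f}) \<and> even (card (\<pi> j - {e, f}) + card (\<pi>1 j))" if j: "j < length ps" for j
      using ci cj[OF j] less.prems(3)[OF j] ge by (cases "j = i") auto
    have "card (edges L) < card (edges H)"
      by (rule psubset_card_mono[OF K.finite_edges]) (use ef in \<open>auto simp: L_simps\<close>)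
    from less.hyps[OF this LL(2) multigraph_L card] obtain \<phi> where
      \<phi>: "even_splitting F L \<phi>" "\<forall>I\<in>\<I>. \<phi> (\<Union>i\<in>I. \<pi>1 i) = (\<Union>i\<in>I. \<pi> i - {e, f})" by blast
    have evs: "even_vertex_splitting H L" unfolding even_vertex_splitting_def
      using v ef L by (intro exI[of _ v] exI[of _ e] exI[of _ f]) (use K.ends_subset[OF ef(1)] in auto)
    have "corresponding_circuit H L (\<phi> (\<Union>i\<in>I. \<pi>1 i)) = (\<Union>i\<in>I. \<pi> i)" if I: "I \<in> \<I>" for I
    proof -
      have 1: "(\<Union>i\<in>I. \<pi> i) \<in> even_circuits H" using circuits[OF fr less.prems(3) I] by blast
      have 2: "(\<Union>i\<in>I. \<pi> i - {e, f}) \<in> even_circuits L" using circuits[OF LL(2) card I] by blast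
      have 3: "(\<Union>i\<in>I. \<pi> i) \<inter> edges L = (\<Union>i\<in>I. \<pi> i - {e, f})"
        using circ_edges[of H "(\<Union>i\<in>I. \<pi> i)"] 1 by (auto simp: L_simps even_circuits_circ)
      show ?thesis using corresponding(4)[OF 2 1 3] \<phi>(2) I by simp
    qed
    then show ?thesis using even_splitting.step[OF \<phi>(1) evs] by (intro exI[of _ "\<lambda>D. corresponding_circuit H L (\<phi> D)"]) simp
  qed
qed

section \<open>Circuits in subdivisions of the three models\<close>

declare One_nat_def [simp del]

lemma nth_Cons_1 [simp]: "(x # xs) ! 1 = xs ! 0"
  by (simp add: One_nat_def)

definition theta_model :: "(nat \<times> nat) list" where
  "theta_model = [(0, 1), (0, 1), (0, 1)]"

definition K4_model :: "(nat \<times> nat) list" where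
  "K4_model = [(0, 1), (0, 2), (0, 3), (1, 2), (1, 3), (2, 3)]"

text \<open>Digons with the ends 0, 1 and 2, 3 and 4, 5, followed by the three connecting edges.\<close>

definition ring_model :: "(nat \<times> nat) list" where
  "ring_model = [(0, 1), (0, 1), (2, 3), (2, 3), (4, 5), (4, 5), (1, 2), (3, 4), (5, 0)]"

text \<open>Quantifiers over the indices of a model become finite conjunctions, so that the lookups
  in its edge list can be evaluated.\<close>

lemma all_less:
  "(\<forall>i<3::nat. P i) \<longleftrightarrow> P 0 \<and> P 1 \<and> P 2"
  "(\<forall>i<6::nat. P i) \<longleftrightarrow> P 0 \<and> P 1 \<and> P 2 \<and> P 3 \<and> P 4 \<and> P 5"
  "(\<forall>i<9::nat. P i) \<longleftrightarrow> P 0 \<and> P 1 \<and> P 2 \<and> P 3 \<and> P 4 \<and> P 5 \<and> P 6 \<and> P 7 \<and> P 8"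
  "(\<forall>i<1::nat. P i) \<longleftrightarrow> P 0"
  "(\<forall>i<2::nat. P i) \<longleftrightarrow> P 0 \<and> P 1"
  "(\<forall>i<4::nat. P i) \<longleftrightarrow> P 0 \<and> P 1 \<and> P 2 \<and> P 3"
  "(\<forall>i<5::nat. P i) \<longleftrightarrow> P 0 \<and> P 1 \<and> P 2 \<and> P 3 \<and> P 4"
  "(\<forall>i<7::nat. P i) \<longleftrightarrow> P 0 \<and> P 1 \<and> P 2 \<and> P 3 \<and> P 4 \<and> P 5 \<and> P 6"
  "(\<forall>i<8::nat. P i) \<longleftrightarrow> P 0 \<and> P 1 \<and> P 2 \<and> P 3 \<and> P 4 \<and> P 5 \<and> P 6 \<and> P 7"
  by (simp_all add: eval_nat_numeral All_less_Suc conj_ac One_nat_def)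

lemma ex_less:
  "(\<exists>i<3::nat. P i) \<longleftrightarrow> P 0 \<or> P 1 \<or> P 2"
  "(\<exists>i<6::nat. P i) \<longleftrightarrow> P 0 \<or> P 1 \<or> P 2 \<or> P 3 \<or> P 4 \<or> P 5"
  "(\<exists>i<9::nat. P i) \<longleftrightarrow> P 0 \<or> P 1 \<or> P 2 \<or> P 3 \<or> P 4 \<or> P 5 \<or> P 6 \<or> P 7 \<or> P 8"
  by (simp_all add: eval_nat_numeral Ex_less_Suc disj_ac One_nat_def)

lemma theta_model_simps:
  "length theta_model = 3" "theta_model ! 0 = (0, 1)" "theta_model ! 1 = (0, 1)" "theta_model ! 2 = (0, 1)"
  by (simp_all add: theta_model_def)

lemma K4_model_simps:
  "length K4_model = 6" "K4_model ! 0 = (0, 1)" "K4_model ! 1 = (0, 2)" "K4_model ! 2 = (0, 3)"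
  "K4_model ! 3 = (1, 2)" "K4_model ! 4 = (1, 3)" "K4_model ! 5 = (2, 3)"
  by (simp_all add: K4_model_def)

lemma ring_model_simps:
  "length ring_model = 9" "ring_model ! 0 = (0, 1)" "ring_model ! 1 = (0, 1)" "ring_model ! 2 = (2, 3)"
  "ring_model ! 3 = (2, 3)" "ring_model ! 4 = (4, 5)" "ring_model ! 5 = (4, 5)" "ring_model ! 6 = (1, 2)"
  "ring_model ! 7 = (3, 4)" "ring_model ! 8 = (5, 0)"
  by (simp_all add: ring_model_def)

lemma lessThan_numerals:
  "{..<3::nat} = {0, 1, 2}" "{..<6::nat} = {0, 1, 2, 3, 4, 5}" "{..<9::nat} = {0, 1, 2, 3, 4, 5, 6, 7, 8}"
  "{..<10::nat} = {0, 1, 2, 3, 4, 5, 6, 7, 8, 9}" "{..<12::nat} = {0, 1, 2, 3, 4, 5, 6, 7, 8, 9, 10, 11}"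
  by (simp_all add: eval_nat_numeral lessThan_Suc insert_commute One_nat_def)

lemma quad_circ:
  assumes p: "spath G x0 P p x1" "spath G x1 Q q x2" "spath G x2 R r x3" "spath G x0 S s x3"
    and i: "P \<inter> Q = {x1}" "Q \<inter> R = {x2}" "P \<inter> R = {}" "P \<inter> S = {x0}" "R \<inter> S = {x3}" "Q \<inter> S = {}"
  shows "circ G (p \<union> q \<union> r \<union> s)"
proof (rule circI)
  show "x0 \<noteq> x3" using disjoint_neq[OF i(3) spath_start[OF p(1)] spath_end[OF p(3)]] .
  show "spath G x0 (P \<union> Q \<union> R) (p \<union> q \<union> r) x3" using spath_app3(1)[OF p(1-3) i(1-3)] .
  show "spath G x0 S s x3" by (rule p(4))
  show "(P \<union> Q \<union> R) \<inter> S = {x0, x3}" by (simp add: Int_Un_distrib2 i insert_commute)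
  show "(p \<union> q \<union> r) \<inter> s = {}"
    using spath_disjoint1[OF p(1,4) i(4)] spath_disjoint0[OF p(2,4) i(6)] spath_disjoint1[OF p(3,4) i(5)] by blast
qed

text \<open>An intersection such as \<open>{t1} \<inter> {s2}\<close> covers two situations at once:
  the connecting path is trivial and the neighbouring sides share its only vertex, or it is not and
  they are disjoint.\<close>

lemma hexagon_circ:
  assumes p: "spath G s1 P1 p1 t1" "spath G s2 P2 p2 t2" "spath G s3 P3 p3 t3"
     "spath G t1 C12 c12 s2" "spath G t2 C23 c23 s3" "spath G t3 C31 c31 s1" and "s1 \<noteq> t1"
    and i: "P1 \<inter> P2 = {t1} \<inter> {s2}" "P2 \<inter> P3 = {t2} \<inter> {s3}" "P3 \<inter> P1 = {t3} \<inter> {s1}"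
     "P1 \<inter> C12 = {t1}" "P2 \<inter> C12 = {s2}" "P3 \<inter> C12 = {}"
     "P2 \<inter> C23 = {t2}" "P3 \<inter> C23 = {s3}" "P1 \<inter> C23 = {}"
     "P3 \<inter> C31 = {t3}" "P1 \<inter> C31 = {s1}" "P2 \<inter> C31 = {}"
     "C12 \<inter> C23 = {}" "C23 \<inter> C31 = {}" "C31 \<inter> C12 = {}"
  shows "circ G (p1 \<union> p2 \<union> p3 \<union> (c12 \<union> c23 \<union> c31))"
proof -
  note ii = i i[THEN Int_sym]
  note m = spath_ends[OF p(4)] spath_ends[OF p(5)] spath_ends[OF p(6)]
  note 1 = spath_app3(1)[OF p(4,2,5)]
  have 2: "spath G t1 (C12 \<union> P2 \<union> C23) (c12 \<union> p2 \<union> c23) s3" by (rule 1) (simp_all add: ii)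
  have 3: "spath G t1 (C12 \<union> P2 \<union> C23 \<union> P3 \<union> C31) (c12 \<union> p2 \<union> c23 \<union> p3 \<union> c31) s1"
    by (rule spath_app3(1)[OF 2 p(3) p(6)]) (auto simp: Int_Un_distrib2 ii)
  have "circ G (p1 \<union> (c12 \<union> p2 \<union> c23 \<union> p3 \<union> c31))"
  proof (rule circI[OF assms(7) p(1) spath_rev[OF 3]])
    show "P1 \<inter> (C12 \<union> P2 \<union> C23 \<union> P3 \<union> C31) = {s1, t1}" by (auto simp: Int_Un_distrib ii)
    show "p1 \<inter> (c12 \<union> p2 \<union> c23 \<union> p3 \<union> c31) = {}"
      using spath_disjoint1[OF p(1,4) i(4)] spath_disjoint2[OF p(1,2) i(1)] spath_disjoint0[OF p(1,5) i(9)]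
        spath_disjoint2[OF p(3,1) i(3)] spath_disjoint1[OF p(1,6) i(11)] by blast
  qed
  moreover have "p1 \<union> (c12 \<union> p2 \<union> c23 \<union> p3 \<union> c31) = p1 \<union> p2 \<union> p3 \<union> (c12 \<union> c23 \<union> c31)" by blast
  ultimately show ?thesis by simp
qed

lemma Int_eqI1: "S \<inter> T \<subseteq> A \<Longrightarrow> S \<inter> T \<subseteq> B \<Longrightarrow> z \<in> S \<Longrightarrow> z \<in> T \<Longrightarrow> A \<inter> B \<subseteq> {z} \<Longrightarrow> S \<inter> T = {z}" by blast

lemma Int_eqI0: "S \<inter> T \<subseteq> A \<Longrightarrow> S \<inter> T \<subseteq> B \<Longrightarrow> A \<inter> B \<subseteq> {} \<Longrightarrow> S \<inter> T = {}" by blast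

lemma Int_eqI2: "S \<inter> T \<subseteq> A \<Longrightarrow> S \<inter> T \<subseteq> B \<Longrightarrow> z \<in> S \<Longrightarrow> z' \<in> T \<Longrightarrow> A \<inter> B \<subseteq> {z} \<inter> {z'} \<Longrightarrow> S \<inter> T = {z} \<inter> {z'}" by blast

lemma theta_circuits:
  assumes fr: "frame theta_model H \<nu> \<sigma> \<pi>" and n: "\<And>i. i < 3 \<Longrightarrow> \<pi> i \<noteq> {}"
  shows "circ H (\<pi> 0 \<union> \<pi> 1)" "circ H (\<pi> 1 \<union> \<pi> 2)" "circ H (\<pi> 0 \<union> \<pi> 2)"
proof -
  have ne: "\<nu> 0 \<noteq> \<nu> 1" using frameD(5)[OF fr, of 0 0 0 1] n by (auto simp: theta_model_simps)
  have p: "spath H (\<nu> 0) (\<sigma> i) (\<pi> i) (\<nu> 1)" if "i < 3" for i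
  proof -
    have "i \<in> {..<3}" using that by simp
    then show ?thesis using frameD(1)[OF fr, of i] unfolding lessThan_numerals by (auto simp: theta_model_simps)
  qed
  have "circ H (\<pi> i \<union> \<pi> j)" if "i < 3" "j < 3" "i \<noteq> j" for i j
  proof (rule circI[OF ne p[OF that(1)] p[OF that(2)]])
    have l: "length theta_model = 3" by (simp add: theta_model_simps)
    have "i \<in> {..<3}" using that by simp
    then have "\<nu> ` joins theta_model i = {\<nu> 0, \<nu> 1}" unfolding lessThan_numerals by (auto simp: theta_model_simps)
    then have "\<sigma> i \<inter> \<sigma> j \<subseteq> {\<nu> 0, \<nu> 1}" using frameD(2)[OF fr, of i j] that l by simp
    then show "\<sigma> i \<inter> \<sigma> j = {\<nu> 0, \<nu> 1}" using spath_ends[OF p[OF that(1)]] spath_ends[OF p[OF that(2)]] by blast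
    show "\<pi> i \<inter> \<pi> j = {}" using frameD(4)[OF fr, of i j] that l by simp
  qed
  then show "circ H (\<pi> 0 \<union> \<pi> 1)" "circ H (\<pi> 1 \<union> \<pi> 2)" "circ H (\<pi> 0 \<union> \<pi> 2)" by simp_all
qed

lemma K4_circuits:
  assumes fr: "frame K4_model H \<nu> \<sigma> \<pi>" and n: "\<And>i. i < 6 \<Longrightarrow> \<pi> i \<noteq> {}"
  shows "circ H (\<pi> 0 \<union> \<pi> 3 \<union> \<pi> 5 \<union> \<pi> 2)" "circ H (\<pi> 0 \<union> \<pi> 4 \<union> \<pi> 5 \<union> \<pi> 1)" "circ H (\<pi> 1 \<union> \<pi> 3 \<union> \<pi> 4 \<union> \<pi> 2)"
proof -
  have l: "length K4_model = 6" by (simp add: K4_model_simps)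
  note d = frameD[OF fr, unfolded l]
  have E: "joins K4_model 0 = {0, 1}" "joins K4_model 1 = {0, 2}" "joins K4_model 2 = {0, 3}"
    "joins K4_model 3 = {1, 2}" "joins K4_model 4 = {1, 3}" "joins K4_model 5 = {2, 3}" by (simp_all add: K4_model_simps)
  have ker: "\<nu> x = \<nu> y \<longleftrightarrow> x = y" if "i < 6" "j < 6" "x \<in> joins K4_model i" "y \<in> joins K4_model j" for i j x y
    using d(5)[OF that] n by blast
  have ne: "\<nu> 0 \<noteq> \<nu> 1" "\<nu> 0 \<noteq> \<nu> 2" "\<nu> 0 \<noteq> \<nu> 3" "\<nu> 1 \<noteq> \<nu> 2" "\<nu> 1 \<noteq> \<nu> 3" "\<nu> 2 \<noteq> \<nu> 3"
    using ker[of 0 5 0 2] ker[of 0 5 0 3] ker[of 0 5 1 2] ker[of 0 5 1 3] ker[of 0 0 0 1] ker[of 5 5 2 3]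
    unfolding E by simp_all
  have p: "spath H (\<nu> 0) (\<sigma> 0) (\<pi> 0) (\<nu> 1)" "spath H (\<nu> 0) (\<sigma> 1) (\<pi> 1) (\<nu> 2)" "spath H (\<nu> 0) (\<sigma> 2) (\<pi> 2) (\<nu> 3)"
    "spath H (\<nu> 1) (\<sigma> 3) (\<pi> 3) (\<nu> 2)" "spath H (\<nu> 1) (\<sigma> 4) (\<pi> 4) (\<nu> 3)" "spath H (\<nu> 2) (\<sigma> 5) (\<pi> 5) (\<nu> 3)"
    using d(1)[of 0] d(1)[of 1] d(1)[of 2] d(1)[of 3] d(1)[of 4] d(1)[of 5] by (simp_all add: K4_model_simps)
  have m: "\<nu> 0 \<in> \<sigma> 0" "\<nu> 1 \<in> \<sigma> 0" "\<nu> 0 \<in> \<sigma> 1" "\<nu> 2 \<in> \<sigma> 1" "\<nu> 0 \<in> \<sigma> 2" "\<nu> 3 \<in> \<sigma> 2"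
    "\<nu> 1 \<in> \<sigma> 3" "\<nu> 2 \<in> \<sigma> 3" "\<nu> 1 \<in> \<sigma> 4" "\<nu> 3 \<in> \<sigma> 4" "\<nu> 2 \<in> \<sigma> 5" "\<nu> 3 \<in> \<sigma> 5" using p spath_ends by metis+
  note ne' = ne ne[symmetric]
  have i: "\<sigma> 0 \<inter> \<sigma> 1 = {\<nu> 0}" "\<sigma> 0 \<inter> \<sigma> 2 = {\<nu> 0}" "\<sigma> 1 \<inter> \<sigma> 2 = {\<nu> 0}" "\<sigma> 0 \<inter> \<sigma> 3 = {\<nu> 1}" "\<sigma> 0 \<inter> \<sigma> 4 = {\<nu> 1}" "\<sigma> 3 \<inter> \<sigma> 4 = {\<nu> 1}"
    "\<sigma> 1 \<inter> \<sigma> 3 = {\<nu> 2}" "\<sigma> 1 \<inter> \<sigma> 5 = {\<nu> 2}" "\<sigma> 3 \<inter> \<sigma> 5 = {\<nu> 2}" "\<sigma> 2 \<inter> \<sigma> 4 = {\<nu> 3}" "\<sigma> 2 \<inter> \<sigma> 5 = {\<nu> 3}" "\<sigma> 4 \<inter> \<sigma> 5 = {\<nu> 3}"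
    by (rule Int_eqI1[OF d(2) d(3)]; simp add: E m ne')+
  have i0: "\<sigma> 0 \<inter> \<sigma> 5 = {}" "\<sigma> 1 \<inter> \<sigma> 4 = {}" "\<sigma> 2 \<inter> \<sigma> 3 = {}"
    by (rule Int_eqI0[OF d(2) d(3)]; simp add: E ne')+
  note ii = i i0 i[THEN Int_sym] i0[THEN Int_sym]
  show "circ H (\<pi> 0 \<union> \<pi> 3 \<union> \<pi> 5 \<union> \<pi> 2)" by (rule quad_circ[OF p(1,4,6,3)]) (simp_all add: ii)
  show "circ H (\<pi> 0 \<union> \<pi> 4 \<union> \<pi> 5 \<union> \<pi> 1)" by (rule quad_circ[OF p(1,5) spath_rev[OF p(6)] p(2)]) (simp_all add: ii)
  show "circ H (\<pi> 1 \<union> \<pi> 3 \<union> \<pi> 4 \<union> \<pi> 2)" by (rule quad_circ[OF p(2) spath_rev[OF p(4)] p(5) p(3)]) (simp_all add: ii)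
qed

lemma ring_circuits:
  assumes fr: "frame ring_model H \<nu> \<sigma> \<pi>" and n: "\<And>i. i < 6 \<Longrightarrow> \<pi> i \<noteq> {}"
  shows "i \<in> {0, 1} \<Longrightarrow> j \<in> {2, 3} \<Longrightarrow> k \<in> {4, 5} \<Longrightarrow> circ H (\<pi> i \<union> \<pi> j \<union> \<pi> k \<union> (\<pi> 6 \<union> \<pi> 7 \<union> \<pi> 8))"
    "circ H (\<pi> 0 \<union> \<pi> 1)" "circ H (\<pi> 2 \<union> \<pi> 3)" "circ H (\<pi> 4 \<union> \<pi> 5)"
proof -
  have l: "length ring_model = 9" by (simp add: ring_model_simps)
  note d = frameD[OF fr, unfolded l]
  have E: "joins ring_model 0 = {0, 1}" "joins ring_model 1 = {0, 1}" "joins ring_model 2 = {2, 3}" "joins ring_model 3 = {2, 3}"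
    "joins ring_model 4 = {4, 5}" "joins ring_model 5 = {4, 5}" "joins ring_model 6 = {1, 2}" "joins ring_model 7 = {3, 4}" "joins ring_model 8 = {5, 0}"
    by (simp_all add: ring_model_simps)
  \<comment> \<open>Only the connecting edges may be trivial, so at most the ends of these three
    edges are identified.\<close>
  have ker: "(x, y) \<notin> {(1, 2), (2, 1), (3, 4), (4, 3), (5, 0), (0, 5)} \<Longrightarrow> x \<noteq> y \<Longrightarrow> \<nu> x \<noteq> \<nu> y" if xy: "x \<in> {0, 1, 2, 3, 4, 5}" "y \<in> {0, 1, 2, 3, 4, 5}" for x y
  proof
    assume a: "(x, y) \<notin> {(1, 2), (2, 1), (3, 4), (4, 3), (5, 0), (0, 5)}" "x \<noteq> y" "\<nu> x = \<nu> y"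
    obtain i j where ij: "i < 9" "j < 9" "x \<in> joins ring_model i" "y \<in> joins ring_model j"
    proof -
      have "\<exists>i<9. x \<in> joins ring_model i" "\<exists>i<9. y \<in> joins ring_model i" using xy unfolding ex_less E by auto
      then show ?thesis using that by blast
    qed
    have "\<exists>k<9. \<pi> k = {} \<and> {x, y} = joins ring_model k" using d(5)[OF ij] a by simp
    then have "(x, y) \<in> {(1, 2), (2, 1), (3, 4), (4, 3), (5, 0), (0, 5)}" unfolding ex_less E using n by (auto simp: doubleton_eq_iff)
    then show False using a(1) by blast
  qed
  have ne: "\<nu> 0 \<noteq> \<nu> 1" "\<nu> 0 \<noteq> \<nu> 2" "\<nu> 0 \<noteq> \<nu> 3" "\<nu> 0 \<noteq> \<nu> 4" "\<nu> 1 \<noteq> \<nu> 3" "\<nu> 1 \<noteq> \<nu> 4" "\<nu> 1 \<noteq> \<nu> 5" "\<nu> 2 \<noteq> \<nu> 3" "\<nu> 2 \<noteq> \<nu> 4" "\<nu> 2 \<noteq> \<nu> 5"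
     "\<nu> 3 \<noteq> \<nu> 5" "\<nu> 4 \<noteq> \<nu> 5" by (rule ker; simp)+
  note ne' = ne ne[symmetric]
  have p: "spath H (\<nu> 0) (\<sigma> 0) (\<pi> 0) (\<nu> 1)" "spath H (\<nu> 0) (\<sigma> 1) (\<pi> 1) (\<nu> 1)" "spath H (\<nu> 2) (\<sigma> 2) (\<pi> 2) (\<nu> 3)"
    "spath H (\<nu> 2) (\<sigma> 3) (\<pi> 3) (\<nu> 3)" "spath H (\<nu> 4) (\<sigma> 4) (\<pi> 4) (\<nu> 5)" "spath H (\<nu> 4) (\<sigma> 5) (\<pi> 5) (\<nu> 5)"
    "spath H (\<nu> 1) (\<sigma> 6) (\<pi> 6) (\<nu> 2)" "spath H (\<nu> 3) (\<sigma> 7) (\<pi> 7) (\<nu> 4)" "spath H (\<nu> 5) (\<sigma> 8) (\<pi> 8) (\<nu> 0)"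
    using d(1)[of 0] d(1)[of 1] d(1)[of 2] d(1)[of 3] d(1)[of 4] d(1)[of 5] d(1)[of 6] d(1)[of 7] d(1)[of 8] by (simp_all add: ring_model_simps)
  have digon: "circ H (\<pi> i \<union> \<pi> j)"
    if "i < 9" "j < 9" "i \<noteq> j" "\<nu> x \<noteq> \<nu> y" "spath H (\<nu> x) (\<sigma> i) (\<pi> i) (\<nu> y)" "spath H (\<nu> x) (\<sigma> j) (\<pi> j) (\<nu> y)" "joins ring_model i = {x, y}" for i j x y
  proof (rule circI[OF that(4-6)])
    have "\<sigma> i \<inter> \<sigma> j \<subseteq> {\<nu> x, \<nu> y}" using d(2)[OF that(1-3)] that(7) by simp
    then show "\<sigma> i \<inter> \<sigma> j = {\<nu> x, \<nu> y}" using spath_ends[OF that(5)] spath_ends[OF that(6)] by blast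
    show "\<pi> i \<inter> \<pi> j = {}" using d(4)[OF that(1-3)] .
  qed
  show "circ H (\<pi> 0 \<union> \<pi> 1)" by (rule digon[OF _ _ _ ne(1) p(1,2)]) (simp_all add: E)
  show "circ H (\<pi> 2 \<union> \<pi> 3)" by (rule digon[OF _ _ _ ne(8) p(3,4)]) (simp_all add: E)
  show "circ H (\<pi> 4 \<union> \<pi> 5)" by (rule digon[OF _ _ _ ne(12) p(5,6)]) (simp_all add: E)
  assume ijk: "i \<in> {0, 1}" "j \<in> {2, 3}" "k \<in> {4, 5}"
  have q: "spath H (\<nu> 0) (\<sigma> i) (\<pi> i) (\<nu> 1)" "spath H (\<nu> 2) (\<sigma> j) (\<pi> j) (\<nu> 3)" "spath H (\<nu> 4) (\<sigma> k) (\<pi> k) (\<nu> 5)"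
    using ijk p by auto
  have Eijk: "joins ring_model i = {0, 1}" "joins ring_model j = {2, 3}" "joins ring_model k = {4, 5}"
    using ijk by (auto simp: ring_model_simps)
  have lt: "i < 9" "j < 9" "k < 9" "i \<noteq> j" "j \<noteq> k" "k \<noteq> i" "i \<noteq> 6" "j \<noteq> 6" "k \<noteq> 6" "i \<noteq> 7" "j \<noteq> 7" "k \<noteq> 7" "i \<noteq> 8" "j \<noteq> 8" "k \<noteq> 8"
    using ijk by auto
  have m: "\<nu> 0 \<in> \<sigma> i" "\<nu> 1 \<in> \<sigma> i" "\<nu> 2 \<in> \<sigma> j" "\<nu> 3 \<in> \<sigma> j" "\<nu> 4 \<in> \<sigma> k" "\<nu> 5 \<in> \<sigma> k"
    "\<nu> 1 \<in> \<sigma> 6" "\<nu> 2 \<in> \<sigma> 6" "\<nu> 3 \<in> \<sigma> 7" "\<nu> 4 \<in> \<sigma> 7" "\<nu> 5 \<in> \<sigma> 8" "\<nu> 0 \<in> \<sigma> 8" using p q spath_ends by metis+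
  show "circ H (\<pi> i \<union> \<pi> j \<union> \<pi> k \<union> (\<pi> 6 \<union> \<pi> 7 \<union> \<pi> 8))"
  proof (rule hexagon_circ[OF q p(7,8,9) ne(1)])
    show "\<sigma> i \<inter> \<sigma> j = {\<nu> 1} \<inter> {\<nu> 2}" "\<sigma> j \<inter> \<sigma> k = {\<nu> 3} \<inter> {\<nu> 4}" "\<sigma> k \<inter> \<sigma> i = {\<nu> 5} \<inter> {\<nu> 0}"
      by (rule Int_eqI2[OF d(2) d(3)]; auto simp add: Eijk m ne' lt)+
    show "\<sigma> i \<inter> \<sigma> 6 = {\<nu> 1}" "\<sigma> j \<inter> \<sigma> 6 = {\<nu> 2}" "\<sigma> j \<inter> \<sigma> 7 = {\<nu> 3}" "\<sigma> k \<inter> \<sigma> 7 = {\<nu> 4}" "\<sigma> k \<inter> \<sigma> 8 = {\<nu> 5}" "\<sigma> i \<inter> \<sigma> 8 = {\<nu> 0}"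
      by (rule Int_eqI1[OF d(2) d(3)]; auto simp add: Eijk E m ne' lt)+
    show "\<sigma> k \<inter> \<sigma> 6 = {}" "\<sigma> i \<inter> \<sigma> 7 = {}" "\<sigma> j \<inter> \<sigma> 8 = {}" "\<sigma> 6 \<inter> \<sigma> 7 = {}" "\<sigma> 7 \<inter> \<sigma> 8 = {}" "\<sigma> 8 \<inter> \<sigma> 6 = {}"
      by (rule Int_eqI0[OF d(2) d(3)]; auto simp add: Eijk E ne' lt)+
  qed
qed

text \<open>\<open>c\<close> stands for the lengths of the branches in the graph before subdivision,
  which have the same parities.\<close>

lemma frame_circuit_even:
  assumes fr: "frame ps H \<nu> \<sigma> \<pi>" and I: "I \<subseteq> {..<length ps}"
    and par: "\<And>i. i < length ps \<Longrightarrow> even (card (\<pi> i) + c i)" "even (\<Sum>i\<in>I. c i)"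
    and circ: "circ H (\<Union>i\<in>I. \<pi> i)"
  shows "(\<Union>i\<in>I. \<pi> i) \<in> even_circuits H"
proof -
  have fin: "finite I" using I finite_subset by blast
  have "card (\<Union>i\<in>I. \<pi> i) = (\<Sum>i\<in>I. card (\<pi> i))"
  proof (rule card_UN_disjoint[OF fin])
    show "\<forall>i\<in>I. finite (\<pi> i)" using spath_finite[OF frameD(1)[OF fr]] I by blast
    show "\<forall>i\<in>I. \<forall>j\<in>I. i \<noteq> j \<longrightarrow> \<pi> i \<inter> \<pi> j = {}" using frameD(4)[OF fr] I by blast
  qed
  moreover have "even (\<Sum>i\<in>I. card (\<pi> i) + c i)" using par(1) I by (intro dvd_sum) auto
  ultimately show ?thesis using par(2) circ by (simp add: even_circuits_circ sum.distrib)
qed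

section \<open>The nine graphs\<close>

lemma spath_two:
  assumes "e \<in> edges G" "f \<in> edges G" "ends G e = {x, m}" "ends G f = {m, y}" "x \<noteq> m" "m \<noteq> y" "x \<noteq> y"
  shows "spath G x {x, m, y} {e, f} y"
  using spath.step[OF assms(1,3) _ spath_single[OF assms(2,4,6)]] assms(5,7) by simp

text \<open>Degrees yield linear conditions modulo 2 on membership of edges. For a concrete graph
  they express a circuit through a few free edges and leave finitely many cases.\<close>

lemma circ_at:
  assumes "circ G C" "{e \<in> edges G. x \<in> ends G e} = A"
  shows "card (C \<inter> A) = 0 \<or> card (C \<inter> A) = 2"
proof -
  have "incident G C x = C \<inter> A" using circ_edges[OF assms(1)] assms(2) by (auto simp: incident_def)
  then show ?thesis using circ_incident[OF assms(1), of x] by simp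
qed

lemma card_Int_insert: "finite A \<Longrightarrow> a \<notin> A \<Longrightarrow> card (C \<inter> insert a A) = of_bool (a \<in> C) + card (C \<inter> A)"
  by (cases "a \<in> C") simp_all

lemma circ_degree_two:
  assumes "circ G C" "{e \<in> edges G. x \<in> ends G e} = {i, j}" "i \<noteq> j"
  shows "i \<in> C \<longleftrightarrow> j \<in> C"
  using circ_at[OF assms(1,2)] assms(3) by (auto simp: card_Int_insert of_bool_def split: if_splits)

lemma circ_degree_three:
  assumes "circ G C" "{e \<in> edges G. x \<in> ends G e} = {i, j, k}" "distinct [i, j, k]"
  shows "i \<in> C \<longleftrightarrow> (j \<in> C) \<noteq> (k \<in> C)"
  using circ_at[OF assms(1,2)] assms(3) by (auto simp: card_Int_insert of_bool_def split: if_splits)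

lemma circ_degree_four:
  assumes "circ G C" "{e \<in> edges G. x \<in> ends G e} = {i, j, k, l}" "distinct [i, j, k, l]"
  shows "i \<in> C \<longleftrightarrow> (j \<in> C) \<noteq> ((k \<in> C) \<noteq> (l \<in> C))" "\<not> (i \<in> C \<and> j \<in> C \<and> k \<in> C \<and> l \<in> C)"
  using circ_at[OF assms(1,2)] assms(3) by (auto simp: card_Int_insert of_bool_def split: if_splits)

lemma members_insert:
  "{D \<in> insert A S. P D} = (if P A then insert A {D \<in> S. P D} else {D \<in> S. P D})" "{D \<in> {}. P D} = {}"
  by auto

text \<open>Here properness of the colouring is tested on the directed pairs, which can be computed
  for a concrete orientation.\<close>

lemma clockwise_parity_colouring:
  assumes d: "orientation G d" and C: "C \<in> even_circuits G" and c: "\<forall>e\<in>C. c (fst (d e)) \<noteq> c (snd (d e))"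
  shows "clockwise_parity G d C = Clockwise_even \<longleftrightarrow> even (card {e \<in> C. c (fst (d e))} + card C div 2)"
proof (rule clockwise_parity_proper[OF d C])
  have "C \<subseteq> edges G" using C by (auto simp: even_circuits_circ dest: circ_edges)
  then show "proper G c C" using c d unfolding proper_def orientation_def by (metis subsetD)
qed

lemma O1_simps:
  "verts O1 = {0, 1, 2, 3, 4}" "edges O1 = {0, 1, 2, 3, 4, 5}"
  "ends O1 0 = {0, 2}" "ends O1 1 = {0, 3}" "ends O1 2 = {0, 4}" "ends O1 3 = {1, 2}" "ends O1 4 = {1, 3}" "ends O1 5 = {1, 4}"
  by (auto simp: O1_def graph_of_def lessThan_numerals)

lemma O1_multigraph: "multigraph O1"
  by unfold_locales (auto simp: O1_simps)

lemma O1_frame: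
  "frame theta_model O1 ((!) [0, 1])
    ((!) [{0, 2, 1}, {0, 3, 1}, {0, 4, 1}])
    ((!) [{0, 3}, {1, 4}, {2, 5}])"
proof -
  have 0: "spath O1 0 {0, 2, 1} {0, 3} 1" by (rule spath_two) (auto simp: O1_simps)
  have 1: "spath O1 0 {0, 3, 1} {1, 4} 1" by (rule spath_two) (auto simp: O1_simps)
  have 2: "spath O1 0 {0, 4, 1} {2, 5} 1" by (rule spath_two) (auto simp: O1_simps)
  show ?thesis
    unfolding frame_def using 0 1 2
    by (simp add: theta_model_simps all_less ex_less lessThan_numerals O1_simps insert_commute)
qed

lemma O1_nonempty: "i < 3 \<Longrightarrow> ([{0, 3}, {1, 4}, {2, 5}] :: nat set list) ! i \<noteq> {}"
  using all_less(1)[of "\<lambda>i. ([{0, 3}, {1, 4}, {2, 5}] :: nat set list) ! i \<noteq> {}"] by simp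

text \<open>The degree conditions determine \<open>C\<close> from the membership of the edges 4 and
  5. Of the four cases one is empty, and the other three are the circuits of a theta.\<close>

lemma O1_even_circuits:
  "even_circuits O1 =
    {{0, 1, 3, 4}, {0, 2, 3, 5}, {1, 2, 4, 5}}"
proof (intro equalityI subsetI)
  fix C assume "C \<in> even_circuits O1"
  then have C: "circ O1 C" "even (card C)" by (auto simp: even_circuits_circ)
  define m where "m = (\<lambda>i. i \<in> C)"
  have "C \<subseteq> set [0, 1, 2, 3, 4, 5]" using circ_edges[OF C(1)] by (simp add: O1_simps)
  then have Ceq: "C = set (filter m [0, 1, 2, 3, 4, 5])" unfolding m_def set_filter by blast
  have e3: "m 3 = (m 4 \<noteq> m 5)"
    unfolding m_def by (rule circ_degree_three[OF C(1), of 1]) (auto simp: O1_simps)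
  have e2: "m 2 = m 5"
    unfolding m_def by (rule circ_degree_two[OF C(1), of 4]) (auto simp: O1_simps)
  have e1: "m 1 = m 4"
    unfolding m_def by (rule circ_degree_two[OF C(1), of 3]) (auto simp: O1_simps)
  have e0: "m 0 = m 3"
    unfolding m_def by (rule circ_degree_two[OF C(1), of 2]) (auto simp: O1_simps)
  have ne: "C \<noteq> {}" using circ_nonempty C(1) by blast
  show "C \<in> {{0, 1, 3, 4}, {0, 2, 3, 5}, {1, 2, 4, 5}}"
    using C(2) ne   unfolding Ceq
    by (cases "m 4"; cases "m 5"; simp add: e3 e2 e1 e0)
next
  fix C :: "nat set"
  assume C: "C \<in> {{0, 1, 3, 4}, {0, 2, 3, 5}, {1, 2, 4, 5}}"
  note c = theta_circuits[OF O1_frame O1_nonempty]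
  have "circ O1 C" using C c by (auto simp: insert_commute)
  moreover have "even (card C)" using C by auto
  ultimately show "C \<in> even_circuits O1" by (simp add: even_circuits_circ)
qed

interpretation O1: base_graph O1
proof -
  interpret multigraph O1 by (rule O1_multigraph)
  show "base_graph O1"
  proof
    fix i :: nat
    show "even (card {D \<in> even_circuits O1. i \<in> D})"
    proof (cases "i \<in> {0, 1, 2, 3, 4, 5}")
      case True
      then show ?thesis unfolding O1_even_circuits members_insert by (elim insertE emptyE) (simp_all add: set_eq_subset)
    next
      case False
      then have "{D \<in> even_circuits O1. i \<in> D} = {}" unfolding O1_even_circuits by auto
      then show ?thesis by (metis card.empty even_zero)
    qed
  qed
qed

text \<open>The edges are directed as in the list that defines the graph, and each set given for
  \<open>c\<close> is a colour class of the circuit concerned. All three circuits turn out clockwise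
  even. This odd number sets \<open>O1\<close> and \<open>O2\<close> apart from the other seven
  graphs and is the origin of the different parity in their condition.\<close>

lemma O1_parity:
  "\<exists>d. orientation O1 d \<and> odd (card {D \<in> even_circuits O1. clockwise_parity O1 d D = Clockwise_even})"
proof -
  define d :: "nat \<Rightarrow> nat \<times> nat" where "d = (!) [(0, 2), (0, 3), (0, 4), (1, 2), (1, 3), (1, 4)]"
  have d: "orientation O1 d" by (simp add: orientation_def O1_simps d_def insert_commute)
  have c0: "(clockwise_parity O1 d {0, 1, 3, 4} = Clockwise_even) = True"
    by (subst clockwise_parity_colouring[OF d, where c = "\<lambda>x. x \<in> {2, 3}"]) (simp_all only: O1_even_circuits members_insert, simp_all add: d_def)
  have c1: "(clockwise_parity O1 d {0, 2, 3, 5} = Clockwise_even) = True"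
    by (subst clockwise_parity_colouring[OF d, where c = "\<lambda>x. x \<in> {2, 4}"]) (simp_all only: O1_even_circuits members_insert, simp_all add: d_def)
  have c2: "(clockwise_parity O1 d {1, 2, 4, 5} = Clockwise_even) = True"
    by (subst clockwise_parity_colouring[OF d, where c = "\<lambda>x. x \<in> {3, 4}"]) (simp_all only: O1_even_circuits members_insert, simp_all add: d_def)
  show ?thesis
    by (intro exI[of _ d] conjI d) (simp only: O1_even_circuits members_insert, simp add: set_eq_subset c0 c1 c2)
qed


lemma O2_simps:
  "verts O2 = {0, 1, 2, 3, 4, 5, 6}" "edges O2 = {0, 1, 2, 3, 4, 5, 6, 7, 8}"
  "ends O2 0 = {0, 4}" "ends O2 1 = {4, 1}" "ends O2 2 = {0, 5}" "ends O2 3 = {5, 2}" "ends O2 4 = {0, 6}" "ends O2 5 = {6, 3}" "ends O2 6 = {1, 2}" "ends O2 7 = {2, 3}" "ends O2 8 = {3, 1}"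
  by (auto simp: O2_def graph_of_def lessThan_numerals)

lemma O2_multigraph: "multigraph O2"
  by unfold_locales (auto simp: O2_simps)

text \<open>The edges 8 and 7 appear in this order because the model lists the pair 1, 3 before the
  pair 2, 3.\<close>

lemma O2_frame:
  "frame K4_model O2 ((!) [0, 1, 2, 3])
    ((!) [{0, 4, 1}, {0, 5, 2}, {0, 6, 3}, {1, 2}, {1, 3}, {2, 3}])
    ((!) [{0, 1}, {2, 3}, {4, 5}, {6}, {8}, {7}])"
proof -
  have 0: "spath O2 0 {0, 4, 1} {0, 1} 1" by (rule spath_two) (auto simp: O2_simps)
  have 1: "spath O2 0 {0, 5, 2} {2, 3} 2" by (rule spath_two) (auto simp: O2_simps)
  have 2: "spath O2 0 {0, 6, 3} {4, 5} 3" by (rule spath_two) (auto simp: O2_simps)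
  have 3: "spath O2 1 {1, 2} {6} 2" by (rule spath_single) (auto simp: O2_simps)
  have 4: "spath O2 1 {1, 3} {8} 3" by (rule spath_single) (auto simp: O2_simps)
  have 5: "spath O2 2 {2, 3} {7} 3" by (rule spath_single) (auto simp: O2_simps)
  show ?thesis
    unfolding frame_def using 0 1 2 3 4 5
    by (simp add: K4_model_simps all_less ex_less lessThan_numerals O2_simps insert_commute)
qed

lemma O2_nonempty: "i < 6 \<Longrightarrow> ([{0, 1}, {2, 3}, {4, 5}, {6}, {8}, {7}] :: nat set list) ! i \<noteq> {}"
  using all_less(2)[of "\<lambda>i. ([{0, 1}, {2, 3}, {4, 5}, {6}, {8}, {7}] :: nat set list) ! i \<noteq> {}"] by simp

text \<open>Three free edges give eight solutions of the degree conditions: the empty set, the four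
  subdivided triangles, which have odd length, and the three circuits listed.\<close>

lemma O2_even_circuits:
  "even_circuits O2 =
    {{0, 1, 2, 3, 7, 8}, {0, 1, 4, 5, 6, 7}, {2, 3, 4, 5, 6, 8}}"
proof (intro equalityI subsetI)
  fix C assume "C \<in> even_circuits O2"
  then have C: "circ O2 C" "even (card C)" by (auto simp: even_circuits_circ)
  define m where "m = (\<lambda>i. i \<in> C)"
  have "C \<subseteq> set [0, 1, 2, 3, 4, 5, 6, 7, 8]" using circ_edges[OF C(1)] by (simp add: O2_simps)
  then have Ceq: "C = set (filter m [0, 1, 2, 3, 4, 5, 6, 7, 8])" unfolding m_def set_filter by blast
  have e5: "m 5 = (m 7 \<noteq> m 8)"
    unfolding m_def by (rule circ_degree_three[OF C(1), of 3]) (auto simp: O2_simps)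
  have e3: "m 3 = (m 6 \<noteq> m 7)"
    unfolding m_def by (rule circ_degree_three[OF C(1), of 2]) (auto simp: O2_simps)
  have e1: "m 1 = (m 6 \<noteq> m 8)"
    unfolding m_def by (rule circ_degree_three[OF C(1), of 1]) (auto simp: O2_simps)
  have e4: "m 4 = m 5"
    unfolding m_def by (rule circ_degree_two[OF C(1), of 6]) (auto simp: O2_simps)
  have e2: "m 2 = m 3"
    unfolding m_def by (rule circ_degree_two[OF C(1), of 5]) (auto simp: O2_simps)
  have e0: "m 0 = m 1"
    unfolding m_def by (rule circ_degree_two[OF C(1), of 4]) (auto simp: O2_simps)
  have ne: "C \<noteq> {}" using circ_nonempty C(1) by blast
  show "C \<in> {{0, 1, 2, 3, 7, 8}, {0, 1, 4, 5, 6, 7}, {2, 3, 4, 5, 6, 8}}"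
    using C(2) ne   unfolding Ceq
    by (cases "m 6"; cases "m 7"; cases "m 8"; simp add: e5 e3 e1 e4 e2 e0)
next
  fix C :: "nat set"
  assume C: "C \<in> {{0, 1, 2, 3, 7, 8}, {0, 1, 4, 5, 6, 7}, {2, 3, 4, 5, 6, 8}}"
  note c = K4_circuits[OF O2_frame O2_nonempty]
  have "circ O2 C" using C c by (auto simp: insert_commute)
  moreover have "even (card C)" using C by auto
  ultimately show "C \<in> even_circuits O2" by (simp add: even_circuits_circ)
qed

interpretation O2: base_graph O2
proof -
  interpret multigraph O2 by (rule O2_multigraph)
  show "base_graph O2"
  proof
    fix i :: nat
    show "even (card {D \<in> even_circuits O2. i \<in> D})"
    proof (cases "i \<in> {0, 1, 2, 3, 4, 5, 6, 7, 8}")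
      case True
      then show ?thesis unfolding O2_even_circuits members_insert by (elim insertE emptyE) (simp_all add: set_eq_subset)
    next
      case False
      then have "{D \<in> even_circuits O2. i \<in> D} = {}" unfolding O2_even_circuits by auto
      then show ?thesis by (metis card.empty even_zero)
    qed
  qed
qed

lemma O2_parity:
  "\<exists>d. orientation O2 d \<and> odd (card {D \<in> even_circuits O2. clockwise_parity O2 d D = Clockwise_even})"
proof -
  define d :: "nat \<Rightarrow> nat \<times> nat" where "d = (!) [(0, 4), (4, 1), (0, 5), (5, 2), (0, 6), (6, 3), (1, 2), (2, 3), (3, 1)]"
  have d: "orientation O2 d" by (simp add: orientation_def O2_simps d_def insert_commute)
  have c0: "(clockwise_parity O2 d {0, 1, 2, 3, 7, 8} = Clockwise_even) = True"
    by (subst clockwise_parity_colouring[OF d, where c = "\<lambda>x. x \<in> {3, 4, 5}"]) (simp_all only: O2_even_circuits members_insert, simp_all add: d_def)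
  have c1: "(clockwise_parity O2 d {0, 1, 4, 5, 6, 7} = Clockwise_even) = True"
    by (subst clockwise_parity_colouring[OF d, where c = "\<lambda>x. x \<in> {2, 4, 6}"]) (simp_all only: O2_even_circuits members_insert, simp_all add: d_def)
  have c2: "(clockwise_parity O2 d {2, 3, 4, 5, 6, 8} = Clockwise_even) = True"
    by (subst clockwise_parity_colouring[OF d, where c = "\<lambda>x. x \<in> {1, 5, 6}"]) (simp_all only: O2_even_circuits members_insert, simp_all add: d_def)
  show ?thesis
    by (intro exI[of _ d] conjI d) (simp only: O2_even_circuits members_insert, simp add: set_eq_subset c0 c1 c2)
qed


lemma E1_simps:
  "verts E1 = {0, 1}" "edges E1 = {0, 1, 2}"
  "ends E1 0 = {0, 1}" "ends E1 1 = {0, 1}" "ends E1 2 = {0, 1}"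
  by (auto simp: E1_def graph_of_def lessThan_numerals)

lemma E1_multigraph: "multigraph E1"
  by unfold_locales (auto simp: E1_simps)

lemma E1_frame:
  "frame theta_model E1 ((!) [0, 1])
    ((!) [{0, 1}, {0, 1}, {0, 1}])
    ((!) [{0}, {1}, {2}])"
proof -
  have 0: "spath E1 0 {0, 1} {0} 1" by (rule spath_single) (auto simp: E1_simps)
  have 1: "spath E1 0 {0, 1} {1} 1" by (rule spath_single) (auto simp: E1_simps)
  have 2: "spath E1 0 {0, 1} {2} 1" by (rule spath_single) (auto simp: E1_simps)
  show ?thesis
    unfolding frame_def using 0 1 2
    by (simp add: theta_model_simps all_less ex_less lessThan_numerals E1_simps insert_commute)
qed

lemma E1_nonempty: "i < 3 \<Longrightarrow> ([{0}, {1}, {2}] :: nat set list) ! i \<noteq> {}"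
  using all_less(1)[of "\<lambda>i. ([{0}, {1}, {2}] :: nat set list) ! i \<noteq> {}"] by simp

lemma E1_even_circuits:
  "even_circuits E1 =
    {{0, 1}, {0, 2}, {1, 2}}"
proof (intro equalityI subsetI)
  fix C assume "C \<in> even_circuits E1"
  then have C: "circ E1 C" "even (card C)" by (auto simp: even_circuits_circ)
  define m where "m = (\<lambda>i. i \<in> C)"
  have "C \<subseteq> set [0, 1, 2]" using circ_edges[OF C(1)] by (simp add: E1_simps)
  then have Ceq: "C = set (filter m [0, 1, 2])" unfolding m_def set_filter by blast
  have e0: "m 0 = (m 1 \<noteq> m 2)"
    unfolding m_def by (rule circ_degree_three[OF C(1), of 1]) (auto simp: E1_simps)
  have ne: "C \<noteq> {}" using circ_nonempty C(1) by blast
  show "C \<in> {{0, 1}, {0, 2}, {1, 2}}"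
    using C(2) ne   unfolding Ceq
    by (cases "m 1"; cases "m 2"; simp add: e0)
next
  fix C :: "nat set"
  assume C: "C \<in> {{0, 1}, {0, 2}, {1, 2}}"
  note c = theta_circuits[OF E1_frame E1_nonempty]
  have "circ E1 C" using C c by (auto simp: insert_commute)
  moreover have "even (card C)" using C by auto
  ultimately show "C \<in> even_circuits E1" by (simp add: even_circuits_circ)
qed

interpretation E1: base_graph E1
proof -
  interpret multigraph E1 by (rule E1_multigraph)
  show "base_graph E1"
  proof
    fix i :: nat
    show "even (card {D \<in> even_circuits E1. i \<in> D})"
    proof (cases "i \<in> {0, 1, 2}")
      case True
      then show ?thesis unfolding E1_even_circuits members_insert by (elim insertE emptyE) (simp_all add: set_eq_subset)
    next
      case False
      then have "{D \<in> even_circuits E1. i \<in> D} = {}" unfolding E1_even_circuits by auto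
      then show ?thesis by (metis card.empty even_zero)
    qed
  qed
qed

text \<open>Two parallel edges with the same direction form a clockwise odd circuit, so the number
  in question is 0.\<close>

lemma E1_parity:
  "\<exists>d. orientation E1 d \<and> even (card {D \<in> even_circuits E1. clockwise_parity E1 d D = Clockwise_even})"
proof -
  define d :: "nat \<Rightarrow> nat \<times> nat" where "d = (!) [(0, 1), (0, 1), (0, 1)]"
  have d: "orientation E1 d" by (simp add: orientation_def E1_simps d_def insert_commute)
  have c0: "(clockwise_parity E1 d {0, 1} = Clockwise_even) = False"
    by (subst clockwise_parity_colouring[OF d, where c = "\<lambda>x. x \<in> {1}"]) (simp_all only: E1_even_circuits members_insert, simp_all add: d_def)
  have c1: "(clockwise_parity E1 d {0, 2} = Clockwise_even) = False"
    by (subst clockwise_parity_colouring[OF d, where c = "\<lambda>x. x \<in> {1}"]) (simp_all only: E1_even_circuits members_insert, simp_all add: d_def)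
  have c2: "(clockwise_parity E1 d {1, 2} = Clockwise_even) = False"
    by (subst clockwise_parity_colouring[OF d, where c = "\<lambda>x. x \<in> {1}"]) (simp_all only: E1_even_circuits members_insert, simp_all add: d_def)
  show ?thesis
    by (intro exI[of _ d] conjI d) (simp only: E1_even_circuits members_insert, simp add: set_eq_subset c0 c1 c2)
qed


lemma E2_simps:
  "verts E2 = {0, 1, 2, 3}" "edges E2 = {0, 1, 2, 3, 4, 5}"
  "ends E2 0 = {0, 1}" "ends E2 1 = {0, 2}" "ends E2 2 = {0, 3}" "ends E2 3 = {1, 2}" "ends E2 4 = {1, 3}" "ends E2 5 = {2, 3}"
  by (auto simp: E2_def graph_of_def lessThan_numerals)

lemma E2_multigraph: "multigraph E2"
  by unfold_locales (auto simp: E2_simps)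

lemma E2_frame:
  "frame K4_model E2 ((!) [0, 1, 2, 3])
    ((!) [{0, 1}, {0, 2}, {0, 3}, {1, 2}, {1, 3}, {2, 3}])
    ((!) [{0}, {1}, {2}, {3}, {4}, {5}])"
proof -
  have 0: "spath E2 0 {0, 1} {0} 1" by (rule spath_single) (auto simp: E2_simps)
  have 1: "spath E2 0 {0, 2} {1} 2" by (rule spath_single) (auto simp: E2_simps)
  have 2: "spath E2 0 {0, 3} {2} 3" by (rule spath_single) (auto simp: E2_simps)
  have 3: "spath E2 1 {1, 2} {3} 2" by (rule spath_single) (auto simp: E2_simps)
  have 4: "spath E2 1 {1, 3} {4} 3" by (rule spath_single) (auto simp: E2_simps)
  have 5: "spath E2 2 {2, 3} {5} 3" by (rule spath_single) (auto simp: E2_simps)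
  show ?thesis
    unfolding frame_def using 0 1 2 3 4 5
    by (simp add: K4_model_simps all_less ex_less lessThan_numerals E2_simps insert_commute)
qed

lemma E2_nonempty: "i < 6 \<Longrightarrow> ([{0}, {1}, {2}, {3}, {4}, {5}] :: nat set list) ! i \<noteq> {}"
  using all_less(2)[of "\<lambda>i. ([{0}, {1}, {2}, {3}, {4}, {5}] :: nat set list) ! i \<noteq> {}"] by simp

lemma E2_even_circuits:
  "even_circuits E2 =
    {{0, 1, 4, 5}, {0, 2, 3, 5}, {1, 2, 3, 4}}"
proof (intro equalityI subsetI)
  fix C assume "C \<in> even_circuits E2"
  then have C: "circ E2 C" "even (card C)" by (auto simp: even_circuits_circ)
  define m where "m = (\<lambda>i. i \<in> C)"
  have "C \<subseteq> set [0, 1, 2, 3, 4, 5]" using circ_edges[OF C(1)] by (simp add: E2_simps)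
  then have Ceq: "C = set (filter m [0, 1, 2, 3, 4, 5])" unfolding m_def set_filter by blast
  have e2: "m 2 = (m 4 \<noteq> m 5)"
    unfolding m_def by (rule circ_degree_three[OF C(1), of 3]) (auto simp: E2_simps)
  have e1: "m 1 = (m 3 \<noteq> m 5)"
    unfolding m_def by (rule circ_degree_three[OF C(1), of 2]) (auto simp: E2_simps)
  have e0: "m 0 = (m 3 \<noteq> m 4)"
    unfolding m_def by (rule circ_degree_three[OF C(1), of 1]) (auto simp: E2_simps)
  have ne: "C \<noteq> {}" using circ_nonempty C(1) by blast
  show "C \<in> {{0, 1, 4, 5}, {0, 2, 3, 5}, {1, 2, 3, 4}}"
    using C(2) ne   unfolding Ceq
    by (cases "m 3"; cases "m 4"; cases "m 5"; simp add: e2 e1 e0)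
next
  fix C :: "nat set"
  assume C: "C \<in> {{0, 1, 4, 5}, {0, 2, 3, 5}, {1, 2, 3, 4}}"
  note c = K4_circuits[OF E2_frame E2_nonempty]
  have "circ E2 C" using C c by (auto simp: insert_commute)
  moreover have "even (card C)" using C by auto
  ultimately show "C \<in> even_circuits E2" by (simp add: even_circuits_circ)
qed

interpretation E2: base_graph E2
proof -
  interpret multigraph E2 by (rule E2_multigraph)
  show "base_graph E2"
  proof
    fix i :: nat
    show "even (card {D \<in> even_circuits E2. i \<in> D})"
    proof (cases "i \<in> {0, 1, 2, 3, 4, 5}")
      case True
      then show ?thesis unfolding E2_even_circuits members_insert by (elim insertE emptyE) (simp_all add: set_eq_subset)
    next
      case False
      then have "{D \<in> even_circuits E2. i \<in> D} = {}" unfolding E2_even_circuits by auto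
      then show ?thesis by (metis card.empty even_zero)
    qed
  qed
qed

lemma E2_parity:
  "\<exists>d. orientation E2 d \<and> even (card {D \<in> even_circuits E2. clockwise_parity E2 d D = Clockwise_even})"
proof -
  define d :: "nat \<Rightarrow> nat \<times> nat" where "d = (!) [(0, 1), (0, 2), (0, 3), (1, 2), (1, 3), (2, 3)]"
  have d: "orientation E2 d" by (simp add: orientation_def E2_simps d_def insert_commute)
  have c0: "(clockwise_parity E2 d {0, 1, 4, 5} = Clockwise_even) = True"
    by (subst clockwise_parity_colouring[OF d, where c = "\<lambda>x. x \<in> {1, 2}"]) (simp_all only: E2_even_circuits members_insert, simp_all add: d_def)
  have c1: "(clockwise_parity E2 d {0, 2, 3, 5} = Clockwise_even) = False"
    by (subst clockwise_parity_colouring[OF d, where c = "\<lambda>x. x \<in> {1, 3}"]) (simp_all only: E2_even_circuits members_insert, simp_all add: d_def)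
  have c2: "(clockwise_parity E2 d {1, 2, 3, 4} = Clockwise_even) = True"
    by (subst clockwise_parity_colouring[OF d, where c = "\<lambda>x. x \<in> {2, 3}"]) (simp_all only: E2_even_circuits members_insert, simp_all add: d_def)
  show ?thesis
    by (intro exI[of _ d] conjI d) (simp only: E2_even_circuits members_insert, simp add: set_eq_subset c0 c1 c2)
qed


lemma E3_simps:
  "verts E3 = {0, 1, 2, 3, 4, 5, 6, 7}" "edges E3 = {0, 1, 2, 3, 4, 5, 6, 7, 8, 9}"
  "ends E3 0 = {0, 4}" "ends E3 1 = {4, 1}" "ends E3 2 = {1, 5}" "ends E3 3 = {5, 2}" "ends E3 4 = {2, 6}" "ends E3 5 = {6, 3}" "ends E3 6 = {3, 7}" "ends E3 7 = {7, 0}" "ends E3 8 = {0, 2}" "ends E3 9 = {1, 3}"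
  by (auto simp: E3_def graph_of_def lessThan_numerals)

lemma E3_multigraph: "multigraph E3"
  by unfold_locales (auto simp: E3_simps)

lemma E3_frame:
  "frame K4_model E3 ((!) [0, 1, 2, 3])
    ((!) [{0, 4, 1}, {0, 2}, {0, 7, 3}, {1, 5, 2}, {1, 3}, {2, 6, 3}])
    ((!) [{0, 1}, {8}, {7, 6}, {2, 3}, {9}, {4, 5}])"
proof -
  have 0: "spath E3 0 {0, 4, 1} {0, 1} 1" by (rule spath_two) (auto simp: E3_simps)
  have 1: "spath E3 0 {0, 2} {8} 2" by (rule spath_single) (auto simp: E3_simps)
  have 2: "spath E3 0 {0, 7, 3} {7, 6} 3" by (rule spath_two) (auto simp: E3_simps)
  have 3: "spath E3 1 {1, 5, 2} {2, 3} 2" by (rule spath_two) (auto simp: E3_simps)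
  have 4: "spath E3 1 {1, 3} {9} 3" by (rule spath_single) (auto simp: E3_simps)
  have 5: "spath E3 2 {2, 6, 3} {4, 5} 3" by (rule spath_two) (auto simp: E3_simps)
  show ?thesis
    unfolding frame_def using 0 1 2 3 4 5
    by (simp add: K4_model_simps all_less ex_less lessThan_numerals E3_simps insert_commute)
qed

lemma E3_nonempty: "i < 6 \<Longrightarrow> ([{0, 1}, {8}, {7, 6}, {2, 3}, {9}, {4, 5}] :: nat set list) ! i \<noteq> {}"
  using all_less(2)[of "\<lambda>i. ([{0, 1}, {8}, {7, 6}, {2, 3}, {9}, {4, 5}] :: nat set list) ! i \<noteq> {}"] by simp

lemma E3_even_circuits:
  "even_circuits E3 =
    {{0, 1, 4, 5, 8, 9}, {2, 3, 6, 7, 8, 9}, {0, 1, 2, 3, 4, 5, 6, 7}}"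
proof (intro equalityI subsetI)
  fix C assume "C \<in> even_circuits E3"
  then have C: "circ E3 C" "even (card C)" by (auto simp: even_circuits_circ)
  define m where "m = (\<lambda>i. i \<in> C)"
  have "C \<subseteq> set [0, 1, 2, 3, 4, 5, 6, 7, 8, 9]" using circ_edges[OF C(1)] by (simp add: E3_simps)
  then have Ceq: "C = set (filter m [0, 1, 2, 3, 4, 5, 6, 7, 8, 9])" unfolding m_def set_filter by blast
  have e4: "m 4 = m 5"
    unfolding m_def by (rule circ_degree_two[OF C(1), of 6]) (auto simp: E3_simps)
  have e3: "m 3 = m 2"
    unfolding m_def by (rule circ_degree_two[OF C(1), of 5]) (auto simp: E3_simps)
  have e6: "m 6 = (m 5 \<noteq> m 9)"
    unfolding m_def by (rule circ_degree_three[OF C(1), of 3]) (auto simp: E3_simps)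
  have e1: "m 1 = (m 2 \<noteq> m 9)"
    unfolding m_def by (rule circ_degree_three[OF C(1), of 1]) (auto simp: E3_simps)
  have e8: "m 8 = (m 3 \<noteq> m 4)"
    unfolding m_def by (rule circ_degree_three[OF C(1), of 2]) (auto simp: E3_simps)
  have e7: "m 7 = m 6"
    unfolding m_def by (rule circ_degree_two[OF C(1), of 7]) (auto simp: E3_simps)
  have e0: "m 0 = m 1"
    unfolding m_def by (rule circ_degree_two[OF C(1), of 4]) (auto simp: E3_simps)
  have ne: "C \<noteq> {}" using circ_nonempty C(1) by blast
  show "C \<in> {{0, 1, 4, 5, 8, 9}, {2, 3, 6, 7, 8, 9}, {0, 1, 2, 3, 4, 5, 6, 7}}"
    using C(2) ne   unfolding Ceq
    by (cases "m 2"; cases "m 5"; cases "m 9"; simp add: e4 e3 e6 e1 e8 e7 e0)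
next
  fix C :: "nat set"
  assume C: "C \<in> {{0, 1, 4, 5, 8, 9}, {2, 3, 6, 7, 8, 9}, {0, 1, 2, 3, 4, 5, 6, 7}}"
  note c = K4_circuits[OF E3_frame E3_nonempty]
  have "circ E3 C" using C c by (auto simp: insert_commute)
  moreover have "even (card C)" using C by auto
  ultimately show "C \<in> even_circuits E3" by (simp add: even_circuits_circ)
qed

interpretation E3: base_graph E3
proof -
  interpret multigraph E3 by (rule E3_multigraph)
  show "base_graph E3"
  proof
    fix i :: nat
    show "even (card {D \<in> even_circuits E3. i \<in> D})"
    proof (cases "i \<in> {0, 1, 2, 3, 4, 5, 6, 7, 8, 9}")
      case True
      then show ?thesis unfolding E3_even_circuits members_insert by (elim insertE emptyE) (simp_all add: set_eq_subset)
    next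
      case False
      then have "{D \<in> even_circuits E3. i \<in> D} = {}" unfolding E3_even_circuits by auto
      then show ?thesis by (metis card.empty even_zero)
    qed
  qed
qed

lemma E3_parity:
  "\<exists>d. orientation E3 d \<and> even (card {D \<in> even_circuits E3. clockwise_parity E3 d D = Clockwise_even})"
proof -
  define d :: "nat \<Rightarrow> nat \<times> nat" where "d = (!) [(0, 4), (4, 1), (1, 5), (5, 2), (2, 6), (6, 3), (3, 7), (7, 0), (0, 2), (1, 3)]"
  have d: "orientation E3 d" by (simp add: orientation_def E3_simps d_def insert_commute)
  have c0: "(clockwise_parity E3 d {0, 1, 4, 5, 8, 9} = Clockwise_even) = False"
    by (subst clockwise_parity_colouring[OF d, where c = "\<lambda>x. x \<in> {2, 3, 4}"]) (simp_all only: E3_even_circuits members_insert, simp_all add: d_def)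
  have c1: "(clockwise_parity E3 d {2, 3, 6, 7, 8, 9} = Clockwise_even) = True"
    by (subst clockwise_parity_colouring[OF d, where c = "\<lambda>x. x \<in> {0, 3, 5}"]) (simp_all only: E3_even_circuits members_insert, simp_all add: d_def)
  have c2: "(clockwise_parity E3 d {0, 1, 2, 3, 4, 5, 6, 7} = Clockwise_even) = True"
    by (subst clockwise_parity_colouring[OF d, where c = "\<lambda>x. x \<in> {4, 5, 6, 7}"]) (simp_all only: E3_even_circuits members_insert, simp_all add: d_def)
  show ?thesis
    by (intro exI[of _ d] conjI d) (simp only: E3_even_circuits members_insert, simp add: set_eq_subset c0 c1 c2)
qed


lemma Delta1_simps:
  "verts Delta1 = {0, 1, 2, 3, 4, 5, 6, 7, 8}" "edges Delta1 = {0, 1, 2, 3, 4, 5, 6, 7, 8, 9, 10, 11}"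
  "ends Delta1 0 = {0, 1}" "ends Delta1 1 = {1, 2}" "ends Delta1 2 = {2, 0}" "ends Delta1 3 = {3, 4}" "ends Delta1 4 = {4, 5}" "ends Delta1 5 = {5, 3}" "ends Delta1 6 = {6, 7}" "ends Delta1 7 = {7, 8}" "ends Delta1 8 = {8, 6}" "ends Delta1 9 = {1, 3}" "ends Delta1 10 = {4, 6}" "ends Delta1 11 = {7, 0}"
  by (auto simp: Delta1_def graph_of_def lessThan_numerals less_Suc_eq)

lemma Delta1_multigraph: "multigraph Delta1"
  by unfold_locales (auto simp: Delta1_simps)

lemma Delta1_frame:
  "frame ring_model Delta1 ((!) [0, 1, 3, 4, 6, 7])
    ((!) [{0, 1}, {0, 2, 1}, {3, 4}, {3, 5, 4}, {6, 7}, {6, 8, 7}, {1, 3}, {4, 6}, {7, 0}])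
    ((!) [{0}, {2, 1}, {3}, {5, 4}, {6}, {8, 7}, {9}, {10}, {11}])"
proof -
  have 0: "spath Delta1 0 {0, 1} {0} 1" by (rule spath_single) (auto simp: Delta1_simps)
  have 1: "spath Delta1 0 {0, 2, 1} {2, 1} 1" by (rule spath_two) (auto simp: Delta1_simps)
  have 2: "spath Delta1 3 {3, 4} {3} 4" by (rule spath_single) (auto simp: Delta1_simps)
  have 3: "spath Delta1 3 {3, 5, 4} {5, 4} 4" by (rule spath_two) (auto simp: Delta1_simps)
  have 4: "spath Delta1 6 {6, 7} {6} 7" by (rule spath_single) (auto simp: Delta1_simps)
  have 5: "spath Delta1 6 {6, 8, 7} {8, 7} 7" by (rule spath_two) (auto simp: Delta1_simps)
  have 6: "spath Delta1 1 {1, 3} {9} 3" by (rule spath_single) (auto simp: Delta1_simps)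
  have 7: "spath Delta1 4 {4, 6} {10} 6" by (rule spath_single) (auto simp: Delta1_simps)
  have 8: "spath Delta1 7 {7, 0} {11} 0" by (rule spath_single) (auto simp: Delta1_simps)
  show ?thesis
    unfolding frame_def using 0 1 2 3 4 5 6 7 8
    by (simp add: ring_model_simps all_less ex_less lessThan_numerals Delta1_simps insert_commute)
qed

lemma Delta1_nonempty: "i < 6 \<Longrightarrow> ([{0}, {2, 1}, {3}, {5, 4}, {6}, {8, 7}, {9}, {10}, {11}] :: nat set list) ! i \<noteq> {}"
  using all_less(2)[of "\<lambda>i. ([{0}, {2, 1}, {3}, {5, 4}, {6}, {8, 7}, {9}, {10}, {11}] :: nat set list) ! i \<noteq> {}"] by simp

text \<open>Unlike in the thetas and in K4, a solution of the degree conditions may be a disjoint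
  union of circuits, for instance two triangles with six edges in all. Since no circuit properly
  contains another, \<open>t0\<close>, \<open>t1\<close> and \<open>t2\<close> rule out the
  triangles.\<close>

lemma Delta1_even_circuits:
  "even_circuits Delta1 =
    {{0, 3, 6, 9, 10, 11}, {0, 4, 5, 7, 8, 9, 10, 11}, {1, 2, 3, 7, 8, 9, 10, 11}, {1, 2, 4, 5, 6, 9, 10, 11}}"
proof (intro equalityI subsetI)
  fix C assume "C \<in> even_circuits Delta1"
  then have C: "circ Delta1 C" "even (card C)" by (auto simp: even_circuits_circ)
  define m where "m = (\<lambda>i. i \<in> C)"
  have "C \<subseteq> set [0, 1, 2, 3, 4, 5, 6, 7, 8, 9, 10, 11]" using circ_edges[OF C(1)] by (simp add: Delta1_simps)
  then have Ceq: "C = set (filter m [0, 1, 2, 3, 4, 5, 6, 7, 8, 9, 10, 11])" unfolding m_def set_filter by blast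
  have e5: "m 5 = m 4"
    unfolding m_def by (rule circ_degree_two[OF C(1), of 5]) (auto simp: Delta1_simps)
  have e3: "m 3 = (m 4 \<noteq> m 10)"
    unfolding m_def by (rule circ_degree_three[OF C(1), of 4]) (auto simp: Delta1_simps)
  have e7: "m 7 = m 8"
    unfolding m_def by (rule circ_degree_two[OF C(1), of 8]) (auto simp: Delta1_simps)
  have e6: "m 6 = (m 8 \<noteq> m 10)"
    unfolding m_def by (rule circ_degree_three[OF C(1), of 6]) (auto simp: Delta1_simps)
  have e9: "m 9 = (m 3 \<noteq> m 5)"
    unfolding m_def by (rule circ_degree_three[OF C(1), of 3]) (auto simp: Delta1_simps)
  have e11: "m 11 = (m 6 \<noteq> m 7)"
    unfolding m_def by (rule circ_degree_three[OF C(1), of 7]) (auto simp: Delta1_simps)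
  have e2: "m 2 = m 1"
    unfolding m_def by (rule circ_degree_two[OF C(1), of 2]) (auto simp: Delta1_simps)
  have e0: "m 0 = (m 1 \<noteq> m 9)"
    unfolding m_def by (rule circ_degree_three[OF C(1), of 1]) (auto simp: Delta1_simps)
  have t0: "\<not> (m 0 \<and> m 1 \<and> m 2)"
  proof
    assume "m 0 \<and> m 1 \<and> m 2"
    then have "{0, 1, 2} \<subseteq> C" by (simp add: m_def)
    then have "C = {0, 1, 2}" using circ_minimal[OF C(1), of "{0, 1, 2}"] ring_circuits(2)[OF Delta1_frame Delta1_nonempty] by (simp add: insert_commute)
    then show False using C(2) by simp
  qed
  have t1: "\<not> (m 3 \<and> m 4 \<and> m 5)"
  proof
    assume "m 3 \<and> m 4 \<and> m 5"
    then have "{3, 4, 5} \<subseteq> C" by (simp add: m_def)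
    then have "C = {3, 4, 5}" using circ_minimal[OF C(1), of "{3, 4, 5}"] ring_circuits(3)[OF Delta1_frame Delta1_nonempty] by (simp add: insert_commute)
    then show False using C(2) by simp
  qed
  have t2: "\<not> (m 6 \<and> m 7 \<and> m 8)"
  proof
    assume "m 6 \<and> m 7 \<and> m 8"
    then have "{6, 7, 8} \<subseteq> C" by (simp add: m_def)
    then have "C = {6, 7, 8}" using circ_minimal[OF C(1), of "{6, 7, 8}"] ring_circuits(4)[OF Delta1_frame Delta1_nonempty] by (simp add: insert_commute)
    then show False using C(2) by simp
  qed
  have ne: "C \<noteq> {}" using circ_nonempty C(1) by blast
  show "C \<in> {{0, 3, 6, 9, 10, 11}, {0, 4, 5, 7, 8, 9, 10, 11}, {1, 2, 3, 7, 8, 9, 10, 11}, {1, 2, 4, 5, 6, 9, 10, 11}}"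
    using C(2) ne t0 t1 t2  unfolding Ceq
    by (cases "m 1"; cases "m 4"; cases "m 8"; cases "m 10"; simp add: e5 e3 e7 e6 e9 e11 e2 e0)
next
  fix C :: "nat set"
  assume C: "C \<in> {{0, 3, 6, 9, 10, 11}, {0, 4, 5, 7, 8, 9, 10, 11}, {1, 2, 3, 7, 8, 9, 10, 11}, {1, 2, 4, 5, 6, 9, 10, 11}}"
  note c = ring_circuits(1)[OF Delta1_frame Delta1_nonempty]
  have "circ Delta1 C" using C c[of 0 2 4] c[of 0 3 5] c[of 1 2 5] c[of 1 3 4] by (auto simp: insert_commute)
  moreover have "even (card C)" using C by auto
  ultimately show "C \<in> even_circuits Delta1" by (simp add: even_circuits_circ)
qed

interpretation Delta1: base_graph Delta1
proof -
  interpret multigraph Delta1 by (rule Delta1_multigraph)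
  show "base_graph Delta1"
  proof
    fix i :: nat
    show "even (card {D \<in> even_circuits Delta1. i \<in> D})"
    proof (cases "i \<in> {0, 1, 2, 3, 4, 5, 6, 7, 8, 9, 10, 11}")
      case True
      then show ?thesis unfolding Delta1_even_circuits members_insert by (elim insertE emptyE) (simp_all add: set_eq_subset)
    next
      case False
      then have "{D \<in> even_circuits Delta1. i \<in> D} = {}" unfolding Delta1_even_circuits by auto
      then show ?thesis by (metis card.empty even_zero)
    qed
  qed
qed

lemma Delta1_parity:
  "\<exists>d. orientation Delta1 d \<and> even (card {D \<in> even_circuits Delta1. clockwise_parity Delta1 d D = Clockwise_even})"
proof -
  define d :: "nat \<Rightarrow> nat \<times> nat" where "d = (!) [(0, 1), (1, 2), (2, 0), (3, 4), (4, 5), (5, 3), (6, 7), (7, 8), (8, 6), (1, 3), (4, 6), (7, 0)]"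
  have d: "orientation Delta1 d" by (simp add: orientation_def Delta1_simps d_def insert_commute)
  have c0: "(clockwise_parity Delta1 d {0, 3, 6, 9, 10, 11} = Clockwise_even) = True"
    by (subst clockwise_parity_colouring[OF d, where c = "\<lambda>x. x \<in> {1, 4, 7}"]) (simp_all only: Delta1_even_circuits members_insert, simp_all add: d_def)
  have c1: "(clockwise_parity Delta1 d {0, 4, 5, 7, 8, 9, 10, 11} = Clockwise_even) = True"
    by (subst clockwise_parity_colouring[OF d, where c = "\<lambda>x. x \<in> {1, 5, 6, 7}"]) (simp_all only: Delta1_even_circuits members_insert, simp_all add: d_def)
  have c2: "(clockwise_parity Delta1 d {1, 2, 3, 7, 8, 9, 10, 11} = Clockwise_even) = True"
    by (subst clockwise_parity_colouring[OF d, where c = "\<lambda>x. x \<in> {2, 3, 6, 7}"]) (simp_all only: Delta1_even_circuits members_insert, simp_all add: d_def)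
  have c3: "(clockwise_parity Delta1 d {1, 2, 4, 5, 6, 9, 10, 11} = Clockwise_even) = True"
    by (subst clockwise_parity_colouring[OF d, where c = "\<lambda>x. x \<in> {2, 3, 4, 7}"]) (simp_all only: Delta1_even_circuits members_insert, simp_all add: d_def)
  show ?thesis
    by (intro exI[of _ d] conjI d) (simp only: Delta1_even_circuits members_insert, simp add: set_eq_subset c0 c1 c2 c3)
qed


lemma Delta2_simps:
  "verts Delta2 = {0, 1, 2, 4, 5, 6, 7, 8}" "edges Delta2 = {0, 1, 2, 3, 4, 5, 6, 7, 8, 10, 11}"
  "ends Delta2 0 = {0, 1}" "ends Delta2 1 = {1, 2}" "ends Delta2 2 = {2, 0}" "ends Delta2 3 = {1, 4}" "ends Delta2 4 = {4, 5}" "ends Delta2 5 = {5, 1}" "ends Delta2 6 = {6, 7}" "ends Delta2 7 = {7, 8}" "ends Delta2 8 = {8, 6}" "ends Delta2 10 = {4, 6}" "ends Delta2 11 = {7, 0}"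
  by (auto simp: Delta2_def contract_onto_def Let_def Delta1_simps)

lemma Delta2_multigraph: "multigraph Delta2"
  by unfold_locales (auto simp: Delta2_simps)

text \<open>The contraction of edge 9 makes the branch with index 6 trivial, so the model vertices 1
  and 2 are both placed at the vertex 1.\<close>

lemma Delta2_frame:
  "frame ring_model Delta2 ((!) [0, 1, 1, 4, 6, 7])
    ((!) [{0, 1}, {0, 2, 1}, {1, 4}, {1, 5, 4}, {6, 7}, {6, 8, 7}, {1}, {4, 6}, {7, 0}])
    ((!) [{0}, {2, 1}, {3}, {5, 4}, {6}, {8, 7}, {}, {10}, {11}])"
proof -
  have 0: "spath Delta2 0 {0, 1} {0} 1" by (rule spath_single) (auto simp: Delta2_simps)
  have 1: "spath Delta2 0 {0, 2, 1} {2, 1} 1" by (rule spath_two) (auto simp: Delta2_simps)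
  have 2: "spath Delta2 1 {1, 4} {3} 4" by (rule spath_single) (auto simp: Delta2_simps)
  have 3: "spath Delta2 1 {1, 5, 4} {5, 4} 4" by (rule spath_two) (auto simp: Delta2_simps)
  have 4: "spath Delta2 6 {6, 7} {6} 7" by (rule spath_single) (auto simp: Delta2_simps)
  have 5: "spath Delta2 6 {6, 8, 7} {8, 7} 7" by (rule spath_two) (auto simp: Delta2_simps)
  have 6: "spath Delta2 1 {1} {} 1" by (rule spath.nil)
  have 7: "spath Delta2 4 {4, 6} {10} 6" by (rule spath_single) (auto simp: Delta2_simps)
  have 8: "spath Delta2 7 {7, 0} {11} 0" by (rule spath_single) (auto simp: Delta2_simps)
  show ?thesis
    unfolding frame_def using 0 1 2 3 4 5 6 7 8
    by (simp add: ring_model_simps all_less ex_less lessThan_numerals Delta2_simps insert_commute doubleton_eq_iff)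
qed

lemma Delta2_nonempty: "i < 6 \<Longrightarrow> ([{0}, {2, 1}, {3}, {5, 4}, {6}, {8, 7}, {}, {10}, {11}] :: nat set list) ! i \<noteq> {}"
  using all_less(2)[of "\<lambda>i. ([{0}, {2, 1}, {3}, {5, 4}, {6}, {8, 7}, {}, {10}, {11}] :: nat set list) ! i \<noteq> {}"] by simp

text \<open>With two connecting edges instead of three, an even circuit uses an even number of the
  triangle sides of length 1; in \<open>Delta1\<close> this number is odd.\<close>

lemma Delta2_even_circuits:
  "even_circuits Delta2 =
    {{0, 3, 7, 8, 10, 11}, {0, 4, 5, 6, 10, 11}, {1, 2, 3, 6, 10, 11}, {1, 2, 4, 5, 7, 8, 10, 11}}"
proof (intro equalityI subsetI)
  fix C assume "C \<in> even_circuits Delta2"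
  then have C: "circ Delta2 C" "even (card C)" by (auto simp: even_circuits_circ)
  define m where "m = (\<lambda>i. i \<in> C)"
  have "C \<subseteq> set [0, 1, 2, 3, 4, 5, 6, 7, 8, 10, 11]" using circ_edges[OF C(1)] by (simp add: Delta2_simps)
  then have Ceq: "C = set (filter m [0, 1, 2, 3, 4, 5, 6, 7, 8, 10, 11])" unfolding m_def set_filter by blast
  have e7: "m 7 = m 8"
    unfolding m_def by (rule circ_degree_two[OF C(1), of 8]) (auto simp: Delta2_simps)
  have e6: "m 6 = (m 8 \<noteq> m 10)"
    unfolding m_def by (rule circ_degree_three[OF C(1), of 6]) (auto simp: Delta2_simps)
  have e5: "m 5 = m 4"
    unfolding m_def by (rule circ_degree_two[OF C(1), of 5]) (auto simp: Delta2_simps)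
  have e3: "m 3 = (m 4 \<noteq> m 10)"
    unfolding m_def by (rule circ_degree_three[OF C(1), of 4]) (auto simp: Delta2_simps)
  have e11: "m 11 = (m 6 \<noteq> m 7)"
    unfolding m_def by (rule circ_degree_three[OF C(1), of 7]) (auto simp: Delta2_simps)
  have e2: "m 2 = m 1"
    unfolding m_def by (rule circ_degree_two[OF C(1), of 2]) (auto simp: Delta2_simps)
  have e0: "m 0 = (m 1 \<noteq> (m 3 \<noteq> m 5))"
    unfolding m_def by (rule circ_degree_four(1)[OF C(1), of 1]) (auto simp: Delta2_simps)
  \<comment> \<open>The contraction has created a vertex of degree 4. Having all four edges there is
    consistent modulo 2 but impossible for a circuit.\<close>
  have f1: "\<not> (m 0 \<and> m 1 \<and> m 3 \<and> m 5)"
    unfolding m_def by (rule circ_degree_four(2)[OF C(1), of 1]) (auto simp: Delta2_simps)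
  have t0: "\<not> (m 0 \<and> m 1 \<and> m 2)"
  proof
    assume "m 0 \<and> m 1 \<and> m 2"
    then have "{0, 1, 2} \<subseteq> C" by (simp add: m_def)
    then have "C = {0, 1, 2}" using circ_minimal[OF C(1), of "{0, 1, 2}"] ring_circuits(2)[OF Delta2_frame Delta2_nonempty] by (simp add: insert_commute)
    then show False using C(2) by simp
  qed
  have t1: "\<not> (m 3 \<and> m 4 \<and> m 5)"
  proof
    assume "m 3 \<and> m 4 \<and> m 5"
    then have "{3, 4, 5} \<subseteq> C" by (simp add: m_def)
    then have "C = {3, 4, 5}" using circ_minimal[OF C(1), of "{3, 4, 5}"] ring_circuits(3)[OF Delta2_frame Delta2_nonempty] by (simp add: insert_commute)
    then show False using C(2) by simp
  qed
  have t2: "\<not> (m 6 \<and> m 7 \<and> m 8)"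
  proof
    assume "m 6 \<and> m 7 \<and> m 8"
    then have "{6, 7, 8} \<subseteq> C" by (simp add: m_def)
    then have "C = {6, 7, 8}" using circ_minimal[OF C(1), of "{6, 7, 8}"] ring_circuits(4)[OF Delta2_frame Delta2_nonempty] by (simp add: insert_commute)
    then show False using C(2) by simp
  qed
  have ne: "C \<noteq> {}" using circ_nonempty C(1) by blast
  show "C \<in> {{0, 3, 7, 8, 10, 11}, {0, 4, 5, 6, 10, 11}, {1, 2, 3, 6, 10, 11}, {1, 2, 4, 5, 7, 8, 10, 11}}"
    using C(2) ne t0 t1 t2 f1 unfolding Ceq
    by (cases "m 1"; cases "m 4"; cases "m 8"; cases "m 10"; simp add: e7 e6 e5 e3 e11 e2 e0)
next
  fix C :: "nat set"
  assume C: "C \<in> {{0, 3, 7, 8, 10, 11}, {0, 4, 5, 6, 10, 11}, {1, 2, 3, 6, 10, 11}, {1, 2, 4, 5, 7, 8, 10, 11}}"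
  note c = ring_circuits(1)[OF Delta2_frame Delta2_nonempty]
  have "circ Delta2 C" using C c[of 0 2 5] c[of 0 3 4] c[of 1 2 4] c[of 1 3 5] by (auto simp: insert_commute)
  moreover have "even (card C)" using C by auto
  ultimately show "C \<in> even_circuits Delta2" by (simp add: even_circuits_circ)
qed

interpretation Delta2: base_graph Delta2
proof -
  interpret multigraph Delta2 by (rule Delta2_multigraph)
  show "base_graph Delta2"
  proof
    fix i :: nat
    show "even (card {D \<in> even_circuits Delta2. i \<in> D})"
    proof (cases "i \<in> {0, 1, 2, 3, 4, 5, 6, 7, 8, 10, 11}")
      case True
      then show ?thesis unfolding Delta2_even_circuits members_insert by (elim insertE emptyE) (simp_all add: set_eq_subset)
    next
      case False
      then have "{D \<in> even_circuits Delta2. i \<in> D} = {}" unfolding Delta2_even_circuits by auto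
      then show ?thesis by (metis card.empty even_zero)
    qed
  qed
qed

lemma Delta2_parity:
  "\<exists>d. orientation Delta2 d \<and> even (card {D \<in> even_circuits Delta2. clockwise_parity Delta2 d D = Clockwise_even})"
proof -
  \<comment> \<open>The pair \<open>(0, 0)\<close> fills position 9, whose edge has been contracted;
    the vertex 3 is now called 1.\<close>
  define d :: "nat \<Rightarrow> nat \<times> nat" where "d = (!) [(0, 1), (1, 2), (2, 0), (1, 4), (4, 5), (5, 1), (6, 7), (7, 8), (8, 6), (0, 0), (4, 6), (7, 0)]"
  have d: "orientation Delta2 d" by (simp add: orientation_def Delta2_simps d_def insert_commute)
  have c0: "(clockwise_parity Delta2 d {0, 3, 7, 8, 10, 11} = Clockwise_even) = True"
    by (subst clockwise_parity_colouring[OF d, where c = "\<lambda>x. x \<in> {1, 6, 7}"]) (simp_all only: Delta2_even_circuits members_insert, simp_all add: d_def)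
  have c1: "(clockwise_parity Delta2 d {0, 4, 5, 6, 10, 11} = Clockwise_even) = True"
    by (subst clockwise_parity_colouring[OF d, where c = "\<lambda>x. x \<in> {1, 4, 7}"]) (simp_all only: Delta2_even_circuits members_insert, simp_all add: d_def)
  have c2: "(clockwise_parity Delta2 d {1, 2, 3, 6, 10, 11} = Clockwise_even) = True"
    by (subst clockwise_parity_colouring[OF d, where c = "\<lambda>x. x \<in> {2, 4, 7}"]) (simp_all only: Delta2_even_circuits members_insert, simp_all add: d_def)
  have c3: "(clockwise_parity Delta2 d {1, 2, 4, 5, 7, 8, 10, 11} = Clockwise_even) = True"
    by (subst clockwise_parity_colouring[OF d, where c = "\<lambda>x. x \<in> {2, 5, 6, 7}"]) (simp_all only: Delta2_even_circuits members_insert, simp_all add: d_def)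
  show ?thesis
    by (intro exI[of _ d] conjI d) (simp only: Delta2_even_circuits members_insert, simp add: set_eq_subset c0 c1 c2 c3)
qed


lemma Delta3_simps:
  "verts Delta3 = {0, 1, 2, 4, 5, 7, 8}" "edges Delta3 = {0, 1, 2, 3, 4, 5, 6, 7, 8, 11}"
  "ends Delta3 0 = {0, 1}" "ends Delta3 1 = {1, 2}" "ends Delta3 2 = {2, 0}" "ends Delta3 3 = {1, 4}" "ends Delta3 4 = {4, 5}" "ends Delta3 5 = {5, 1}" "ends Delta3 6 = {4, 7}" "ends Delta3 7 = {7, 8}" "ends Delta3 8 = {8, 4}" "ends Delta3 11 = {7, 0}"
  by (auto simp: Delta3_def contract_onto_def Let_def Delta2_simps)

lemma Delta3_multigraph: "multigraph Delta3"
  by unfold_locales (auto simp: Delta3_simps)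

lemma Delta3_frame:
  "frame ring_model Delta3 ((!) [0, 1, 1, 4, 4, 7])
    ((!) [{0, 1}, {0, 2, 1}, {1, 4}, {1, 5, 4}, {4, 7}, {4, 8, 7}, {1}, {4}, {7, 0}])
    ((!) [{0}, {2, 1}, {3}, {5, 4}, {6}, {8, 7}, {}, {}, {11}])"
proof -
  have 0: "spath Delta3 0 {0, 1} {0} 1" by (rule spath_single) (auto simp: Delta3_simps)
  have 1: "spath Delta3 0 {0, 2, 1} {2, 1} 1" by (rule spath_two) (auto simp: Delta3_simps)
  have 2: "spath Delta3 1 {1, 4} {3} 4" by (rule spath_single) (auto simp: Delta3_simps)
  have 3: "spath Delta3 1 {1, 5, 4} {5, 4} 4" by (rule spath_two) (auto simp: Delta3_simps)
  have 4: "spath Delta3 4 {4, 7} {6} 7" by (rule spath_single) (auto simp: Delta3_simps)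
  have 5: "spath Delta3 4 {4, 8, 7} {8, 7} 7" by (rule spath_two) (auto simp: Delta3_simps)
  have 6: "spath Delta3 1 {1} {} 1" by (rule spath.nil)
  have 7: "spath Delta3 4 {4} {} 4" by (rule spath.nil)
  have 8: "spath Delta3 7 {7, 0} {11} 0" by (rule spath_single) (auto simp: Delta3_simps)
  show ?thesis
    unfolding frame_def using 0 1 2 3 4 5 6 7 8
    by (simp add: ring_model_simps all_less ex_less lessThan_numerals Delta3_simps insert_commute doubleton_eq_iff)
qed

lemma Delta3_nonempty: "i < 6 \<Longrightarrow> ([{0}, {2, 1}, {3}, {5, 4}, {6}, {8, 7}, {}, {}, {11}] :: nat set list) ! i \<noteq> {}"
  using all_less(2)[of "\<lambda>i. ([{0}, {2, 1}, {3}, {5, 4}, {6}, {8, 7}, {}, {}, {11}] :: nat set list) ! i \<noteq> {}"] by simp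

lemma Delta3_even_circuits:
  "even_circuits Delta3 =
    {{0, 3, 6, 11}, {0, 4, 5, 7, 8, 11}, {1, 2, 3, 7, 8, 11}, {1, 2, 4, 5, 6, 11}}"
proof (intro equalityI subsetI)
  fix C assume "C \<in> even_circuits Delta3"
  then have C: "circ Delta3 C" "even (card C)" by (auto simp: even_circuits_circ)
  define m where "m = (\<lambda>i. i \<in> C)"
  have "C \<subseteq> set [0, 1, 2, 3, 4, 5, 6, 7, 8, 11]" using circ_edges[OF C(1)] by (simp add: Delta3_simps)
  then have Ceq: "C = set (filter m [0, 1, 2, 3, 4, 5, 6, 7, 8, 11])" unfolding m_def set_filter by blast
  have e7: "m 7 = m 8"
    unfolding m_def by (rule circ_degree_two[OF C(1), of 8]) (auto simp: Delta3_simps)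
  have e5: "m 5 = m 4"
    unfolding m_def by (rule circ_degree_two[OF C(1), of 5]) (auto simp: Delta3_simps)
  have e3: "m 3 = (m 4 \<noteq> (m 6 \<noteq> m 8))"
    unfolding m_def by (rule circ_degree_four(1)[OF C(1), of 4]) (auto simp: Delta3_simps)
  have e11: "m 11 = (m 6 \<noteq> m 7)"
    unfolding m_def by (rule circ_degree_three[OF C(1), of 7]) (auto simp: Delta3_simps)
  have e2: "m 2 = m 1"
    unfolding m_def by (rule circ_degree_two[OF C(1), of 2]) (auto simp: Delta3_simps)
  have e0: "m 0 = (m 1 \<noteq> (m 3 \<noteq> m 5))"
    unfolding m_def by (rule circ_degree_four(1)[OF C(1), of 1]) (auto simp: Delta3_simps)
  have f1: "\<not> (m 0 \<and> m 1 \<and> m 3 \<and> m 5)"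
    unfolding m_def by (rule circ_degree_four(2)[OF C(1), of 1]) (auto simp: Delta3_simps)
  have f4: "\<not> (m 3 \<and> m 4 \<and> m 6 \<and> m 8)"
    unfolding m_def by (rule circ_degree_four(2)[OF C(1), of 4]) (auto simp: Delta3_simps)
  have t0: "\<not> (m 0 \<and> m 1 \<and> m 2)"
  proof
    assume "m 0 \<and> m 1 \<and> m 2"
    then have "{0, 1, 2} \<subseteq> C" by (simp add: m_def)
    then have "C = {0, 1, 2}" using circ_minimal[OF C(1), of "{0, 1, 2}"] ring_circuits(2)[OF Delta3_frame Delta3_nonempty] by (simp add: insert_commute)
    then show False using C(2) by simp
  qed
  have t1: "\<not> (m 3 \<and> m 4 \<and> m 5)"
  proof
    assume "m 3 \<and> m 4 \<and> m 5"
    then have "{3, 4, 5} \<subseteq> C" by (simp add: m_def)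
    then have "C = {3, 4, 5}" using circ_minimal[OF C(1), of "{3, 4, 5}"] ring_circuits(3)[OF Delta3_frame Delta3_nonempty] by (simp add: insert_commute)
    then show False using C(2) by simp
  qed
  have t2: "\<not> (m 6 \<and> m 7 \<and> m 8)"
  proof
    assume "m 6 \<and> m 7 \<and> m 8"
    then have "{6, 7, 8} \<subseteq> C" by (simp add: m_def)
    then have "C = {6, 7, 8}" using circ_minimal[OF C(1), of "{6, 7, 8}"] ring_circuits(4)[OF Delta3_frame Delta3_nonempty] by (simp add: insert_commute)
    then show False using C(2) by simp
  qed
  have ne: "C \<noteq> {}" using circ_nonempty C(1) by blast
  show "C \<in> {{0, 3, 6, 11}, {0, 4, 5, 7, 8, 11}, {1, 2, 3, 7, 8, 11}, {1, 2, 4, 5, 6, 11}}"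
    using C(2) ne t0 t1 t2 f1 f4 unfolding Ceq
    by (cases "m 1"; cases "m 4"; cases "m 6"; cases "m 8"; simp add: e7 e5 e3 e11 e2 e0)
next
  fix C :: "nat set"
  assume C: "C \<in> {{0, 3, 6, 11}, {0, 4, 5, 7, 8, 11}, {1, 2, 3, 7, 8, 11}, {1, 2, 4, 5, 6, 11}}"
  note c = ring_circuits(1)[OF Delta3_frame Delta3_nonempty]
  have "circ Delta3 C" using C c[of 0 2 4] c[of 0 3 5] c[of 1 2 5] c[of 1 3 4] by (auto simp: insert_commute)
  moreover have "even (card C)" using C by auto
  ultimately show "C \<in> even_circuits Delta3" by (simp add: even_circuits_circ)
qed

interpretation Delta3: base_graph Delta3
proof -
  interpret multigraph Delta3 by (rule Delta3_multigraph)
  show "base_graph Delta3"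
  proof
    fix i :: nat
    show "even (card {D \<in> even_circuits Delta3. i \<in> D})"
    proof (cases "i \<in> {0, 1, 2, 3, 4, 5, 6, 7, 8, 11}")
      case True
      then show ?thesis unfolding Delta3_even_circuits members_insert by (elim insertE emptyE) (simp_all add: set_eq_subset)
    next
      case False
      then have "{D \<in> even_circuits Delta3. i \<in> D} = {}" unfolding Delta3_even_circuits by auto
      then show ?thesis by (metis card.empty even_zero)
    qed
  qed
qed

lemma Delta3_parity:
  "\<exists>d. orientation Delta3 d \<and> even (card {D \<in> even_circuits Delta3. clockwise_parity Delta3 d D = Clockwise_even})"
proof -
  \<comment> \<open>The positions 9 and 10 of the contracted edges are filled with
    \<open>(0, 0)\<close>; the vertices 3 and 6 are now called 1 and 4.\<close>
  define d :: "nat \<Rightarrow> nat \<times> nat" where "d = (!) [(0, 1), (1, 2), (2, 0), (1, 4), (4, 5), (5, 1), (4, 7), (7, 8), (8, 4), (0, 0), (0, 0), (7, 0)]"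
  have d: "orientation Delta3 d" by (simp add: orientation_def Delta3_simps d_def insert_commute)
  have c0: "(clockwise_parity Delta3 d {0, 3, 6, 11} = Clockwise_even) = True"
    by (subst clockwise_parity_colouring[OF d, where c = "\<lambda>x. x \<in> {1, 7}"]) (simp_all only: Delta3_even_circuits members_insert, simp_all add: d_def)
  have c1: "(clockwise_parity Delta3 d {0, 4, 5, 7, 8, 11} = Clockwise_even) = True"
    by (subst clockwise_parity_colouring[OF d, where c = "\<lambda>x. x \<in> {1, 4, 7}"]) (simp_all only: Delta3_even_circuits members_insert, simp_all add: d_def)
  have c2: "(clockwise_parity Delta3 d {1, 2, 3, 7, 8, 11} = Clockwise_even) = True"
    by (subst clockwise_parity_colouring[OF d, where c = "\<lambda>x. x \<in> {2, 4, 7}"]) (simp_all only: Delta3_even_circuits members_insert, simp_all add: d_def)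
  have c3: "(clockwise_parity Delta3 d {1, 2, 4, 5, 6, 11} = Clockwise_even) = True"
    by (subst clockwise_parity_colouring[OF d, where c = "\<lambda>x. x \<in> {2, 5, 7}"]) (simp_all only: Delta3_even_circuits members_insert, simp_all add: d_def)
  show ?thesis
    by (intro exI[of _ d] conjI d) (simp only: Delta3_even_circuits members_insert, simp add: set_eq_subset c0 c1 c2 c3)
qed


lemma Delta4_simps:
  "verts Delta4 = {1, 2, 4, 5, 7, 8}" "edges Delta4 = {0, 1, 2, 3, 4, 5, 6, 7, 8}"
  "ends Delta4 0 = {7, 1}" "ends Delta4 1 = {1, 2}" "ends Delta4 2 = {2, 7}" "ends Delta4 3 = {1, 4}" "ends Delta4 4 = {4, 5}" "ends Delta4 5 = {5, 1}" "ends Delta4 6 = {4, 7}" "ends Delta4 7 = {7, 8}" "ends Delta4 8 = {8, 4}"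
  by (auto simp: Delta4_def contract_onto_def Let_def Delta3_simps)

lemma Delta4_multigraph: "multigraph Delta4"
  by unfold_locales (auto simp: Delta4_simps)

text \<open>All three connecting branches are trivial. The last contraction renames the vertex 0 to
  7, which is therefore the place of both the first and the last model vertex.\<close>

lemma Delta4_frame:
  "frame ring_model Delta4 ((!) [7, 1, 1, 4, 4, 7])
    ((!) [{7, 1}, {7, 2, 1}, {1, 4}, {1, 5, 4}, {4, 7}, {4, 8, 7}, {1}, {4}, {7}])
    ((!) [{0}, {2, 1}, {3}, {5, 4}, {6}, {8, 7}, {}, {}, {}])"
proof -
  have 0: "spath Delta4 7 {7, 1} {0} 1" by (rule spath_single) (auto simp: Delta4_simps)
  have 1: "spath Delta4 7 {7, 2, 1} {2, 1} 1" by (rule spath_two) (auto simp: Delta4_simps)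
  have 2: "spath Delta4 1 {1, 4} {3} 4" by (rule spath_single) (auto simp: Delta4_simps)
  have 3: "spath Delta4 1 {1, 5, 4} {5, 4} 4" by (rule spath_two) (auto simp: Delta4_simps)
  have 4: "spath Delta4 4 {4, 7} {6} 7" by (rule spath_single) (auto simp: Delta4_simps)
  have 5: "spath Delta4 4 {4, 8, 7} {8, 7} 7" by (rule spath_two) (auto simp: Delta4_simps)
  have 6: "spath Delta4 1 {1} {} 1" by (rule spath.nil)
  have 7: "spath Delta4 4 {4} {} 4" by (rule spath.nil)
  have 8: "spath Delta4 7 {7} {} 7" by (rule spath.nil)
  show ?thesis
    unfolding frame_def using 0 1 2 3 4 5 6 7 8
    by (simp add: ring_model_simps all_less ex_less lessThan_numerals Delta4_simps insert_commute doubleton_eq_iff)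
qed

lemma Delta4_nonempty: "i < 6 \<Longrightarrow> ([{0}, {2, 1}, {3}, {5, 4}, {6}, {8, 7}, {}, {}, {}] :: nat set list) ! i \<noteq> {}"
  using all_less(2)[of "\<lambda>i. ([{0}, {2, 1}, {3}, {5, 4}, {6}, {8, 7}, {}, {}, {}] :: nat set list) ! i \<noteq> {}"] by simp

lemma Delta4_even_circuits:
  "even_circuits Delta4 =
    {{0, 3, 7, 8}, {0, 4, 5, 6}, {1, 2, 3, 6}, {1, 2, 4, 5, 7, 8}}"
proof (intro equalityI subsetI)
  fix C assume "C \<in> even_circuits Delta4"
  then have C: "circ Delta4 C" "even (card C)" by (auto simp: even_circuits_circ)
  define m where "m = (\<lambda>i. i \<in> C)"
  have "C \<subseteq> set [0, 1, 2, 3, 4, 5, 6, 7, 8]" using circ_edges[OF C(1)] by (simp add: Delta4_simps)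
  then have Ceq: "C = set (filter m [0, 1, 2, 3, 4, 5, 6, 7, 8])" unfolding m_def set_filter by blast
  have e7: "m 7 = m 8"
    unfolding m_def by (rule circ_degree_two[OF C(1), of 8]) (auto simp: Delta4_simps)
  have e5: "m 5 = m 4"
    unfolding m_def by (rule circ_degree_two[OF C(1), of 5]) (auto simp: Delta4_simps)
  have e3: "m 3 = (m 4 \<noteq> (m 6 \<noteq> m 8))"
    unfolding m_def by (rule circ_degree_four(1)[OF C(1), of 4]) (auto simp: Delta4_simps)
  have e1: "m 1 = m 2"
    unfolding m_def by (rule circ_degree_two[OF C(1), of 2]) (auto simp: Delta4_simps)
  have e0: "m 0 = (m 2 \<noteq> (m 6 \<noteq> m 7))"
    unfolding m_def by (rule circ_degree_four(1)[OF C(1), of 7]) (auto simp: Delta4_simps)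
  have f1: "\<not> (m 0 \<and> m 1 \<and> m 3 \<and> m 5)"
    unfolding m_def by (rule circ_degree_four(2)[OF C(1), of 1]) (auto simp: Delta4_simps)
  have f4: "\<not> (m 3 \<and> m 4 \<and> m 6 \<and> m 8)"
    unfolding m_def by (rule circ_degree_four(2)[OF C(1), of 4]) (auto simp: Delta4_simps)
  have f7: "\<not> (m 0 \<and> m 2 \<and> m 6 \<and> m 7)"
    unfolding m_def by (rule circ_degree_four(2)[OF C(1), of 7]) (auto simp: Delta4_simps)
  have t0: "\<not> (m 0 \<and> m 1 \<and> m 2)"
  proof
    assume "m 0 \<and> m 1 \<and> m 2"
    then have "{0, 1, 2} \<subseteq> C" by (simp add: m_def)
    then have "C = {0, 1, 2}" using circ_minimal[OF C(1), of "{0, 1, 2}"] ring_circuits(2)[OF Delta4_frame Delta4_nonempty] by (simp add: insert_commute)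
    then show False using C(2) by simp
  qed
  have t1: "\<not> (m 3 \<and> m 4 \<and> m 5)"
  proof
    assume "m 3 \<and> m 4 \<and> m 5"
    then have "{3, 4, 5} \<subseteq> C" by (simp add: m_def)
    then have "C = {3, 4, 5}" using circ_minimal[OF C(1), of "{3, 4, 5}"] ring_circuits(3)[OF Delta4_frame Delta4_nonempty] by (simp add: insert_commute)
    then show False using C(2) by simp
  qed
  have t2: "\<not> (m 6 \<and> m 7 \<and> m 8)"
  proof
    assume "m 6 \<and> m 7 \<and> m 8"
    then have "{6, 7, 8} \<subseteq> C" by (simp add: m_def)
    then have "C = {6, 7, 8}" using circ_minimal[OF C(1), of "{6, 7, 8}"] ring_circuits(4)[OF Delta4_frame Delta4_nonempty] by (simp add: insert_commute)
    then show False using C(2) by simp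
  qed
  have ne: "C \<noteq> {}" using circ_nonempty C(1) by blast
  show "C \<in> {{0, 3, 7, 8}, {0, 4, 5, 6}, {1, 2, 3, 6}, {1, 2, 4, 5, 7, 8}}"
    using C(2) ne t0 t1 t2 f1 f4 f7 unfolding Ceq
    by (cases "m 2"; cases "m 4"; cases "m 6"; cases "m 8"; simp add: e7 e5 e3 e1 e0)
next
  fix C :: "nat set"
  assume C: "C \<in> {{0, 3, 7, 8}, {0, 4, 5, 6}, {1, 2, 3, 6}, {1, 2, 4, 5, 7, 8}}"
  note c = ring_circuits(1)[OF Delta4_frame Delta4_nonempty]
  have "circ Delta4 C" using C c[of 0 2 5] c[of 0 3 4] c[of 1 2 4] c[of 1 3 5] by (auto simp: insert_commute)
  moreover have "even (card C)" using C by auto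
  ultimately show "C \<in> even_circuits Delta4" by (simp add: even_circuits_circ)
qed

interpretation Delta4: base_graph Delta4
proof -
  interpret multigraph Delta4 by (rule Delta4_multigraph)
  show "base_graph Delta4"
  proof
    fix i :: nat
    show "even (card {D \<in> even_circuits Delta4. i \<in> D})"
    proof (cases "i \<in> {0, 1, 2, 3, 4, 5, 6, 7, 8}")
      case True
      then show ?thesis unfolding Delta4_even_circuits members_insert by (elim insertE emptyE) (simp_all add: set_eq_subset)
    next
      case False
      then have "{D \<in> even_circuits Delta4. i \<in> D} = {}" unfolding Delta4_even_circuits by auto
      then show ?thesis by (metis card.empty even_zero)
    qed
  qed
qed

lemma Delta4_parity:
  "\<exists>d. orientation Delta4 d \<and> even (card {D \<in> even_circuits Delta4. clockwise_parity Delta4 d D = Clockwise_even})"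
proof -
  define d :: "nat \<Rightarrow> nat \<times> nat" where "d = (!) [(7, 1), (1, 2), (2, 7), (1, 4), (4, 5), (5, 1), (4, 7), (7, 8), (8, 4)]"
  have d: "orientation Delta4 d" by (simp add: orientation_def Delta4_simps d_def insert_commute)
  have c0: "(clockwise_parity Delta4 d {0, 3, 7, 8} = Clockwise_even) = True"
    by (subst clockwise_parity_colouring[OF d, where c = "\<lambda>x. x \<in> {1, 8}"]) (simp_all only: Delta4_even_circuits members_insert, simp_all add: d_def)
  have c1: "(clockwise_parity Delta4 d {0, 4, 5, 6} = Clockwise_even) = True"
    by (subst clockwise_parity_colouring[OF d, where c = "\<lambda>x. x \<in> {1, 4}"]) (simp_all only: Delta4_even_circuits members_insert, simp_all add: d_def)
  have c2: "(clockwise_parity Delta4 d {1, 2, 3, 6} = Clockwise_even) = True"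
    by (subst clockwise_parity_colouring[OF d, where c = "\<lambda>x. x \<in> {2, 4}"]) (simp_all only: Delta4_even_circuits members_insert, simp_all add: d_def)
  have c3: "(clockwise_parity Delta4 d {1, 2, 4, 5, 7, 8} = Clockwise_even) = True"
    by (subst clockwise_parity_colouring[OF d, where c = "\<lambda>x. x \<in> {2, 5, 8}"]) (simp_all only: Delta4_even_circuits members_insert, simp_all add: d_def)
  show ?thesis
    by (intro exI[of _ d] conjI d) (simp only: Delta4_even_circuits members_insert, simp add: set_eq_subset c0 c1 c2 c3)
qed

section \<open>Obstructions and relations\<close>

lemma theta_splitting:
  fixes H :: "('v, 'e) mgraph"
  assumes F: "frame theta_model F \<nu>1 \<sigma>1 \<pi>1" and H: "frame theta_model H \<nu> \<sigma> \<pi>" "multigraph H"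
    and c_all: "\<forall>i<3. 0 < card (\<pi>1 i) \<and> card (\<pi>1 i) \<le> card (\<pi> i) \<and> even (card (\<pi> i) + card (\<pi>1 i))"
    and e: "even (card (\<pi>1 0) + card (\<pi>1 1))" "even (card (\<pi>1 1) + card (\<pi>1 2))"
  shows "\<exists>\<phi>. even_splitting F H \<phi> \<and> \<phi> (\<pi>1 0 \<union> \<pi>1 1) = \<pi> 0 \<union> \<pi> 1 \<and> \<phi> (\<pi>1 1 \<union> \<pi>1 2) = \<pi> 1 \<union> \<pi> 2 \<and>
     \<phi> (\<pi>1 0 \<union> \<pi>1 2) = \<pi> 0 \<union> \<pi> 2"
proof -
  note c = c_all[rule_format]
  let ?I = "{{0, 1}, {1, 2}, {0, 2 :: nat}}"
  have "\<exists>\<phi>. even_splitting F H \<phi> \<and> (\<forall>I\<in>?I. \<phi> (\<Union>i\<in>I. \<pi>1 i) = (\<Union>i\<in>I. \<pi> i))"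
  proof (rule frame_even_splitting[OF F H]; (unfold theta_model_simps(1))?)
    show "card (\<pi>1 i) \<le> card (\<pi> i) \<and> even (card (\<pi> i) + card (\<pi>1 i))" if "i < 3" for i using c[OF that] by blast
    have "\<forall>i<3. fst (theta_model ! i) \<noteq> snd (theta_model ! i)" by (simp add: all_less theta_model_simps)
    then show "fst (theta_model ! i) \<noteq> snd (theta_model ! i)" if "i < 3" for i using that by blast
    show "joins theta_model j \<noteq> joins theta_model i \<and> (card (\<pi>1 j) = 0 \<longrightarrow> joins theta_model j \<inter> joins theta_model i = {})"
      if "i < 3" "card (\<pi>1 i) = 0" for i j using c[OF that(1)] that(2) by simp
    show "I \<subseteq> {..<3} \<and> (\<Union>i\<in>I. \<pi>' i) \<in> even_circuits H'"
      if fr: "frame theta_model H' \<nu>' \<sigma>' \<pi>'" and c': "\<And>i. i < 3 \<Longrightarrow> card (\<pi>1 i) \<le> card (\<pi>' i) \<and> even (card (\<pi>' i) + card (\<pi>1 i))"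
        and I: "I \<in> ?I" for H' :: "('v, 'e) mgraph" and \<nu>' \<sigma>' \<pi>' I
    proof -
      have n: "\<pi>' i \<noteq> {}" if "i < 3" for i using c[OF that] c'[OF that] by auto
      have "circ H' (\<Union>i\<in>I. \<pi>' i)" using I theta_circuits[OF fr n] by (auto simp: Un_commute)
      moreover have "even (\<Sum>i\<in>I. card (\<pi>1 i))" using I e by auto
      moreover have I3: "I \<subseteq> {..<3}" using I by auto
      ultimately show ?thesis
        using frame_circuit_even[OF fr, of I "\<lambda>i. card (\<pi>1 i)"] c' by (simp add: theta_model_simps)
    qed
  qed
  then show ?thesis by simp
qed

lemma K4_splitting:
  fixes H :: "('v, 'e) mgraph"
  assumes F: "frame K4_model F \<nu>1 \<sigma>1 \<pi>1" and H: "frame K4_model H \<nu> \<sigma> \<pi>" "multigraph H"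
    and c_all: "\<forall>i<6. 0 < card (\<pi>1 i) \<and> card (\<pi>1 i) \<le> card (\<pi> i) \<and> even (card (\<pi> i) + card (\<pi>1 i))"
    and e: "even (card (\<pi>1 0) + card (\<pi>1 3) + card (\<pi>1 5) + card (\<pi>1 2))"
      "even (card (\<pi>1 0) + card (\<pi>1 4) + card (\<pi>1 5) + card (\<pi>1 1))"
      "even (card (\<pi>1 1) + card (\<pi>1 3) + card (\<pi>1 4) + card (\<pi>1 2))"
  shows "\<exists>\<phi>. even_splitting F H \<phi> \<and> \<phi> (\<pi>1 0 \<union> \<pi>1 3 \<union> \<pi>1 5 \<union> \<pi>1 2) = \<pi> 0 \<union> \<pi> 3 \<union> \<pi> 5 \<union> \<pi> 2 \<and>
     \<phi> (\<pi>1 0 \<union> \<pi>1 4 \<union> \<pi>1 5 \<union> \<pi>1 1) = \<pi> 0 \<union> \<pi> 4 \<union> \<pi> 5 \<union> \<pi> 1 \<and>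
     \<phi> (\<pi>1 1 \<union> \<pi>1 3 \<union> \<pi>1 4 \<union> \<pi>1 2) = \<pi> 1 \<union> \<pi> 3 \<union> \<pi> 4 \<union> \<pi> 2"
proof -
  note c = c_all[rule_format]
  let ?I = "{{0, 3, 5, 2}, {0, 4, 5, 1}, {1, 3, 4, 2 :: nat}}"
  have "\<exists>\<phi>. even_splitting F H \<phi> \<and> (\<forall>I\<in>?I. \<phi> (\<Union>i\<in>I. \<pi>1 i) = (\<Union>i\<in>I. \<pi> i))"
  proof (rule frame_even_splitting[OF F H]; (unfold K4_model_simps(1))?)
    show "card (\<pi>1 i) \<le> card (\<pi> i) \<and> even (card (\<pi> i) + card (\<pi>1 i))" if "i < 6" for i using c[OF that] by blast
    have "\<forall>i<6. fst (K4_model ! i) \<noteq> snd (K4_model ! i)" by (simp add: all_less K4_model_simps)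
    then show "fst (K4_model ! i) \<noteq> snd (K4_model ! i)" if "i < 6" for i using that by blast
    show "joins K4_model j \<noteq> joins K4_model i \<and> (card (\<pi>1 j) = 0 \<longrightarrow> joins K4_model j \<inter> joins K4_model i = {})"
      if "i < 6" "card (\<pi>1 i) = 0" for i j using c[OF that(1)] that(2) by simp
    show "I \<subseteq> {..<6} \<and> (\<Union>i\<in>I. \<pi>' i) \<in> even_circuits H'"
      if fr: "frame K4_model H' \<nu>' \<sigma>' \<pi>'" and c': "\<And>i. i < 6 \<Longrightarrow> card (\<pi>1 i) \<le> card (\<pi>' i) \<and> even (card (\<pi>' i) + card (\<pi>1 i))"
        and I: "I \<in> ?I" for H' :: "('v, 'e) mgraph" and \<nu>' \<sigma>' \<pi>' I
    proof -
      have n: "\<pi>' i \<noteq> {}" if "i < 6" for i using c[OF that] c'[OF that] by auto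
      note ci = K4_circuits[OF fr n, unfolded Un_assoc]
      have "circ H' (\<Union>i\<in>I. \<pi>' i) \<and> even (\<Sum>i\<in>I. card (\<pi>1 i)) \<and> I \<subseteq> {..<6}"
        using I by (elim insertE emptyE) (use e ci in auto)
      then show ?thesis
        using frame_circuit_even[OF fr, of I "\<lambda>i. card (\<pi>1 i)"] c' by (simp add: K4_model_simps)
    qed
  qed
  then show ?thesis by (simp add: Un_assoc)
qed

text \<open>Which choices of sides give even circuits depends on the lengths of the connecting
  branches, so all eight choices are treated together under a parity condition.\<close>

lemma ring_splitting:
  fixes H :: "('v, 'e) mgraph"
  assumes F: "frame ring_model F \<nu>1 \<sigma>1 \<pi>1" and H: "frame ring_model H \<nu> \<sigma> \<pi>" "multigraph H"
    and c_all: "\<forall>i<9. card (\<pi>1 i) \<le> card (\<pi> i) \<and> even (card (\<pi> i) + card (\<pi>1 i))"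
    and p_all: "\<forall>i<6. 0 < card (\<pi>1 i)"
  shows "\<exists>\<phi>. even_splitting F H \<phi> \<and> (\<forall>i\<in>{0, 1}. \<forall>j\<in>{2, 3}. \<forall>k\<in>{4, 5}.
     even (card (\<pi>1 i) + card (\<pi>1 j) + card (\<pi>1 k) + card (\<pi>1 6) + card (\<pi>1 7) + card (\<pi>1 8)) \<longrightarrow>
     \<phi> (\<pi>1 i \<union> \<pi>1 j \<union> \<pi>1 k \<union> (\<pi>1 6 \<union> \<pi>1 7 \<union> \<pi>1 8)) = \<pi> i \<union> \<pi> j \<union> \<pi> k \<union> (\<pi> 6 \<union> \<pi> 7 \<union> \<pi> 8))"
proof -
  note c = c_all[rule_format] and p = p_all[rule_format]
  let ?I = "{{i, j, k, 6, 7, 8} | i j k. i \<in> {0, 1} \<and> j \<in> {2, 3} \<and> k \<in> {4, 5 :: nat} \<and>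
    even (card (\<pi>1 i) + card (\<pi>1 j) + card (\<pi>1 k) + card (\<pi>1 6) + card (\<pi>1 7) + card (\<pi>1 8))}"
  have "\<exists>\<phi>. even_splitting F H \<phi> \<and> (\<forall>I\<in>?I. \<phi> (\<Union>i\<in>I. \<pi>1 i) = (\<Union>i\<in>I. \<pi> i))"
  proof (rule frame_even_splitting[OF F H]; (unfold ring_model_simps(1))?)
    show "card (\<pi>1 i) \<le> card (\<pi> i) \<and> even (card (\<pi> i) + card (\<pi>1 i))" if "i < 9" for i using c[OF that] by blast
    have "\<forall>i<9. fst (ring_model ! i) \<noteq> snd (ring_model ! i)" by (simp add: all_less ring_model_simps)
    then show "fst (ring_model ! i) \<noteq> snd (ring_model ! i)" if "i < 9" for i using that by blast
    \<comment> \<open>The branches that may be trivial have index at least 6; they are pairwise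
      disjoint and parallel to no other branch.\<close>
    have *: "\<forall>i<9. 6 \<le> i \<longrightarrow> (\<forall>j<9. j \<noteq> i \<longrightarrow> joins ring_model j \<noteq> joins ring_model i \<and>
        (6 \<le> j \<longrightarrow> joins ring_model j \<inter> joins ring_model i = {}))"
      by (simp add: all_less ring_model_simps doubleton_eq_iff)
    show "joins ring_model j \<noteq> joins ring_model i \<and> (card (\<pi>1 j) = 0 \<longrightarrow> joins ring_model j \<inter> joins ring_model i = {})"
      if "i < 9" "j < 9" "j \<noteq> i" "card (\<pi>1 i) = 0" for i j
    proof -
      have "6 \<le> i" "card (\<pi>1 j) = 0 \<longrightarrow> 6 \<le> j" using p[of i] p[of j] that(4) by linarith+
      then show ?thesis using * that(1-3) by blast
    qed
    show "I \<subseteq> {..<9} \<and> (\<Union>i\<in>I. \<pi>' i) \<in> even_circuits H'"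
      if fr: "frame ring_model H' \<nu>' \<sigma>' \<pi>'" and c': "\<And>i. i < 9 \<Longrightarrow> card (\<pi>1 i) \<le> card (\<pi>' i) \<and> even (card (\<pi>' i) + card (\<pi>1 i))"
        and I: "I \<in> ?I" for H' :: "('v, 'e) mgraph" and \<nu>' \<sigma>' \<pi>' I
    proof -
      have n: "\<pi>' i \<noteq> {}" if "i < 6" for i
      proof -
        have "i < 9" using that by simp
        then show ?thesis using p[OF that] c'[of i] by auto
      qed
      obtain i j k where ijk: "i \<in> {0, 1}" "j \<in> {2, 3}" "k \<in> {4, 5}" and I: "I = {i, j, k, 6, 7, 8}"
        and e: "even (card (\<pi>1 i) + card (\<pi>1 j) + card (\<pi>1 k) + card (\<pi>1 6) + card (\<pi>1 7) + card (\<pi>1 8))" using I by blast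
      have d: "i \<noteq> j" "j \<noteq> k" "i \<noteq> k" "i < 6" "j < 6" "k < 6" using ijk by auto
      have "circ H' (\<Union>i\<in>I. \<pi>' i)" using ring_circuits(1)[OF fr n ijk] by (simp add: I Un_assoc)
      moreover have "even (\<Sum>i\<in>I. card (\<pi>1 i))" using d e by (simp add: I add.assoc)
      moreover have "I \<subseteq> {..<9}" using d by (simp add: I)
      ultimately show ?thesis
        using frame_circuit_even[OF fr, of I "\<lambda>i. card (\<pi>1 i)"] c' by (simp add: ring_model_simps)
    qed
  qed
  then obtain \<phi> where \<phi>: "even_splitting F H \<phi>" "\<forall>I\<in>?I. \<phi> (\<Union>i\<in>I. \<pi>1 i) = (\<Union>i\<in>I. \<pi> i)" by blast
  have "\<phi> (\<pi>1 i \<union> \<pi>1 j \<union> \<pi>1 k \<union> (\<pi>1 6 \<union> \<pi>1 7 \<union> \<pi>1 8)) = \<pi> i \<union> \<pi> j \<union> \<pi> k \<union> (\<pi> 6 \<union> \<pi> 7 \<union> \<pi> 8)"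
    if "i \<in> {0, 1}" "j \<in> {2, 3}" "k \<in> {4, 5}"
      "even (card (\<pi>1 i) + card (\<pi>1 j) + card (\<pi>1 k) + card (\<pi>1 6) + card (\<pi>1 7) + card (\<pi>1 8))" for i j k
  proof -
    have "{i, j, k, 6, 7, 8} \<in> ?I" using that by blast
    from bspec[OF \<phi>(2) this] show ?thesis by (simp add: Un_assoc)
  qed
  then show ?thesis by (intro exI[of _ \<phi>] conjI ballI impI \<phi>(1))
qed

lemma clockwise_parity_subgraph:
  assumes H: "subgraph H G" and d: "orientation G d" and C: "C \<in> even_circuits H"
  shows "C \<in> even_circuits G" "orientation H d"
    "clockwise_parity H d C = Clockwise_even \<longleftrightarrow> clockwise_parity G d C = Clockwise_even"
proof -
  have sub: "edges H \<subseteq> edges G" "\<And>e. e \<in> edges H \<Longrightarrow> ends H e = ends G e" using H by (auto simp: subgraph_def)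
  have CH: "C \<subseteq> edges H" "circ H C" using C by (auto simp: even_circuits_circ dest: circ_edges)
  have "circ G C" using circ_mono[OF CH(2), of G] CH(1) sub by (metis order_trans subsetD)
  then show CG: "C \<in> even_circuits G" using C by (simp add: even_circuits_circ)
  show dH: "orientation H d" using d sub by (auto simp: orientation_def)
  obtain c where c: "proper H c C" using even_circuit_proper C by blast
  then have "proper G c C" using CH(1) sub(2) unfolding proper_def by (metis subsetD)
  then show "clockwise_parity H d C = Clockwise_even \<longleftrightarrow> clockwise_parity G d C = Clockwise_even"
    by (simp add: clockwise_parity_proper[OF dH C c] clockwise_parity_proper[OF d CG])
qed

text \<open>Modulo 2, the circuits prescribed to be clockwise even are counted by the disagreements
  with \<open>d\<close> plus the circuits that are clockwise even under \<open>d\<close>. The latter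
  number may be computed in \<open>F\<close>, as it is invariant under splitting.\<close>

lemma (in base_graph) prescribed_parity:
  assumes s: "even_splitting F H \<phi>" and H: "subgraph H G" and d: "orientation G d" "orientation F d1"
  shows "even (card (prescribed_even J F \<phi>)) =
    (even (card {D \<in> EC. (J (\<phi> D) = Clockwise_even) \<noteq> (clockwise_parity G d (\<phi> D) = Clockwise_even)}) =
     even (card {D \<in> EC. clockwise_parity F d1 D = Clockwise_even}))"
proof -
  have mH: "multigraph H" using H by (simp add: subgraph_def)
  have dH: "orientation H d" using d(1) H by (auto simp: orientation_def subgraph_def)
  note p = even_splitting_parity[OF s mH dH d(2)]
  have "prescribed_even J F \<phi> = \<phi> ` {D \<in> EC. J (\<phi> D) = Clockwise_even}" by (auto simp: prescribed_even_def)
  moreover have "inj_on \<phi> {D \<in> EC. J (\<phi> D) = Clockwise_even}" using p(1) by (auto intro: inj_on_subset)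
  ultimately have 1: "card (prescribed_even J F \<phi>) = card {D \<in> EC. J (\<phi> D) = Clockwise_even}" by (simp add: card_image)
  have 2: "{D \<in> EC. clockwise_parity H d (\<phi> D) = Clockwise_even} = {D \<in> EC. clockwise_parity G d (\<phi> D) = Clockwise_even}"
    using clockwise_parity_subgraph(3)[OF H d(1)] p(2) by blast
  show ?thesis
    unfolding 1 even_card_neq[OF finite_EC, of "\<lambda>D. J (\<phi> D) = Clockwise_even" "\<lambda>D. clockwise_parity G d (\<phi> D) = Clockwise_even"]
      p(3)[symmetric] 2 by argo
qed

text \<open>The second component tells whether the number of clockwise even circuits, which does not depend on the
  orientation, is even.\<close>

definition nine_graphs :: "((nat, nat) mgraph \<times> bool) set" where
  "nine_graphs = {(O1, False), (O2, False), (E1, True), (E2, True), (E3, True),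
     (Delta1, True), (Delta2, True), (Delta3, True), (Delta4, True)}"

lemma nine_graphs_parity:
  assumes "(F, b) \<in> nine_graphs"
  obtains d1 where "base_graph F" "orientation F d1" "even (card {D \<in> even_circuits F. clockwise_parity F d1 D = Clockwise_even}) = b"
proof -
  have "base_graph F \<and> (\<exists>d1. orientation F d1 \<and> even (card {D \<in> even_circuits F. clockwise_parity F d1 D = Clockwise_even}) = b)"
    using assms unfolding nine_graphs_def
    by (elim insertE emptyE) (erule Pair_inject, hypsubst, simp only: simp_thms
      O1_parity O2_parity E1_parity E2_parity E3_parity Delta1_parity Delta2_parity Delta3_parity Delta4_parity
      O1.base_graph_axioms O2.base_graph_axioms E1.base_graph_axioms E2.base_graph_axioms E3.base_graph_axioms
      Delta1.base_graph_axioms Delta2.base_graph_axioms Delta3.base_graph_axioms Delta4.base_graph_axioms)+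
  then show ?thesis using that by blast
qed

lemma nine_graphs_prescribed:
  assumes F: "(F, b) \<in> nine_graphs" and s: "even_splitting F H \<phi>" "subgraph H G" "orientation G d"
  shows "even (card (prescribed_even J F \<phi>)) =
    (even (card {D \<in> even_circuits F. (J (\<phi> D) = Clockwise_even) \<noteq> (clockwise_parity G d (\<phi> D) = Clockwise_even)}) = b)"
proof -
  obtain d1 where "base_graph F" "orientation F d1"
    "even (card {D \<in> even_circuits F. clockwise_parity F d1 D = Clockwise_even}) = b" using nine_graphs_parity[OF F] .
  then show ?thesis using base_graph.prescribed_parity[OF _ s] by simp
qed

lemma even_card_three:
  assumes "A \<noteq> B" "A \<noteq> C" "B \<noteq> C"
  shows "even (card {D \<in> {A, B, C}. P D}) \<longleftrightarrow> P A = (P B \<noteq> P C)"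
  unfolding members_insert using assms by auto

lemma even_card_four:
  assumes "A \<noteq> B" "A \<noteq> C" "A \<noteq> D" "B \<noteq> C" "B \<noteq> D" "C \<noteq> D"
  shows "even (card {E \<in> {A, B, C, D}. P E}) \<longleftrightarrow> (P A \<noteq> P B) = (P C \<noteq> P D)"
  unfolding members_insert using assms by auto

lemma spath_subset_verts:
  assumes "multigraph G" "spath G x S p y" "x \<in> verts G"
  shows "S \<subseteq> verts G"
  using spath_verts[OF assms(2)] spath_edges[OF assms(2)] multigraph.ends_subset[OF assms(1)] assms(3) by blast

lemma spath_subset_verts':
  assumes "multigraph G" "spath G x S p y" "x \<noteq> y"
  shows "S \<subseteq> verts G"
proof -
  have "p \<noteq> {}" using spath_empty_iff[OF assms(2)] assms(3) by simp
  have "x \<in> verts G" using assms(2,3) multigraph.ends_subset[OF assms(1)] by (cases rule: spath.cases) auto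
  then show ?thesis by (rule spath_subset_verts[OF assms(1,2)])
qed

lemma frame_subgraph:
  assumes G: "multigraph G"
    and p: "\<forall>i<length ps. spath G (\<nu> (fst (ps ! i))) (\<sigma> i) (\<pi> i) (\<nu> (snd (ps ! i)))"
    and v: "\<forall>i<length ps. \<sigma> i \<subseteq> verts G"
    and i: "\<forall>i<length ps. \<forall>j<i. \<sigma> i \<inter> \<sigma> j \<subseteq> \<nu> ` joins ps i \<inter> \<nu> ` joins ps j \<and> \<pi> i \<inter> \<pi> j = {}"
    and k: "\<forall>x\<in>\<Union>i<length ps. joins ps i. \<forall>y\<in>\<Union>i<length ps. joins ps i.
       \<nu> x = \<nu> y \<longleftrightarrow> x = y \<or> (\<exists>i<length ps. \<pi> i = {} \<and> {x, y} = joins ps i)"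
  obtains H where "subgraph H G" "frame ps H \<nu> \<sigma> \<pi>"
proof
  let ?H = "\<lparr>verts = (\<Union>i<length ps. \<sigma> i), edges = (\<Union>i<length ps. \<pi> i), ends = ends G\<rparr>"
  have sub: "verts ?H \<subseteq> verts G" "edges ?H \<subseteq> edges G" using v p spath_edges by fastforce+
  have "multigraph ?H"
  proof
    show "finite (verts ?H)" using sub(1) multigraph.finite_verts[OF G] finite_subset by blast
    show "finite (edges ?H)" using sub(2) multigraph.finite_edges[OF G] finite_subset by blast
    fix e assume e: "e \<in> edges ?H"
    then show "card (ends ?H e) \<in> {1, 2}" using sub(2) multigraph.card_ends[OF G] by auto
    obtain i where "i < length ps" "e \<in> \<pi> i" using e by auto
    then show "ends ?H e \<subseteq> verts ?H" using p spath_ends_subset by fastforce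
  qed
  then show "subgraph ?H G" using sub by (simp add: subgraph_def)
  have p': "\<forall>i<length ps. spath ?H (\<nu> (fst (ps ! i))) (\<sigma> i) (\<pi> i) (\<nu> (snd (ps ! i)))"
  proof (intro allI impI)
    fix i assume i: "i < length ps"
    then have "\<pi> i \<subseteq> edges ?H" by auto
    then show "spath ?H (\<nu> (fst (ps ! i))) (\<sigma> i) (\<pi> i) (\<nu> (snd (ps ! i)))"
      by (rule spath_mono[OF p[rule_format, OF i]]) simp
  qed
  show "frame ps ?H \<nu> \<sigma> \<pi>" unfolding frame_def by (rule conjI[OF p' conjI[OF i conjI[OF k]]]) simp
qed

section \<open>Graphs without obstructions\<close>

locale obstruction_free = multigraph G for G :: "('v, 'e) mgraph" +
  fixes J d0
  assumes d0: "orientation G d0"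
    and free: "subgraph H G \<Longrightarrow> (F, b) \<in> nine_graphs \<Longrightarrow> even_splitting F H \<phi> \<Longrightarrow> even (card (prescribed_even J F \<phi>)) = b"
begin

text \<open>This is the function \<open>f\<close> to which the results on linearity are applied;
  flipping \<open>d0\<close> on the set \<open>X\<close> that represents it produces a compatible
  orientation.\<close>

definition disc :: "'e set \<Rightarrow> bool" where
  "disc C \<longleftrightarrow> (J C = Clockwise_even) \<noteq> (clockwise_parity G d0 C = Clockwise_even)"

lemma G: "multigraph G" ..

text \<open>Without an obstruction the prescribed number has the same parity as the number of
  circuits that are clockwise even under any orientation, so the number of disagreements is
  even.\<close>

lemma nine_graphs_disc:
  assumes "subgraph H G" "(F, b) \<in> nine_graphs" "even_splitting F H \<phi>"
  shows "even (card {D \<in> even_circuits F. disc (\<phi> D)})"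
  using nine_graphs_prescribed[OF assms(2,3,1) d0, of J] free[OF assms] unfolding disc_def by argo

lemma nine_graphs_disc_three:
  assumes "subgraph H G" "(F, b) \<in> nine_graphs" "even_splitting F H \<phi>"
    and "even_circuits F = {A, B, C}" "A \<noteq> B" "A \<noteq> C" "B \<noteq> C"
  shows "disc (\<phi> A) = (disc (\<phi> B) \<noteq> disc (\<phi> C))"
  using nine_graphs_disc[OF assms(1-3)] unfolding assms(4) even_card_three[OF assms(5-7)] .

lemma nine_graphs_disc_four:
  assumes "subgraph H G" "(F, b) \<in> nine_graphs" "even_splitting F H \<phi>"
    and "even_circuits F = {A, B, C, D}" "A \<noteq> B" "A \<noteq> C" "A \<noteq> D" "B \<noteq> C" "B \<noteq> D" "C \<noteq> D"
  shows "(disc (\<phi> A) \<noteq> disc (\<phi> B)) = (disc (\<phi> C) \<noteq> disc (\<phi> D))"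
  using nine_graphs_disc[OF assms(1-3)] unfolding assms(4) even_card_four[OF assms(5-10)] .

lemma theta_rel_disc: "theta_rel G disc"
  unfolding theta_rel_def
proof (intro allI impI)
  fix x y P Q R p q r
  assume ne: "x \<noteq> y" and s: "spath G x P p y" "spath G x Q q y" "spath G x R r y"
    and i: "P \<inter> Q = {x, y}" "P \<inter> R = {x, y}" "Q \<inter> R = {x, y}" and d: "p \<inter> q = {}" "p \<inter> r = {}" "q \<inter> r = {}"
    and e: "even (card p + card q)" "even (card q + card r)"
  obtain H where H: "subgraph H G" "frame theta_model H ((!) [x, y]) ((!) [P, Q, R]) ((!) [p, q, r])"
  proof (rule frame_subgraph[OF G, of theta_model "(!) [x, y]" "(!) [P, Q, R]" "(!) [p, q, r]"])
    have ne': "p \<noteq> {}" "q \<noteq> {}" "r \<noteq> {}" using ne s spath_empty_iff by metis+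
    show "\<forall>i<length theta_model. spath G ([x, y] ! fst (theta_model ! i)) ([P, Q, R] ! i) ([p, q, r] ! i) ([x, y] ! snd (theta_model ! i))"
      using s by (simp add: theta_model_simps all_less)
    show "\<forall>i<length theta_model. [P, Q, R] ! i \<subseteq> verts G"
      using s[THEN spath_subset_verts'[OF G]] ne by (simp add: theta_model_simps all_less)
    show "\<forall>i<length theta_model. \<forall>j<i. [P, Q, R] ! i \<inter> [P, Q, R] ! j \<subseteq> (!) [x, y] ` joins theta_model i \<inter> (!) [x, y] ` joins theta_model j
       \<and> [p, q, r] ! i \<inter> [p, q, r] ! j = {}"
      using i[THEN Int_sym] d[THEN Int_sym] by (simp add: theta_model_simps all_less)
    show "\<forall>a\<in>\<Union>i<length theta_model. joins theta_model i. \<forall>b\<in>\<Union>i<length theta_model. joins theta_model i.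
       [x, y] ! a = [x, y] ! b \<longleftrightarrow> a = b \<or> (\<exists>i<length theta_model. [p, q, r] ! i = {} \<and> {a, b} = joins theta_model i)"
      using ne ne' by (simp add: theta_model_simps all_less ex_less lessThan_numerals)
  qed
  have mH: "multigraph H" using H(1) by (simp add: subgraph_def)
  have pos: "0 < card p" "0 < card q" "0 < card r"
    using ne s spath_empty_iff spath_finite by (metis card_gt_0_iff)+
  show "disc (p \<union> q) = (disc (q \<union> r) \<noteq> disc (p \<union> r))"
  proof (cases "odd (card p)")
    case True
    then obtain \<phi> where \<phi>: "even_splitting E1 H \<phi>" "\<phi> {0, 1} = p \<union> q" "\<phi> {1, 2} = q \<union> r" "\<phi> {0, 2} = p \<union> r"
      using theta_splitting[OF E1_frame H(2) mH] e pos
      by (auto simp: all_less insert_commute One_nat_def Suc_le_eq)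
    show ?thesis using nine_graphs_disc_three[OF H(1) _ \<phi>(1) E1_even_circuits] \<phi>(2-4)
      by (auto simp: nine_graphs_def set_eq_subset)
  next
    case False
    then have "2 \<le> card p" "2 \<le> card q" "2 \<le> card r" using e pos by presburger+
    then obtain \<phi> where \<phi>: "even_splitting O1 H \<phi>" "\<phi> {0, 1, 3, 4} = p \<union> q" "\<phi> {1, 2, 4, 5} = q \<union> r" "\<phi> {0, 2, 3, 5} = p \<union> r"
      using theta_splitting[OF O1_frame H(2) mH] e False
      by (auto simp: all_less insert_commute)
    show ?thesis using nine_graphs_disc_three[OF H(1) _ \<phi>(1) O1_even_circuits] \<phi>(2-4)
      by (auto simp: nine_graphs_def set_eq_subset)
  qed
qed

text \<open>Bundles the incidences of \<open>K4_rel\<close> without the parities, so that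
  permutations of the four branch vertices can be applied to them as facts.\<close>

definition K4_subdivision :: "'v \<Rightarrow> 'v \<Rightarrow> 'v \<Rightarrow> 'v \<Rightarrow> 'v set \<Rightarrow> 'v set \<Rightarrow> 'v set \<Rightarrow> 'v set \<Rightarrow> 'v set \<Rightarrow> 'v set \<Rightarrow>
    'e set \<Rightarrow> 'e set \<Rightarrow> 'e set \<Rightarrow> 'e set \<Rightarrow> 'e set \<Rightarrow> 'e set \<Rightarrow> bool" where
  "K4_subdivision x0 x1 x2 x3 P01 P02 P03 P12 P13 P23 p01 p02 p03 p12 p13 p23 \<longleftrightarrow>
     spath G x0 P01 p01 x1 \<and> spath G x0 P02 p02 x2 \<and> spath G x0 P03 p03 x3 \<and>
     spath G x1 P12 p12 x2 \<and> spath G x1 P13 p13 x3 \<and> spath G x2 P23 p23 x3 \<and>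
     P01 \<inter> P02 = {x0} \<and> P01 \<inter> P03 = {x0} \<and> P02 \<inter> P03 = {x0} \<and>
     P01 \<inter> P12 = {x1} \<and> P01 \<inter> P13 = {x1} \<and> P12 \<inter> P13 = {x1} \<and>
     P02 \<inter> P12 = {x2} \<and> P02 \<inter> P23 = {x2} \<and> P12 \<inter> P23 = {x2} \<and>
     P03 \<inter> P13 = {x3} \<and> P03 \<inter> P23 = {x3} \<and> P13 \<inter> P23 = {x3} \<and>
     P01 \<inter> P23 = {} \<and> P02 \<inter> P13 = {} \<and> P03 \<inter> P12 = {}"

text \<open>The three transpositions of neighbouring labels generate all permutations of the branch
  vertices.\<close>

lemma K4_subdivision_swap:
  assumes "K4_subdivision x0 x1 x2 x3 P01 P02 P03 P12 P13 P23 p01 p02 p03 p12 p13 p23"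
  shows "K4_subdivision x1 x0 x2 x3 P01 P12 P13 P02 P03 P23 p01 p12 p13 p02 p03 p23"
    "K4_subdivision x0 x2 x1 x3 P02 P01 P03 P12 P23 P13 p02 p01 p03 p12 p23 p13"
    "K4_subdivision x0 x1 x3 x2 P01 P03 P02 P13 P12 P23 p01 p03 p02 p13 p12 p23"
proof -
  have s: "spath G x0 P01 p01 x1" "spath G x0 P02 p02 x2" "spath G x0 P03 p03 x3"
    "spath G x1 P12 p12 x2" "spath G x1 P13 p13 x3" "spath G x2 P23 p23 x3"
    and i: "P01 \<inter> P02 = {x0}" "P01 \<inter> P03 = {x0}" "P02 \<inter> P03 = {x0}" "P01 \<inter> P12 = {x1}" "P01 \<inter> P13 = {x1}" "P12 \<inter> P13 = {x1}"
     "P02 \<inter> P12 = {x2}" "P02 \<inter> P23 = {x2}" "P12 \<inter> P23 = {x2}" "P03 \<inter> P13 = {x3}" "P03 \<inter> P23 = {x3}" "P13 \<inter> P23 = {x3}"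
     "P01 \<inter> P23 = {}" "P02 \<inter> P13 = {}" "P03 \<inter> P12 = {}"
    using assms unfolding K4_subdivision_def by simp_all
  note r = s i s[THEN spath_rev] i[THEN Int_sym]
  show "K4_subdivision x1 x0 x2 x3 P01 P12 P13 P02 P03 P23 p01 p12 p13 p02 p03 p23"
    "K4_subdivision x0 x2 x1 x3 P02 P01 P03 P12 P23 P13 p02 p01 p03 p12 p23 p13"
    "K4_subdivision x0 x1 x3 x2 P01 P03 P02 P13 P12 P23 p01 p03 p02 p13 p12 p23"
    unfolding K4_subdivision_def by (intro conjI r)+
qed

definition K4_relation :: "'e set \<Rightarrow> 'e set \<Rightarrow> 'e set \<Rightarrow> 'e set \<Rightarrow> 'e set \<Rightarrow> 'e set \<Rightarrow> bool" where
  "K4_relation p01 p02 p03 p12 p13 p23 \<longleftrightarrow>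
     disc (p01 \<union> p12 \<union> p23 \<union> p03) = (disc (p01 \<union> p13 \<union> p23 \<union> p02) \<noteq> disc (p02 \<union> p12 \<union> p13 \<union> p03))"

lemma K4_relation_swap:
  "K4_relation p01 p12 p13 p02 p03 p23 = K4_relation p01 p02 p03 p12 p13 p23"
  "K4_relation p02 p01 p03 p12 p23 p13 = K4_relation p01 p02 p03 p12 p13 p23"
  "K4_relation p01 p03 p02 p13 p12 p23 = K4_relation p01 p02 p03 p12 p13 p23"
  unfolding K4_relation_def by (simp_all only: Un_ac) argo+

text \<open>The branches of even length form a cut. Up to relabelling it is empty, the star of
  \<open>x0\<close>, or the cut between \<open>{x0, x2}\<close> and \<open>{x1, x3}\<close>; the
  shortest subdivisions with these patterns are \<open>E2\<close>, \<open>O2\<close> and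
  \<open>E3\<close>.\<close>

lemma K4_relation_normalised:
  assumes K: "K4_subdivision x0 x1 x2 x3 P01 P02 P03 P12 P13 P23 p01 p02 p03 p12 p13 p23"
    and par: "odd (card p01) \<and> odd (card p02) \<and> odd (card p03) \<and> odd (card p12) \<and> odd (card p13) \<and> odd (card p23) \<or>
      even (card p01) \<and> even (card p02) \<and> even (card p03) \<and> odd (card p12) \<and> odd (card p13) \<and> odd (card p23) \<or>
      even (card p01) \<and> odd (card p02) \<and> even (card p03) \<and> even (card p12) \<and> odd (card p13) \<and> even (card p23)"
  shows "K4_relation p01 p02 p03 p12 p13 p23"
proof -
  have s: "spath G x0 P01 p01 x1" "spath G x0 P02 p02 x2" "spath G x0 P03 p03 x3"
    "spath G x1 P12 p12 x2" "spath G x1 P13 p13 x3" "spath G x2 P23 p23 x3"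
    and i: "P01 \<inter> P02 = {x0}" "P01 \<inter> P03 = {x0}" "P02 \<inter> P03 = {x0}" "P01 \<inter> P12 = {x1}" "P01 \<inter> P13 = {x1}" "P12 \<inter> P13 = {x1}"
     "P02 \<inter> P12 = {x2}" "P02 \<inter> P23 = {x2}" "P12 \<inter> P23 = {x2}" "P03 \<inter> P13 = {x3}" "P03 \<inter> P23 = {x3}" "P13 \<inter> P23 = {x3}"
    and z: "P01 \<inter> P23 = {}" "P02 \<inter> P13 = {}" "P03 \<inter> P12 = {}"
    using K unfolding K4_subdivision_def by simp_all
  note m = s[THEN spath_start] s[THEN spath_end]
  have ne: "x0 \<noteq> x1" "x0 \<noteq> x2" "x0 \<noteq> x3" "x1 \<noteq> x2" "x1 \<noteq> x3" "x2 \<noteq> x3"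
    using disjoint_neq[OF z(1)] disjoint_neq[OF z(2)] m by blast+
  have ne': "p01 \<noteq> {}" "p02 \<noteq> {}" "p03 \<noteq> {}" "p12 \<noteq> {}" "p13 \<noteq> {}" "p23 \<noteq> {}"
    using ne s[THEN spath_empty_iff] by simp_all
  have d: "p01 \<inter> p02 = {}" "p01 \<inter> p03 = {}" "p02 \<inter> p03 = {}" "p01 \<inter> p12 = {}" "p01 \<inter> p13 = {}" "p12 \<inter> p13 = {}"
     "p02 \<inter> p12 = {}" "p02 \<inter> p23 = {}" "p12 \<inter> p23 = {}" "p03 \<inter> p13 = {}" "p03 \<inter> p23 = {}" "p13 \<inter> p23 = {}"
    by (rule spath_disjoint1, rule s, rule s, rule i)+
  have d0: "p01 \<inter> p23 = {}" "p02 \<inter> p13 = {}" "p03 \<inter> p12 = {}"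
    by (rule spath_disjoint0, rule s, rule s, rule z)+
  let ?\<nu> = "(!) [x0, x1, x2, x3]" and ?\<sigma> = "(!) [P01, P02, P03, P12, P13, P23]" and ?\<pi> = "(!) [p01, p02, p03, p12, p13, p23]"
  obtain H where H: "subgraph H G" "frame K4_model H ?\<nu> ?\<sigma> ?\<pi>"
  proof (rule frame_subgraph[OF G, of K4_model ?\<nu> ?\<sigma> ?\<pi>])
    show "\<forall>i<length K4_model. spath G (?\<nu> (fst (K4_model ! i))) (?\<sigma> i) (?\<pi> i) (?\<nu> (snd (K4_model ! i)))"
      using s by (simp add: K4_model_simps all_less)
    show "\<forall>i<length K4_model. ?\<sigma> i \<subseteq> verts G"
      using s[THEN spath_subset_verts'[OF G]] ne by (simp add: K4_model_simps all_less)
    show "\<forall>i<length K4_model. \<forall>j<i. ?\<sigma> i \<inter> ?\<sigma> j \<subseteq> ?\<nu> ` joins K4_model i \<inter> ?\<nu> ` joins K4_model j \<and> ?\<pi> i \<inter> ?\<pi> j = {}"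
      using i[THEN Int_sym] z[THEN Int_sym] d[THEN Int_sym] d0[THEN Int_sym] by (simp add: K4_model_simps all_less)
    show "\<forall>a\<in>\<Union>i<length K4_model. joins K4_model i. \<forall>b\<in>\<Union>i<length K4_model. joins K4_model i.
       ?\<nu> a = ?\<nu> b \<longleftrightarrow> a = b \<or> (\<exists>i<length K4_model. ?\<pi> i = {} \<and> {a, b} = joins K4_model i)"
      using ne ne[symmetric] ne' by (simp add: K4_model_simps all_less ex_less lessThan_numerals)
  qed
  have mH: "multigraph H" using H(1) by (simp add: subgraph_def)
  have pos: "0 < card p01" "0 < card p02" "0 < card p03" "0 < card p12" "0 < card p13" "0 < card p23"
    using ne' s[THEN spath_finite] by (simp_all add: card_gt_0_iff)
  have two: "2 \<le> n" if "even n" "0 < n" for n :: nat using that by presburger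
  from par show ?thesis
  proof (elim disjE conjE)
    assume o: "odd (card p01)" "odd (card p02)" "odd (card p03)" "odd (card p12)" "odd (card p13)" "odd (card p23)"
    obtain \<phi> where \<phi>: "even_splitting E2 H \<phi>" "\<phi> {0, 2, 3, 5} = p01 \<union> p12 \<union> p23 \<union> p03"
       "\<phi> {0, 1, 4, 5} = p01 \<union> p13 \<union> p23 \<union> p02" "\<phi> {1, 2, 3, 4} = p02 \<union> p12 \<union> p13 \<union> p03"
      using K4_splitting[OF E2_frame H(2) mH] o pos by (auto simp: all_less insert_commute One_nat_def Suc_le_eq)
    show ?thesis using nine_graphs_disc_three[OF H(1) _ \<phi>(1) E2_even_circuits] \<phi>(2-4)
      by (auto simp: nine_graphs_def set_eq_subset K4_relation_def)
  next
    assume o: "even (card p01)" "even (card p02)" "even (card p03)" "odd (card p12)" "odd (card p13)" "odd (card p23)"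
    obtain \<phi> where \<phi>: "even_splitting O2 H \<phi>" "\<phi> {0, 1, 4, 5, 6, 7} = p01 \<union> p12 \<union> p23 \<union> p03"
       "\<phi> {0, 1, 2, 3, 7, 8} = p01 \<union> p13 \<union> p23 \<union> p02" "\<phi> {2, 3, 4, 5, 6, 8} = p02 \<union> p12 \<union> p13 \<union> p03"
      using K4_splitting[OF O2_frame H(2) mH] o pos two[OF o(1) pos(1)] two[OF o(2) pos(2)] two[OF o(3) pos(3)]
      by (auto simp: all_less insert_commute One_nat_def Suc_le_eq)
    show ?thesis using nine_graphs_disc_three[OF H(1) _ \<phi>(1) O2_even_circuits] \<phi>(2-4)
      by (auto simp: nine_graphs_def set_eq_subset K4_relation_def)
  next
    assume o: "even (card p01)" "odd (card p02)" "even (card p03)" "even (card p12)" "odd (card p13)" "even (card p23)"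
    obtain \<phi> where \<phi>: "even_splitting E3 H \<phi>" "\<phi> {0, 1, 2, 3, 4, 5, 6, 7} = p01 \<union> p12 \<union> p23 \<union> p03"
       "\<phi> {0, 1, 4, 5, 8, 9} = p01 \<union> p13 \<union> p23 \<union> p02" "\<phi> {2, 3, 6, 7, 8, 9} = p02 \<union> p12 \<union> p13 \<union> p03"
      using K4_splitting[OF E3_frame H(2) mH] o pos two[OF o(1) pos(1)] two[OF o(3) pos(3)] two[OF o(4) pos(4)] two[OF o(6) pos(6)]
      by (auto simp: all_less insert_commute One_nat_def Suc_le_eq)
    show ?thesis using nine_graphs_disc_three[OF H(1) _ \<phi>(1) E3_even_circuits] \<phi>(2-4)
      by (auto simp: nine_graphs_def set_eq_subset K4_relation_def)
  qed
qed

text \<open>The parities at \<open>x0\<close> determine the cut. Exactly one even branch at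
  \<open>x0\<close> means the star of its other end, which is moved to the place of
  \<open>x0\<close>; exactly one odd branch means a cut between two pairs, with the ends of this
  branch on the same side.\<close>

lemma K4_relation_holds:
  assumes K: "K4_subdivision x0 x1 x2 x3 P01 P02 P03 P12 P13 P23 p01 p02 p03 p12 p13 p23"
    and par: "odd (card p01 + card p12 + card p02)" "odd (card p01 + card p13 + card p03)" "odd (card p02 + card p23 + card p03)"
  shows "K4_relation p01 p02 p03 p12 p13 p23"
proof (cases "odd (card p01)"; cases "odd (card p02)"; cases "odd (card p03)")
  assume o: "odd (card p01)" "odd (card p02)" "odd (card p03)"
  show ?thesis by (rule K4_relation_normalised[OF K]) (use o par in auto)
next
  assume o: "odd (card p01)" "odd (card p02)" "\<not> odd (card p03)"
  note 1 = K4_subdivision_swap(3)[OF K]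
  note 2 = K4_subdivision_swap(2)[OF 1]
  have "K4_relation p03 p13 p23 p01 p02 p12" by (rule K4_relation_normalised[OF K4_subdivision_swap(1)[OF 2]]) (use o par in auto)
  then show ?thesis using K4_relation_swap by metis
next
  assume o: "odd (card p01)" "\<not> odd (card p02)" "odd (card p03)"
  note 1 = K4_subdivision_swap(2)[OF K]
  have "K4_relation p02 p12 p23 p01 p03 p13" by (rule K4_relation_normalised[OF K4_subdivision_swap(1)[OF 1]]) (use o par in auto)
  then show ?thesis using K4_relation_swap by metis
next
  assume o: "odd (card p01)" "\<not> odd (card p02)" "\<not> odd (card p03)"
  have "K4_relation p02 p01 p03 p12 p23 p13" by (rule K4_relation_normalised[OF K4_subdivision_swap(2)[OF K]]) (use o par in auto)
  then show ?thesis using K4_relation_swap by metis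
next
  assume o: "\<not> odd (card p01)" "odd (card p02)" "odd (card p03)"
  have "K4_relation p01 p12 p13 p02 p03 p23" by (rule K4_relation_normalised[OF K4_subdivision_swap(1)[OF K]]) (use o par in auto)
  then show ?thesis using K4_relation_swap by metis
next
  assume o: "\<not> odd (card p01)" "odd (card p02)" "\<not> odd (card p03)"
  show ?thesis by (rule K4_relation_normalised[OF K]) (use o par in auto)
next
  assume o: "\<not> odd (card p01)" "\<not> odd (card p02)" "odd (card p03)"
  have "K4_relation p01 p03 p02 p13 p12 p23" by (rule K4_relation_normalised[OF K4_subdivision_swap(3)[OF K]]) (use o par in auto)
  then show ?thesis using K4_relation_swap by metis
next
  assume o: "\<not> odd (card p01)" "\<not> odd (card p02)" "\<not> odd (card p03)"
  show ?thesis by (rule K4_relation_normalised[OF K]) (use o par in auto)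
qed

lemma K4_rel_disc: "K4_rel G disc"
  unfolding K4_rel_def using K4_relation_holds[unfolded K4_subdivision_def K4_relation_def] by (intro allI impI) blast

text \<open>The condition on the total length in \<open>ring_rel\<close> is kept apart, because it
  changes when the sides of one digon are exchanged.\<close>

definition ring_subdivision :: "'v \<Rightarrow> 'v \<Rightarrow> 'v \<Rightarrow> 'v \<Rightarrow> 'v \<Rightarrow> 'v \<Rightarrow>
    'v set \<Rightarrow> 'v set \<Rightarrow> 'v set \<Rightarrow> 'v set \<Rightarrow> 'v set \<Rightarrow> 'v set \<Rightarrow> 'v set \<Rightarrow> 'v set \<Rightarrow> 'v set \<Rightarrow>
    'e set \<Rightarrow> 'e set \<Rightarrow> 'e set \<Rightarrow> 'e set \<Rightarrow> 'e set \<Rightarrow> 'e set \<Rightarrow> 'e set \<Rightarrow> 'e set \<Rightarrow> 'e set \<Rightarrow> bool" where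
  "ring_subdivision s1 t1 s2 t2 s3 t3 P1 Q1 P2 Q2 P3 Q3 C12 C23 C31 p1 q1 p2 q2 p3 q3 c12 c23 c31 \<longleftrightarrow>
     s1 \<noteq> t1 \<and> s2 \<noteq> t2 \<and> s3 \<noteq> t3 \<and>
     spath G s1 P1 p1 t1 \<and> spath G s1 Q1 q1 t1 \<and> spath G s2 P2 p2 t2 \<and> spath G s2 Q2 q2 t2 \<and>
     spath G s3 P3 p3 t3 \<and> spath G s3 Q3 q3 t3 \<and>
     spath G t1 C12 c12 s2 \<and> spath G t2 C23 c23 s3 \<and> spath G t3 C31 c31 s1 \<and>
     P1 \<inter> Q1 = {s1, t1} \<and> P2 \<inter> Q2 = {s2, t2} \<and> P3 \<inter> Q3 = {s3, t3} \<and>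
     (P1 \<union> Q1) \<inter> (P2 \<union> Q2) = {t1} \<inter> {s2} \<and> (P2 \<union> Q2) \<inter> (P3 \<union> Q3) = {t2} \<inter> {s3} \<and>
     (P3 \<union> Q3) \<inter> (P1 \<union> Q1) = {t3} \<inter> {s1} \<and>
     (P1 \<union> Q1) \<inter> C12 = {t1} \<and> (P2 \<union> Q2) \<inter> C12 = {s2} \<and> (P3 \<union> Q3) \<inter> C12 = {} \<and>
     (P2 \<union> Q2) \<inter> C23 = {t2} \<and> (P3 \<union> Q3) \<inter> C23 = {s3} \<and> (P1 \<union> Q1) \<inter> C23 = {} \<and>
     (P3 \<union> Q3) \<inter> C31 = {t3} \<and> (P1 \<union> Q1) \<inter> C31 = {s1} \<and> (P2 \<union> Q2) \<inter> C31 = {} \<and>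
     C12 \<inter> C23 = {} \<and> C23 \<inter> C31 = {} \<and> C31 \<inter> C12 = {} \<and>
     odd (card p1 + card q1) \<and> odd (card p2 + card q2) \<and> odd (card p3 + card q3)"

lemma ring_subdivision_rotate:
  assumes "ring_subdivision s1 t1 s2 t2 s3 t3 P1 Q1 P2 Q2 P3 Q3 C12 C23 C31 p1 q1 p2 q2 p3 q3 c12 c23 c31"
  shows "ring_subdivision s2 t2 s3 t3 s1 t1 P2 Q2 P3 Q3 P1 Q1 C23 C31 C12 p2 q2 p3 q3 p1 q1 c23 c31 c12"
  using assms unfolding ring_subdivision_def by simp

lemma ring_subdivision_swap:
  assumes "ring_subdivision s1 t1 s2 t2 s3 t3 P1 Q1 P2 Q2 P3 Q3 C12 C23 C31 p1 q1 p2 q2 p3 q3 c12 c23 c31"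
  shows "ring_subdivision s1 t1 s2 t2 s3 t3 Q1 P1 P2 Q2 P3 Q3 C12 C23 C31 q1 p1 p2 q2 p3 q3 c12 c23 c31"
    "ring_subdivision s1 t1 s2 t2 s3 t3 P1 Q1 Q2 P2 P3 Q3 C12 C23 C31 p1 q1 q2 p2 p3 q3 c12 c23 c31"
    "ring_subdivision s1 t1 s2 t2 s3 t3 P1 Q1 P2 Q2 Q3 P3 C12 C23 C31 p1 q1 p2 q2 q3 p3 c12 c23 c31"
  using assms unfolding ring_subdivision_def
  by (simp_all add: Un_commute[of Q1 P1] Un_commute[of Q2 P2] Un_commute[of Q3 P3]
    Int_commute[of Q1 P1] Int_commute[of Q2 P2] Int_commute[of Q3 P3] add.commute[of "card q1" "card p1"]
    add.commute[of "card q2" "card p2"] add.commute[of "card q3" "card p3"])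

definition ring_relation :: "'e set \<Rightarrow> 'e set \<Rightarrow> 'e set \<Rightarrow> 'e set \<Rightarrow> 'e set \<Rightarrow> 'e set \<Rightarrow> 'e set \<Rightarrow> bool" where
  "ring_relation p1 q1 p2 q2 p3 q3 c \<longleftrightarrow>
     (disc (p1 \<union> p2 \<union> p3 \<union> c) \<noteq> disc (p1 \<union> q2 \<union> q3 \<union> c)) = (disc (q1 \<union> p2 \<union> q3 \<union> c) \<noteq> disc (q1 \<union> q2 \<union> p3 \<union> c))"

lemma ring_relation_rotate: "ring_relation p2 q2 p3 q3 p1 q1 c \<longleftrightarrow> ring_relation p1 q1 p2 q2 p3 q3 c"
proof -
  have *: "x \<union> y \<union> z \<union> c = y \<union> z \<union> x \<union> c" for x y z :: "'e set" by blast
  show ?thesis unfolding ring_relation_def *[of p1] *[of q1] by argo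
qed

text \<open>Exchanging the sides of two digons permutes the four circuits of the relation, whereas
  exchanging those of one or of all three leads to the complementary four.\<close>

lemma ring_relation_swap:
  "ring_relation q1 p1 q2 p2 p3 q3 c \<longleftrightarrow> ring_relation p1 q1 p2 q2 p3 q3 c"
  "ring_relation q1 p1 p2 q2 q3 p3 c \<longleftrightarrow> ring_relation p1 q1 p2 q2 p3 q3 c"
  "ring_relation p1 q1 q2 p2 q3 p3 c \<longleftrightarrow> ring_relation p1 q1 p2 q2 p3 q3 c"
  unfolding ring_relation_def by argo+

text \<open>A common edge would join \<open>s\<close> and \<open>t\<close> and therefore be the
  whole of both paths, whose lengths would add up to 2.\<close>

lemma odd_digon_disjoint:
  assumes P: "spath G s P p t" and Q: "spath G s Q q t" and i: "P \<inter> Q = {s, t}" and o: "odd (card p + card q)"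
  shows "p \<inter> q = {}"
proof (rule ccontr)
  assume "p \<inter> q \<noteq> {}"
  then obtain e where e: "e \<in> p" "e \<in> q" by blast
  have en: "ends G e \<subseteq> {s, t}" using spath_ends_subset[OF P e(1)] spath_ends_subset[OF Q e(2)] i by blast
  have single: "r = {e}" if r: "spath G s R r t" "e \<in> r" for R r
  proof -
    obtain a b S1 S2 r1 r2 where h: "spath G s S1 r1 a" "spath G b S2 r2 t" "S1 \<inter> S2 = {}"
      "ends G e = {a, b}" "insert e (r1 \<union> r2) = r" using spath_edge_decomp[OF r] by blast
    have "a \<noteq> t" "b \<noteq> s" using spath_ends[OF h(1)] spath_ends[OF h(2)] h(3) by blast+
    then have "a = s" "b = t" using en h(4) by auto
    then show ?thesis using h(1,2,5) by (simp add: spath_loop)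
  qed
  then have "p = {e}" "q = {e}" using P Q e by blast+
  then show False using o by simp
qed

text \<open>Collects what a frame demands of the two sides of a digon and a further path.
  \<open>A\<close> and \<open>B\<close> will be the pairs of branch vertices at the ends of the
  branches; writing the intersection with \<open>z\<close> and \<open>z'\<close> treats meeting and
  disjoint branches alike.\<close>

lemma spath_meets:
  assumes "spath G a P p b" "spath G a' Q q b'" "spath G u C c v" "(P \<union> Q) \<inter> C \<subseteq> {z} \<inter> {z'}" "z \<in> A" "z' \<in> B"
  shows "C \<inter> P \<subseteq> A" "C \<inter> P \<subseteq> B" "C \<inter> Q \<subseteq> A" "C \<inter> Q \<subseteq> B" "c \<inter> p = {}" "c \<inter> q = {}"
proof -
  have i: "C \<inter> P \<subseteq> {z} \<inter> {z'}" "C \<inter> Q \<subseteq> {z} \<inter> {z'}" using assms(4) by blast+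
  then show "C \<inter> P \<subseteq> A" "C \<inter> P \<subseteq> B" "C \<inter> Q \<subseteq> A" "C \<inter> Q \<subseteq> B" using assms(5,6) by blast+
  show "c \<inter> p = {}" "c \<inter> q = {}"
    using spath_disjoint[OF assms(3,1), of z] spath_disjoint[OF assms(3,2), of z] i by blast+
qed

lemma ring_frame:
  assumes R: "ring_subdivision s1 t1 s2 t2 s3 t3 P1 Q1 P2 Q2 P3 Q3 C12 C23 C31 p1 q1 p2 q2 p3 q3 c12 c23 c31"
  obtains H where "subgraph H G" "frame ring_model H ((!) [s1, t1, s2, t2, s3, t3]) ((!) [P1, Q1, P2, Q2, P3, Q3, C12, C23, C31])
    ((!) [p1, q1, p2, q2, p3, q3, c12, c23, c31])"
proof -
  have ne: "s1 \<noteq> t1" "s2 \<noteq> t2" "s3 \<noteq> t3"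
    and s: "spath G s1 P1 p1 t1" "spath G s1 Q1 q1 t1" "spath G s2 P2 p2 t2" "spath G s2 Q2 q2 t2" "spath G s3 P3 p3 t3" "spath G s3 Q3 q3 t3"
    and c: "spath G t1 C12 c12 s2" "spath G t2 C23 c23 s3" "spath G t3 C31 c31 s1"
    and g: "P1 \<inter> Q1 = {s1, t1}" "P2 \<inter> Q2 = {s2, t2}" "P3 \<inter> Q3 = {s3, t3}"
    and i: "(P1 \<union> Q1) \<inter> (P2 \<union> Q2) = {t1} \<inter> {s2}" "(P2 \<union> Q2) \<inter> (P3 \<union> Q3) = {t2} \<inter> {s3}" "(P3 \<union> Q3) \<inter> (P1 \<union> Q1) = {t3} \<inter> {s1}"
    and ic: "(P1 \<union> Q1) \<inter> C12 = {t1}" "(P2 \<union> Q2) \<inter> C12 = {s2}" "(P3 \<union> Q3) \<inter> C12 = {}"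
     "(P2 \<union> Q2) \<inter> C23 = {t2}" "(P3 \<union> Q3) \<inter> C23 = {s3}" "(P1 \<union> Q1) \<inter> C23 = {}"
     "(P3 \<union> Q3) \<inter> C31 = {t3}" "(P1 \<union> Q1) \<inter> C31 = {s1}" "(P2 \<union> Q2) \<inter> C31 = {}"
    and cc: "C12 \<inter> C23 = {}" "C23 \<inter> C31 = {}" "C31 \<inter> C12 = {}"
    and o: "odd (card p1 + card q1)" "odd (card p2 + card q2)" "odd (card p3 + card q3)"
    using R unfolding ring_subdivision_def by simp_all
  have gd: "p1 \<inter> q1 = {}" "p2 \<inter> q2 = {}" "p3 \<inter> q3 = {}"
    using odd_digon_disjoint[OF s(1,2) g(1) o(1)] odd_digon_disjoint[OF s(3,4) g(2) o(2)] odd_digon_disjoint[OF s(5,6) g(3) o(3)] .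
  have m: "s1 \<in> P1" "t1 \<in> P1" "s2 \<in> P2" "t2 \<in> P2" "s3 \<in> P3" "t3 \<in> P3" using s spath_ends by metis+
  have apart: "x \<in> P1 \<Longrightarrow> y \<in> P2 \<Longrightarrow> x \<noteq> t1 \<or> y \<noteq> s2 \<Longrightarrow> x \<noteq> y" "x \<in> P2 \<Longrightarrow> y \<in> P3 \<Longrightarrow> x \<noteq> t2 \<or> y \<noteq> s3 \<Longrightarrow> x \<noteq> y"
    "x \<in> P1 \<Longrightarrow> y \<in> P3 \<Longrightarrow> x \<noteq> s1 \<or> y \<noteq> t3 \<Longrightarrow> x \<noteq> y" for x y
    using i(1) i(2) i(3) by (blast, blast, blast)
  have ne2: "s1 \<noteq> s2" "s1 \<noteq> t2" "s1 \<noteq> s3" "t1 \<noteq> t2" "t1 \<noteq> s3" "t1 \<noteq> t3" "s2 \<noteq> s3" "s2 \<noteq> t3" "t2 \<noteq> t3"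
    using apart m ne by metis+
  have kc: "t1 = s2 \<longleftrightarrow> c12 = {}" "t2 = s3 \<longleftrightarrow> c23 = {}" "t3 = s1 \<longleftrightarrow> c31 = {}"
    using c[THEN spath_empty_iff] by blast+
  then have kc': "s2 = t1 \<longleftrightarrow> c12 = {}" "s3 = t2 \<longleftrightarrow> c23 = {}" "s1 = t3 \<longleftrightarrow> c31 = {}" by blast+
  have ps: "p1 \<noteq> {}" "q1 \<noteq> {}" "p2 \<noteq> {}" "q2 \<noteq> {}" "p3 \<noteq> {}" "q3 \<noteq> {}" using s[THEN spath_empty_iff] ne by simp_all
  have v: "P1 \<subseteq> verts G" "Q1 \<subseteq> verts G" "P2 \<subseteq> verts G" "Q2 \<subseteq> verts G" "P3 \<subseteq> verts G" "Q3 \<subseteq> verts G"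
    using s[THEN spath_subset_verts'[OF G]] ne by simp_all
  have vc: "C12 \<subseteq> verts G" "C23 \<subseteq> verts G" "C31 \<subseteq> verts G"
    using c[THEN spath_subset_verts[OF G]] m v by blast+
  let ?\<nu> = "(!) [s1, t1, s2, t2, s3, t3]" and ?\<sigma> = "(!) [P1, Q1, P2, Q2, P3, Q3, C12, C23, C31]" and ?\<pi> = "(!) [p1, q1, p2, q2, p3, q3, c12, c23, c31]"
  have d: "(P1 \<union> Q1) \<inter> P2 \<subseteq> {t1} \<inter> {s2}" "(P1 \<union> Q1) \<inter> Q2 \<subseteq> {t1} \<inter> {s2}" "(P2 \<union> Q2) \<inter> P3 \<subseteq> {t2} \<inter> {s3}"
    "(P2 \<union> Q2) \<inter> Q3 \<subseteq> {t2} \<inter> {s3}" "(P1 \<union> Q1) \<inter> P3 \<subseteq> {s1} \<inter> {t3}" "(P1 \<union> Q1) \<inter> Q3 \<subseteq> {s1} \<inter> {t3}"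
    using i by blast+
  have e: "(P1 \<union> Q1) \<inter> C12 \<subseteq> {t1} \<inter> {t1}" "(P2 \<union> Q2) \<inter> C12 \<subseteq> {s2} \<inter> {s2}" "(P3 \<union> Q3) \<inter> C12 \<subseteq> {s3} \<inter> {t1}"
    "(P2 \<union> Q2) \<inter> C23 \<subseteq> {t2} \<inter> {t2}" "(P3 \<union> Q3) \<inter> C23 \<subseteq> {s3} \<inter> {s3}" "(P1 \<union> Q1) \<inter> C23 \<subseteq> {s1} \<inter> {t2}"
    "(P3 \<union> Q3) \<inter> C31 \<subseteq> {t3} \<inter> {t3}" "(P1 \<union> Q1) \<inter> C31 \<subseteq> {s1} \<inter> {s1}" "(P2 \<union> Q2) \<inter> C31 \<subseteq> {s2} \<inter> {t3}"
    "(C12 \<union> C12) \<inter> C23 \<subseteq> {t1} \<inter> {t2}" "(C23 \<union> C23) \<inter> C31 \<subseteq> {t2} \<inter> {t3}" "(C12 \<union> C12) \<inter> C31 \<subseteq> {t1} \<inter> {t3}"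
    using cc(3)[THEN Int_sym] by (simp_all add: ic cc)
  note M = spath_meets[OF s(1,2) s(3) d(1), of "{s1, t1}" "{s2, t2}", simplified] spath_meets[OF s(1,2) s(4) d(2), of "{s1, t1}" "{s2, t2}", simplified]
    spath_meets[OF s(3,4) s(5) d(3), of "{s2, t2}" "{s3, t3}", simplified] spath_meets[OF s(3,4) s(6) d(4), of "{s2, t2}" "{s3, t3}", simplified]
    spath_meets[OF s(1,2) s(5) d(5), of "{s1, t1}" "{s3, t3}", simplified] spath_meets[OF s(1,2) s(6) d(6), of "{s1, t1}" "{s3, t3}", simplified]
    spath_meets[OF s(1,2) c(1) e(1), of "{s1, t1}" "{t1, s2}", simplified] spath_meets[OF s(3,4) c(1) e(2), of "{s2, t2}" "{t1, s2}", simplified]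
    spath_meets[OF s(5,6) c(1) e(3), of "{s3, t3}" "{t1, s2}", simplified]
    spath_meets[OF s(3,4) c(2) e(4), of "{s2, t2}" "{t2, s3}", simplified] spath_meets[OF s(5,6) c(2) e(5), of "{s3, t3}" "{t2, s3}", simplified]
    spath_meets[OF s(1,2) c(2) e(6), of "{s1, t1}" "{t2, s3}", simplified]
    spath_meets[OF s(5,6) c(3) e(7), of "{s3, t3}" "{t3, s1}", simplified] spath_meets[OF s(1,2) c(3) e(8), of "{s1, t1}" "{t3, s1}", simplified]
    spath_meets[OF s(3,4) c(3) e(9), of "{s2, t2}" "{t3, s1}", simplified]
    spath_meets[OF c(1,1) c(2) e(10), of "{t1, s2}" "{t2, s3}", simplified] spath_meets[OF c(2,2) c(3) e(11), of "{t2, s3}" "{t3, s1}", simplified]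
    spath_meets[OF c(1,1) c(3) e(12), of "{t1, s2}" "{t3, s1}", simplified]
  have ex: "(\<exists>i<length ring_model. ?\<pi> i = {} \<and> {a, b} = joins ring_model i) \<longleftrightarrow>
      c12 = {} \<and> {a, b} = {1, 2} \<or> c23 = {} \<and> {a, b} = {3, 4} \<or> c31 = {} \<and> {a, b} = {5, 0}" for a b
    using ps by (simp add: ring_model_simps ex_less)
  have dom: "(\<Union>i<length ring_model. joins ring_model i) = {0, 1, 2, 3, 4, 5}"
    by (auto simp: ring_model_simps lessThan_numerals)
  show ?thesis
  proof (rule frame_subgraph[OF G, of ring_model ?\<nu> ?\<sigma> ?\<pi>])
    show "\<forall>i<length ring_model. spath G (?\<nu> (fst (ring_model ! i))) (?\<sigma> i) (?\<pi> i) (?\<nu> (snd (ring_model ! i)))"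
      using s c by (simp add: ring_model_simps all_less)
    show "\<forall>i<length ring_model. ?\<sigma> i \<subseteq> verts G"
      using v vc by (simp add: ring_model_simps all_less)
    show "\<forall>i<length ring_model. \<forall>j<i. ?\<sigma> i \<inter> ?\<sigma> j \<subseteq> ?\<nu> ` joins ring_model i \<inter> ?\<nu> ` joins ring_model j \<and> ?\<pi> i \<inter> ?\<pi> j = {}"
      by (simp add: ring_model_simps all_less M g[THEN Int_sym] gd[THEN Int_sym])
    show "\<forall>a\<in>\<Union>i<length ring_model. joins ring_model i. \<forall>b\<in>\<Union>i<length ring_model. joins ring_model i.
       ?\<nu> a = ?\<nu> b \<longleftrightarrow> a = b \<or> (\<exists>i<length ring_model. ?\<pi> i = {} \<and> {a, b} = joins ring_model i)"
      by (simp only: ex dom, simp add: doubleton_eq_iff ne ne[symmetric] ne2 ne2[symmetric] ps kc kc')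
  next
    fix H assume H: "subgraph H G" and fr: "frame ring_model H ?\<nu> ?\<sigma> ?\<pi>"
    show thesis by (rule that[OF H fr])
  qed
qed

text \<open>With \<open>p1\<close>, \<open>p2\<close>, \<open>p3\<close> odd, an even circuit uses
  an odd number of them if the connecting paths have odd total length, and an even number otherwise;
  hence the exchanged arguments in the second statement. The further parity conditions fix the
  rotation in which the connecting paths fit the chosen frames: \<open>Delta1\<close> and
  \<open>Delta3\<close> in the first statement, \<open>Delta2\<close> and \<open>Delta4\<close> in
  the second.\<close>

lemma ring_relation_normalised:
  assumes R: "ring_subdivision s1 t1 s2 t2 s3 t3 P1 Q1 P2 Q2 P3 Q3 C12 C23 C31 p1 q1 p2 q2 p3 q3 c12 c23 c31"
    and o: "odd (card p1)" "odd (card p2)" "odd (card p3)"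
  shows "odd (card c31) \<Longrightarrow> even (card c12 + card c23) \<Longrightarrow> ring_relation p1 q1 p2 q2 p3 q3 (c12 \<union> c23 \<union> c31)"
    "even (card c12) \<Longrightarrow> even (card c23 + card c31) \<Longrightarrow> ring_relation q1 p1 q2 p2 q3 p3 (c12 \<union> c23 \<union> c31)"
proof -
  obtain H where H: "subgraph H G" and fr: "frame ring_model H ((!) [s1, t1, s2, t2, s3, t3]) ((!) [P1, Q1, P2, Q2, P3, Q3, C12, C23, C31])
    ((!) [p1, q1, p2, q2, p3, q3, c12, c23, c31])" using ring_frame[OF R] .
  have mH: "multigraph H" using H(1) by (simp add: subgraph_def)
  have q: "even (card q1)" "even (card q2)" "even (card q3)" using o R unfolding ring_subdivision_def by simp_all
  have "q1 \<noteq> {}" "q2 \<noteq> {}" "q3 \<noteq> {}" "finite q1" "finite q2" "finite q3"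
    using R spath_empty_iff spath_finite unfolding ring_subdivision_def by metis+
  then have "0 < card q1" "0 < card q2" "0 < card q3" by (simp_all add: card_gt_0_iff)
  then have q2: "2 \<le> card q1" "2 \<le> card q2" "2 \<le> card q3" using q by presburger+
  have one: "1 \<le> n" if "odd n" for n :: nat using that by presburger
  note o1 = o[THEN one]
  let ?c = "c12 \<union> c23 \<union> c31"
  {
    assume c: "odd (card c31)" "even (card c12 + card c23)"
    show "ring_relation p1 q1 p2 q2 p3 q3 ?c"
    proof (cases "odd (card c12)")
      case True
      then have c': "odd (card c12)" "odd (card c23)" using c by auto
      obtain \<phi> where es: "even_splitting Delta1 H \<phi>" and \<phi>:
        "\<phi> {0, 3, 6, 9, 10, 11} = p1 \<union> p2 \<union> p3 \<union> ?c" "\<phi> {0, 4, 5, 7, 8, 9, 10, 11} = p1 \<union> q2 \<union> q3 \<union> ?c"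
        "\<phi> {1, 2, 3, 7, 8, 9, 10, 11} = q1 \<union> p2 \<union> q3 \<union> ?c" "\<phi> {1, 2, 4, 5, 6, 9, 10, 11} = q1 \<union> q2 \<union> p3 \<union> ?c"
        using ring_splitting[OF Delta1_frame fr mH] o q q2 o1 c c' c'[THEN one] one[OF c(1)]
        by (auto simp: all_less insert_commute Un_assoc)
      show ?thesis unfolding ring_relation_def \<phi>[symmetric]
        by (rule nine_graphs_disc_four[OF H _ es Delta1_even_circuits, where b = True]) (simp_all add: nine_graphs_def set_eq_subset)
    next
      case False
      then have c': "even (card c12)" "even (card c23)" using c by auto
      obtain \<phi> where es: "even_splitting Delta3 H \<phi>" and \<phi>:
        "\<phi> {0, 3, 6, 11} = p1 \<union> p2 \<union> p3 \<union> ?c" "\<phi> {0, 4, 5, 7, 8, 11} = p1 \<union> q2 \<union> q3 \<union> ?c"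
        "\<phi> {1, 2, 3, 7, 8, 11} = q1 \<union> p2 \<union> q3 \<union> ?c" "\<phi> {1, 2, 4, 5, 6, 11} = q1 \<union> q2 \<union> p3 \<union> ?c"
        using ring_splitting[OF Delta3_frame fr mH] o q q2 o1 c c' one[OF c(1)]
        by (auto simp: all_less insert_commute Un_assoc)
      show ?thesis unfolding ring_relation_def \<phi>[symmetric]
        by (rule nine_graphs_disc_four[OF H _ es Delta3_even_circuits, where b = True]) (simp_all add: nine_graphs_def set_eq_subset)
    qed
  next
    assume c: "even (card c12)" "even (card c23 + card c31)"
    show "ring_relation q1 p1 q2 p2 q3 p3 ?c"
    proof (cases "odd (card c23)")
      case True
      then have c': "odd (card c23)" "odd (card c31)" using c by auto
      obtain \<phi> where es: "even_splitting Delta2 H \<phi>" and \<phi>: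
        "\<phi> {0, 3, 7, 8, 10, 11} = p1 \<union> p2 \<union> q3 \<union> ?c" "\<phi> {0, 4, 5, 6, 10, 11} = p1 \<union> q2 \<union> p3 \<union> ?c"
        "\<phi> {1, 2, 3, 6, 10, 11} = q1 \<union> p2 \<union> p3 \<union> ?c" "\<phi> {1, 2, 4, 5, 7, 8, 10, 11} = q1 \<union> q2 \<union> q3 \<union> ?c"
        using ring_splitting[OF Delta2_frame fr mH] o q q2 o1 c c' c'[THEN one]
        by (auto simp: all_less insert_commute Un_assoc)
      have "(disc (p1 \<union> p2 \<union> q3 \<union> ?c) \<noteq> disc (p1 \<union> q2 \<union> p3 \<union> ?c)) =
          (disc (q1 \<union> p2 \<union> p3 \<union> ?c) \<noteq> disc (q1 \<union> q2 \<union> q3 \<union> ?c))"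
        unfolding \<phi>[symmetric]
        by (rule nine_graphs_disc_four[OF H _ es Delta2_even_circuits, where b = True]) (simp_all add: nine_graphs_def set_eq_subset)
      then show ?thesis unfolding ring_relation_def by argo
    next
      case False
      then have c': "even (card c23)" "even (card c31)" using c by auto
      obtain \<phi> where es: "even_splitting Delta4 H \<phi>" and \<phi>:
        "\<phi> {0, 3, 7, 8} = p1 \<union> p2 \<union> q3 \<union> ?c" "\<phi> {0, 4, 5, 6} = p1 \<union> q2 \<union> p3 \<union> ?c"
        "\<phi> {1, 2, 3, 6} = q1 \<union> p2 \<union> p3 \<union> ?c" "\<phi> {1, 2, 4, 5, 7, 8} = q1 \<union> q2 \<union> q3 \<union> ?c"
        using ring_splitting[OF Delta4_frame fr mH] o q q2 o1 c c'
        by (auto simp: all_less insert_commute Un_assoc)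
      have "(disc (p1 \<union> p2 \<union> q3 \<union> ?c) \<noteq> disc (p1 \<union> q2 \<union> p3 \<union> ?c)) =
          (disc (q1 \<union> p2 \<union> p3 \<union> ?c) \<noteq> disc (q1 \<union> q2 \<union> q3 \<union> ?c))"
        unfolding \<phi>[symmetric]
        by (rule nine_graphs_disc_four[OF H _ es Delta4_even_circuits, where b = True]) (simp_all add: nine_graphs_def set_eq_subset)
      then show ?thesis unfolding ring_relation_def by argo
    qed
  }
qed

text \<open>For every parity pattern of the connecting paths one of the three rotations of the ring
  is normalised.\<close>

lemma ring_relation_odd_paths:
  assumes R: "ring_subdivision s1 t1 s2 t2 s3 t3 P1 Q1 P2 Q2 P3 Q3 C12 C23 C31 p1 q1 p2 q2 p3 q3 c12 c23 c31"
    and o: "odd (card p1)" "odd (card p2)" "odd (card p3)"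
  shows "odd (card c12 + card c23 + card c31) \<Longrightarrow> ring_relation p1 q1 p2 q2 p3 q3 (c12 \<union> c23 \<union> c31)"
    "even (card c12 + card c23 + card c31) \<Longrightarrow> ring_relation q1 p1 q2 p2 q3 p3 (c12 \<union> c23 \<union> c31)"
proof -
  note R2 = ring_subdivision_rotate[OF R]
  note R3 = ring_subdivision_rotate[OF R2]
  have U: "c23 \<union> c31 \<union> c12 = c12 \<union> c23 \<union> c31" "c31 \<union> c12 \<union> c23 = c12 \<union> c23 \<union> c31" by blast+
  note V = ring_relation_rotate[of p2 q2 p3 q3 p1 q1] ring_relation_rotate[of q2 p2 q3 p3 q1 p1]
    ring_relation_rotate[of p3 q3 p1 q1 p2 q2] ring_relation_rotate[of q3 p3 q1 p1 q2 p2]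
  note 1 = ring_relation_normalised[OF R o] and 2 = ring_relation_normalised[OF R2 o(2,3,1), unfolded U V] and 3 = ring_relation_normalised[OF R3 o(3,1,2), unfolded U V]
  show "ring_relation p1 q1 p2 q2 p3 q3 (c12 \<union> c23 \<union> c31)" if "odd (card c12 + card c23 + card c31)"
    using that 1(1) 2(1) 3(1) by (cases "odd (card c12)"; cases "odd (card c23)"; cases "odd (card c31)") simp_all
  show "ring_relation q1 p1 q2 p2 q3 p3 (c12 \<union> c23 \<union> c31)" if "even (card c12 + card c23 + card c31)"
    using that 1(2) 2(2) 3(2) by (cases "odd (card c12)"; cases "odd (card c23)"; cases "odd (card c31)") simp_all
qed

text \<open>Exactly one side of each digon is odd, and it is moved to the first place. Each exchange
  of sides changes the total parity and also turns the four circuits into the complementary four, so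
  these two effects match and the relation obtained is the one for the even circuits.\<close>

lemma ring_relation_holds:
  assumes R: "ring_subdivision s1 t1 s2 t2 s3 t3 P1 Q1 P2 Q2 P3 Q3 C12 C23 C31 p1 q1 p2 q2 p3 q3 c12 c23 c31"
    and e: "even (card p1 + card p2 + card p3 + card c12 + card c23 + card c31)"
  shows "ring_relation p1 q1 p2 q2 p3 q3 (c12 \<union> c23 \<union> c31)"
proof -
  have q: "odd (card q1) \<longleftrightarrow> even (card p1)" "odd (card q2) \<longleftrightarrow> even (card p2)" "odd (card q3) \<longleftrightarrow> even (card p3)"
    using R unfolding ring_subdivision_def by auto
  note s1 = ring_subdivision_swap(1) and s2 = ring_subdivision_swap(2) and s3 = ring_subdivision_swap(3)
  have sw: "ring_relation q1 p1 q2 p2 q3 p3 c \<longleftrightarrow> ring_relation p1 q1 p2 q2 q3 p3 c"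
    "ring_relation p1 q1 q2 p2 p3 q3 c \<longleftrightarrow> ring_relation p1 q1 p2 q2 q3 p3 c"
    "ring_relation q1 p1 p2 q2 p3 q3 c \<longleftrightarrow> ring_relation p1 q1 p2 q2 q3 p3 c" for p1 q1 p2 q2 p3 q3 c
    using ring_relation_swap by metis+
  show ?thesis
  proof (cases "odd (card p1)"; cases "odd (card p2)"; cases "odd (card p3)")
    assume o: "odd (card p1)" "odd (card p2)" "odd (card p3)"
    show ?thesis by (rule ring_relation_odd_paths(1)[OF R o]) (use o e in auto)
  next
    assume o: "odd (card p1)" "odd (card p2)" "\<not> odd (card p3)"
    have "ring_relation q1 p1 q2 p2 p3 q3 (c12 \<union> c23 \<union> c31)" by (rule ring_relation_odd_paths(2)[OF s3[OF R]]) (use o q e in auto)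
    then show ?thesis by (simp only: ring_relation_swap)
  next
    assume o: "odd (card p1)" "\<not> odd (card p2)" "odd (card p3)"
    have "ring_relation q1 p1 p2 q2 q3 p3 (c12 \<union> c23 \<union> c31)" by (rule ring_relation_odd_paths(2)[OF s2[OF R]]) (use o q e in auto)
    then show ?thesis by (simp only: ring_relation_swap)
  next
    assume o: "odd (card p1)" "\<not> odd (card p2)" "\<not> odd (card p3)"
    have "ring_relation p1 q1 q2 p2 q3 p3 (c12 \<union> c23 \<union> c31)" by (rule ring_relation_odd_paths(1)[OF s2[OF s3[OF R]]]) (use o q e in auto)
    then show ?thesis by (simp only: ring_relation_swap)
  next
    assume o: "\<not> odd (card p1)" "odd (card p2)" "odd (card p3)"
    have "ring_relation p1 q1 q2 p2 q3 p3 (c12 \<union> c23 \<union> c31)" by (rule ring_relation_odd_paths(2)[OF s1[OF R]]) (use o q e in auto)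
    then show ?thesis by (simp only: ring_relation_swap)
  next
    assume o: "\<not> odd (card p1)" "odd (card p2)" "\<not> odd (card p3)"
    have "ring_relation q1 p1 p2 q2 q3 p3 (c12 \<union> c23 \<union> c31)" by (rule ring_relation_odd_paths(1)[OF s1[OF s3[OF R]]]) (use o q e in auto)
    then show ?thesis by (simp only: ring_relation_swap)
  next
    assume o: "\<not> odd (card p1)" "\<not> odd (card p2)" "odd (card p3)"
    have "ring_relation q1 p1 q2 p2 p3 q3 (c12 \<union> c23 \<union> c31)" by (rule ring_relation_odd_paths(1)[OF s1[OF s2[OF R]]]) (use o q e in auto)
    then show ?thesis by (simp only: ring_relation_swap)
  next
    assume o: "\<not> odd (card p1)" "\<not> odd (card p2)" "\<not> odd (card p3)"
    show ?thesis by (rule ring_relation_odd_paths(2)[OF s1[OF s2[OF s3[OF R]]]]) (use o q e in auto)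
  qed
qed

lemma ring_rel_disc: "ring_rel G disc"
  unfolding ring_rel_def
proof (intro allI impI, goal_cases)
  case (1 s1 t1 s2 t2 s3 t3 P1 Q1 P2 Q2 P3 Q3 C12 C23 C31 p1 q1 p2 q2 p3 q3 c12 c23 c31)
  have "ring_subdivision s1 t1 s2 t2 s3 t3 P1 Q1 P2 Q2 P3 Q3 C12 C23 C31 p1 q1 p2 q2 p3 q3 c12 c23 c31"
    unfolding ring_subdivision_def by (intro conjI 1)
  from ring_relation_holds[OF this 1(34)] show ?case unfolding ring_relation_def .
qed

lemma compatible: "compatible G J"
proof -
  have "rels G disc" using theta_rel_disc K4_rel_disc ring_rel_disc by (simp add: rels_def)
  then obtain X where X: "\<And>C. circ G C \<Longrightarrow> C \<subseteq> edges G \<Longrightarrow> even (card C) \<Longrightarrow> disc C = odd (card (C \<inter> X))"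
    using linear_on_edges[OF _ finite_edges order_refl] unfolding linear_on_def by blast
  define d where "d e = (if e \<in> X then prod.swap (d0 e) else d0 e)" for e
  have d: "orientation G d" using d0 by (auto simp: orientation_def d_def insert_commute)
  have "clockwise_parity G d C = J C" if C: "C \<in> even_circuits G" for C
  proof -
    obtain c where c: "proper G c C" using even_circuit_proper C by blast
    have CG: "circ G C" "C \<subseteq> edges G" "even (card C)" using C circ_edges by (auto simp: even_circuits_circ)
    \<comment> \<open>Reversal changes the pair of an edge only if the edge is not a loop; edges of
      even circuits are no loops.\<close>
    have "d0 e \<noteq> d e \<longleftrightarrow> e \<in> X" if e: "e \<in> C" for e
    proof -
      obtain x y where xy: "ends G e = {x, y}" "x \<noteq> y" using c e unfolding proper_def by blast
      have "{fst (d0 e), snd (d0 e)} = {x, y}" using d0 CG(2) e xy(1) by (auto simp: orientation_def)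
      then have "fst (d0 e) \<noteq> snd (d0 e)" using xy(2) by (metis doubleton_eq_iff)
      then show ?thesis by (auto simp: d_def prod.swap_def prod_eq_iff)
    qed
    then have "{e \<in> C. d0 e \<noteq> d e} = C \<inter> X" by blast
    then have "(clockwise_parity G d0 C = Clockwise_even) = ((clockwise_parity G d C = Clockwise_even) = even (card (C \<inter> X)))"
      using clockwise_parity_flip[OF d0 d C] by simp
    moreover have "((J C = Clockwise_even) \<noteq> (clockwise_parity G d0 C = Clockwise_even)) = odd (card (C \<inter> X))"
      using X[OF CG] by (simp add: disc_def)
    ultimately have "(clockwise_parity G d C = Clockwise_even) = (J C = Clockwise_even)" by argo
    then show ?thesis by (metis parity.exhaust)
  qed
  then show ?thesis using d unfolding compatible_def compatible_orientation_def by blast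
qed

end

lemma orientation_exists:
  assumes "multigraph G"
  obtains d where "orientation G d"
proof -
  have "\<exists>p. {fst p, snd p} = ends G e" if "e \<in> edges G" for e
  proof -
    have "card (ends G e) = 1 \<or> card (ends G e) = 2" using multigraph.card_ends[OF assms that] by simp
    then show ?thesis
    proof
      assume "card (ends G e) = 1"
      then obtain x where "ends G e = {x}" by (metis card_1_singletonE)
      then show ?thesis by (intro exI[of _ "(x, x)"]) simp
    next
      assume "card (ends G e) = 2"
      then obtain x y where "ends G e = {x, y}" by (metis card_2_iff)
      then show ?thesis by (intro exI[of _ "(x, y)"]) simp
    qed
  qed
  then show ?thesis using that unfolding orientation_def by metis
qed

theorem theorem1:
  fixes G :: "('v, 'e) mgraph" and J :: "'e set \<Rightarrow> parity"
  assumes "multigraph G"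
  shows "incompatible G J \<longleftrightarrow>
    (\<exists>H. subgraph H G \<and>
       ((\<exists>F\<in>{O1, O2}. \<exists>\<phi>. even_splitting F H \<phi> \<and> even (card (prescribed_even J F \<phi>))) \<or>
        (\<exists>F\<in>{E1, E2, E3}. \<exists>\<phi>. even_splitting F H \<phi> \<and> odd (card (prescribed_even J F \<phi>))) \<or>
        (\<exists>F\<in>{Delta1, Delta2, Delta3, Delta4}.
           \<exists>\<phi>. even_splitting F H \<phi> \<and> odd (card (prescribed_even J F \<phi>)))))"
    (is "_ \<longleftrightarrow> ?R")
proof -
  \<comment> \<open>The nine alternatives are merged: \<open>b\<close> records the parity that every
    orientation produces, and an obstruction is a prescription with the opposite parity.\<close>
  have R: "?R \<longleftrightarrow> (\<exists>H F b \<phi>. subgraph H G \<and> (F, b) \<in> nine_graphs \<and> even_splitting F H \<phi> \<and>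
      even (card (prescribed_even J F \<phi>)) \<noteq> b)"
    unfolding nine_graphs_def by auto
  show ?thesis
  proof
    assume inc: "incompatible G J"
    obtain d0 where d0: "orientation G d0" using orientation_exists[OF assms] .
    show ?R
    proof (rule ccontr)
      assume "\<not> ?R"
      then have "obstruction_free G J d0"
        using assms d0 unfolding R obstruction_free_def obstruction_free_axioms_def by blast
      then show False using inc obstruction_free.compatible by blast
    qed
  next
    assume ?R
    then obtain H F b \<phi> where h: "subgraph H G" "(F, b) \<in> nine_graphs" "even_splitting F H \<phi>"
      "even (card (prescribed_even J F \<phi>)) \<noteq> b" unfolding R by blast
    show "incompatible G J"
    proof
      assume "compatible G J"
      then obtain d where d: "orientation G d" "\<And>C. C \<in> even_circuits G \<Longrightarrow> clockwise_parity G d C = J C"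
        unfolding compatible_def compatible_orientation_def by blast
      have mH: "multigraph H" using h(1) by (simp add: subgraph_def)
      have dH: "orientation H d" using d(1) h(1) by (auto simp: orientation_def subgraph_def)
      obtain d1 where d1: "base_graph F" "orientation F d1" using nine_graphs_parity[OF h(2)] by metis
      have "\<phi> D \<in> even_circuits G" if "D \<in> even_circuits F" for D
        using base_graph.even_splitting_parity(2)[OF d1(1) h(3) mH dH d1(2)] clockwise_parity_subgraph(1)[OF h(1) d(1)] that by blast
      \<comment> \<open>Under a compatible orientation there is no disagreement, so the prescribed
        number would have the parity given by \<open>b\<close>.\<close>
      then have empty: "{D \<in> even_circuits F. (J (\<phi> D) = Clockwise_even) \<noteq> (clockwise_parity G d (\<phi> D) = Clockwise_even)} = {}"
        using d(2) by auto
      then show False using nine_graphs_prescribed[OF h(2,3,1) d(1), of J] h(4) unfolding empty by simp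
    qed
  qed
qed

end
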